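(* Let $M$ be the monoid of injective self-maps of $\omega=\{1,2,3,\dots\}$. For every symmetric spectrum $X$ (of topological spaces) and every integer $k$ there is an isomorphism of $M$-modules, natural in $X$, $$\pi_k(F_1S^0\wedge X)\ \cong\ \mathbb Z[M]^+\otimes_{\mathbb Z[M]}\pi_{k+1}X.$$
   Context: Symmetric spectra. Spaces are taken in a convenient category (e.g. compactly generated weak Hausdorff). $S^m$ is the $m$-fold smash power of $S^1$, with $\Sigma_m$ permuting the factors. $\Sigma_n\times\Sigma_m$ is embedded in $\Sigma_{n+m}$ by letting $\Sigma_n$ act on $\{1,\dots,n\}$ and $\Sigma_m$ on $\{n+1,\dots,n+m\}$. A symmetric spectrum $X$ consists of pointed spaces $X_n$ ($n\ge 0$), a basepoint preserving continuous left $\Sigma_n$-action on $X_n$, and pointed maps $\sigma_n:X_n\wedge S^1\to X_{n+1}$ such that all iterated structure maps $\sigma^m:X_n\wedge S^m\to X_{n+m}$ are $\Sigma_n\times\Sigma_m$-equivariant. A morphism consists of $\Sigma_n$-equivariant pointed maps $X_n\to Y_n$ compatible with the structure maps. Homotopy groups. For $k\in\mathbb Z$, $\pi_kX=\operatorname{colim}_n\pi_{k+n}X_n$ along the maps $\iota_*:\pi_{k+n}X_n\xrightarrow{-\wedge S^1}\pi_{k+n+1}(X_n\wedge S^1)\xrightarrow{(\sigma_n)_*}\pi_{k+n+1}X_{n+1}$. $M$-action. $M$ is a monoid under composition; an $M$-module is a left $\mathbb Z[M]$-module. For $f\in M$ and a class $[x]\in\pi_kX$ represented by $x\in\pi_{k+n}X_n$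 with $k+n\ge 2$, put $m=\max f(\{1,\dots,n\})$ (with $m=0$ if $n=0$), choose $\gamma\in\Sigma_m$ with $\gamma(i)=f(i)$ for $1\le i\le n$, and set $f\cdot[x]=[\operatorname{sgn}(\gamma)\cdot\gamma_*(\iota_*^{m-n}(x))]$. This is a well-defined additive left action of $M$ on $\pi_kX$. The bimodule $\mathbb Z[M]^+$ is the monoid ring $\mathbb Z[M]$ with its usual left $M$-action, and with right $M$-action through the monomorphism $(1\times -):M\to M$ given by $(1\times f)(1)=1$ and $(1\times f)(i)=f(i-1)+1$ for $i\ge 2$. The symmetric spectrum $F_1S^0\wedge X$ (smash product of $X$ with the free symmetric spectrum generated by $S^0$ in level 1) is explicitly: a point in level $0$, and $(F_1S^0\wedge X)_{1+n}=\Sigma_{1+n}^+\wedge_{\Sigma_n}X_n$ for $n\ge 0$, where $\Sigma_n$ acts from the right on $\Sigma_{1+n}$ through the monomorphism $1\times -:\Sigma_n\to\Sigma_{1+n}$, $(1\times\gamma)(1)=1$, $(1\times\gamma)(i)=\gamma(i-1)+1$ for $2\le i\le 1+n$; the structure maps are induced by the inclusion $\Sigma_{1+n}\to\Sigma_{1+n+1}$ (permutations fixing the last element) and the structure maps of $X$. *)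

theory Defs
  imports
    "HOL-Analysis.Analysis"
    "HOL-Algebra.Module"
    "HOL-Algebra.Free_Abelian_Groups"
    "HOL-Combinatorics.Permutations"
begin

section \<open>Pointed compactly generated weak Hausdorff spaces\<close>

definition quot_topology :: "'a topology \<Rightarrow> ('a \<Rightarrow> 'b) \<Rightarrow> 'b topology" where
  "quot_topology X q =
     topology (\<lambda>U. U \<subseteq> q ` topspace X \<and> openin X {x \<in> topspace X. q x \<in> U})"

lemma istopology_quot_topology:
  "istopology (\<lambda>U. U \<subseteq> q ` topspace X \<and> openin X {x \<in> topspace X. q x \<in> U})"
proof -
  have 1: "{x \<in> topspace X. q x \<in> S \<inter> T}
      = {x \<in> topspace X. q x \<in> S} \<inter> {x \<in> topspace X. q x \<in> T}" for S T
    by auto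
  have 2: "{x \<in> topspace X. q x \<in> \<Union>\<K>} = (\<Union>K\<in>\<K>. {x \<in> topspace X. q x \<in> K})" for \<K>
    by auto
  show ?thesis
    unfolding istopology_def 1 2 by blast
qed

lemma openin_quot_topology:
  "openin (quot_topology X q) U \<longleftrightarrow>
     U \<subseteq> q ` topspace X \<and> openin X {x \<in> topspace X. q x \<in> U}"
  by (simp add: quot_topology_def istopology_quot_topology)

lemma topspace_quot_topology [simp]: "topspace (quot_topology X q) = q ` topspace X"
proof
  show "topspace (quot_topology X q) \<subseteq> q ` topspace X"
    using openin_topspace[of "quot_topology X q"] by (simp only: openin_quot_topology)
  have "{x \<in> topspace X. q x \<in> q ` topspace X} = topspace X"
    by auto
  then have "openin (quot_topology X q) (q ` topspace X)"
    by (simp add: openin_quot_topology)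
  then show "q ` topspace X \<subseteq> topspace (quot_topology X q)"
    by (rule openin_subset)
qed

lemma quotient_map_quot_topology: "quotient_map X (quot_topology X q) q"
  by (auto simp: quotient_map_def openin_quot_topology)

text \<open>
  The test spaces of the next two definitions range over compact Hausdorff spaces carried by
  \<open>'a set set\<close>. This is no restriction for weak Hausdorff spaces: if \<open>u\<close> is a continuous map from
  a compact Hausdorff space \<open>K\<close> to a space on \<open>'a\<close> and \<open>B\<close> contains one point of each fibre, then
  the closure of \<open>B\<close> has the same image as \<open>K\<close>, and it has at most as many points as \<open>'a set set\<close>
  (a point is determined by the traces on \<open>B\<close> of its neighbourhoods). For the second
  definition choose \<open>B\<close> within the preimage of \<open>S\<close>: if that preimage is not closed in \<open>K\<close>,
  then its intersection with the closure of \<open>B\<close> is not closed either.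
\<close>

definition weak_Hausdorff_space :: "'a topology \<Rightarrow> bool" where
  "weak_Hausdorff_space X \<longleftrightarrow>
     (\<forall>(K :: 'a set set topology) u.
        compact_space K \<and> Hausdorff_space K \<and> continuous_map K X u
        \<longrightarrow> closedin X (u ` topspace K))"

definition compactly_generated_space :: "'a topology \<Rightarrow> bool" where
  "compactly_generated_space X \<longleftrightarrow>
     (\<forall>S \<subseteq> topspace X.
        (\<forall>(K :: 'a set set topology) u.
           compact_space K \<and> Hausdorff_space K \<and> continuous_map K X u
           \<longrightarrow> closedin K {z \<in> topspace K. u z \<in> S})
        \<longrightarrow> closedin X S)"

record 'a pointed_space =
  top_of :: "'a topology"
  base :: 'a

abbreviation points :: "'a pointed_space \<Rightarrow> 'a set" where
  "points A \<equiv> topspace (top_of A)"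

definition pointed_CGWH :: "'a pointed_space \<Rightarrow> bool" where
  "pointed_CGWH A \<longleftrightarrow>
     compactly_generated_space (top_of A) \<and> weak_Hausdorff_space (top_of A) \<and> base A \<in> points A"

definition pointed_map :: "'a pointed_space \<Rightarrow> 'b pointed_space \<Rightarrow> ('a \<Rightarrow> 'b) \<Rightarrow> bool" where
  "pointed_map A B f \<longleftrightarrow> continuous_map (top_of A) (top_of B) f \<and> f (base A) = base B"

text \<open>
  The circle is \<open>[0,1]\<close> with both ends identified; \<^const>\<open>frac\<close> sends \<open>1\<close> to \<open>0\<close> and fixes
  all other points of \<open>[0,1]\<close>, so the points of the circle are those of \<open>[0,1)\<close>.
\<close>

definition S1 :: "real pointed_space" where
  "S1 = \<lparr>top_of = quot_topology (top_of_set {0..1}) frac, base = 0\<rparr>"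

text \<open>
  The smash product is the product with the wedge collapsed to \<open>(base A, base B)\<close>, all other points
  being kept. It is only used with \<open>B = S1\<close>; as \<^const>\<open>S1\<close> is compact Hausdorff, the
  product topology then agrees with the compactly generated product.
\<close>

definition smash_proj :: "'a pointed_space \<Rightarrow> 'b pointed_space \<Rightarrow> 'a \<times> 'b \<Rightarrow> 'a \<times> 'b" where
  "smash_proj A B p = (if fst p = base A \<or> snd p = base B then (base A, base B) else p)"

definition smash :: "'a pointed_space \<Rightarrow> 'b pointed_space \<Rightarrow> ('a \<times> 'b) pointed_space" where
  "smash A B =
     \<lparr>top_of = quot_topology (prod_topology (top_of A) (top_of B)) (smash_proj A B),
      base = (base A, base B)\<rparr>"


section \<open>Symmetric spectra\<close>

text \<open>
  The elements of the symmetric group on \<open>{1..n}\<close> are the functions \<open>\<gamma>\<close> with \<open>\<gamma> permutes {1..n}\<close>;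
  thus the inclusion of this group into the symmetric group on \<open>{1..n+1}\<close> is the identity on functions.
  In a structure \<open>X\<close> all levels are carried by one type; since the levels of an arbitrary spectrum can
  be replaced by disjoint copies in a common type, this is no restriction.
\<close>

record 'a spectrum_data =
  level :: "nat \<Rightarrow> 'a pointed_space"
  sym_act :: "nat \<Rightarrow> (nat \<Rightarrow> nat) \<Rightarrow> 'a \<Rightarrow> 'a"
  struct_map :: "nat \<Rightarrow> 'a \<times> real \<Rightarrow> 'a"

text \<open>\<open>block_perm n \<gamma> \<delta>\<close> is the permutation \<open>\<gamma> \<times> \<delta>\<close>.\<close>

definition block_perm :: "nat \<Rightarrow> (nat \<Rightarrow> nat) \<Rightarrow> (nat \<Rightarrow> nat) \<Rightarrow> nat \<Rightarrow> nat" where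
  "block_perm n \<gamma> \<delta> i = (if i \<le> n then \<gamma> i else n + \<delta> (i - n))"

text \<open>
  The value of the iterated structure map \<open>\<sigma>\<^sup>m\<close> at the point \<open>x \<and> t 1 \<and> \<dots> \<and> t m\<close> of
  the smash product of \<open>X\<^sub>n\<close> and \<open>S\<^sup>m\<close>.
\<close>

primrec iter_struct_map :: "'a spectrum_data \<Rightarrow> nat \<Rightarrow> nat \<Rightarrow> 'a \<Rightarrow> (nat \<Rightarrow> real) \<Rightarrow> 'a" where
  "iter_struct_map X n 0 x t = x"
| "iter_struct_map X n (Suc m) x t =
     struct_map X (n + m) (smash_proj (level X (n + m)) S1 (iter_struct_map X n m x t, t (Suc m)))"

text \<open>
  In the last clause, \<open>\<delta>\<close> acts on \<open>S\<^sup>m\<close> by moving the \<open>i\<close>-th factor to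
  position \<open>\<delta> i\<close>, that is \<open>t \<mapsto> t \<circ> inv \<delta>\<close>.
\<close>

definition symmetric_spectrum :: "'a spectrum_data \<Rightarrow> bool" where
  "symmetric_spectrum X \<longleftrightarrow>
     (\<forall>n. pointed_CGWH (level X n)) \<and>
     (\<forall>n \<gamma>. \<gamma> permutes {1..n} \<longrightarrow> pointed_map (level X n) (level X n) (sym_act X n \<gamma>)) \<and>
     (\<forall>n. \<forall>x \<in> points (level X n). sym_act X n id x = x) \<and>
     (\<forall>n \<gamma> \<delta>. \<gamma> permutes {1..n} \<longrightarrow> \<delta> permutes {1..n} \<longrightarrow>
        (\<forall>x \<in> points (level X n). sym_act X n (\<gamma> \<circ> \<delta>) x = sym_act X n \<gamma> (sym_act X n \<delta> x))) \<and>
     (\<forall>n. pointed_map (smash (level X n) S1) (level X (Suc n)) (struct_map X n)) \<and>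
     (\<forall>n m \<gamma> \<delta>. \<gamma> permutes {1..n} \<longrightarrow> \<delta> permutes {1..m} \<longrightarrow>
        (\<forall>x \<in> points (level X n). \<forall>t \<in> {1..m} \<rightarrow> points S1.
           iter_struct_map X n m (sym_act X n \<gamma> x) (t \<circ> inv_into UNIV \<delta>) =
           sym_act X (n + m) (block_perm n \<gamma> \<delta>) (iter_struct_map X n m x t)))"

definition spectrum_morphism ::
  "'a spectrum_data \<Rightarrow> 'b spectrum_data \<Rightarrow> (nat \<Rightarrow> 'a \<Rightarrow> 'b) \<Rightarrow> bool" where
  "spectrum_morphism X Y f \<longleftrightarrow>
     (\<forall>n. pointed_map (level X n) (level Y n) (f n)) \<and>
     (\<forall>n \<gamma>. \<gamma> permutes {1..n} \<longrightarrow>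
        (\<forall>x \<in> points (level X n). f n (sym_act X n \<gamma> x) = sym_act Y n \<gamma> (f n x))) \<and>
     (\<forall>n. \<forall>x \<in> points (level X n). \<forall>t \<in> points S1.
        f (Suc n) (struct_map X n (smash_proj (level X n) S1 (x, t))) =
        struct_map Y n (smash_proj (level Y n) S1 (f n x, t)))"


section \<open>Homotopy groups of spaces\<close>

text \<open>
  From here on, a function on a quotient is defined through representatives as
  \<open>the_elem\<close> of the set of all values obtained from representatives, which is a singleton when
  the function is well defined.
\<close>

definition cube :: "nat \<Rightarrow> (nat \<Rightarrow> real) topology" where
  "cube m = product_topology (\<lambda>_. top_of_set {0..1}) {1..m}"

definition cube_boundary :: "nat \<Rightarrow> (nat \<Rightarrow> real) set" where
  "cube_boundary m = {t \<in> topspace (cube m). \<exists>i \<in> {1..m}. t i = 0 \<or> t i = 1}"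

definition cube_maps :: "nat \<Rightarrow> 'a pointed_space \<Rightarrow> ((nat \<Rightarrow> real) \<Rightarrow> 'a) set" where
  "cube_maps m A =
     {g. continuous_map (cube m) (top_of A) g \<and> g ` cube_boundary m \<subseteq> {base A}}"

definition cube_homotopic ::
  "nat \<Rightarrow> 'a pointed_space \<Rightarrow> (((nat \<Rightarrow> real) \<Rightarrow> 'a) \<times> ((nat \<Rightarrow> real) \<Rightarrow> 'a)) set" where
  "cube_homotopic m A =
     {(g, h). homotopic_with (\<lambda>u. u ` cube_boundary m \<subseteq> {base A}) (cube m) (top_of A) g h}"

definition cube_class ::
  "nat \<Rightarrow> 'a pointed_space \<Rightarrow> ((nat \<Rightarrow> real) \<Rightarrow> 'a) \<Rightarrow> ((nat \<Rightarrow> real) \<Rightarrow> 'a) set" where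
  "cube_class m A g = cube_homotopic m A `` {g}"

definition cube_concat ::
  "((nat \<Rightarrow> real) \<Rightarrow> 'a) \<Rightarrow> ((nat \<Rightarrow> real) \<Rightarrow> 'a) \<Rightarrow> (nat \<Rightarrow> real) \<Rightarrow> 'a" where
  "cube_concat g h t = (if t 1 \<le> 1/2 then g (t(1 := 2 * t 1)) else h (t(1 := 2 * t 1 - 1)))"

text \<open>The multiplication is meaningful for \<open>m \<ge> 1\<close>; only \<open>m \<ge> 2\<close> is used below.\<close>

definition homotopy_group :: "nat \<Rightarrow> 'a pointed_space \<Rightarrow> ((nat \<Rightarrow> real) \<Rightarrow> 'a) set monoid" where
  "homotopy_group m A =
     \<lparr>carrier = cube_maps m A // cube_homotopic m A,
      monoid.mult = (\<lambda>c d. the_elem ((\<lambda>(g, h). cube_class m A (cube_concat g h)) ` (c \<times> d))),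
      monoid.one = cube_class m A (\<lambda>_. base A)\<rparr>"

definition homotopy_map ::
  "nat \<Rightarrow> 'b pointed_space \<Rightarrow> ('a \<Rightarrow> 'b) \<Rightarrow>
     ((nat \<Rightarrow> real) \<Rightarrow> 'a) set \<Rightarrow> ((nat \<Rightarrow> real) \<Rightarrow> 'b) set" where
  "homotopy_map m B f c = the_elem ((\<lambda>g. cube_class m B (f \<circ> g)) ` c)"

text \<open>The new circle coordinate is the last one.\<close>

definition suspend_map ::
  "nat \<Rightarrow> 'a pointed_space \<Rightarrow> ((nat \<Rightarrow> real) \<Rightarrow> 'a) \<Rightarrow> (nat \<Rightarrow> real) \<Rightarrow> 'a \<times> real" where
  "suspend_map m A g t = smash_proj A S1 (g (restrict t {1..m}), frac (t (Suc m)))"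

definition suspension ::
  "nat \<Rightarrow> 'a pointed_space \<Rightarrow> ((nat \<Rightarrow> real) \<Rightarrow> 'a) set \<Rightarrow> ((nat \<Rightarrow> real) \<Rightarrow> 'a \<times> real) set" where
  "suspension m A c = the_elem ((\<lambda>g. cube_class (Suc m) (smash A S1) (suspend_map m A g)) ` c)"


section \<open>Sequential colimits of abelian groups\<close>

primrec seq_iter :: "(nat \<Rightarrow> 'g \<Rightarrow> 'g) \<Rightarrow> nat \<Rightarrow> nat \<Rightarrow> 'g \<Rightarrow> 'g" where
  "seq_iter j n 0 x = x"
| "seq_iter j n (Suc d) x = j (n + d) (seq_iter j n d x)"

text \<open>
  Here \<open>I\<close> is an up-closed set of indices; \<open>j n\<close> maps \<open>G n\<close> to \<open>G (Suc n)\<close> for \<open>n \<in> I\<close>.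
\<close>

definition colim_rel ::
  "nat set \<Rightarrow> (nat \<Rightarrow> 'g monoid) \<Rightarrow> (nat \<Rightarrow> 'g \<Rightarrow> 'g) \<Rightarrow> ((nat \<times> 'g) \<times> (nat \<times> 'g)) set" where
  "colim_rel I G j =
     {((n, x), (n', x')). n \<in> I \<and> x \<in> carrier (G n) \<and> n' \<in> I \<and> x' \<in> carrier (G n') \<and>
        (\<exists>p. n \<le> p \<and> n' \<le> p \<and> seq_iter j n (p - n) x = seq_iter j n' (p - n') x')}"

definition colim_class ::
  "nat set \<Rightarrow> (nat \<Rightarrow> 'g monoid) \<Rightarrow> (nat \<Rightarrow> 'g \<Rightarrow> 'g) \<Rightarrow> nat \<times> 'g \<Rightarrow> (nat \<times> 'g) set" where
  "colim_class I G j p = colim_rel I G j `` {p}"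

text \<open>The multiplicative part of an abelian group presented as a ring record is never used.\<close>

definition colim_group ::
  "nat set \<Rightarrow> (nat \<Rightarrow> 'g monoid) \<Rightarrow> (nat \<Rightarrow> 'g \<Rightarrow> 'g) \<Rightarrow> (nat \<times> 'g) set ring" where
  "colim_group I G j =
     \<lparr>carrier = (SIGMA n:I. carrier (G n)) // colim_rel I G j,
      monoid.mult = undefined,
      monoid.one = undefined,
      ring.zero = the_elem ((\<lambda>n. colim_class I G j (n, \<one>\<^bsub>G n\<^esub>)) ` I),
      ring.add = (\<lambda>c d. the_elem
        ((\<lambda>((n, x), (n', x')). colim_class I G j
            (max n n', seq_iter j n (max n n' - n) x
               \<otimes>\<^bsub>G (max n n')\<^esub> seq_iter j n' (max n n' - n') x')) ` (c \<times> d)))\<rparr>"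


section \<open>Modules over monoid rings\<close>

definition monoid_ring :: "('m, 'z) monoid_scheme \<Rightarrow> ('m \<Rightarrow>\<^sub>0 int) ring" where
  "monoid_ring G =
     \<lparr>carrier = {a. Poly_Mapping.keys a \<subseteq> carrier G},
      monoid.mult = (\<lambda>a b. frag_extend (\<lambda>f. frag_extend (\<lambda>g. frag_of (f \<otimes>\<^bsub>G\<^esub> g)) b) a),
      monoid.one = frag_of \<one>\<^bsub>G\<^esub>,
      ring.zero = 0,
      ring.add = (+)\<rparr>"

text \<open>The library's locale \<^locale>\<open>module\<close> is restricted to commutative rings.\<close>

locale left_module = R?: ring R + M?: abelian_group M
  for R :: "('r, 'x) ring_scheme" (structure)
  and M :: "('r, 'a, 'y) module_scheme" (structure) +
  assumes lsmult_closed: "\<lbrakk>a \<in> carrier R; x \<in> carrier M\<rbrakk> \<Longrightarrow> a \<odot>\<^bsub>M\<^esub> x \<in> carrier M"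
    and lsmult_l_distr: "\<lbrakk>a \<in> carrier R; b \<in> carrier R; x \<in> carrier M\<rbrakk>
      \<Longrightarrow> (a \<oplus>\<^bsub>R\<^esub> b) \<odot>\<^bsub>M\<^esub> x = a \<odot>\<^bsub>M\<^esub> x \<oplus>\<^bsub>M\<^esub> b \<odot>\<^bsub>M\<^esub> x"
    and lsmult_r_distr: "\<lbrakk>a \<in> carrier R; x \<in> carrier M; y \<in> carrier M\<rbrakk>
      \<Longrightarrow> a \<odot>\<^bsub>M\<^esub> (x \<oplus>\<^bsub>M\<^esub> y) = a \<odot>\<^bsub>M\<^esub> x \<oplus>\<^bsub>M\<^esub> a \<odot>\<^bsub>M\<^esub> y"
    and lsmult_assoc: "\<lbrakk>a \<in> carrier R; b \<in> carrier R; x \<in> carrier M\<rbrakk>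
      \<Longrightarrow> (a \<otimes>\<^bsub>R\<^esub> b) \<odot>\<^bsub>M\<^esub> x = a \<odot>\<^bsub>M\<^esub> (b \<odot>\<^bsub>M\<^esub> x)"
    and lsmult_one: "x \<in> carrier M \<Longrightarrow> \<one>\<^bsub>R\<^esub> \<odot>\<^bsub>M\<^esub> x = x"

definition left_module_iso ::
  "('r, 'x) ring_scheme \<Rightarrow> ('r, 'a, 'y) module_scheme \<Rightarrow> ('r, 'b, 'z) module_scheme
     \<Rightarrow> ('a \<Rightarrow> 'b) \<Rightarrow> bool" where
  "left_module_iso R M N h \<longleftrightarrow>
     left_module R M \<and> left_module R N \<and>
     h \<in> iso (add_monoid M) (add_monoid N) \<and>
     (\<forall>a \<in> carrier R. \<forall>x \<in> carrier M. h (a \<odot>\<^bsub>M\<^esub> x) = a \<odot>\<^bsub>N\<^esub> h x)"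

text \<open>The module over the monoid ring given by an additive monoid action on an abelian group.\<close>

definition action_module :: "'a ring \<Rightarrow> ('m \<Rightarrow> 'a \<Rightarrow> 'a) \<Rightarrow> ('m \<Rightarrow>\<^sub>0 int, 'a) module" where
  "action_module A \<mu> =
     \<lparr>carrier = carrier A,
      monoid.mult = monoid.mult A,
      monoid.one = monoid.one A,
      ring.zero = ring.zero A,
      ring.add = ring.add A,
      module.smult = (\<lambda>c x. finsum A (\<lambda>f. [Poly_Mapping.lookup c f] \<cdot>\<^bsub>A\<^esub> \<mu> f x) (Poly_Mapping.keys c))\<rparr>"

text \<open>In an \<open>S\<close>-\<open>R\<close>-bimodule \<open>P\<close>, \<open>rsmult P p r\<close> is the right action \<open>p \<cdot> r\<close> of \<open>R\<close>.\<close>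

record ('s, 'r, 'p) bimodule = "('s, 'p) module" +
  rsmult :: "'p \<Rightarrow> 'r \<Rightarrow> 'p"

definition tensor_relations ::
  "('r, 'x) ring_scheme \<Rightarrow> ('s, 'r, 'p) bimodule \<Rightarrow> ('r, 'a) module \<Rightarrow> ('p \<times> 'a \<Rightarrow>\<^sub>0 int) set" where
  "tensor_relations R P N =
     {frag_of (p \<oplus>\<^bsub>P\<^esub> p', x) - frag_of (p, x) - frag_of (p', x) | p p' x.
        p \<in> carrier P \<and> p' \<in> carrier P \<and> x \<in> carrier N} \<union>
     {frag_of (p, x \<oplus>\<^bsub>N\<^esub> x') - frag_of (p, x) - frag_of (p, x') | p x x'.
        p \<in> carrier P \<and> x \<in> carrier N \<and> x' \<in> carrier N} \<union>
     {frag_of (rsmult P p r, x) - frag_of (p, r \<odot>\<^bsub>N\<^esub> x) | p r x.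
        p \<in> carrier P \<and> r \<in> carrier R \<and> x \<in> carrier N}"

definition tensor_subgroup ::
  "('r, 'x) ring_scheme \<Rightarrow> ('s, 'r, 'p) bimodule \<Rightarrow> ('r, 'a) module \<Rightarrow> ('p \<times> 'a \<Rightarrow>\<^sub>0 int) set" where
  "tensor_subgroup R P N =
     generate (free_Abelian_group (carrier P \<times> carrier N)) (tensor_relations R P N)"

definition tensor_class ::
  "('r, 'x) ring_scheme \<Rightarrow> ('s, 'r, 'p) bimodule \<Rightarrow> ('r, 'a) module
     \<Rightarrow> ('p \<times> 'a \<Rightarrow>\<^sub>0 int) \<Rightarrow> ('p \<times> 'a \<Rightarrow>\<^sub>0 int) set" where
  "tensor_class R P N c =
     tensor_subgroup R P N #>\<^bsub>free_Abelian_group (carrier P \<times> carrier N)\<^esub> c"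

definition tensor ::
  "('r, 'x) ring_scheme \<Rightarrow> ('s, 'r, 'p) bimodule \<Rightarrow> ('r, 'a) module
     \<Rightarrow> ('s, ('p \<times> 'a \<Rightarrow>\<^sub>0 int) set) module" where
  "tensor R P N =
     (let Q = free_Abelian_group (carrier P \<times> carrier N) Mod tensor_subgroup R P N in
      \<lparr>carrier = carrier Q,
       monoid.mult = undefined,
       monoid.one = undefined,
       ring.zero = \<one>\<^bsub>Q\<^esub>,
       ring.add = monoid.mult Q,
       module.smult = (\<lambda>s C. the_elem
         ((\<lambda>c. tensor_class R P N (frag_extend (\<lambda>(p, x). frag_of (s \<odot>\<^bsub>P\<^esub> p, x)) c)) ` C))\<rparr>)"

text \<open>The map \<open>id \<otimes> g\<close> from \<open>P \<otimes> N\<close> to \<open>P \<otimes> N'\<close>.\<close>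

definition tensor_map ::
  "('r, 'x) ring_scheme \<Rightarrow> ('s, 'r, 'p) bimodule \<Rightarrow> ('r, 'b) module \<Rightarrow> ('a \<Rightarrow> 'b)
     \<Rightarrow> ('p \<times> 'a \<Rightarrow>\<^sub>0 int) set \<Rightarrow> ('p \<times> 'b \<Rightarrow>\<^sub>0 int) set" where
  "tensor_map R P N' g C =
     the_elem ((\<lambda>c. tensor_class R P N' (frag_extend (\<lambda>(p, x). frag_of (p, g x)) c)) ` C)"


section \<open>The injection monoid\<close>

text \<open>
  An injective self-map of \<open>{1, 2, \<dots>}\<close> is extended to all natural numbers by sending \<open>0\<close> to \<open>0\<close>.
\<close>

definition inj_monoid :: "(nat \<Rightarrow> nat) monoid" where
  "inj_monoid = \<lparr>carrier = {f. inj f \<and> f 0 = 0}, monoid.mult = (\<circ>), monoid.one = id\<rparr>"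

abbreviation ZM :: "((nat \<Rightarrow> nat) \<Rightarrow>\<^sub>0 int) ring" where
  "ZM \<equiv> monoid_ring inj_monoid"

definition one_times :: "(nat \<Rightarrow> nat) \<Rightarrow> nat \<Rightarrow> nat" where
  "one_times f i = (if i \<le> 1 then i else f (i - 1) + 1)"

definition ZM_plus ::
  "((nat \<Rightarrow> nat) \<Rightarrow>\<^sub>0 int, (nat \<Rightarrow> nat) \<Rightarrow>\<^sub>0 int, (nat \<Rightarrow> nat) \<Rightarrow>\<^sub>0 int) bimodule" where
  "ZM_plus =
     \<lparr>carrier = carrier ZM,
      monoid.mult = monoid.mult ZM,
      monoid.one = monoid.one ZM,
      ring.zero = ring.zero ZM,
      ring.add = ring.add ZM,
      module.smult = (\<lambda>a p. a \<otimes>\<^bsub>ZM\<^esub> p),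
      rsmult = (\<lambda>p a. p \<otimes>\<^bsub>ZM\<^esub> frag_extend (frag_of \<circ> one_times) a)\<rparr>"


section \<open>Homotopy groups of symmetric spectra\<close>

text \<open>
  The colimit is formed over those \<open>n\<close> for which \<open>k + n \<ge> 2\<close>, so that all its terms are
  abelian groups; they are cofinal among all \<open>n\<close>.
\<close>

definition stable_range :: "int \<Rightarrow> nat set" where
  "stable_range k = {n. 2 \<le> k + int n}"

definition level_group ::
  "'a spectrum_data \<Rightarrow> int \<Rightarrow> nat \<Rightarrow> ((nat \<Rightarrow> real) \<Rightarrow> 'a) set monoid" where
  "level_group X k n = homotopy_group (nat (k + int n)) (level X n)"

definition iota ::
  "'a spectrum_data \<Rightarrow> int \<Rightarrow> nat \<Rightarrow> ((nat \<Rightarrow> real) \<Rightarrow> 'a) set \<Rightarrow> ((nat \<Rightarrow> real) \<Rightarrow> 'a) set" where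
  "iota X k n c =
     homotopy_map (nat (k + int (Suc n))) (level X (Suc n)) (struct_map X n)
       (suspension (nat (k + int n)) (level X n) c)"

definition stable_class ::
  "'a spectrum_data \<Rightarrow> int \<Rightarrow> nat \<times> ((nat \<Rightarrow> real) \<Rightarrow> 'a) set
     \<Rightarrow> (nat \<times> ((nat \<Rightarrow> real) \<Rightarrow> 'a) set) set" where
  "stable_class X k = colim_class (stable_range k) (level_group X k) (iota X k)"

definition max_value :: "(nat \<Rightarrow> nat) \<Rightarrow> nat \<Rightarrow> nat" where
  "max_value f n = (if n = 0 then 0 else Max (f ` {1..n}))"

text \<open>The values \<open>[sgn \<gamma> \<cdot> \<gamma>\<^sub>*(\<iota>\<^sub>*\<^bsup>m-n\<^esup> x)]\<close> for all representatives \<open>x\<close> and all admissible \<open>\<gamma>\<close>.\<close>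

definition inj_action ::
  "'a spectrum_data \<Rightarrow> int \<Rightarrow> (nat \<Rightarrow> nat) \<Rightarrow> (nat \<times> ((nat \<Rightarrow> real) \<Rightarrow> 'a) set) set
     \<Rightarrow> (nat \<times> ((nat \<Rightarrow> real) \<Rightarrow> 'a) set) set" where
  "inj_action X k f c = the_elem
     {stable_class X k
        (m, homotopy_map (nat (k + int m)) (level X m) (sym_act X m \<gamma>) (seq_iter (iota X k) n (m - n) x)
              [^]\<^bsub>level_group X k m\<^esub> sign \<gamma>)
      | n x m \<gamma>. (n, x) \<in> c \<and> m = max_value f n \<and> \<gamma> permutes {1..m} \<and> (\<forall>i \<in> {1..n}. \<gamma> i = f i)}"

definition stable_homotopy ::
  "'a spectrum_data \<Rightarrow> int
     \<Rightarrow> ((nat \<Rightarrow> nat) \<Rightarrow>\<^sub>0 int, (nat \<times> ((nat \<Rightarrow> real) \<Rightarrow> 'a) set) set) module" where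
  "stable_homotopy X k =
     action_module (colim_group (stable_range k) (level_group X k) (iota X k)) (inj_action X k)"

definition stable_homotopy_map ::
  "'b spectrum_data \<Rightarrow> int \<Rightarrow> (nat \<Rightarrow> 'a \<Rightarrow> 'b) \<Rightarrow> (nat \<times> ((nat \<Rightarrow> real) \<Rightarrow> 'a) set) set
     \<Rightarrow> (nat \<times> ((nat \<Rightarrow> real) \<Rightarrow> 'b) set) set" where
  "stable_homotopy_map Y k f c = the_elem
     ((\<lambda>(n, x). stable_class Y k (n, homotopy_map (nat (k + int n)) (level Y n) (f n) x)) ` c)"


section \<open>The smash product with the free symmetric spectrum on the zero-sphere in level one\<close>

text \<open>
  The space in level \<open>1 + n\<close> is the quotient of \<open>\<Sigma>\<^sub>1\<^sub>+\<^sub>n \<times> X\<^sub>n\<close> by the relation below, which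
  identifies \<open>(\<alpha> \<circ> (1 \<times> \<gamma>), x)\<close> with \<open>(\<alpha>, \<gamma> x)\<close> and collapses all \<open>(\<alpha>, base)\<close>
  to one point. Its points are equivalence classes; the only point in level \<open>0\<close> is given by
  the empty set.
\<close>

definition F1_rel ::
  "'a spectrum_data \<Rightarrow> nat \<Rightarrow> (((nat \<Rightarrow> nat) \<times> 'a) \<times> ((nat \<Rightarrow> nat) \<times> 'a)) set" where
  "F1_rel X n =
     {((\<alpha>, x), (\<beta>, y)).
        \<alpha> permutes {1..1 + n} \<and> \<beta> permutes {1..1 + n} \<and>
        x \<in> points (level X n) \<and> y \<in> points (level X n) \<and>
        ((\<exists>\<gamma>. \<gamma> permutes {1..n} \<and> \<alpha> = \<beta> \<circ> one_times \<gamma> \<and> y = sym_act X n \<gamma> x) \<or>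
         (x = base (level X n) \<and> y = base (level X n)))}"

definition F1_class :: "'a spectrum_data \<Rightarrow> nat \<Rightarrow> (nat \<Rightarrow> nat) \<times> 'a \<Rightarrow> ((nat \<Rightarrow> nat) \<times> 'a) set" where
  "F1_class X n p = F1_rel X n `` {p}"

definition F1_level :: "'a spectrum_data \<Rightarrow> nat \<Rightarrow> ((nat \<Rightarrow> nat) \<times> 'a) set pointed_space" where
  "F1_level X l = (case l of
     0 \<Rightarrow> \<lparr>top_of = discrete_topology {{}}, base = {}\<rparr>
   | Suc n \<Rightarrow>
       \<lparr>top_of = quot_topology
          (prod_topology (discrete_topology {\<alpha>. \<alpha> permutes {1..1 + n}}) (top_of (level X n)))
          (F1_class X n),
        base = F1_class X n (id, base (level X n))\<rparr>)"

definition F1_sym_act ::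
  "'a spectrum_data \<Rightarrow> nat \<Rightarrow> (nat \<Rightarrow> nat) \<Rightarrow> ((nat \<Rightarrow> nat) \<times> 'a) set \<Rightarrow> ((nat \<Rightarrow> nat) \<times> 'a) set" where
  "F1_sym_act X l \<beta> C = (case l of
     0 \<Rightarrow> {}
   | Suc n \<Rightarrow> the_elem ((\<lambda>(\<alpha>, x). F1_class X n (\<beta> \<circ> \<alpha>, x)) ` C))"

definition F1_struct_map ::
  "'a spectrum_data \<Rightarrow> nat \<Rightarrow> ((nat \<Rightarrow> nat) \<times> 'a) set \<times> real \<Rightarrow> ((nat \<Rightarrow> nat) \<times> 'a) set" where
  "F1_struct_map X l = (\<lambda>(C, t). case l of
     0 \<Rightarrow> base (F1_level X 1)
   | Suc n \<Rightarrow> the_elem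
       ((\<lambda>(\<alpha>, x). F1_class X (Suc n) (\<alpha>, struct_map X n (smash_proj (level X n) S1 (x, t)))) ` C))"

definition F1_smash :: "'a spectrum_data \<Rightarrow> ((nat \<Rightarrow> nat) \<times> 'a) set spectrum_data" where
  "F1_smash X =
     \<lparr>level = F1_level X, sym_act = F1_sym_act X, struct_map = F1_struct_map X\<rparr>"

definition F1_smash_map ::
  "'b spectrum_data \<Rightarrow> (nat \<Rightarrow> 'a \<Rightarrow> 'b)
     \<Rightarrow> nat \<Rightarrow> ((nat \<Rightarrow> nat) \<times> 'a) set \<Rightarrow> ((nat \<Rightarrow> nat) \<times> 'b) set" where
  "F1_smash_map Y f l C = (case l of
     0 \<Rightarrow> {}
   | Suc n \<Rightarrow> the_elem ((\<lambda>(\<alpha>, x). F1_class Y n (\<alpha>, f n x)) ` C))"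

end

theory Submission
  imports Defs
begin

text \<open>
  The level \<open>1 + n\<close> of \<open>F\<^sub>1S\<^sup>0 \<and> X\<close> is a wedge of \<open>1 + n\<close> copies of \<open>X\<^sub>n\<close>, indexed by the
  value \<open>\<alpha> 1\<close> of the permutation \<open>\<alpha>\<close>. After one suspension, a map from a cube into a wedge is
  homotopic to the sum of its components, so that in the colimit \<open>\<pi>\<^sub>k(F\<^sub>1S\<^sup>0 \<and> X)\<close> is a direct sum of
  copies of \<open>\<pi>\<^sub>k\<^sub>+\<^sub>1X\<close>. The inclusion \<open>\<eta>\<close> of the first copy satisfies \<open>\<eta>(f \<cdot> x) = (1 \<times> f) \<cdot> \<eta>(x)\<close>, and the
  cycle that moves \<open>1\<close> to \<open>i\<close> carries, up to sign, the first copy to the \<open>i\<close>-th. Algebraically, the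
  same cycles form a basis of the right module \<open>\<int>[M]\<^sup>+\<close>. Hence the map \<open>f \<otimes> x \<mapsto> f \<cdot> \<eta>(x)\<close> from
  \<open>\<int>[M]\<^sup>+ \<otimes> \<pi>\<^sub>k\<^sub>+\<^sub>1X\<close> to \<open>\<pi>\<^sub>k(F\<^sub>1S\<^sup>0 \<and> X)\<close> is bijective.
\<close>

text \<open>Surjectivity: peeling the copies off the wedge one at a time writes every class as a
  finite sum of classes f \<cdot> \<eta>(x); each step costs one suspension, which the colimit does
  not see. Injectivity: every tensor reduces to a sum of terms in which a cycle is paired with an
  element of the homotopy group of \<open>X\<close>, and the projections of the wedge to its copies
  recover these elements up to sign. The projections do not commute with the symmetric groups and so
  induce no maps of M-modules. But stabilization does not change the index \<alpha> 1 of a copy, so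
  they induce additive maps on the colimit, and additive maps suffice to detect zero. Signs arise
  because a permutation of suspension coordinates acts on a homotopy group by its sign. The factor
  sgn(\<gamma>) in the action compensates for this, at the price that the cycles permute the copies
  only up to sign. The point-set obstacle is the continuity of the structure maps, since a quotient
  map times the circle has to be controlled. It is settled by pasting over the copies, which are
  closed because weak Hausdorffness makes the base point closed.\<close>

lemma the_elem_image_const:
  assumes "A \<noteq> {}" "\<And>x. x \<in> A \<Longrightarrow> f x = v"
  shows "the_elem (f ` A) = v"
proof -
  have "f ` A = {v}"
    using assms by auto
  then show ?thesis
    by simp
qed

section \<open>Cubes\<close>

declare One_nat_def [simp del]

text \<open>Points of the cube are total functions on the natural numbers that are
  \<open>undefined\<close> outside {1..m}; hence the use of \<open>restrict\<close> whenever a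
  coordinate is dropped.\<close>

definition unit_cube :: "nat \<Rightarrow> (nat \<Rightarrow> real) set" where
  "unit_cube m = PiE {1..m} (\<lambda>_. {0..1})"

text \<open>The product topology on extensional functions is inherited from the space of all
  functions. Continuity on the cube can then be proved with \<open>continuous_on\<close> and its
  introduction rules.\<close>

lemma cube_eq: "cube m = top_of_set (unit_cube m)"
proof -
  have top: "topspace (cube m) = unit_cube m"
    by (simp add: cube_def unit_cube_def)
  have "continuous_map (cube m) euclidean id"
    unfolding euclidean_product_topology[symmetric] continuous_map_componentwise_UNIV
  proof
    fix i
    show "continuous_map (cube m) euclidean (\<lambda>x. id x i)"
    proof (cases "i \<in> {1..m}")
      case True
      then have "continuous_map (cube m) (top_of_set {0..1}) (\<lambda>x. x i)"
        unfolding cube_def by (rule continuous_map_product_projection)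
      then show ?thesis
        by (simp add: continuous_map_in_subtopology)
    next
      case False
      \<comment> \<open>Coordinates outside {1..m} are constantly \<open>undefined\<close>, hence
        continuous.\<close>
      have "continuous_map (cube m) euclidean (\<lambda>_. undefined :: real)"
        by simp
      then show ?thesis
        by (rule continuous_map_eq) (use False in \<open>auto simp: top unit_cube_def PiE_def extensional_def\<close>)
    qed
  qed
  then have "continuous_map (cube m) (top_of_set (unit_cube m)) id"
    by (simp add: continuous_map_in_subtopology top)
  moreover have "continuous_map (top_of_set (unit_cube m)) (cube m) id"
    unfolding cube_def continuous_map_componentwise
    by (auto simp: unit_cube_def PiE_def Pi_def continuous_map_in_subtopology
        intro!: continuous_on_product_then_coordinatewise[OF continuous_on_id])
  ultimately show ?thesis
    by (metis top topology_eq topology_finer_continuous_id topspace_euclidean_subtopology)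
qed

lemma cube_boundary_eq:
  "cube_boundary m = {t \<in> unit_cube m. \<exists>i \<in> {1..m}. t i = 0 \<or> t i = 1}"
  by (simp add: cube_boundary_def cube_eq)

lemma unit_cube_coord: "t \<in> unit_cube m \<Longrightarrow> i \<in> {1..m} \<Longrightarrow> 0 \<le> t i \<and> t i \<le> 1"
  by (auto simp: unit_cube_def PiE_iff)

lemma unit_cube_upd:
  "t \<in> unit_cube m \<Longrightarrow> i \<in> {1..m} \<Longrightarrow> 0 \<le> x \<Longrightarrow> x \<le> 1 \<Longrightarrow> t(i := x) \<in> unit_cube m"
  by (auto simp: unit_cube_def PiE_iff extensional_def)

lemma cube_boundary_upd:
  "t \<in> cube_boundary m \<Longrightarrow> i \<in> {1..m} \<Longrightarrow> 0 \<le> x \<Longrightarrow> x \<le> 1 \<Longrightarrow> t i \<noteq> 0 \<Longrightarrow> t i \<noteq> 1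
    \<Longrightarrow> t(i := x) \<in> cube_boundary m"
  unfolding cube_boundary_eq using unit_cube_upd by fastforce

lemma cube_boundary_upd_end:
  "t \<in> unit_cube m \<Longrightarrow> i \<in> {1..m} \<Longrightarrow> x = 0 \<or> x = 1 \<Longrightarrow> t(i := x) \<in> cube_boundary m"
  unfolding cube_boundary_eq by (auto intro: unit_cube_upd)

lemma cube_boundary_subset: "t \<in> cube_boundary m \<Longrightarrow> t \<in> unit_cube m"
  by (simp add: cube_boundary_eq)

section \<open>Cube maps and their homotopies relative to the boundary\<close>

lemma cube_maps_iff:
  "g \<in> cube_maps m A \<longleftrightarrow>
     continuous_map (top_of_set (unit_cube m)) (top_of A) g \<and> (\<forall>t \<in> cube_boundary m. g t = base A)"
  by (auto simp: cube_maps_def cube_eq)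

lemma cube_maps_point: "g \<in> cube_maps m A \<Longrightarrow> t \<in> unit_cube m \<Longrightarrow> g t \<in> points A"
  using continuous_map_image_subset_topspace by (fastforce simp: cube_maps_iff)

lemma cube_maps_boundary: "g \<in> cube_maps m A \<Longrightarrow> t \<in> cube_boundary m \<Longrightarrow> g t = base A"
  by (simp add: cube_maps_iff)

lemma const_cube_map: "base A \<in> points A \<Longrightarrow> (\<lambda>_. base A) \<in> cube_maps m A"
  by (simp add: cube_maps_iff)

text \<open>The boundary condition depends only on values on the cube, so
  \<open>homotopic_with\<close> unfolds to a single map on a subset of real \<times> (nat
  \<Rightarrow> real). Homotopies given by formulas enter in this form.\<close>

lemma cube_homotopic_iff:
  "(g, g') \<in> cube_homotopic m A \<longleftrightarrow>
     (\<exists>h. continuous_map (top_of_set ({0..1::real} \<times> unit_cube m)) (top_of A) h \<and>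
        (\<forall>t \<in> unit_cube m. h (0, t) = g t) \<and> (\<forall>t \<in> unit_cube m. h (1, t) = g' t) \<and>
        (\<forall>r \<in> {0..1}. \<forall>t \<in> cube_boundary m. h (r, t) = base A))"
proof -
  have "homotopic_with (\<lambda>u. u ` cube_boundary m \<subseteq> {base A}) (cube m) (top_of A) g g' \<longleftrightarrow>
      (\<exists>h. continuous_map (prod_topology (top_of_set {0..1::real}) (cube m)) (top_of A) h \<and>
        (\<forall>x \<in> topspace (cube m). h (0, x) = g x) \<and> (\<forall>x \<in> topspace (cube m). h (1, x) = g' x) \<and>
        (\<forall>t \<in> {0..1}. (\<lambda>x. h (t, x)) ` cube_boundary m \<subseteq> {base A}))"
  proof (rule homotopic_with)
    fix u v :: "(nat \<Rightarrow> real) \<Rightarrow> 'a"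
    assume "\<And>x. x \<in> topspace (cube m) \<Longrightarrow> u x = v x"
    then have "u ` cube_boundary m = v ` cube_boundary m"
      by (intro image_cong) (auto simp: cube_boundary_eq cube_eq)
    then show "u ` cube_boundary m \<subseteq> {base A} \<longleftrightarrow> v ` cube_boundary m \<subseteq> {base A}"
      by simp
  qed
  then show ?thesis
    by (simp add: cube_homotopic_def cube_eq image_subset_iff del: split_paired_Ex)
qed

lemma cube_homotopicE:
  assumes "(g, g') \<in> cube_homotopic m A"
  obtains h where "continuous_map (top_of_set ({0..1::real} \<times> unit_cube m)) (top_of A) h"
    "\<And>t. t \<in> unit_cube m \<Longrightarrow> h (0, t) = g t" "\<And>t. t \<in> unit_cube m \<Longrightarrow> h (1, t) = g' t"
    "\<And>r t. r \<in> {0..1} \<Longrightarrow> t \<in> cube_boundary m \<Longrightarrow> h (r, t) = base A"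
  using assms unfolding cube_homotopic_iff by (elim exE conjE) simp

lemma cube_homotopic_maps:
  "(g, g') \<in> cube_homotopic m A \<Longrightarrow> g \<in> cube_maps m A \<and> g' \<in> cube_maps m A"
  unfolding cube_homotopic_def cube_maps_def
  by (auto dest: homotopic_with_imp_continuous_maps homotopic_with_imp_property)

lemma equiv_cube_homotopic: "equiv (cube_maps m A) (cube_homotopic m A)"
proof (rule equivI)
  show "cube_homotopic m A \<subseteq> cube_maps m A \<times> cube_maps m A"
    by (auto dest: cube_homotopic_maps)
  show "refl_on (cube_maps m A) (cube_homotopic m A)"
    by (rule refl_onI) (simp add: cube_homotopic_def cube_maps_def)
  show "sym (cube_homotopic m A)"
    by (rule symI) (simp add: cube_homotopic_def homotopic_with_sym)
  show "trans (cube_homotopic m A)"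
    by (rule transI) (auto simp: cube_homotopic_def intro: homotopic_with_trans)
qed

lemma cube_homotopic_refl: "g \<in> cube_maps m A \<Longrightarrow> (g, g) \<in> cube_homotopic m A"
  by (simp add: cube_homotopic_def cube_maps_def)

lemma cube_homotopic_sym: "(g, h) \<in> cube_homotopic m A \<Longrightarrow> (h, g) \<in> cube_homotopic m A"
  by (simp add: cube_homotopic_def homotopic_with_sym)

lemma cube_homotopic_trans [trans]:
  "(g, h) \<in> cube_homotopic m A \<Longrightarrow> (h, k) \<in> cube_homotopic m A \<Longrightarrow> (g, k) \<in> cube_homotopic m A"
  by (auto simp: cube_homotopic_def intro: homotopic_with_trans)

text \<open>Representatives are total functions whose values off the cube are arbitrary. This
  identifies the classes of formulas that agree only on the cube.\<close>

lemma cube_homotopic_eq: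
  assumes "g \<in> cube_maps m A" "\<And>t. t \<in> unit_cube m \<Longrightarrow> g t = g' t"
  shows "(g, g') \<in> cube_homotopic m A"
  unfolding cube_homotopic_def
  using assms
  by (auto intro!: homotopic_with_equal simp: cube_maps_def cube_eq cube_boundary_eq image_subset_iff)

lemma cube_homotopic_comp:
  assumes "(g, h) \<in> cube_homotopic m A" "pointed_map A B f"
  shows "(f \<circ> g, f \<circ> h) \<in> cube_homotopic m B"
  using assms unfolding cube_homotopic_def pointed_map_def
  by (auto elim!: homotopic_with_compose_continuous_map_left)

lemma cube_maps_comp: "g \<in> cube_maps m A \<Longrightarrow> pointed_map A B f \<Longrightarrow> f \<circ> g \<in> cube_maps m B"
  using cube_homotopic_comp cube_homotopic_maps cube_homotopic_refl by blast

lemma cube_class_eq: "(g, h) \<in> cube_homotopic m A \<Longrightarrow> cube_class m A g = cube_class m A h"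
  unfolding cube_class_def using equiv_cube_homotopic equiv_class_eq by metis

lemma mem_cube_class: "h \<in> cube_class m A g \<longleftrightarrow> (g, h) \<in> cube_homotopic m A"
  by (simp add: cube_class_def)

lemma carrier_homotopy_group: "carrier (homotopy_group m A) = cube_class m A ` cube_maps m A"
  by (auto simp: homotopy_group_def quotient_def cube_class_def)

lemma cube_class_in_carrier: "g \<in> cube_maps m A \<Longrightarrow> cube_class m A g \<in> carrier (homotopy_group m A)"
  by (simp add: carrier_homotopy_group)

lemma homotopy_groupE:
  assumes "c \<in> carrier (homotopy_group m A)"
  obtains g where "g \<in> cube_maps m A" "c = cube_class m A g"
  using assms by (auto simp: carrier_homotopy_group)

lemma the_elem_cube_class:
  assumes "g \<in> cube_maps m A" "\<And>h. (g, h) \<in> cube_homotopic m A \<Longrightarrow> F h = F g"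
  shows "the_elem (F ` cube_class m A g) = F g"
proof (rule the_elem_image_const)
  show "cube_class m A g \<noteq> {}"
    using cube_homotopic_refl[OF assms(1)] mem_cube_class by blast
  show "F h = F g" if "h \<in> cube_class m A g" for h
    using that assms(2) by (simp only: mem_cube_class)
qed

lemma homotopy_map_class:
  assumes "g \<in> cube_maps m A" "pointed_map A B f"
  shows "homotopy_map m B f (cube_class m A g) = cube_class m B (f \<circ> g)"
  unfolding homotopy_map_def
proof (rule the_elem_cube_class[OF assms(1)])
  fix h
  assume "(g, h) \<in> cube_homotopic m A"
  then show "cube_class m B (f \<circ> h) = cube_class m B (f \<circ> g)"
    using cube_class_eq[OF cube_homotopic_comp[OF _ assms(2)]] by metis
qed


section \<open>Reparametrization\<close>

lemma continuous_on_coord_snd [continuous_intros]: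
  "continuous_on S (\<lambda>p. snd p (i :: 'i) :: 'b :: topological_space)"
  by (rule continuous_on_product_then_coordinatewise[OF continuous_on_snd[OF continuous_on_id]])

lemma continuous_on_fun_upd [continuous_intros]:
  fixes f :: "'c :: topological_space \<Rightarrow> 'i \<Rightarrow> 'b :: topological_space"
  assumes "continuous_on S f" "continuous_on S u"
  shows "continuous_on S (\<lambda>x. (f x)(i := u x))"
proof (rule continuous_on_coordinatewise_then_product)
  fix j
  show "continuous_on S (\<lambda>x. ((f x)(i := u x)) j)"
    by (cases "j = i") (use assms continuous_on_product_then_coordinatewise in auto)
qed

text \<open>Precomposition of \<open>g\<close> with a homotopy of maps between cubes that preserves
  boundaries. The end maps \<open>f0\<close> and \<open>f1\<close> are arbitrary functions agreeing
  with \<open>g \<circ> \<phi>\<close> on the cube, so that piecewise formulas such as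
  concatenations can be plugged in directly.\<close>

lemma reparam_homotopic:
  assumes cont: "continuous_on ({0..1::real} \<times> unit_cube m) \<phi>"
    and cube: "\<And>r t. r \<in> {0..1} \<Longrightarrow> t \<in> unit_cube m \<Longrightarrow> \<phi> (r, t) \<in> unit_cube n"
    and bd: "\<And>r t. r \<in> {0..1} \<Longrightarrow> t \<in> cube_boundary m \<Longrightarrow> \<phi> (r, t) \<in> cube_boundary n"
    and g: "g \<in> cube_maps n A"
    and 0: "\<And>t. t \<in> unit_cube m \<Longrightarrow> (g \<circ> \<phi>) (0, t) = f0 t"
    and 1: "\<And>t. t \<in> unit_cube m \<Longrightarrow> (g \<circ> \<phi>) (1, t) = f1 t"
  shows "(f0, f1) \<in> cube_homotopic m A"
  unfolding cube_homotopic_iff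
proof (intro exI conjI ballI)
  have "continuous_map (top_of_set (unit_cube n)) (top_of A) g"
    using g by (simp add: cube_maps_iff)
  moreover have "continuous_map (top_of_set ({0..1::real} \<times> unit_cube m)) (top_of_set (unit_cube n)) \<phi>"
    using cont cube by auto
  ultimately show "continuous_map (top_of_set ({0..1::real} \<times> unit_cube m)) (top_of A) (g \<circ> \<phi>)"
    by (metis continuous_map_compose)
  fix t
  assume t: "t \<in> unit_cube m"
  show "(g \<circ> \<phi>) (0, t) = f0 t" "(g \<circ> \<phi>) (1, t) = f1 t"
    using t by (rule 0, rule 1)
next
  fix r :: real and t
  assume "r \<in> {0..1}" "t \<in> cube_boundary m"
  then have "\<phi> (r, t) \<in> cube_boundary n"
    by (rule bd)
  then show "(g \<circ> \<phi>) (r, t) = base A"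
    using cube_maps_boundary[OF g] by simp
qed

definition reparam_at :: "nat \<Rightarrow> (real \<Rightarrow> real) \<Rightarrow> ((nat \<Rightarrow> real) \<Rightarrow> 'a) \<Rightarrow> (nat \<Rightarrow> real) \<Rightarrow> 'a" where
  "reparam_at i u g t = g (t(i := u (t i)))"

text \<open>The homotopy moves coordinate \<open>i\<close> along the segment from \<open>u\<close>
  to \<open>v\<close>. It is stationary on the two faces of direction \<open>i\<close>, which are
  sent into such faces; on the other faces a coordinate that is not touched witnesses the boundary.
  Both ends of \<open>u\<close> may go to the same face, which is used for paths that run out and
  return.\<close>

lemma coordinate_reparam_homotopic:
  fixes u v :: "real \<Rightarrow> real"
  assumes g: "g \<in> cube_maps m A" and i: "i \<in> {1..m}"
    and u: "continuous_on {0..1} u" "\<And>x. x \<in> {0..1} \<Longrightarrow> u x \<in> {0..1}"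
    and v: "continuous_on {0..1} v" "\<And>x. x \<in> {0..1} \<Longrightarrow> v x \<in> {0..1}"
    and ends: "u 0 = v 0" "u 1 = v 1" "u 0 \<in> {0, 1}" "u 1 \<in> {0, 1}"
    and eq: "\<And>t. t \<in> unit_cube m \<Longrightarrow> reparam_at i u g t = f0 t"
      "\<And>t. t \<in> unit_cube m \<Longrightarrow> reparam_at i v g t = f1 t"
  shows "(f0, f1) \<in> cube_homotopic m A"
proof -
  define \<phi> where "\<phi> = (\<lambda>p. (snd p)(i := (1 - fst p) * u (snd p i) + fst p * v (snd p i)))"
  have comp: "continuous_on ({0..1::real} \<times> unit_cube m) (\<lambda>p. w (snd p i))"
    if "continuous_on {0..1} w" for w :: "real \<Rightarrow> real"
    by (rule continuous_on_compose2[OF that continuous_on_coord_snd]) (use i unit_cube_coord in auto)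
  have cont: "continuous_on ({0..1::real} \<times> unit_cube m) \<phi>"
    unfolding \<phi>_def
    by (intro continuous_intros comp[OF u(1)] comp[OF v(1)])
  have conv: "(1 - r) * x + r * y \<in> {0..1}" if "r \<in> {0..1}" "x \<in> {0..1}" "y \<in> {0..1}" for r x y :: real
    using that convexD_alt[of "{0..1::real}" x y r] by simp
  have cube: "\<phi> (r, t) \<in> unit_cube m" if "r \<in> {0..1}" "t \<in> unit_cube m" for r t
    using conv[OF that(1) u(2) v(2), of "t i" "t i"] unit_cube_coord[OF that(2) i] that i
    by (auto simp: \<phi>_def intro!: unit_cube_upd)
  have bd: "\<phi> (r, t) \<in> cube_boundary m" if r: "r \<in> {0..1}" and t: "t \<in> cube_boundary m" for r t
  proof (cases "t i = 0 \<or> t i = 1")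
    case True
    then have "(1 - r) * u (t i) + r * v (t i) = u (t i) \<and> u (t i) \<in> {0, 1}"
      using ends by (auto simp: algebra_simps)
    then show ?thesis
      using cube_boundary_upd_end[OF cube_boundary_subset[OF t] i] by (auto simp: \<phi>_def)
  next
    case False
    have "t i \<in> {0..1}"
      using unit_cube_coord[OF cube_boundary_subset[OF t] i] by simp
    then have "(1 - r) * u (t i) + r * v (t i) \<in> {0..1}"
      by (intro conv r u v)
    then show ?thesis
      using False cube_boundary_upd[OF t i] by (auto simp: \<phi>_def)
  qed
  have "\<phi> (0, t) = t(i := u (t i))" "\<phi> (1, t) = t(i := v (t i))" for t
    by (simp_all add: \<phi>_def)
  then have eq': "(g \<circ> \<phi>) (0, t) = f0 t" "(g \<circ> \<phi>) (1, t) = f1 t" if "t \<in> unit_cube m" for t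
    using eq[OF that] by (simp_all only: reparam_at_def o_apply)
  show ?thesis
  proof (rule reparam_homotopic[where \<phi> = \<phi> and g = g and n = m and ?f0.0 = f0 and ?f1.0 = f1])
    show "continuous_on ({0..1} \<times> unit_cube m) \<phi>"
      by (rule cont)
    show "g \<in> cube_maps m A"
      by (rule g)
    show "\<phi> (r, t) \<in> unit_cube m" if "r \<in> {0..1}" "t \<in> unit_cube m" for r t
      using that by (rule cube)
    show "\<phi> (r, t) \<in> cube_boundary m" if "r \<in> {0..1}" "t \<in> cube_boundary m" for r t
      using that by (rule bd)
    show "(g \<circ> \<phi>) (0, t) = f0 t" "(g \<circ> \<phi>) (1, t) = f1 t" if "t \<in> unit_cube m" for t
      using eq'[OF that] by blast+
  qed
qed


section \<open>Homotopy groups\<close>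

definition concat_at ::
  "nat \<Rightarrow> ((nat \<Rightarrow> real) \<Rightarrow> 'a) \<Rightarrow> ((nat \<Rightarrow> real) \<Rightarrow> 'a) \<Rightarrow> (nat \<Rightarrow> real) \<Rightarrow> 'a" where
  "concat_at i g h t = (if t i \<le> 1/2 then g (t(i := 2 * t i)) else h (t(i := 2 * t i - 1)))"

lemma cube_concat_eq: "cube_concat = concat_at 1"
  by (intro ext) (simp add: cube_concat_def concat_at_def)

text \<open>The two homotopies are glued along the wall where coordinate \<open>i\<close> is 1/2.
  Applied to constant homotopies, this also shows that a concatenation is a cube map.\<close>

lemma concat_at_homotopic:
  assumes "(g, g') \<in> cube_homotopic m A" "(h, h') \<in> cube_homotopic m A" and i: "i \<in> {1..m}"
  shows "(concat_at i g h, concat_at i g' h') \<in> cube_homotopic m A"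
proof -
  obtain K where K: "continuous_map (top_of_set ({0..1::real} \<times> unit_cube m)) (top_of A) K"
    "\<And>t. t \<in> unit_cube m \<Longrightarrow> K (0, t) = g t" "\<And>t. t \<in> unit_cube m \<Longrightarrow> K (1, t) = g' t"
    "\<And>r t. r \<in> {0..1} \<Longrightarrow> t \<in> cube_boundary m \<Longrightarrow> K (r, t) = base A"
    by (rule cube_homotopicE[OF assms(1)], rule that)
  obtain L where L: "continuous_map (top_of_set ({0..1::real} \<times> unit_cube m)) (top_of A) L"
    "\<And>t. t \<in> unit_cube m \<Longrightarrow> L (0, t) = h t" "\<And>t. t \<in> unit_cube m \<Longrightarrow> L (1, t) = h' t"
    "\<And>r t. r \<in> {0..1} \<Longrightarrow> t \<in> cube_boundary m \<Longrightarrow> L (r, t) = base A"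
    by (rule cube_homotopicE[OF assms(2)], rule that)
  define N where "N = (\<lambda>p. if snd p i \<le> 1/2 then K (fst p, (snd p)(i := 2 * snd p i))
      else L (fst p, (snd p)(i := 2 * snd p i - 1)))"
  \<comment> \<open>The offset \<open>d\<close> is 0 on the lower half and 1 on the upper
    half.\<close>
  have upd: "continuous_on S (\<lambda>p. (fst p, (snd p)(i := 2 * snd p i - d)))" for d and S :: "(real \<times> (nat \<Rightarrow> real)) set"
    by (intro continuous_intros)
  have sub: "continuous_map (subtopology (top_of_set ({0..1::real} \<times> unit_cube m)) {p \<in> topspace (top_of_set ({0..1::real} \<times> unit_cube m)). Q p})
      (top_of_set ({0..1::real} \<times> unit_cube m)) (\<lambda>p. (fst p, (snd p)(i := 2 * snd p i - d)))"
    if "\<And>p. 0 \<le> snd p i \<Longrightarrow> snd p i \<le> 1 \<Longrightarrow> Q p \<Longrightarrow> d \<le> 2 * snd p i \<and> 2 * snd p i - d \<le> 1" for d Q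
    using upd that unit_cube_coord[OF _ i]
    by (auto simp: subtopology_subtopology intro!: unit_cube_upd i)
  have "continuous_map (top_of_set ({0..1::real} \<times> unit_cube m)) (top_of A) N"
    unfolding N_def
  proof (rule continuous_map_cases_le)
    show "continuous_map (subtopology (top_of_set ({0..1::real} \<times> unit_cube m))
        {p \<in> topspace (top_of_set ({0..1::real} \<times> unit_cube m)). snd p i \<le> 1/2}) (top_of A)
        (\<lambda>p. K (fst p, (snd p)(i := 2 * snd p i)))"
      using continuous_map_compose[OF sub K(1), where d1 = 0 and Q1 = "\<lambda>p. snd p i \<le> 1/2", unfolded o_def]
      by simp
    show "continuous_map (subtopology (top_of_set ({0..1::real} \<times> unit_cube m))
        {p \<in> topspace (top_of_set ({0..1::real} \<times> unit_cube m)). 1/2 \<le> snd p i}) (top_of A)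
        (\<lambda>p. L (fst p, (snd p)(i := 2 * snd p i - 1)))"
      by (rule continuous_map_compose[OF sub L(1), unfolded o_def]) auto
    show "K (fst p, (snd p)(i := 2 * snd p i)) = L (fst p, (snd p)(i := 2 * snd p i - 1))"
      if p: "p \<in> topspace (top_of_set ({0..1::real} \<times> unit_cube m))" "snd p i = 1/2" for p
    proof -
      \<comment> \<open>On the wall the rescaled coordinates are 1 and 0, so both halves have the
        base point as value.\<close>
      have "(snd p)(i := 1) \<in> cube_boundary m" "(snd p)(i := 0) \<in> cube_boundary m" "fst p \<in> {0..1}"
        using p i by (auto intro: cube_boundary_upd_end)
      moreover have "2 * snd p i = 1" "2 * snd p i - 1 = 0"
        using p(2) by simp_all
      ultimately show ?thesis
        using K(4) L(4) by (simp only:)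
    qed
    show "continuous_map (top_of_set ({0..1::real} \<times> unit_cube m)) euclideanreal (\<lambda>p. snd p i)"
      by (simp add: continuous_on_coord_snd)
  qed simp
  moreover have "N (r, t) = base A" if r: "r \<in> {0..1}" and t: "t \<in> cube_boundary m" for r t
  proof (cases "t i = 0 \<or> t i = 1")
    case True
    then show ?thesis
      using r K(4) L(4) cube_boundary_upd_end[OF cube_boundary_subset[OF t] i] by (auto simp: N_def)
  next
    case False
    then show ?thesis
      using r K(4) L(4) cube_boundary_upd[OF t i, of "2 * t i"] cube_boundary_upd[OF t i, of "2 * t i - 1"]
        unit_cube_coord[OF cube_boundary_subset[OF t] i]
      by (auto simp: N_def)
  qed
  moreover have "N (0, t) = concat_at i g h t" "N (1, t) = concat_at i g' h' t" if t: "t \<in> unit_cube m" for t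
    using unit_cube_coord[OF t i]
    by (simp_all add: N_def concat_at_def K(2,3) L(2,3) unit_cube_upd[OF t i])
  ultimately show ?thesis
    unfolding cube_homotopic_iff by (intro exI[of _ N]) simp
qed

lemma concat_at_maps:
  "g \<in> cube_maps m A \<Longrightarrow> h \<in> cube_maps m A \<Longrightarrow> i \<in> {1..m} \<Longrightarrow> concat_at i g h \<in> cube_maps m A"
  using cube_homotopic_maps concat_at_homotopic cube_homotopic_refl by metis

lemma concat_at_assoc:
  assumes g: "g \<in> cube_maps m A" and h: "h \<in> cube_maps m A" and k: "k \<in> cube_maps m A" and i: "i \<in> {1..m}"
  shows "(concat_at i (concat_at i g h) k, concat_at i g (concat_at i h k)) \<in> cube_homotopic m A"
proof -
  \<comment> \<open>\<open>u\<close> maps the breakpoints 0, 1/4, 1/2, 1 of the left bracketing to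
    the breakpoints 0, 1/2, 3/4, 1 of the right one. It is concave with slopes 2, 1, 1/2, hence the
    minimum of its three linear pieces.\<close>
  define u :: "real \<Rightarrow> real" where "u = (\<lambda>s. min (2 * s) (min (s + 1/4) ((s + 1) / 2)))"
  have u: "continuous_on {0..1} u"
    unfolding u_def by (auto intro!: continuous_intros)
  show ?thesis
  proof (rule coordinate_reparam_homotopic[OF _ i u _ continuous_on_id'])
    show "concat_at i g (concat_at i h k) \<in> cube_maps m A"
      by (intro concat_at_maps g h k i)
    fix t :: "nat \<Rightarrow> real"
    consider "t i \<le> 1/4" | "1/4 < t i" "t i \<le> 1/2" | "1/2 < t i"
      by linarith
    then have "concat_at i g (concat_at i h k) (t(i := u (t i))) = concat_at i (concat_at i g h) k t"
    proof cases
      case 1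
      then have "u (t i) = 2 * t i"
        by (simp add: u_def min_def)
      then show ?thesis
        using 1 by (simp add: concat_at_def)
    next
      case 2
      then have "u (t i) = t i + 1/4"
        by (simp add: u_def min_def field_simps)
      moreover have "2 * (t i + 1/4) - 1 = 2 * t i - 1/2" "2 * (2 * t i - 1/2) = 2 * (2 * t i) - 1"
        by simp_all
      ultimately show ?thesis
        using 2 by (simp add: concat_at_def)
    next
      case 3
      then have e: "u (t i) = (t i + 1) / 2"
        by (simp add: u_def min_def field_simps)
      have "2 * ((t i + 1) / 2) - 1 = t i"
        by (simp add: field_simps)
      then show ?thesis
        using 3 unfolding concat_at_def fun_upd_same fun_upd_upd e by simp
    qed
    then show "reparam_at i u (concat_at i g (concat_at i h k)) t = concat_at i (concat_at i g h) k t"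
      by (simp add: reparam_at_def)
  qed (auto simp: u_def min_def reparam_at_def)
qed

lemma concat_at_const_left:
  assumes g: "g \<in> cube_maps m A" and i: "i \<in> {1..m}"
  shows "(concat_at i (\<lambda>_. base A) g, g) \<in> cube_homotopic m A"
proof (rule coordinate_reparam_homotopic[OF g i _ _ continuous_on_id'])
  \<comment> \<open>The path waits at 0 during the first half and then runs at double speed.\<close>
  show "continuous_on {0..1} (\<lambda>s :: real. max 0 (2 * s - 1))"
    by (intro continuous_intros)
qed (auto intro!: cube_maps_boundary[OF g] cube_boundary_upd_end i simp: reparam_at_def concat_at_def max_def)

lemma concat_at_const_right:
  assumes g: "g \<in> cube_maps m A" and i: "i \<in> {1..m}"
  shows "(concat_at i g (\<lambda>_. base A), g) \<in> cube_homotopic m A"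
proof (rule coordinate_reparam_homotopic[OF g i _ _ continuous_on_id'])
  show "continuous_on {0..1} (\<lambda>s :: real. min 1 (2 * s))"
    by (intro continuous_intros)
  show "reparam_at i (\<lambda>s. min 1 (2 * s)) g t = concat_at i g (\<lambda>_. base A) t" if t: "t \<in> unit_cube m" for t
  proof (cases "t i \<le> 1/2")
    case True
    then have "min 1 (2 * t i) = 2 * t i"
      by simp
    then show ?thesis
      using True by (simp add: reparam_at_def concat_at_def)
  next
    case False
    then show ?thesis
      using t i cube_maps_boundary[OF g cube_boundary_upd_end] by (simp add: reparam_at_def concat_at_def min_def)
  qed
qed (auto simp: reparam_at_def)

abbreviation reverse_at :: "nat \<Rightarrow> ((nat \<Rightarrow> real) \<Rightarrow> 'a) \<Rightarrow> (nat \<Rightarrow> real) \<Rightarrow> 'a" where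
  "reverse_at i \<equiv> reparam_at i (\<lambda>s. 1 - s)"

lemma reverse_at_maps:
  assumes g: "g \<in> cube_maps m A" and i: "i \<in> {1..m}"
  shows "reverse_at i g \<in> cube_maps m A"
proof -
  have c: "continuous_on {0..1} (\<lambda>s :: real. 1 - s)"
    by (intro continuous_intros)
  have "(reverse_at i g, reverse_at i g) \<in> cube_homotopic m A"
    by (rule coordinate_reparam_homotopic[OF g i c _ c]) (simp_all add: reparam_at_def)
  then show ?thesis
    by (simp add: cube_homotopic_maps)
qed

lemma concat_at_reverse_right:
  assumes g: "g \<in> cube_maps m A" and i: "i \<in> {1..m}"
  shows "(concat_at i g (reverse_at i g), \<lambda>_. base A) \<in> cube_homotopic m A"
proof -
  \<comment> \<open>\<open>u\<close> runs to 1 and back. It starts and ends at 0, so it can be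
    deformed with fixed ends to the constant 0, where \<open>g\<close> has the base point as
    value.\<close>
  define u :: "real \<Rightarrow> real" where "u = (\<lambda>s. min (2 * s) (2 - 2 * s))"
  have u: "continuous_on {0..1} u"
    unfolding u_def by (intro continuous_intros)
  have eq: "reparam_at i u g t = concat_at i g (reverse_at i g) t" for t
    by (simp add: concat_at_def reparam_at_def u_def min_def)
  have bd: "g (t(i := 0)) = base A" if "t \<in> unit_cube m" for t
    using that i by (intro cube_maps_boundary[OF g] cube_boundary_upd_end) auto
  show ?thesis
    by (rule coordinate_reparam_homotopic[OF g i u _ continuous_on_const[of _ 0]])
      (simp_all add: eq, simp_all add: bd u_def min_def reparam_at_def)
qed

lemma reverse_at_reverse_at: "reverse_at i (reverse_at i g) = g"
  by (simp add: reparam_at_def fun_eq_iff)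

text \<open>Both sides subdivide the square of the two coordinates into the same four cells carrying
  the same maps.\<close>

lemma concat_at_interchange:
  assumes "i \<noteq> j"
  shows "concat_at i (concat_at j a b) (concat_at j c d) =
     concat_at j (concat_at i a c) (concat_at i b d)"
  by (rule ext) (use assms in \<open>simp add: concat_at_def fun_upd_twist[OF assms]\<close>)

text \<open>The Eckmann-Hilton argument.\<close>

lemma concat_at_change:
  assumes g: "g \<in> cube_maps m A" and h: "h \<in> cube_maps m A"
    and i: "i \<in> {1..m}" and j: "j \<in> {1..m}" and "i \<noteq> j" and A: "base A \<in> points A"
  shows "(concat_at i g h, concat_at j g h) \<in> cube_homotopic m A"
    and "(concat_at i g h, concat_at j h g) \<in> cube_homotopic m A"
proof -
  let ?c = "\<lambda>_ :: nat \<Rightarrow> real. base A"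
  have "(concat_at i g h, concat_at i (concat_at j g ?c) (concat_at j ?c h)) \<in> cube_homotopic m A"
    by (intro concat_at_homotopic cube_homotopic_sym[OF concat_at_const_left]
        cube_homotopic_sym[OF concat_at_const_right] g h i j)
  also have "concat_at i (concat_at j g ?c) (concat_at j ?c h)
      = concat_at j (concat_at i g ?c) (concat_at i ?c h)"
    by (rule concat_at_interchange) fact
  also have "(\<dots>, concat_at j g h) \<in> cube_homotopic m A"
    by (intro concat_at_homotopic concat_at_const_left concat_at_const_right g h i j)
  finally show "(concat_at i g h, concat_at j g h) \<in> cube_homotopic m A" .
  have "(concat_at i g h, concat_at i (concat_at j ?c g) (concat_at j h ?c)) \<in> cube_homotopic m A"
    by (intro concat_at_homotopic cube_homotopic_sym[OF concat_at_const_left]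
        cube_homotopic_sym[OF concat_at_const_right] g h i j)
  also have "concat_at i (concat_at j ?c g) (concat_at j h ?c)
      = concat_at j (concat_at i ?c h) (concat_at i g ?c)"
    by (rule concat_at_interchange) fact
  also have "(\<dots>, concat_at j h g) \<in> cube_homotopic m A"
    by (intro concat_at_homotopic concat_at_const_left concat_at_const_right g h i j)
  finally show "(concat_at i g h, concat_at j h g) \<in> cube_homotopic m A" .
qed

section \<open>The group structure on homotopy classes\<close>

lemma mult_cube_class_1:
  assumes g: "g \<in> cube_maps m A" and h: "h \<in> cube_maps m A" and m: "1 \<le> m"
  shows "cube_class m A g \<otimes>\<^bsub>homotopy_group m A\<^esub> cube_class m A h = cube_class m A (concat_at 1 g h)"
  unfolding homotopy_group_def monoid.simps
proof (rule the_elem_image_const)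
  have "(g, h) \<in> cube_class m A g \<times> cube_class m A h"
    using g h by (simp add: mem_cube_class cube_homotopic_refl)
  then show "cube_class m A g \<times> cube_class m A h \<noteq> {}"
    by blast
  fix p
  assume "p \<in> cube_class m A g \<times> cube_class m A h"
  then have "(concat_at 1 g h, concat_at 1 (fst p) (snd p)) \<in> cube_homotopic m A"
    using m by (intro concat_at_homotopic) (auto simp: mem_cube_class mem_Times_iff)
  then show "(case p of (g, h) \<Rightarrow> cube_class m A (cube_concat g h)) = cube_class m A (concat_at 1 g h)"
    by (simp add: cube_concat_eq case_prod_unfold cube_class_eq)
qed

lemma one_homotopy_group: "\<one>\<^bsub>homotopy_group m A\<^esub> = cube_class m A (\<lambda>_. base A)"
  by (simp add: homotopy_group_def)

text \<open>By the Eckmann-Hilton argument the product may be formed in any coordinate. The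
  definition uses the first one, whereas the splitting over a wedge produces a concatenation in the
  last one, the suspension coordinate.\<close>

lemma mult_cube_class:
  assumes g: "g \<in> cube_maps m A" and h: "h \<in> cube_maps m A" and i: "i \<in> {1..m}" and A: "base A \<in> points A"
  shows "cube_class m A g \<otimes>\<^bsub>homotopy_group m A\<^esub> cube_class m A h = cube_class m A (concat_at i g h)"
proof (cases "i = 1")
  case True
  then show ?thesis
    using mult_cube_class_1[OF g h] i by simp
next
  case False
  then show ?thesis
    using mult_cube_class_1[OF g h] i concat_at_change(1)[OF g h i _ False A]
    by (simp add: cube_class_eq)
qed

lemma comm_group_homotopy_group:
  assumes A: "base A \<in> points A" and m: "2 \<le> m"
  shows "comm_group (homotopy_group m A)"
proof (rule group.group_comm_groupI)
  have 1: "1 \<in> {1..m}" and 2: "2 \<in> {1..m}"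
    using m by auto
  note mult = mult_cube_class[OF _ _ 1 A]
  show "group (homotopy_group m A)"
  proof (rule groupI)
    fix x y z
    assume "x \<in> carrier (homotopy_group m A)" "y \<in> carrier (homotopy_group m A)"
      "z \<in> carrier (homotopy_group m A)"
    then obtain g h k where g: "g \<in> cube_maps m A" "x = cube_class m A g"
      and h: "h \<in> cube_maps m A" "y = cube_class m A h"
      and k: "k \<in> cube_maps m A" "z = cube_class m A k"
      by (metis homotopy_groupE)
    show "x \<otimes>\<^bsub>homotopy_group m A\<^esub> y \<in> carrier (homotopy_group m A)"
      using g h 1 by (simp add: mult cube_class_in_carrier concat_at_maps)
    show "x \<otimes>\<^bsub>homotopy_group m A\<^esub> y \<otimes>\<^bsub>homotopy_group m A\<^esub> z
        = x \<otimes>\<^bsub>homotopy_group m A\<^esub> (y \<otimes>\<^bsub>homotopy_group m A\<^esub> z)"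
      using g h k 1 by (simp add: mult concat_at_maps cube_class_eq[OF concat_at_assoc])
  next
    show "\<one>\<^bsub>homotopy_group m A\<^esub> \<in> carrier (homotopy_group m A)"
      by (simp add: one_homotopy_group cube_class_in_carrier const_cube_map A)
  next
    fix x
    assume "x \<in> carrier (homotopy_group m A)"
    then obtain g where g: "g \<in> cube_maps m A" "x = cube_class m A g"
      by (metis homotopy_groupE)
    show "\<one>\<^bsub>homotopy_group m A\<^esub> \<otimes>\<^bsub>homotopy_group m A\<^esub> x = x"
      using g 1 by (simp add: one_homotopy_group mult const_cube_map A cube_class_eq[OF concat_at_const_left])
    have rev: "reverse_at 1 g \<in> cube_maps m A"
      using g 1 by (simp add: reverse_at_maps)
    have "cube_class m A (reverse_at 1 g) \<otimes>\<^bsub>homotopy_group m A\<^esub> x = \<one>\<^bsub>homotopy_group m A\<^esub>"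
      using g rev 1 cube_class_eq[OF concat_at_reverse_right[OF rev 1]]
      by (simp add: one_homotopy_group mult reverse_at_reverse_at)
    then show "\<exists>y \<in> carrier (homotopy_group m A).
        y \<otimes>\<^bsub>homotopy_group m A\<^esub> x = \<one>\<^bsub>homotopy_group m A\<^esub>"
      using rev cube_class_in_carrier by blast
  qed
  fix x y
  assume "x \<in> carrier (homotopy_group m A)" "y \<in> carrier (homotopy_group m A)"
  then obtain g h where g: "g \<in> cube_maps m A" "x = cube_class m A g"
    and h: "h \<in> cube_maps m A" "y = cube_class m A h"
    by (metis homotopy_groupE)
  \<comment> \<open>Trading coordinate 1 for coordinate 2 may swap the factors, and both coordinates
    compute the same product.\<close>
  have "cube_class m A (concat_at 1 g h) = cube_class m A (concat_at 2 h g)"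
    by (rule cube_class_eq[OF concat_at_change(2)[OF g(1) h(1) 1 2 _ A]]) simp
  then show "x \<otimes>\<^bsub>homotopy_group m A\<^esub> y = y \<otimes>\<^bsub>homotopy_group m A\<^esub> x"
    unfolding g(2) h(2) mult_cube_class[OF g(1) h(1) 1 A] mult_cube_class[OF h(1) g(1) 2 A] .
qed

text \<open>Reversal in coordinate \<open>i\<close> is an inverse for concatenation in that
  coordinate, and the product may be computed there.\<close>

lemma inv_cube_class:
  assumes g: "g \<in> cube_maps m A" and i: "i \<in> {1..m}" and A: "base A \<in> points A" and m: "2 \<le> m"
  shows "inv\<^bsub>homotopy_group m A\<^esub> cube_class m A g = cube_class m A (reverse_at i g)"
proof -
  interpret comm_group "homotopy_group m A"
    by (rule comm_group_homotopy_group[OF A m])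
  have "cube_class m A g \<otimes>\<^bsub>homotopy_group m A\<^esub> cube_class m A (reverse_at i g) = \<one>\<^bsub>homotopy_group m A\<^esub>"
    by (simp add: mult_cube_class[OF g reverse_at_maps[OF g i] i A] one_homotopy_group
        cube_class_eq[OF concat_at_reverse_right[OF g i]])
  moreover have "cube_class m A g \<in> carrier (homotopy_group m A)"
    "cube_class m A (reverse_at i g) \<in> carrier (homotopy_group m A)"
    using g reverse_at_maps[OF g i] by (simp_all add: cube_class_in_carrier)
  ultimately show ?thesis
    by (metis inv_equality m_comm)
qed

lemma concat_at_comp: "f \<circ> concat_at i g h = concat_at i (f \<circ> g) (f \<circ> h)"
  by (auto simp: concat_at_def fun_eq_iff)

lemma homotopy_map_hom:
  assumes f: "pointed_map A B f" and A: "base A \<in> points A" and B: "base B \<in> points B" and m: "2 \<le> m"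
  shows "homotopy_map m B f \<in> hom (homotopy_group m A) (homotopy_group m B)"
proof (rule homI)
  have 1: "1 \<in> {1..m}"
    using m by auto
  fix x y
  assume "x \<in> carrier (homotopy_group m A)" "y \<in> carrier (homotopy_group m A)"
  then obtain g h where g: "g \<in> cube_maps m A" "x = cube_class m A g"
    and h: "h \<in> cube_maps m A" "y = cube_class m A h"
    by (metis homotopy_groupE)
  show "homotopy_map m B f x \<in> carrier (homotopy_group m B)"
    using g f by (simp add: homotopy_map_class cube_class_in_carrier cube_maps_comp)
  show "homotopy_map m B f (x \<otimes>\<^bsub>homotopy_group m A\<^esub> y)
      = homotopy_map m B f x \<otimes>\<^bsub>homotopy_group m B\<^esub> homotopy_map m B f y"
    using g h f A B 1
    by (simp add: homotopy_map_class mult_cube_class[OF _ _ 1] cube_maps_comp concat_at_maps concat_at_comp)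
qed


section \<open>Permutations of the coordinates\<close>

text \<open>
  Write \<open>J\<close> for the rotation of the plane by a right angle. The matrices
  \<open>((1 - r) I + r J) / ((1 - r)\<^sup>2 + r\<^sup>2)\<close> have inverses \<open>(1 - r) I - r J\<close>, which do not increase
  the maximum norm. Hence they map the complement of the open square around the origin to itself,
  and truncating them to the square gives a homotopy that respects the boundary.
\<close>

lemma rotation_homotopic:
  assumes g: "g \<in> cube_maps m A" and i: "i \<in> {1..m}" and j: "j \<in> {1..m}" and "i \<noteq> j"
  shows "(g, \<lambda>t. g (t(i := 1 - t j, j := t i))) \<in> cube_homotopic m A"
proof -
  define cl :: "real \<Rightarrow> real" where "cl = (\<lambda>x. max 0 (min 1 x))"
  define N :: "real \<Rightarrow> real" where "N = (\<lambda>r. (1 - r)\<^sup>2 + r\<^sup>2)"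
  define L1 where "L1 = (\<lambda>r (t :: nat \<Rightarrow> real). ((1 - r) * (t i - 1/2) - r * (t j - 1/2)) / N r)"
  define L2 where "L2 = (\<lambda>r (t :: nat \<Rightarrow> real). ((1 - r) * (t j - 1/2) + r * (t i - 1/2)) / N r)"
  define \<phi> where "\<phi> = (\<lambda>p. (snd p)(i := cl (1/2 + L1 (fst p) (snd p)), j := cl (1/2 + L2 (fst p) (snd p))))"
  have N: "N r \<noteq> 0" for r
    by (simp add: N_def sum_power2_eq_zero_iff)
  have cl01: "0 \<le> cl x" "cl x \<le> 1" for x
    by (auto simp: cl_def)
  have cont: "continuous_on ({0..1::real} \<times> unit_cube m) \<phi>"
    unfolding \<phi>_def cl_def L1_def L2_def
    by (intro continuous_intros) (use N in \<open>auto simp: N_def intro!: continuous_intros\<close>)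
  have cube: "\<phi> (r, t) \<in> unit_cube m" if "t \<in> unit_cube m" for r t
    using that i j by (simp add: \<phi>_def unit_cube_upd cl01)
  have id: "cl (t k) = t k" if "t \<in> unit_cube m" "k \<in> {1..m}" for t k
    using unit_cube_coord[OF that] by (simp add: cl_def)
  have bd: "\<phi> (r, t) \<in> cube_boundary m" if r: "r \<in> {0..1}" and t: "t \<in> cube_boundary m" for r t
  proof (cases "\<exists>k \<in> {1..m}. k \<noteq> i \<and> k \<noteq> j \<and> (t k = 0 \<or> t k = 1)")
    case True
    then obtain k where "k \<in> {1..m}" "\<phi> (r, t) k = 0 \<or> \<phi> (r, t) k = 1"
      by (auto simp: \<phi>_def)
    then show ?thesis
      using cube[OF cube_boundary_subset[OF t]] unfolding cube_boundary_eq by blast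
  next
    case False
    define a b where "a = t i - 1/2" and "b = t j - 1/2"
    have L: "L1 r t = ((1 - r) * a - r * b) / N r" "L2 r t = ((1 - r) * b + r * a) / N r"
      by (simp_all add: L1_def L2_def a_def b_def)
    have comb: "(1 - r) * (x / n) + r * (y / n) = ((1 - r) * x + r * y) / n"
      "(1 - r) * (x / n) - r * (y / n) = ((1 - r) * x - r * y) / n" for x y n
      by (simp_all add: add_divide_distrib diff_divide_distrib)
    have "(1 - r) * L1 r t + r * L2 r t = ((1 - r) * ((1 - r) * a - r * b) + r * ((1 - r) * b + r * a)) / N r"
      unfolding L comb ..
    also have "(1 - r) * ((1 - r) * a - r * b) + r * ((1 - r) * b + r * a) = a * N r"
      by (simp add: N_def power2_eq_square algebra_simps)
    finally have ea: "a = (1 - r) * L1 r t + r * L2 r t"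
      using N[of r] by simp
    have "(1 - r) * L2 r t - r * L1 r t = ((1 - r) * ((1 - r) * b + r * a) - r * ((1 - r) * a - r * b)) / N r"
      unfolding L comb ..
    also have "(1 - r) * ((1 - r) * b + r * a) - r * ((1 - r) * a - r * b) = b * N r"
      by (simp add: N_def power2_eq_square algebra_simps)
    finally have eb: "b = (1 - r) * L2 r t - r * L1 r t"
      using N[of r] by simp
    \<comment> \<open>A boundary point with no other coordinate on a face has its coordinate
      \<open>i\<close> or \<open>j\<close> at distance 1/2 from the centre of the square.\<close>
    have ab: "\<bar>a\<bar> = 1/2 \<or> \<bar>b\<bar> = 1/2"
      using t False by (auto simp: cube_boundary_eq a_def b_def)
    have "\<not> (\<bar>L1 r t\<bar> < 1/2 \<and> \<bar>L2 r t\<bar> < 1/2)"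
    proof
      assume L: "\<bar>L1 r t\<bar> < 1/2 \<and> \<bar>L2 r t\<bar> < 1/2"
      define M where "M = max \<bar>L1 r t\<bar> \<bar>L2 r t\<bar>"
      have M: "\<bar>L1 r t\<bar> \<le> M" "\<bar>L2 r t\<bar> \<le> M" "M < 1/2"
        using L by (auto simp: M_def)
      have b1: "\<bar>(1 - r) * x\<bar> \<le> (1 - r) * M" "\<bar>r * x\<bar> \<le> r * M" if "\<bar>x\<bar> \<le> M" for x
        using r that by (auto simp: abs_mult intro: mult_left_mono)
      have "\<bar>a\<bar> \<le> (1 - r) * M + r * M" "\<bar>b\<bar> \<le> (1 - r) * M + r * M"
        using b1[OF M(1)] b1[OF M(2)] ea eb by linarith+
      then show False
        using M(3) ab by (auto simp: algebra_simps)
    qed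
    then have "(cl (1/2 + L1 r t) = 0 \<or> cl (1/2 + L1 r t) = 1) \<or> (cl (1/2 + L2 r t) = 0 \<or> cl (1/2 + L2 r t) = 1)"
      by (auto simp: cl_def)
    then have "\<exists>k \<in> {1..m}. \<phi> (r, t) k = 0 \<or> \<phi> (r, t) k = 1"
      using i j \<open>i \<noteq> j\<close> by (auto simp: \<phi>_def)
    then show ?thesis
      using cube[OF cube_boundary_subset[OF t]] unfolding cube_boundary_eq by blast
  qed
  have N01: "N 0 = 1" "N 1 = 1"
    by (simp_all add: N_def)
  show ?thesis
  proof (rule reparam_homotopic[where \<phi> = \<phi> and g = g and n = m and ?f0.0 = g and ?f1.0 = "\<lambda>t. g (t(i := 1 - t j, j := t i))"])
    show "continuous_on ({0..1} \<times> unit_cube m) \<phi>"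
      by (rule cont)
    show "g \<in> cube_maps m A"
      by (rule g)
    show "\<phi> (r, t) \<in> unit_cube m" if "t \<in> unit_cube m" for r t
      using that by (rule cube)
    show "\<phi> (r, t) \<in> cube_boundary m" if "r \<in> {0..1}" "t \<in> cube_boundary m" for r t
      using that by (rule bd)
    fix t
    assume t: "t \<in> unit_cube m"
    have "\<phi> (0, t) = t"
      using id[OF t i] id[OF t j] by (simp add: \<phi>_def L1_def L2_def N01)
    then show "(g \<circ> \<phi>) (0, t) = g t"
      by simp
    \<comment> \<open>At r = 1 the matrix is J, which takes the centred pair (a, b) to (-b, a); in
      cube coordinates this is (1 - t j, t i).\<close>
    have "cl (1 - t j) = 1 - t j"
      using unit_cube_coord[OF t j] by (simp add: cl_def)
    then have "\<phi> (1, t) = t(i := 1 - t j, j := t i)"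
      using id[OF t i] by (simp add: \<phi>_def L1_def L2_def N01)
    then show "(g \<circ> \<phi>) (1, t) = g (t(i := 1 - t j, j := t i))"
      by simp
  qed
qed

lemma unit_cube_permute:
  assumes p: "p permutes {1..m}" and t: "t \<in> unit_cube m"
  shows "t \<circ> p \<in> unit_cube m"
  using assms permutes_in_image[OF p] permutes_not_in[OF p]
  by (auto simp: unit_cube_def PiE_iff extensional_def)

lemma cube_boundary_permute:
  assumes p: "p permutes {1..m}" and t: "t \<in> cube_boundary m"
  shows "t \<circ> p \<in> cube_boundary m"
proof -
  obtain i where i: "i \<in> {1..m}" "t i = 0 \<or> t i = 1"
    using t by (auto simp: cube_boundary_eq)
  have "inv_into UNIV p i \<in> {1..m}" "(t \<circ> p) (inv_into UNIV p i) = t i"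
    using i permutes_in_image[OF permutes_inv[OF p]] permutes_inverses[OF p] by auto
  then show ?thesis
    using i unit_cube_permute[OF p cube_boundary_subset[OF t]] unfolding cube_boundary_eq by auto
qed

lemma permute_cube_maps:
  assumes g: "g \<in> cube_maps m A" and p: "p permutes {1..m}"
  shows "(\<lambda>t. g (t \<circ> p)) \<in> cube_maps m A"
proof -
  have "((\<lambda>t. g (t \<circ> p)), \<lambda>t. g (t \<circ> p)) \<in> cube_homotopic m A"
  proof (rule reparam_homotopic[where g = g and n = m and \<phi> = "\<lambda>q. snd q \<circ> p"])
    show "continuous_on ({0..1::real} \<times> unit_cube m) (\<lambda>q. snd q \<circ> p)"
      by (intro continuous_on_coordinatewise_then_product) (simp add: continuous_on_coord_snd)
    show "g \<in> cube_maps m A"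
      by (rule g)
  qed (simp_all add: unit_cube_permute[OF p] cube_boundary_permute[OF p])
  then show ?thesis
    using cube_homotopic_maps by blast
qed

text \<open>A quarter turn is homotopic to the identity and differs from the transposition by the
  reversal of one coordinate. So the transposition acts as that reversal, that is, by
  inversion.\<close>

lemma cube_class_transpose:
  assumes g: "g \<in> cube_maps m A" and i: "i \<in> {1..m}" and j: "j \<in> {1..m}" and "i \<noteq> j"
    and A: "base A \<in> points A"
  shows "cube_class m A (\<lambda>t. g (t \<circ> Transposition.transpose i j)) = inv\<^bsub>homotopy_group m A\<^esub> cube_class m A g"
proof -
  have m: "2 \<le> m"
    using i j \<open>i \<noteq> j\<close> by auto
  let ?f = "\<lambda>t. g (t \<circ> Transposition.transpose i j)"
  have f: "?f \<in> cube_maps m A"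
    by (intro permute_cube_maps g permutes_swap_id i j)
  have e: "(t(i := 1 - t j, j := t i)) \<circ> Transposition.transpose i j = t(j := 1 - t j)" for t :: "nat \<Rightarrow> real"
    using \<open>i \<noteq> j\<close> by (auto simp: fun_eq_iff Transposition.transpose_def)
  have "(\<lambda>t. ?f (t(i := 1 - t j, j := t i))) = reverse_at j g"
    by (rule ext) (simp only: e reparam_at_def)
  then have "(?f, reverse_at j g) \<in> cube_homotopic m A"
    using rotation_homotopic[OF f i j \<open>i \<noteq> j\<close>] by simp
  then show ?thesis
    by (simp add: cube_class_eq inv_cube_class[OF g j A m])
qed

text \<open>Induction over products of transpositions: each of them inverts the class and changes
  the sign.\<close>

lemma cube_class_permute:
  assumes p: "p permutes {1..m}" and g: "g \<in> cube_maps m A" and A: "base A \<in> points A" and m: "2 \<le> m"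
  shows "cube_class m A (\<lambda>t. g (t \<circ> p)) = cube_class m A g [^]\<^bsub>homotopy_group m A\<^esub> sign p"
proof -
  interpret comm_group "homotopy_group m A"
    by (rule comm_group_homotopy_group[OF A m])
  show ?thesis
    using p finite_atLeastAtMost
  proof (induction rule: permutes_induct)
    show "cube_class m A (\<lambda>t. g (t \<circ> id)) = cube_class m A g [^]\<^bsub>homotopy_group m A\<^esub> sign id"
      by (simp add: cube_class_in_carrier g)
  next
    fix a b p
    assume ab: "a \<in> {1..m}" "b \<in> {1..m}" "a \<noteq> b" and p: "p permutes {1..m}"
      and IH: "cube_class m A (\<lambda>t. g (t \<circ> p)) = cube_class m A g [^]\<^bsub>homotopy_group m A\<^esub> sign p"
    have "permutation p"
      using p by (rule permutes_imp_permutation[rotated]) simp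
    then have s: "sign (Transposition.transpose a b \<circ> p) = - sign p"
      using ab by (simp add: sign_compose permutation_swap_id sign_swap_id)
    have "cube_class m A (\<lambda>t. g (t \<circ> (Transposition.transpose a b \<circ> p)))
        = cube_class m A (\<lambda>t. (\<lambda>t. g (t \<circ> p)) (t \<circ> Transposition.transpose a b))"
      by (simp add: o_assoc)
    also have "\<dots> = inv\<^bsub>homotopy_group m A\<^esub> cube_class m A (\<lambda>t. g (t \<circ> p))"
      by (rule cube_class_transpose[OF permute_cube_maps[OF g p] ab A])
    also have "\<dots> = cube_class m A g [^]\<^bsub>homotopy_group m A\<^esub> sign (Transposition.transpose a b \<circ> p)"
      by (simp add: IH s int_pow_neg cube_class_in_carrier g)
    finally show "cube_class m A (\<lambda>t. g (t \<circ> (Transposition.transpose a b \<circ> p)))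
        = cube_class m A g [^]\<^bsub>homotopy_group m A\<^esub> sign (Transposition.transpose a b \<circ> p)" .
  qed
qed

section \<open>Sequential colimits\<close>

lemma seq_iter_add: "seq_iter j n (d + e) x = seq_iter j (n + d) e (seq_iter j n d x)"
  by (induction e) (simp_all add: add.assoc)

lemma seq_iter_le: "n \<le> p \<Longrightarrow> p \<le> q \<Longrightarrow> seq_iter j n (q - n) x = seq_iter j p (q - p) (seq_iter j n (p - n) x)"
  using seq_iter_add[of j n "p - n" "q - p" x] by simp

locale seq_colim =
  fixes I :: "nat set" and G :: "nat \<Rightarrow> 'g monoid" and j :: "nat \<Rightarrow> 'g \<Rightarrow> 'g"
  assumes index_nonempty: "I \<noteq> {}"
    and index_Suc: "n \<in> I \<Longrightarrow> Suc n \<in> I"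
    and comm_group_level: "n \<in> I \<Longrightarrow> comm_group (G n)"
    and level_hom: "n \<in> I \<Longrightarrow> j n \<in> hom (G n) (G (Suc n))"
begin

abbreviation cls :: "nat \<Rightarrow> 'g \<Rightarrow> (nat \<times> 'g) set" where
  "cls n x \<equiv> colim_class I G j (n, x)"

abbreviation colim :: "(nat \<times> 'g) set ring" where
  "colim \<equiv> colim_group I G j"

lemma group_level: "n \<in> I \<Longrightarrow> group (G n)"
  using comm_group_level by (simp add: comm_group_def)

lemma monoid_level: "n \<in> I \<Longrightarrow> monoid (G n)"
  using group_level by (simp add: group_def)

lemma index_le:
  assumes "n \<in> I" "n \<le> m"
  shows "m \<in> I"
  using assms(2,1) by (induction rule: dec_induct) (auto intro: index_Suc)

lemma seq_iter_hom: "n \<in> I \<Longrightarrow> seq_iter j n d \<in> hom (G n) (G (n + d))"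
proof (induction d)
  case 0
  then show ?case
    by (simp add: hom_def)
next
  case (Suc d)
  then have "j (n + d) \<in> hom (G (n + d)) (G (Suc (n + d)))"
    using index_le level_hom by simp
  with Suc have "compose (carrier (G n)) (j (n + d)) (seq_iter j n d) \<in> hom (G n) (G (Suc (n + d)))"
    using group.hom_compose[OF group_level[OF Suc.prems]] by blast
  then show ?case
    using monoid.m_closed[OF monoid_level[OF Suc.prems]]
    by (auto simp: hom_def compose_def Pi_def)
qed

lemma seq_iter_hom_le: "n \<in> I \<Longrightarrow> n \<le> m \<Longrightarrow> seq_iter j n (m - n) \<in> hom (G n) (G m)"
  using seq_iter_hom[of n "m - n"] by simp

lemma seq_iter_closed: "n \<in> I \<Longrightarrow> n \<le> m \<Longrightarrow> x \<in> carrier (G n) \<Longrightarrow> seq_iter j n (m - n) x \<in> carrier (G m)"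
  using seq_iter_hom_le hom_in_carrier by metis

lemma colim_rel_iff:
  "((n, x), (n', x')) \<in> colim_rel I G j \<longleftrightarrow>
     n \<in> I \<and> x \<in> carrier (G n) \<and> n' \<in> I \<and> x' \<in> carrier (G n') \<and>
     (\<exists>p. n \<le> p \<and> n' \<le> p \<and> seq_iter j n (p - n) x = seq_iter j n' (p - n') x')"
  by (simp add: colim_rel_def)

lemma colim_relI:
  "n \<in> I \<Longrightarrow> x \<in> carrier (G n) \<Longrightarrow> n' \<in> I \<Longrightarrow> x' \<in> carrier (G n') \<Longrightarrow> n \<le> p \<Longrightarrow> n' \<le> p \<Longrightarrow>
     seq_iter j n (p - n) x = seq_iter j n' (p - n') x' \<Longrightarrow> ((n, x), (n', x')) \<in> colim_rel I G j"
  by (auto simp: colim_rel_iff)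

lemma seq_iter_eq_le:
  assumes "seq_iter j n (p - n) x = seq_iter j n' (p - n') x'" "n \<le> p" "n' \<le> p" "p \<le> q"
  shows "seq_iter j n (q - n) x = seq_iter j n' (q - n') x'"
  using assms by (simp add: seq_iter_le[of n p q] seq_iter_le[of n' p q])

lemma equiv_colim_rel: "equiv (SIGMA n:I. carrier (G n)) (colim_rel I G j)"
proof (rule equivI)
  show "colim_rel I G j \<subseteq> (SIGMA n:I. carrier (G n)) \<times> (SIGMA n:I. carrier (G n))"
    by (auto simp: colim_rel_def)
  show "refl_on (SIGMA n:I. carrier (G n)) (colim_rel I G j)"
    by (rule refl_onI) (auto simp: colim_rel_iff)
  show "sym (colim_rel I G j)"
  proof (rule symI)
    fix a b
    assume "(a, b) \<in> colim_rel I G j"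
    then show "(b, a) \<in> colim_rel I G j"
      by (cases a; cases b) (simp add: colim_rel_iff, metis)
  qed
  show "trans (colim_rel I G j)"
  proof (rule transI)
    fix a b c
    assume ab: "(a, b) \<in> colim_rel I G j" and bc: "(b, c) \<in> colim_rel I G j"
    obtain n x n' x' n'' x'' where abc: "a = (n, x)" "b = (n', x')" "c = (n'', x'')"
      by (metis surj_pair)
    obtain p where p: "n \<le> p" "n' \<le> p" "seq_iter j n (p - n) x = seq_iter j n' (p - n') x'"
      using ab unfolding abc colim_rel_iff by blast
    obtain q where q: "n' \<le> q" "n'' \<le> q" "seq_iter j n' (q - n') x' = seq_iter j n'' (q - n'') x''"
      using bc unfolding abc colim_rel_iff by blast
    have "seq_iter j n (max p q - n) x = seq_iter j n'' (max p q - n'') x''"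
      using seq_iter_eq_le[OF p(3,1,2), of "max p q"] seq_iter_eq_le[OF q(3,1,2), of "max p q"] by simp
    then show "(a, c) \<in> colim_rel I G j"
      using ab bc p q unfolding abc by (intro colim_relI[where p = "max p q"]) (auto simp: colim_rel_iff)
  qed
qed

lemma mem_cls: "(n', x') \<in> cls n x \<longleftrightarrow> ((n, x), (n', x')) \<in> colim_rel I G j"
  by (simp add: colim_class_def)

lemma cls_self: "n \<in> I \<Longrightarrow> x \<in> carrier (G n) \<Longrightarrow> (n, x) \<in> cls n x"
  by (auto simp: mem_cls colim_rel_iff)

lemma cls_eqI: "((n, x), (n', x')) \<in> colim_rel I G j \<Longrightarrow> cls n x = cls n' x'"
  unfolding colim_class_def using equiv_colim_rel equiv_class_eq by metis

lemma cls_push: "n \<in> I \<Longrightarrow> x \<in> carrier (G n) \<Longrightarrow> n \<le> p \<Longrightarrow> cls n x = cls p (seq_iter j n (p - n) x)"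
  by (rule cls_eqI, rule colim_relI[where p = p]) (auto intro: index_le seq_iter_closed)

lemma cls_step: "n \<in> I \<Longrightarrow> x \<in> carrier (G n) \<Longrightarrow> cls (Suc n) (j n x) = cls n x"
  using cls_push[of n x "Suc n"] by simp

lemma carrier_colim: "carrier colim = {cls n x | n x. n \<in> I \<and> x \<in> carrier (G n)}"
  by (auto simp: colim_group_def quotient_def colim_class_def)

lemma cls_closed: "n \<in> I \<Longrightarrow> x \<in> carrier (G n) \<Longrightarrow> cls n x \<in> carrier colim"
  by (auto simp: carrier_colim)

text \<open>The level of a representative can be pushed beyond any bound \<open>N\<close>. This
  serves to bring several elements to one level, to avoid level 0, and to make room for a given
  cycle.\<close>

lemma colimE:
  assumes "c \<in> carrier colim"
  obtains n x where "N \<le> n" "n \<in> I" "x \<in> carrier (G n)" "c = cls n x"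
proof -
  obtain n x where n: "n \<in> I" "x \<in> carrier (G n)" "c = cls n x"
    using assms by (auto simp: carrier_colim)
  show thesis
    by (rule that[of "max N n" "seq_iter j n (max N n - n) x"])
      (use n cls_push[OF n(1,2), of "max N n"] in \<open>auto intro: index_le seq_iter_closed\<close>)
qed

text \<open>The definition adds arbitrary representatives after pushing them to a common level. Such
  sums agree at a level beyond all witnesses of the equivalences, because the transition maps are
  homomorphisms.\<close>

lemma add_cls:
  assumes n: "n \<in> I" and x: "x \<in> carrier (G n)" and y: "y \<in> carrier (G n)"
  shows "cls n x \<oplus>\<^bsub>colim\<^esub> cls n y = cls n (x \<otimes>\<^bsub>G n\<^esub> y)"
  unfolding colim_group_def ring.simps
proof (rule the_elem_image_const)
  show "cls n x \<times> cls n y \<noteq> {}"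
    using cls_self[OF n x] cls_self[OF n y] by blast
  fix q
  assume "q \<in> cls n x \<times> cls n y"
  then obtain n1 x1 n2 x2 where q: "q = ((n1, x1), (n2, x2))"
    and 1: "((n, x), (n1, x1)) \<in> colim_rel I G j" and 2: "((n, y), (n2, x2)) \<in> colim_rel I G j"
    by (cases q) (auto simp: mem_cls)
  obtain p1 where p1: "n \<le> p1" "n1 \<le> p1" "seq_iter j n (p1 - n) x = seq_iter j n1 (p1 - n1) x1"
    using 1 unfolding colim_rel_iff by blast
  obtain p2 where p2: "n \<le> p2" "n2 \<le> p2" "seq_iter j n (p2 - n) y = seq_iter j n2 (p2 - n2) x2"
    using 2 unfolding colim_rel_iff by blast
  have I: "n1 \<in> I" "x1 \<in> carrier (G n1)" "n2 \<in> I" "x2 \<in> carrier (G n2)"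
    using 1 2 by (auto simp: colim_rel_iff)
  define N where "N = max n1 n2"
  define p where "p = max p1 p2"
  have N: "n1 \<le> N" "n2 \<le> N" "N \<in> I" "N \<le> p" and p: "n \<le> p" "p1 \<le> p" "p2 \<le> p"
    using p1 p2 I index_le[of n1 N] by (auto simp: N_def p_def)
  have ex: "seq_iter j n (p - n) x = seq_iter j N (p - N) (seq_iter j n1 (N - n1) x1)"
    using seq_iter_eq_le[OF p1(3,1,2) p(2)] seq_iter_le[OF N(1,4)] by simp
  have ey: "seq_iter j n (p - n) y = seq_iter j N (p - N) (seq_iter j n2 (N - n2) x2)"
    using seq_iter_eq_le[OF p2(3,1,2) p(3)] seq_iter_le[OF N(2,4)] by simp
  have cl: "seq_iter j n1 (N - n1) x1 \<in> carrier (G N)" "seq_iter j n2 (N - n2) x2 \<in> carrier (G N)"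
    using I N seq_iter_closed by auto
  have "cls N (seq_iter j n1 (N - n1) x1 \<otimes>\<^bsub>G N\<^esub> seq_iter j n2 (N - n2) x2) = cls n (x \<otimes>\<^bsub>G n\<^esub> y)"
  proof (rule cls_eqI, rule colim_relI[where p = p])
    show "seq_iter j N (p - N) (seq_iter j n1 (N - n1) x1 \<otimes>\<^bsub>G N\<^esub> seq_iter j n2 (N - n2) x2)
        = seq_iter j n (p - n) (x \<otimes>\<^bsub>G n\<^esub> y)"
      using hom_mult[OF seq_iter_hom_le[OF N(3,4)] cl] hom_mult[OF seq_iter_hom_le[OF n p(1)] x y]
      by (simp add: ex ey)
  qed (use N p n x y cl monoid.m_closed[OF monoid_level] in auto)
  then show "(case q of (a, b) \<Rightarrow> (case a of (n, x) \<Rightarrow> \<lambda>(n', x'). colim_class I G j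
      (max n n', seq_iter j n (max n n' - n) x \<otimes>\<^bsub>G (max n n')\<^esub> seq_iter j n' (max n n' - n') x')) b)
      = cls n (x \<otimes>\<^bsub>G n\<^esub> y)"
    by (simp add: q N_def)
qed

lemma zero_colim:
  assumes n: "n \<in> I"
  shows "\<zero>\<^bsub>colim\<^esub> = cls n \<one>\<^bsub>G n\<^esub>"
  unfolding colim_group_def ring.simps
proof (rule the_elem_image_const)
  fix m
  assume m: "m \<in> I"
  have one: "seq_iter j k (max m n - k) \<one>\<^bsub>G k\<^esub> = \<one>\<^bsub>G (max m n)\<^esub>" if "k \<in> I" "k \<le> max m n" for k
    using that by (intro hom_one[OF seq_iter_hom_le]) (auto intro: group_level index_le)
  show "cls m \<one>\<^bsub>G m\<^esub> = cls n \<one>\<^bsub>G n\<^esub>"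
    by (rule cls_eqI, rule colim_relI[where p = "max m n"])
      (use m n one monoid.one_closed[OF monoid_level] in auto)
qed (fact index_nonempty)

lemma abelian_group_colim: "abelian_group colim"
proof (rule abelian_groupI)
  fix c d
  assume "c \<in> carrier colim" "d \<in> carrier colim"
  moreover from this(1) obtain m u where m: "m \<in> I" "u \<in> carrier (G m)" "c = cls m u"
    by (rule colimE)
  ultimately obtain n y where n: "m \<le> n" "n \<in> I" "y \<in> carrier (G n)" "d = cls n y"
    by (metis colimE)
  define x where "x = seq_iter j m (n - m) u"
  have x: "x \<in> carrier (G n)" "c = cls n x"
    using m n by (auto simp: x_def seq_iter_closed cls_push)
  interpret Gn: comm_group "G n"
    by (rule comm_group_level) fact
  show "c \<oplus>\<^bsub>colim\<^esub> d \<in> carrier colim"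
    using n x by (simp add: add_cls cls_closed)
  show "c \<oplus>\<^bsub>colim\<^esub> d = d \<oplus>\<^bsub>colim\<^esub> c"
    using n x by (simp add: add_cls Gn.m_comm)
  fix e
  assume "e \<in> carrier colim"
  then obtain p z where p: "n \<le> p" "p \<in> I" "z \<in> carrier (G p)" "e = cls p z"
    by (rule colimE)
  define x' y' where "x' = seq_iter j n (p - n) x" and "y' = seq_iter j n (p - n) y"
  have x': "x' \<in> carrier (G p)" "c = cls p x'" "y' \<in> carrier (G p)" "d = cls p y'"
    using x n p by (auto simp: x'_def y'_def seq_iter_closed cls_push)
  interpret Gp: comm_group "G p"
    by (rule comm_group_level) fact
  show "c \<oplus>\<^bsub>colim\<^esub> d \<oplus>\<^bsub>colim\<^esub> e = c \<oplus>\<^bsub>colim\<^esub> (d \<oplus>\<^bsub>colim\<^esub> e)"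
    using x' p by (simp add: add_cls Gp.m_assoc)
next
  obtain n where n: "n \<in> I"
    using index_nonempty by blast
  then show "\<zero>\<^bsub>colim\<^esub> \<in> carrier colim"
    by (simp add: zero_colim cls_closed monoid.one_closed monoid_level)
next
  fix c
  assume "c \<in> carrier colim"
  then obtain n x where n: "n \<in> I" "x \<in> carrier (G n)" "c = cls n x"
    by (rule colimE)
  interpret Gn: comm_group "G n"
    by (rule comm_group_level) fact
  show "\<zero>\<^bsub>colim\<^esub> \<oplus>\<^bsub>colim\<^esub> c = c"
    using n by (simp add: zero_colim[OF n(1)] add_cls)
  have "cls n (inv\<^bsub>G n\<^esub> x) \<oplus>\<^bsub>colim\<^esub> c = \<zero>\<^bsub>colim\<^esub>"
    using n by (simp add: zero_colim[OF n(1)] add_cls)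
  then show "\<exists>d \<in> carrier colim. d \<oplus>\<^bsub>colim\<^esub> c = \<zero>\<^bsub>colim\<^esub>"
    using n cls_closed by blast
qed

lemma cls_hom: "n \<in> I \<Longrightarrow> cls n \<in> hom (G n) (add_monoid colim)"
  by (rule homI) (simp_all add: cls_closed add_cls)

lemma cls_int_pow:
  assumes "n \<in> I" "x \<in> carrier (G n)"
  shows "cls n (x [^]\<^bsub>G n\<^esub> (a :: int)) = [a] \<cdot>\<^bsub>colim\<^esub> cls n x"
proof -
  interpret group_hom "G n" "add_monoid colim" "cls n"
    by (intro group_hom.intro group_hom_axioms.intro group_level cls_hom assms
        abelian_group.a_group[OF abelian_group_colim])
  show ?thesis
    using assms by (simp add: add_pow_def hom_int_pow)
qed

text \<open>The hypothesis \<open>eq\<close> permits any description of \<open>F\<close> whose value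
  on a class can be read off once \<open>\<phi>\<close> is known to be constant on that class. This
  covers functions defined by \<open>the_elem\<close> as well as the monoid action, for which
  \<open>\<phi>\<close> is itself written in terms of the class.\<close>

lemma colim_lift:
  assumes H: "abelian_group H"
    and hom: "\<And>n. n \<in> I \<Longrightarrow> \<phi> n \<in> hom (G n) (add_monoid H)"
    and step: "\<And>n x. n \<in> I \<Longrightarrow> x \<in> carrier (G n) \<Longrightarrow> \<phi> (Suc n) (j n x) = \<phi> n x"
    and eq: "\<And>n x. n \<in> I \<Longrightarrow> x \<in> carrier (G n) \<Longrightarrow>
      (\<And>n' x'. (n', x') \<in> cls n x \<Longrightarrow> \<phi> n' x' = \<phi> n x) \<Longrightarrow> F (cls n x) = \<phi> n x"
  shows "F \<in> hom (add_monoid colim) (add_monoid H)"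
    and "\<And>n x. n \<in> I \<Longrightarrow> x \<in> carrier (G n) \<Longrightarrow> F (cls n x) = \<phi> n x"
proof -
  have iter: "\<phi> (n + d) (seq_iter j n d x) = \<phi> n x" if "n \<in> I" "x \<in> carrier (G n)" for n d x
  proof (induction d)
    case (Suc d)
    have "seq_iter j n d x \<in> carrier (G (n + d))"
      using seq_iter_closed[of n "n + d"] that by simp
    then show ?case
      using Suc step[of "n + d"] index_le[of n "n + d"] that by simp
  qed simp
  have iter': "\<phi> p (seq_iter j n (p - n) x) = \<phi> n x" if "n \<in> I" "x \<in> carrier (G n)" "n \<le> p" for n p x
    using iter[of n x "p - n"] that by simp
  show F: "F (cls n x) = \<phi> n x" if nx: "n \<in> I" "x \<in> carrier (G n)" for n x
  proof (rule eq[OF nx])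
    fix n' x'
    assume "(n', x') \<in> cls n x"
    then obtain p where "n' \<in> I" "x' \<in> carrier (G n')" "n \<le> p" "n' \<le> p"
      "seq_iter j n (p - n) x = seq_iter j n' (p - n') x'"
      unfolding mem_cls colim_rel_iff by blast
    then show "\<phi> n' x' = \<phi> n x"
      using iter'[of n x p] iter'[of n' x' p] nx by simp
  qed
  show "F \<in> hom (add_monoid colim) (add_monoid H)"
  proof (rule homI)
    fix c d
    assume "c \<in> carrier (add_monoid colim)" "d \<in> carrier (add_monoid colim)"
    then have "c \<in> carrier colim" "d \<in> carrier colim"
      by simp_all
    moreover from this(1) obtain m u where m: "m \<in> I" "u \<in> carrier (G m)" "c = cls m u"
      by (rule colimE)
    ultimately obtain n y where n: "m \<le> n" "n \<in> I" "y \<in> carrier (G n)" "d = cls n y"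
      by (metis colimE)
    define x where "x = seq_iter j m (n - m) u"
    have x: "x \<in> carrier (G n)" "c = cls n x"
      using m n by (auto simp: x_def seq_iter_closed cls_push)
    show "F c \<in> carrier (add_monoid H)"
      using F[OF n(2) x(1)] hom_in_carrier[OF hom[OF n(2)] x(1)] x by simp
    show "F (c \<otimes>\<^bsub>add_monoid colim\<^esub> d) = F c \<otimes>\<^bsub>add_monoid H\<^esub> F d"
      using n x hom_mult[OF hom[OF n(2)] x(1) n(3)] monoid.m_closed[OF monoid_level[OF n(2)]]
      by (simp add: add_cls F)
  qed
qed

lemma colim_lift_the_elem:
  assumes H: "abelian_group H"
    and hom: "\<And>n. n \<in> I \<Longrightarrow> \<phi> n \<in> hom (G n) (add_monoid H)"
    and step: "\<And>n x. n \<in> I \<Longrightarrow> x \<in> carrier (G n) \<Longrightarrow> \<phi> (Suc n) (j n x) = \<phi> n x"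
    and F: "\<And>c. F c = the_elem ((\<lambda>(n, x). \<phi> n x) ` c)"
  shows "F \<in> hom (add_monoid colim) (add_monoid H)"
    and "\<And>n x. n \<in> I \<Longrightarrow> x \<in> carrier (G n) \<Longrightarrow> F (cls n x) = \<phi> n x"
proof -
  have eq: "F (cls n x) = \<phi> n x"
    if n: "n \<in> I" "x \<in> carrier (G n)" and eq: "\<And>n' x'. (n', x') \<in> cls n x \<Longrightarrow> \<phi> n' x' = \<phi> n x" for n x
    unfolding F
  proof (rule the_elem_image_const)
    show "cls n x \<noteq> {}"
      using cls_self[OF n] by blast
    fix p
    assume "p \<in> cls n x"
    then show "(case p of (n, x) \<Rightarrow> \<phi> n x) = \<phi> n x"
      using eq[of "fst p" "snd p"] by (simp add: case_prod_unfold)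
  qed
  show "F \<in> hom (add_monoid colim) (add_monoid H)"
    by (rule colim_lift(1)[where \<phi> = \<phi>, OF H hom step eq])
  show "F (cls n x) = \<phi> n x" if "n \<in> I" "x \<in> carrier (G n)" for n x
    by (rule colim_lift(2)[where \<phi> = \<phi>, OF H hom step eq that])
qed

end

section \<open>Monoid rings and their modules\<close>

text \<open>Closure under differences yields sums and negatives at once. Carrying the bound on the
  support through the induction makes it available for \<open>a\<close> and \<open>b\<close> in the
  last case.\<close>

lemma frag_induction_on [consumes 1, case_names zero one diff]:
  assumes "Poly_Mapping.keys c \<subseteq> S" "P 0" "\<And>x. x \<in> S \<Longrightarrow> P (frag_of x)"
    and "\<And>a b. Poly_Mapping.keys a \<subseteq> S \<Longrightarrow> Poly_Mapping.keys b \<subseteq> S \<Longrightarrow> P a \<Longrightarrow> P b \<Longrightarrow> P (a - b)"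
  shows "P c"
proof -
  have "Poly_Mapping.keys c \<subseteq> S \<and> P c"
    using assms(1)
  proof (induction c rule: frag_induction)
    case (diff a b)
    then show ?case
      using assms(4) keys_diff[of a b] by blast
  qed (use assms in auto)
  then show ?thesis ..
qed

lemma frag_extend_fun_add: "frag_extend (\<lambda>x. f x + g x) c = frag_extend f c + frag_extend g c"
  by (simp add: frag_extend_def frag_cmul_distrib2 sum.distrib)

lemma frag_extend_fun_diff: "frag_extend (\<lambda>x. f x - g x) c = frag_extend f c - frag_extend g c"
  using frag_extend_fun_add[of "\<lambda>x. f x - g x" g c] by simp

lemma carrier_monoid_ring: "a \<in> carrier (monoid_ring G) \<longleftrightarrow> Poly_Mapping.keys a \<subseteq> carrier G"
  by (simp add: monoid_ring_def)

lemma add_monoid_ring [simp]: "a \<oplus>\<^bsub>monoid_ring G\<^esub> b = a + b"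
  by (simp add: monoid_ring_def)

lemma zero_monoid_ring [simp]: "\<zero>\<^bsub>monoid_ring G\<^esub> = 0"
  by (simp add: monoid_ring_def)

lemma one_monoid_ring: "\<one>\<^bsub>monoid_ring G\<^esub> = frag_of \<one>\<^bsub>G\<^esub>"
  by (simp add: monoid_ring_def)

lemma mult_monoid_ring:
  "a \<otimes>\<^bsub>monoid_ring G\<^esub> b = frag_extend (\<lambda>f. frag_extend (\<lambda>g. frag_of (f \<otimes>\<^bsub>G\<^esub> g)) b) a"
  by (simp add: monoid_ring_def)

lemma mult_monoid_ring_of:
  "frag_of f \<otimes>\<^bsub>monoid_ring G\<^esub> frag_of g = frag_of (f \<otimes>\<^bsub>G\<^esub> g)"
  by (simp add: mult_monoid_ring)

lemma mult_monoid_ring_add_left: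
  "(a + b) \<otimes>\<^bsub>monoid_ring G\<^esub> c = a \<otimes>\<^bsub>monoid_ring G\<^esub> c + b \<otimes>\<^bsub>monoid_ring G\<^esub> c"
  by (simp add: mult_monoid_ring frag_extend_add)

lemma mult_monoid_ring_add_right:
  "a \<otimes>\<^bsub>monoid_ring G\<^esub> (b + c) = a \<otimes>\<^bsub>monoid_ring G\<^esub> b + a \<otimes>\<^bsub>monoid_ring G\<^esub> c"
  by (simp add: mult_monoid_ring frag_extend_add frag_extend_fun_add)

lemma mult_monoid_ring_diff_left:
  "(a - b) \<otimes>\<^bsub>monoid_ring G\<^esub> c = a \<otimes>\<^bsub>monoid_ring G\<^esub> c - b \<otimes>\<^bsub>monoid_ring G\<^esub> c"
  by (simp add: mult_monoid_ring frag_extend_diff)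

lemma mult_monoid_ring_diff_right:
  "a \<otimes>\<^bsub>monoid_ring G\<^esub> (b - c) = a \<otimes>\<^bsub>monoid_ring G\<^esub> b - a \<otimes>\<^bsub>monoid_ring G\<^esub> c"
  by (simp add: mult_monoid_ring frag_extend_diff frag_extend_fun_diff)

lemma mult_monoid_ring_zero [simp]:
  "0 \<otimes>\<^bsub>monoid_ring G\<^esub> c = 0" "c \<otimes>\<^bsub>monoid_ring G\<^esub> 0 = 0"
  using mult_monoid_ring_diff_left[where a = 0 and b = 0 and c = c and G = G]
    mult_monoid_ring_diff_right[where b = 0 and c = 0 and a = c and G = G] by simp_all

lemma carrier_monoid_ring_diff:
  "a \<in> carrier (monoid_ring G) \<Longrightarrow> b \<in> carrier (monoid_ring G) \<Longrightarrow> a - b \<in> carrier (monoid_ring G)"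
  using keys_diff[of a b] by (auto simp: carrier_monoid_ring)

lemma carrier_monoid_ring_add:
  "a \<in> carrier (monoid_ring G) \<Longrightarrow> b \<in> carrier (monoid_ring G) \<Longrightarrow> a + b \<in> carrier (monoid_ring G)"
  using keys_add[of a b] by (auto simp: carrier_monoid_ring)

lemma carrier_monoid_ring_of: "f \<in> carrier G \<Longrightarrow> frag_of f \<in> carrier (monoid_ring G)"
  by (simp add: carrier_monoid_ring)

lemma carrier_monoid_ring_zero: "0 \<in> carrier (monoid_ring G)"
  by (simp add: carrier_monoid_ring)

lemma monoid_ring_induct [consumes 1, case_names zero one diff]:
  assumes "c \<in> carrier (monoid_ring G)" "P 0" "\<And>x. x \<in> carrier G \<Longrightarrow> P (frag_of x)"
    and "\<And>a b. a \<in> carrier (monoid_ring G) \<Longrightarrow> b \<in> carrier (monoid_ring G) \<Longrightarrow> P a \<Longrightarrow> P b \<Longrightarrow> P (a - b)"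
  shows "P c"
  using assms(1) unfolding carrier_monoid_ring
  by (induction c rule: frag_induction_on) (auto intro: assms simp: carrier_monoid_ring)

context
  fixes G :: "('m, 'z) monoid_scheme"
  assumes G: "monoid G"
begin

interpretation G: monoid G
  by (rule G)

lemma mult_monoid_ring_closed:
  assumes "a \<in> carrier (monoid_ring G)" "b \<in> carrier (monoid_ring G)"
  shows "a \<otimes>\<^bsub>monoid_ring G\<^esub> b \<in> carrier (monoid_ring G)"
  using assms
proof (induction a rule: monoid_ring_induct)
  case (one f)
  from this(2) show ?case
    by (induction b rule: monoid_ring_induct)
      (use one in \<open>auto simp: mult_monoid_ring_of mult_monoid_ring_diff_right
        intro: carrier_monoid_ring_of carrier_monoid_ring_diff carrier_monoid_ring_zero\<close>)
qed (auto simp: mult_monoid_ring_diff_left intro: carrier_monoid_ring_diff carrier_monoid_ring_zero)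

lemma mult_monoid_ring_assoc:
  assumes "a \<in> carrier (monoid_ring G)" "b \<in> carrier (monoid_ring G)" "c \<in> carrier (monoid_ring G)"
  shows "a \<otimes>\<^bsub>monoid_ring G\<^esub> b \<otimes>\<^bsub>monoid_ring G\<^esub> c = a \<otimes>\<^bsub>monoid_ring G\<^esub> (b \<otimes>\<^bsub>monoid_ring G\<^esub> c)"
  using assms(1)
proof (induction a rule: monoid_ring_induct)
  case (one f)
  show ?case
    using assms(2)
  proof (induction b rule: monoid_ring_induct)
    case (one g)
    show ?case
      using assms(3)
      by (induction c rule: monoid_ring_induct)
        (use \<open>f \<in> carrier G\<close> \<open>g \<in> carrier G\<close> in
          \<open>simp_all add: mult_monoid_ring_of mult_monoid_ring_diff_right G.m_assoc\<close>)
  qed (simp_all add: mult_monoid_ring_diff_left mult_monoid_ring_diff_right)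
qed (simp_all add: mult_monoid_ring_diff_left)

lemma mult_monoid_ring_one:
  assumes "a \<in> carrier (monoid_ring G)"
  shows "\<one>\<^bsub>monoid_ring G\<^esub> \<otimes>\<^bsub>monoid_ring G\<^esub> a = a" "a \<otimes>\<^bsub>monoid_ring G\<^esub> \<one>\<^bsub>monoid_ring G\<^esub> = a"
  using assms
  by (induction a rule: monoid_ring_induct)
    (simp_all add: one_monoid_ring mult_monoid_ring_of mult_monoid_ring_diff_right mult_monoid_ring_diff_left)

lemma ring_monoid_ring: "ring (monoid_ring G)"
proof (rule ringI)
  show "abelian_group (monoid_ring G)"
  proof (rule abelian_groupI)
    fix a
    assume "a \<in> carrier (monoid_ring G)"
    then show "\<exists>b \<in> carrier (monoid_ring G). b \<oplus>\<^bsub>monoid_ring G\<^esub> a = \<zero>\<^bsub>monoid_ring G\<^esub>"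
      by (intro bexI[of _ "- a"]) (simp_all add: carrier_monoid_ring)
  qed (auto simp: carrier_monoid_ring_zero algebra_simps intro: carrier_monoid_ring_add)
  show "Group.monoid (monoid_ring G)"
  proof (rule monoidI)
    show "\<one>\<^bsub>monoid_ring G\<^esub> \<in> carrier (monoid_ring G)"
      by (simp add: one_monoid_ring carrier_monoid_ring_of)
  qed (auto intro: mult_monoid_ring_closed simp: mult_monoid_ring_assoc mult_monoid_ring_one)
qed (simp_all add: mult_monoid_ring_add_left mult_monoid_ring_add_right)

end

section \<open>Additive monoid actions as modules over the monoid ring\<close>

locale monoid_action = G?: monoid G + A?: abelian_group A
  for G :: "('m, 'z) monoid_scheme" and A :: "'a ring" +
  fixes \<mu> :: "'m \<Rightarrow> 'a \<Rightarrow> 'a"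
  assumes action_hom: "f \<in> carrier G \<Longrightarrow> \<mu> f \<in> hom (add_monoid A) (add_monoid A)"
    and action_mult: "f \<in> carrier G \<Longrightarrow> g \<in> carrier G \<Longrightarrow> x \<in> carrier A \<Longrightarrow> \<mu> (f \<otimes>\<^bsub>G\<^esub> g) x = \<mu> f (\<mu> g x)"
    and action_one: "x \<in> carrier A \<Longrightarrow> \<mu> \<one>\<^bsub>G\<^esub> x = x"
begin

lemma action_closed: "f \<in> carrier G \<Longrightarrow> x \<in> carrier A \<Longrightarrow> \<mu> f x \<in> carrier A"
  using hom_in_carrier[OF action_hom] by fastforce

lemma action_add:
  "f \<in> carrier G \<Longrightarrow> x \<in> carrier A \<Longrightarrow> y \<in> carrier A \<Longrightarrow> \<mu> f (x \<oplus>\<^bsub>A\<^esub> y) = \<mu> f x \<oplus>\<^bsub>A\<^esub> \<mu> f y"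
  using hom_mult[OF action_hom] by fastforce

lemma int_add_pow_closed: "x \<in> carrier A \<Longrightarrow> [(k :: int)] \<cdot>\<^bsub>A\<^esub> x \<in> carrier A"
  using A.add.int_pow_closed[of x k] by (simp add: add_pow_def)

abbreviation scale :: "('m \<Rightarrow>\<^sub>0 int) \<Rightarrow> 'a \<Rightarrow> 'a" where
  "scale c x \<equiv> finsum A (\<lambda>f. [Poly_Mapping.lookup c f] \<cdot>\<^bsub>A\<^esub> \<mu> f x) (Poly_Mapping.keys c)"

text \<open>Supports shrink under addition because of cancellation. With vanishing terms added, sums
  over different supports can be compared over one finite set.\<close>

lemma scale_superset:
  assumes "finite S" "Poly_Mapping.keys c \<subseteq> S" "S \<subseteq> carrier G" "x \<in> carrier A"
  shows "scale c x = finsum A (\<lambda>f. [Poly_Mapping.lookup c f] \<cdot>\<^bsub>A\<^esub> \<mu> f x) S"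
proof -
  have "[Poly_Mapping.lookup c f] \<cdot>\<^bsub>A\<^esub> \<mu> f x = \<zero>\<^bsub>A\<^esub>" if "f \<in> S - Poly_Mapping.keys c" for f
    using that by (simp add: in_keys_iff add_pow_def)
  moreover have "(\<lambda>f. [Poly_Mapping.lookup c f] \<cdot>\<^bsub>A\<^esub> \<mu> f x) \<in> S \<rightarrow> carrier A"
    using assms by (auto intro!: int_add_pow_closed action_closed)
  ultimately show ?thesis
    unfolding finsum_def
    by (intro comm_monoid.finprod_mono_neutral_cong_left[OF A.a_comm_monoid]) (use assms in simp_all)
qed

lemma scale_closed:
  assumes "c \<in> carrier (monoid_ring G)" "x \<in> carrier A"
  shows "scale c x \<in> carrier A"
  using assms by (intro finsum_closed) (auto simp: carrier_monoid_ring int_add_pow_closed action_closed subset_eq)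

lemma scale_add:
  assumes c: "c \<in> carrier (monoid_ring G)" and d: "d \<in> carrier (monoid_ring G)" and x: "x \<in> carrier A"
  shows "scale (c + d) x = scale c x \<oplus>\<^bsub>A\<^esub> scale d x"
proof -
  let ?S = "Poly_Mapping.keys c \<union> Poly_Mapping.keys d"
  have S: "finite ?S" "?S \<subseteq> carrier G" "Poly_Mapping.keys (c + d) \<subseteq> ?S"
    using c d keys_add[of c d] by (auto simp: carrier_monoid_ring)
  have cl: "[k] \<cdot>\<^bsub>A\<^esub> \<mu> f x \<in> carrier A" if "f \<in> ?S" for f and k :: int
    using that S x by (auto simp: int_add_pow_closed action_closed subset_eq)
  have "scale (c + d) x = finsum A (\<lambda>f. [Poly_Mapping.lookup (c + d) f] \<cdot>\<^bsub>A\<^esub> \<mu> f x) ?S"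
    by (rule scale_superset[OF S(1,3,2) x])
  also have "\<dots> = finsum A (\<lambda>f. [Poly_Mapping.lookup c f] \<cdot>\<^bsub>A\<^esub> \<mu> f x \<oplus>\<^bsub>A\<^esub> [Poly_Mapping.lookup d f] \<cdot>\<^bsub>A\<^esub> \<mu> f x) ?S"
  proof (rule finsum_cong')
    fix f
    assume f: "f \<in> ?S"
    then have "\<mu> f x \<in> carrier A"
      using S x by (auto intro: action_closed)
    then show "[Poly_Mapping.lookup (c + d) f] \<cdot>\<^bsub>A\<^esub> \<mu> f x
        = [Poly_Mapping.lookup c f] \<cdot>\<^bsub>A\<^esub> \<mu> f x \<oplus>\<^bsub>A\<^esub> [Poly_Mapping.lookup d f] \<cdot>\<^bsub>A\<^esub> \<mu> f x"
      using add.int_pow_mult[of "\<mu> f x"] by (simp add: lookup_add add_pow_def)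
  qed (use cl in auto)
  also have "\<dots> = finsum A (\<lambda>f. [Poly_Mapping.lookup c f] \<cdot>\<^bsub>A\<^esub> \<mu> f x) ?S
      \<oplus>\<^bsub>A\<^esub> finsum A (\<lambda>f. [Poly_Mapping.lookup d f] \<cdot>\<^bsub>A\<^esub> \<mu> f x) ?S"
    by (rule finsum_addf) (use cl in auto)
  also have "\<dots> = scale c x \<oplus>\<^bsub>A\<^esub> scale d x"
    by (subst (1 2) scale_superset[OF S(1) _ S(2) x]) auto
  finally show ?thesis .
qed

lemma scale_of:
  assumes "f \<in> carrier G" "x \<in> carrier A"
  shows "scale (frag_of f) x = \<mu> f x"
proof -
  have "[(1 :: int)] \<cdot>\<^bsub>A\<^esub> \<mu> f x = \<mu> f x"
    using A.add.int_pow_1[of "\<mu> f x"] action_closed[OF assms] by (simp add: add_pow_def)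
  then show ?thesis
    using A.finsum_insert[of "{}" f "\<lambda>g. [Poly_Mapping.lookup (frag_of f) g] \<cdot>\<^bsub>A\<^esub> \<mu> g x"] action_closed[OF assms]
    by simp
qed

lemma scale_zero: "scale 0 x = \<zero>\<^bsub>A\<^esub>"
  by simp

lemma scale_diff:
  assumes c: "c \<in> carrier (monoid_ring G)" and d: "d \<in> carrier (monoid_ring G)" and x: "x \<in> carrier A"
  shows "scale (c - d) x = scale c x \<ominus>\<^bsub>A\<^esub> scale d x"
proof -
  have "scale c x = scale (c - d) x \<oplus>\<^bsub>A\<^esub> scale d x"
    using scale_add[OF carrier_monoid_ring_diff[OF c d] d x] by simp
  then show ?thesis
    using scale_closed[OF carrier_monoid_ring_diff[OF c d] x] scale_closed[OF d x]
    by (simp add: A.minus_eq A.a_assoc A.r_neg)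
qed

lemma scale_add_right:
  assumes "c \<in> carrier (monoid_ring G)" and x: "x \<in> carrier A" and y: "y \<in> carrier A"
  shows "scale c (x \<oplus>\<^bsub>A\<^esub> y) = scale c x \<oplus>\<^bsub>A\<^esub> scale c y"
  using assms(1)
proof (induction c rule: monoid_ring_induct)
  case zero
  show ?case
    by simp
next
  case (one f)
  show ?case
    by (simp only: scale_of[OF one] x y A.a_closed action_add[OF one x y])
next
  case (diff a b)
  note cl = scale_closed[OF diff(1) x] scale_closed[OF diff(1) y] scale_closed[OF diff(2) x] scale_closed[OF diff(2) y]
  show ?case
    unfolding scale_diff[OF diff(1,2) x] scale_diff[OF diff(1,2) y] scale_diff[OF diff(1,2) A.a_closed[OF x y]] diff(3,4)
    using cl by (simp only: A.minus_eq A.minus_add A.a_closed A.a_inv_closed A.a_ac)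
qed

lemma scale_diff_right:
  assumes c: "c \<in> carrier (monoid_ring G)" and x: "x \<in> carrier A" and y: "y \<in> carrier A"
  shows "scale c (x \<ominus>\<^bsub>A\<^esub> y) = scale c x \<ominus>\<^bsub>A\<^esub> scale c y"
proof -
  have xy: "x \<ominus>\<^bsub>A\<^esub> y \<in> carrier A"
    using x y by simp
  have "x = (x \<ominus>\<^bsub>A\<^esub> y) \<oplus>\<^bsub>A\<^esub> y"
    using x y by (simp add: A.minus_eq A.a_assoc A.l_neg)
  then have "scale c x = scale c (x \<ominus>\<^bsub>A\<^esub> y) \<oplus>\<^bsub>A\<^esub> scale c y"
    using scale_add_right[OF c xy y] by simp
  then show ?thesis
    using scale_closed[OF c xy] scale_closed[OF c y] by (simp add: A.minus_eq A.a_assoc A.r_neg)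
qed

text \<open>Both sides are additive in \<open>a\<close> and in \<open>b\<close>, so the identity
  reduces to monoid elements, where it is \<open>action_mult\<close>.\<close>

lemma scale_mult:
  assumes a: "a \<in> carrier (monoid_ring G)" and b: "b \<in> carrier (monoid_ring G)" and x: "x \<in> carrier A"
  shows "scale (a \<otimes>\<^bsub>monoid_ring G\<^esub> b) x = scale a (scale b x)"
  using a
proof (induction a rule: monoid_ring_induct)
  case zero
  show ?case
    by simp
next
  case (one f)
  note f = one
  show ?case
    using b
  proof (induction b rule: monoid_ring_induct)
    case zero
    have "\<mu> f \<zero>\<^bsub>A\<^esub> \<oplus>\<^bsub>A\<^esub> \<mu> f \<zero>\<^bsub>A\<^esub> = \<mu> f \<zero>\<^bsub>A\<^esub>"
      using action_add[OF f A.zero_closed A.zero_closed] by simp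
    then have "\<mu> f \<zero>\<^bsub>A\<^esub> = \<zero>\<^bsub>A\<^esub>"
      using action_closed[OF f A.zero_closed] by (simp add: A.add.l_cancel_one)
    then show ?case
      by (simp only: mult_monoid_ring_zero scale_zero scale_of[OF f A.zero_closed])
  next
    case (one g)
    show ?case
      by (simp only: mult_monoid_ring_of scale_of f one x action_closed action_mult G.m_closed)
  next
    case (diff c d)
    have F: "frag_of f \<in> carrier (monoid_ring G)"
      by (rule carrier_monoid_ring_of[OF f])
    show ?case
      unfolding mult_monoid_ring_diff_right
        scale_diff[OF mult_monoid_ring_closed[OF G.monoid_axioms F diff(1)]
          mult_monoid_ring_closed[OF G.monoid_axioms F diff(2)] x]
        scale_diff[OF diff(1,2) x] scale_diff_right[OF F scale_closed[OF diff(1) x] scale_closed[OF diff(2) x]]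
        diff(3,4) ..
  qed
next
  case (diff c d)
  show ?case
    unfolding mult_monoid_ring_diff_left
      scale_diff[OF mult_monoid_ring_closed[OF G.monoid_axioms diff(1) b]
        mult_monoid_ring_closed[OF G.monoid_axioms diff(2) b] x]
      scale_diff[OF diff(1,2) scale_closed[OF b x]] diff(3,4) ..
qed

lemma carrier_action_module [simp]: "carrier (action_module A \<mu>) = carrier A"
  by (simp add: action_module_def)

lemma smult_action_module: "c \<odot>\<^bsub>action_module A \<mu>\<^esub> x = scale c x"
  by (simp add: action_module_def)

lemma zero_action_module [simp]: "\<zero>\<^bsub>action_module A \<mu>\<^esub> = \<zero>\<^bsub>A\<^esub>"
  by (simp add: action_module_def)

lemma add_action_module [simp]: "x \<oplus>\<^bsub>action_module A \<mu>\<^esub> y = x \<oplus>\<^bsub>A\<^esub> y"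
  by (simp add: action_module_def)

lemma smult_action_module_of:
  "f \<in> carrier G \<Longrightarrow> x \<in> carrier A \<Longrightarrow> frag_of f \<odot>\<^bsub>action_module A \<mu>\<^esub> x = \<mu> f x"
  unfolding smult_action_module by (rule scale_of)

lemma left_module_action_module: "left_module (monoid_ring G) (action_module A \<mu>)"
proof (intro left_module.intro left_module_axioms.intro)
  show "ring (monoid_ring G)"
    by (rule ring_monoid_ring[OF G.monoid_axioms])
  show "abelian_group (action_module A \<mu>)"
  proof (rule abelian_groupI)
    fix x
    assume "x \<in> carrier (action_module A \<mu>)"
    then show "\<exists>y \<in> carrier (action_module A \<mu>). y \<oplus>\<^bsub>action_module A \<mu>\<^esub> x = \<zero>\<^bsub>action_module A \<mu>\<^esub>"
      by (intro bexI[of _ "\<ominus>\<^bsub>A\<^esub> x"]) (simp_all add: A.l_neg)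
  qed (simp_all add: A.a_ac)
  show "\<one>\<^bsub>monoid_ring G\<^esub> \<odot>\<^bsub>action_module A \<mu>\<^esub> x = x" if "x \<in> carrier (action_module A \<mu>)" for x
    using that by (simp only: one_monoid_ring smult_action_module scale_of G.one_closed carrier_action_module action_one)
qed (simp_all only: carrier_action_module smult_action_module scale_closed add_action_module
    add_monoid_ring scale_add scale_add_right scale_mult)

end

lemma monoid_inj_monoid: "Group.monoid inj_monoid"
  by (rule monoidI) (auto simp: inj_monoid_def comp_assoc intro: inj_compose)

section \<open>Extension of scalars along the shift\<close>

text \<open>
  The cycles \<open>cyc i\<close> represent the orbits of the right action of the injection monoid on itself
  along \<open>1 \<times> -\<close>: an injection \<open>f\<close> is \<open>cyc (f 1) \<circ> (1 \<times> shift_down f)\<close>, and the orbit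
  of \<open>f\<close> is determined by \<open>f 1\<close>. So the right module \<open>ZM_plus\<close> is free on these cycles.
\<close>

definition cyc :: "nat \<Rightarrow> nat \<Rightarrow> nat" where
  "cyc i j = (if j = 1 then i else if 2 \<le> j \<and> j \<le> i then j - 1 else j)"

definition cyc_inv :: "nat \<Rightarrow> nat \<Rightarrow> nat" where
  "cyc_inv i j = (if j = i then 1 else if 1 \<le> j \<and> j < i then j + 1 else j)"

definition shift_down :: "(nat \<Rightarrow> nat) \<Rightarrow> nat \<Rightarrow> nat" where
  "shift_down f j = (if j = 0 then 0 else cyc_inv (f 1) (f (j + 1)) - 1)"

lemma cyc_inv_cyc: "1 \<le> i \<Longrightarrow> cyc_inv i (cyc i j) = j"
  by (auto simp: cyc_inv_def cyc_def)

lemma cyc_cyc_inv: "1 \<le> i \<Longrightarrow> cyc i (cyc_inv i j) = j"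
  by (auto simp: cyc_inv_def cyc_def)

lemma cyc_1 [simp]: "cyc i 1 = i"
  by (simp add: cyc_def)

lemma cyc_permutes:
  assumes "1 \<le> i" "i \<le> m"
  shows "cyc i permutes {1..m}"
proof (rule bij_imp_permutes)
  show "bij_betw (cyc i) {1..m} {1..m}"
    by (rule bij_betw_byWitness[where f' = "cyc_inv i"])
      (use assms in \<open>auto simp: cyc_inv_cyc cyc_cyc_inv, auto simp: cyc_def cyc_inv_def\<close>)
  show "cyc i j = j" if "j \<notin> {1..m}" for j
    using assms that by (auto simp: cyc_def)
qed

lemma carrier_inj_monoid: "f \<in> carrier inj_monoid \<longleftrightarrow> inj f \<and> f 0 = 0"
  by (simp add: inj_monoid_def)

lemma mult_inj_monoid [simp]: "f \<otimes>\<^bsub>inj_monoid\<^esub> g = f \<circ> g"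
  by (simp add: inj_monoid_def)

lemma one_inj_monoid [simp]: "\<one>\<^bsub>inj_monoid\<^esub> = id"
  by (simp add: inj_monoid_def)

lemma permutes_inj_monoid: "\<gamma> permutes {1..m} \<Longrightarrow> \<gamma> \<in> carrier inj_monoid"
  by (simp add: carrier_inj_monoid permutes_inj permutes_not_in)

lemma cyc_inj_monoid: "1 \<le> i \<Longrightarrow> cyc i \<in> carrier inj_monoid"
  using cyc_permutes[of i i] permutes_inj_monoid by blast

lemma inj_monoid_pos: "f \<in> carrier inj_monoid \<Longrightarrow> 1 \<le> j \<Longrightarrow> 1 \<le> f j"
  unfolding carrier_inj_monoid by (metis One_nat_def Suc_leI injD neq0_conv not_one_le_zero)

lemma one_times_inj_monoid:
  assumes "f \<in> carrier inj_monoid"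
  shows "one_times f \<in> carrier inj_monoid"
  unfolding carrier_inj_monoid
proof
  show "inj (one_times f)"
  proof (rule injI)
    fix a b
    assume eq: "one_times f a = one_times f b"
    have "2 \<le> one_times f c" if "2 \<le> c" for c
    proof -
      have "1 \<le> f (c - 1)" "one_times f c = f (c - 1) + 1"
        using that inj_monoid_pos[OF assms, of "c - 1"] by (auto simp: one_times_def)
      then show ?thesis
        by linarith
    qed
    then have "a \<le> 1 \<longleftrightarrow> b \<le> 1"
      using eq by (metis Suc_1 not_less_eq_eq one_times_def One_nat_def)
    then show "a = b"
      using eq assms by (auto simp: one_times_def carrier_inj_monoid inj_eq split: if_splits)
  qed
qed (simp add: one_times_def)

lemma one_times_comp: "f \<in> carrier inj_monoid \<Longrightarrow> g \<in> carrier inj_monoid \<Longrightarrow>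
    one_times (f \<circ> g) = one_times f \<circ> one_times g"
proof (rule ext)
  fix j
  assume g: "g \<in> carrier inj_monoid"
  show "one_times (f \<circ> g) j = (one_times f \<circ> one_times g) j"
  proof (cases "j \<le> 1")
    case False
    then have "1 \<le> g (j - 1)"
      by (intro inj_monoid_pos[OF g]) simp
    then show ?thesis
      using False by (simp add: one_times_def)
  qed (simp add: one_times_def)
qed

lemma cyc_one_times_shift_down:
  assumes f: "f \<in> carrier inj_monoid"
  shows "f = cyc (f 1) \<circ> one_times (shift_down f)"
proof
  fix j
  have 1: "1 \<le> f 1"
    using inj_monoid_pos[OF f] by simp
  show "f j = (cyc (f 1) \<circ> one_times (shift_down f)) j"
  proof (cases "j \<le> 1")
    case True
    then have "j = 0 \<or> j = 1"
      by linarith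
    then show ?thesis
      using f by (auto simp: one_times_def cyc_def carrier_inj_monoid)
  next
    case False
    have "1 \<le> cyc_inv (f 1) (f j)"
      using inj_monoid_pos[OF f, of j] False by (auto simp: cyc_inv_def)
    then have "one_times (shift_down f) j = cyc_inv (f 1) (f j)"
      using False by (simp add: one_times_def shift_down_def)
    then show ?thesis
      by (simp add: cyc_cyc_inv[OF 1])
  qed
qed

text \<open>Injectivity is read off the factorization of \<open>f\<close>: the value 0 at a positive
  argument would make \<open>f\<close> take the value \<open>f 1\<close> twice, and equal values at
  positive arguments give equal values of \<open>f\<close>.\<close>

lemma shift_down_inj_monoid:
  assumes f: "f \<in> carrier inj_monoid"
  shows "shift_down f \<in> carrier inj_monoid"
proof -
  have "inj (shift_down f)"
  proof (rule injI)
    fix a b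
    assume eq: "shift_down f a = shift_down f b"
    have one_times: "one_times (shift_down f) (Suc c) = Suc (shift_down f c)" if "c \<noteq> 0" for c
      using that by (simp add: one_times_def)
    have pos: "shift_down f c \<noteq> 0" if "c \<noteq> 0" for c
    proof
      assume 0: "shift_down f c = 0"
      have "f (Suc c) = f 1"
        using cyc_one_times_shift_down[OF f] one_times[OF that] 0 cyc_1 by (metis One_nat_def comp_apply)
      then show False
        using f that by (simp add: carrier_inj_monoid inj_eq)
    qed
    show "a = b"
    proof (cases "a = 0 \<or> b = 0")
      case True
      then show ?thesis
        using eq pos by (metis shift_down_def)
    next
      case False
      then have "f (Suc a) = f (Suc b)"
        using cyc_one_times_shift_down[OF f] one_times eq by (metis comp_apply)
      then show ?thesis
        using f by (simp add: carrier_inj_monoid inj_eq)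
    qed
  qed
  then show ?thesis
    by (simp add: carrier_inj_monoid shift_down_def)
qed

text \<open>Precomposing with \<open>1 \<times> g\<close> does not change the value at 1, so the
  same cycle is split off. This right equivariance makes the projections of the wedge well defined
  on orbits.\<close>

lemma shift_down_comp_one_times:
  assumes f: "f \<in> carrier inj_monoid" and g: "g \<in> carrier inj_monoid"
  shows "shift_down (f \<circ> one_times g) = shift_down f \<circ> g"
proof (rule ext)
  fix j
  show "shift_down (f \<circ> one_times g) j = (shift_down f \<circ> g) j"
  proof (cases "j = 0")
    case True
    then show ?thesis
      using g by (simp add: shift_down_def carrier_inj_monoid)
  next
    case False
    then have "g j \<noteq> 0"
      using inj_monoid_pos[OF g, of j] by linarith
    then show ?thesis
      using False by (simp add: shift_down_def one_times_def)
  qed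
qed

lemma shift_down_cyc: "1 \<le> i \<Longrightarrow> shift_down (cyc i) = id"
  by (auto simp: shift_down_def cyc_inv_cyc fun_eq_iff)

lemma one_times_id [simp]: "one_times id = id"
  by (auto simp: one_times_def fun_eq_iff)

lemma shift_down_permutes:
  assumes f: "f permutes {1..Suc n}"
  shows "shift_down f permutes {1..n}"
proof (rule bij_imp_permutes)
  have fM: "f \<in> carrier inj_monoid"
    by (rule permutes_inj_monoid[OF f])
  have f1: "1 \<le> f 1" "f 1 \<le> Suc n"
    using permutes_in_image[OF f, of 1] by auto
  have fixed: "shift_down f j = j" if "j \<notin> {1..n}" for j
  proof (cases "j = 0")
    case False
    \<comment> \<open>A fixed value above \<open>n + 1\<close> is larger than \<open>f 1\<close>, so
      \<open>cyc_inv (f 1)\<close> does not move it.\<close>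
    then have "f (j + 1) = j + 1"
      using that permutes_not_in[OF f] by auto
    then show ?thesis
      using f1 that False by (auto simp: shift_down_def cyc_inv_def)
  qed (simp add: shift_down_def)
  then show "shift_down f j = j" if "j \<notin> {1..n}" for j
    using that .
  have inj: "inj (shift_down f)"
    using shift_down_inj_monoid[OF fM] by (simp add: carrier_inj_monoid)
  \<comment> \<open>An injection that fixes every point outside {1..n} cannot send a point of {1..n}
    there.\<close>
  have "shift_down f ` {1..n} \<subseteq> {1..n}"
  proof
    fix y
    assume "y \<in> shift_down f ` {1..n}"
    then obtain x where x: "x \<in> {1..n}" "y = shift_down f x"
      by blast
    then show "y \<in> {1..n}"
      using fixed[of y] inj by (metis injD)
  qed
  then show "bij_betw (shift_down f) {1..n} {1..n}"
    using inj by (metis bij_betw_def endo_inj_surj finite_atLeastAtMost inj_on_subset subset_UNIV)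
qed

lemma one_times_permutes:
  assumes g: "g permutes {1..n}"
  shows "one_times g permutes {1..Suc n}"
proof (rule bij_imp_permutes)
  have gM: "g \<in> carrier inj_monoid"
    by (rule permutes_inj_monoid[OF g])
  show "one_times g j = j" if "j \<notin> {1..Suc n}" for j
  proof (cases "j = 0")
    case False
    then have "j - 1 \<notin> {1..n}"
      using that by auto
    then show ?thesis
      using False permutes_not_in[OF g, of "j - 1"] by (auto simp: one_times_def)
  qed (simp add: one_times_def)
  have inj: "inj (one_times g)"
    using one_times_inj_monoid[OF gM] by (simp add: carrier_inj_monoid)
  have "one_times g ` {1..Suc n} \<subseteq> {1..Suc n}"
  proof
    fix y
    assume "y \<in> one_times g ` {1..Suc n}"
    then obtain x where x: "x \<in> {1..Suc n}" "y = one_times g x"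
      by blast
    show "y \<in> {1..Suc n}"
    proof (cases "x = 1")
      case False
      then have "g (x - 1) \<in> {1..n}"
        using x permutes_in_image[OF g, of "x - 1"] by auto
      then show ?thesis
        using x False by (auto simp: one_times_def)
    qed (use x in \<open>simp add: one_times_def\<close>)
  qed
  then show "bij_betw (one_times g) {1..Suc n} {1..Suc n}"
    using inj by (metis bij_betw_def endo_inj_surj finite_atLeastAtMost inj_on_subset subset_UNIV)
qed

context left_module
begin

lemma lsmult_r_null:
  assumes "a \<in> carrier R"
  shows "a \<odot>\<^bsub>M\<^esub> \<zero>\<^bsub>M\<^esub> = \<zero>\<^bsub>M\<^esub>"
proof -
  have "a \<odot>\<^bsub>M\<^esub> \<zero>\<^bsub>M\<^esub> \<oplus>\<^bsub>M\<^esub> a \<odot>\<^bsub>M\<^esub> \<zero>\<^bsub>M\<^esub> = a \<odot>\<^bsub>M\<^esub> \<zero>\<^bsub>M\<^esub>"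
    using lsmult_r_distr[OF assms M.zero_closed M.zero_closed] by simp
  then show ?thesis
    using lsmult_closed[OF assms M.zero_closed] by (simp add: M.add.l_cancel_one)
qed

lemma lsmult_l_null:
  assumes "x \<in> carrier M"
  shows "\<zero>\<^bsub>R\<^esub> \<odot>\<^bsub>M\<^esub> x = \<zero>\<^bsub>M\<^esub>"
proof -
  have "\<zero>\<^bsub>R\<^esub> \<odot>\<^bsub>M\<^esub> x \<oplus>\<^bsub>M\<^esub> \<zero>\<^bsub>R\<^esub> \<odot>\<^bsub>M\<^esub> x = \<zero>\<^bsub>R\<^esub> \<odot>\<^bsub>M\<^esub> x"
    using lsmult_l_distr[OF R.zero_closed R.zero_closed assms] by simp
  then show ?thesis
    using lsmult_closed[OF R.zero_closed assms] by (simp add: M.add.l_cancel_one)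
qed

lemma lsmult_r_minus:
  assumes "a \<in> carrier R" "x \<in> carrier M" "y \<in> carrier M"
  shows "a \<odot>\<^bsub>M\<^esub> (x \<ominus>\<^bsub>M\<^esub> y) = a \<odot>\<^bsub>M\<^esub> x \<ominus>\<^bsub>M\<^esub> a \<odot>\<^bsub>M\<^esub> y"
proof -
  have "x = (x \<ominus>\<^bsub>M\<^esub> y) \<oplus>\<^bsub>M\<^esub> y"
    using assms by (simp add: M.minus_eq M.a_assoc M.l_neg)
  then have "a \<odot>\<^bsub>M\<^esub> x = a \<odot>\<^bsub>M\<^esub> (x \<ominus>\<^bsub>M\<^esub> y) \<oplus>\<^bsub>M\<^esub> a \<odot>\<^bsub>M\<^esub> y"
    using lsmult_r_distr[of a "x \<ominus>\<^bsub>M\<^esub> y" y] assms by simp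
  then show ?thesis
    using assms by (simp add: lsmult_closed M.minus_eq M.a_assoc M.r_neg)
qed

end

lemma (in abelian_group) minus_self: "x \<in> carrier G \<Longrightarrow> x \<ominus> x = \<zero>"
  by (simp add: minus_eq r_neg)

lemma (in abelian_group) add_minus_minus:
  assumes "x \<in> carrier G" "y \<in> carrier G"
  shows "x \<oplus> y \<ominus> x \<ominus> y = \<zero>"
proof -
  have "x \<oplus> y \<ominus> x = y"
    using assms by (simp add: minus_eq a_comm[of x y] a_assoc r_neg)
  then show ?thesis
    using assms by (simp add: minus_self)
qed

lemma hom_minus:
  assumes "abelian_group A" "abelian_group B" "h \<in> hom (add_monoid A) (add_monoid B)"
    and "x \<in> carrier A" "y \<in> carrier A"
  shows "h (x \<ominus>\<^bsub>A\<^esub> y) = h x \<ominus>\<^bsub>B\<^esub> h y"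
proof -
  interpret A: abelian_group A by fact
  interpret B: abelian_group B by fact
  have cl: "x \<ominus>\<^bsub>A\<^esub> y \<in> carrier A"
    using assms by simp
  have hcl: "h z \<in> carrier B" if "z \<in> carrier A" for z
    using hom_in_carrier[OF assms(3)] that by simp
  have "x = (x \<ominus>\<^bsub>A\<^esub> y) \<oplus>\<^bsub>A\<^esub> y"
    using assms by (simp add: A.minus_eq A.a_assoc A.l_neg)
  then have "h x = h (x \<ominus>\<^bsub>A\<^esub> y) \<oplus>\<^bsub>B\<^esub> h y"
    using hom_mult[OF assms(3), of "x \<ominus>\<^bsub>A\<^esub> y" y] cl assms by simp
  then show ?thesis
    using hcl[OF cl] hcl[OF assms(5)] by (simp add: B.minus_eq B.a_assoc B.r_neg)
qed

lemma hom_zero: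
  assumes "abelian_group A" "abelian_group B" "h \<in> hom (add_monoid A) (add_monoid B)"
  shows "h \<zero>\<^bsub>A\<^esub> = \<zero>\<^bsub>B\<^esub>"
  using hom_one[OF assms(3) abelian_group.a_group[OF assms(1)] abelian_group.a_group[OF assms(2)]] by simp

lemma carrier_ZM_plus [simp]: "carrier ZM_plus = carrier ZM"
  by (simp add: ZM_plus_def)

lemma add_ZM_plus [simp]: "p \<oplus>\<^bsub>ZM_plus\<^esub> q = p + q"
  by (simp add: ZM_plus_def)

lemma smult_ZM_plus [simp]: "a \<odot>\<^bsub>ZM_plus\<^esub> p = a \<otimes>\<^bsub>ZM\<^esub> p"
  by (simp add: ZM_plus_def)

text \<open>The ring endomorphism of \<int>[M] induced by \<open>1 \<times> -\<close>, through which
  \<int>[M] acts on \<open>ZM_plus\<close> from the right.\<close>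

definition shift_ring :: "((nat \<Rightarrow> nat) \<Rightarrow>\<^sub>0 int) \<Rightarrow> (nat \<Rightarrow> nat) \<Rightarrow>\<^sub>0 int" where
  "shift_ring = frag_extend (frag_of \<circ> one_times)"

lemma shift_ring_zero [simp]: "shift_ring 0 = 0"
  by (simp add: shift_ring_def)

lemma shift_ring_of [simp]: "shift_ring (frag_of f) = frag_of (one_times f)"
  by (simp add: shift_ring_def)

lemma shift_ring_diff: "shift_ring (a - b) = shift_ring a - shift_ring b"
  by (simp add: shift_ring_def frag_extend_diff)

lemma rsmult_ZM_plus [simp]: "rsmult ZM_plus p a = p \<otimes>\<^bsub>ZM\<^esub> shift_ring a"
  by (simp add: ZM_plus_def shift_ring_def)

lemma shift_ring_closed:
  assumes "a \<in> carrier ZM"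
  shows "shift_ring a \<in> carrier ZM"
  using assms
  by (induction a rule: monoid_ring_induct)
    (auto simp: shift_ring_diff
      intro: carrier_monoid_ring_zero carrier_monoid_ring_of one_times_inj_monoid carrier_monoid_ring_diff)

text \<open>
  The homomorphisms \<open>P\<close> separate the summands \<open>cyc (Suc i) \<cdot> \<eta> N\<close> of \<open>Q\<close>; they are only required to be
  injective on their own summand, where the action of a cycle contributes a sign.
\<close>

locale extension_of_scalars = N: left_module ZM N + Q: left_module ZM Q
  for N :: "((nat \<Rightarrow> nat) \<Rightarrow>\<^sub>0 int, 'a) module" and Q :: "((nat \<Rightarrow> nat) \<Rightarrow>\<^sub>0 int, 'b) module" +
  fixes \<eta> :: "'a \<Rightarrow> 'b"
  assumes \<eta>_hom: "\<eta> \<in> hom (add_monoid N) (add_monoid Q)"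
    and \<eta>_smult: "f \<in> carrier inj_monoid \<Longrightarrow> x \<in> carrier N \<Longrightarrow>
      \<eta> (frag_of f \<odot>\<^bsub>N\<^esub> x) = frag_of (one_times f) \<odot>\<^bsub>Q\<^esub> \<eta> x"
    and generated: "carrier Q \<subseteq> generate (add_monoid Q)
      {frag_of f \<odot>\<^bsub>Q\<^esub> \<eta> x | f x. f \<in> carrier inj_monoid \<and> x \<in> carrier N}"
    and detected: "\<exists>P \<in> hom (add_monoid Q) (add_monoid N).
      (\<forall>i x. i \<noteq> j \<longrightarrow> x \<in> carrier N \<longrightarrow> P (frag_of (cyc (Suc i)) \<odot>\<^bsub>Q\<^esub> \<eta> x) = \<zero>\<^bsub>N\<^esub>) \<and>
      (\<forall>x. x \<in> carrier N \<longrightarrow> P (frag_of (cyc (Suc j)) \<odot>\<^bsub>Q\<^esub> \<eta> x) = \<zero>\<^bsub>N\<^esub> \<longrightarrow> x = \<zero>\<^bsub>N\<^esub>)"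
begin

abbreviation gens :: "(((nat \<Rightarrow> nat) \<Rightarrow>\<^sub>0 int) \<times> 'a) set" where
  "gens \<equiv> carrier ZM \<times> carrier N"

abbreviation K :: "(((nat \<Rightarrow> nat) \<Rightarrow>\<^sub>0 int) \<times> 'a \<Rightarrow>\<^sub>0 int) set" where
  "K \<equiv> tensor_subgroup ZM ZM_plus N"

abbreviation tcls :: "(((nat \<Rightarrow> nat) \<Rightarrow>\<^sub>0 int) \<times> 'a \<Rightarrow>\<^sub>0 int) \<Rightarrow> (((nat \<Rightarrow> nat) \<Rightarrow>\<^sub>0 int) \<times> 'a \<Rightarrow>\<^sub>0 int) set" where
  "tcls \<equiv> tensor_class ZM ZM_plus N"

abbreviation Ten where
  "Ten \<equiv> tensor ZM ZM_plus N"

lemma \<eta>_closed: "x \<in> carrier N \<Longrightarrow> \<eta> x \<in> carrier Q"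
  using hom_in_carrier[OF \<eta>_hom] by simp

lemma \<eta>_add: "x \<in> carrier N \<Longrightarrow> y \<in> carrier N \<Longrightarrow> \<eta> (x \<oplus>\<^bsub>N\<^esub> y) = \<eta> x \<oplus>\<^bsub>Q\<^esub> \<eta> y"
  using hom_mult[OF \<eta>_hom, of x y] by simp

lemma N_diff:
  assumes "a \<in> carrier ZM" "b \<in> carrier ZM" "x \<in> carrier N"
  shows "(a - b) \<odot>\<^bsub>N\<^esub> x = a \<odot>\<^bsub>N\<^esub> x \<ominus>\<^bsub>N\<^esub> b \<odot>\<^bsub>N\<^esub> x"
proof -
  have "a \<odot>\<^bsub>N\<^esub> x = (a - b) \<odot>\<^bsub>N\<^esub> x \<oplus>\<^bsub>N\<^esub> b \<odot>\<^bsub>N\<^esub> x"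
    using N.lsmult_l_distr[OF carrier_monoid_ring_diff[OF assms(1,2)] assms(2,3)] by simp
  then show ?thesis
    using assms by (simp add: N.lsmult_closed carrier_monoid_ring_diff N.M.minus_eq N.M.a_assoc N.M.r_neg)
qed

lemma Q_diff:
  assumes "a \<in> carrier ZM" "b \<in> carrier ZM" "x \<in> carrier Q"
  shows "(a - b) \<odot>\<^bsub>Q\<^esub> x = a \<odot>\<^bsub>Q\<^esub> x \<ominus>\<^bsub>Q\<^esub> b \<odot>\<^bsub>Q\<^esub> x"
proof -
  have "a \<odot>\<^bsub>Q\<^esub> x = (a - b) \<odot>\<^bsub>Q\<^esub> x \<oplus>\<^bsub>Q\<^esub> b \<odot>\<^bsub>Q\<^esub> x"
    using Q.lsmult_l_distr[OF carrier_monoid_ring_diff[OF assms(1,2)] assms(2,3)] by simp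
  then show ?thesis
    using assms by (simp add: Q.lsmult_closed carrier_monoid_ring_diff Q.M.minus_eq Q.M.a_assoc Q.M.r_neg)
qed

lemma \<eta>_shift:
  assumes "r \<in> carrier ZM" "x \<in> carrier N"
  shows "\<eta> (r \<odot>\<^bsub>N\<^esub> x) = shift_ring r \<odot>\<^bsub>Q\<^esub> \<eta> x"
  using assms(1)
proof (induction r rule: monoid_ring_induct)
  case zero
  then show ?case
    using N.lsmult_l_null[OF assms(2)] Q.lsmult_l_null[OF \<eta>_closed[OF assms(2)]]
      hom_zero[OF N.M.abelian_group_axioms Q.M.abelian_group_axioms \<eta>_hom] by simp
next
  case (one f)
  then show ?case
    by (simp add: \<eta>_smult assms(2))
next
  case (diff a b)
  then show ?case
    using assms(2) hom_minus[OF N.M.abelian_group_axioms Q.M.abelian_group_axioms \<eta>_hom]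
    by (simp add: N_diff shift_ring_diff Q_diff shift_ring_closed \<eta>_closed N.lsmult_closed)
qed

text \<open>The map p \<otimes> x \<mapsto> p \<cdot> \<eta>(x) before passage to the quotient,
  chosen by the universal property of the free abelian group. Only its values on combinations
  supported in \<open>gens\<close> are determined.\<close>

definition lift0 :: "(((nat \<Rightarrow> nat) \<Rightarrow>\<^sub>0 int) \<times> 'a \<Rightarrow>\<^sub>0 int) \<Rightarrow> 'b" where
  "lift0 = (SOME h. h \<in> hom (free_Abelian_group gens) (add_monoid Q) \<and>
     (\<forall>p \<in> gens. h (frag_of p) = fst p \<odot>\<^bsub>Q\<^esub> \<eta> (snd p)))"

lemma lift0: "lift0 \<in> hom (free_Abelian_group gens) (add_monoid Q) \<and>
     (\<forall>p \<in> gens. lift0 (frag_of p) = fst p \<odot>\<^bsub>Q\<^esub> \<eta> (snd p))"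
proof -
  have "(\<lambda>p. fst p \<odot>\<^bsub>Q\<^esub> \<eta> (snd p)) ` gens \<subseteq> carrier (add_monoid Q)"
    by (auto simp: Q.lsmult_closed \<eta>_closed)
  then obtain h where "h \<in> hom (free_Abelian_group gens) (add_monoid Q)"
    "\<And>p. p \<in> gens \<Longrightarrow> h (frag_of p) = fst p \<odot>\<^bsub>Q\<^esub> \<eta> (snd p)"
    by (rule comm_group.free_Abelian_group_universal[OF Q.M.a_comm_group]) blast
  then have "\<exists>h. h \<in> hom (free_Abelian_group gens) (add_monoid Q) \<and>
      (\<forall>p \<in> gens. h (frag_of p) = fst p \<odot>\<^bsub>Q\<^esub> \<eta> (snd p))"
    by blast
  from someI_ex[OF this] show ?thesis
    unfolding lift0_def .
qed

lemma lift0_closed: "Poly_Mapping.keys c \<subseteq> gens \<Longrightarrow> lift0 c \<in> carrier Q"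
  using hom_in_carrier[OF conjunct1[OF lift0], of c] by simp

lemma lift0_add:
  "Poly_Mapping.keys c \<subseteq> gens \<Longrightarrow> Poly_Mapping.keys d \<subseteq> gens \<Longrightarrow> lift0 (c + d) = lift0 c \<oplus>\<^bsub>Q\<^esub> lift0 d"
  using hom_mult[OF conjunct1[OF lift0], of c d] by simp

lemma lift0_of: "p \<in> carrier ZM \<Longrightarrow> x \<in> carrier N \<Longrightarrow> lift0 (frag_of (p, x)) = p \<odot>\<^bsub>Q\<^esub> \<eta> x"
  using conjunct2[OF lift0] by simp

lemma keys_diff_subset: "Poly_Mapping.keys a \<subseteq> S \<Longrightarrow> Poly_Mapping.keys b \<subseteq> S \<Longrightarrow> Poly_Mapping.keys (a - b) \<subseteq> S"
  using keys_diff[of a b] by blast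

lemma keys_add_subset: "Poly_Mapping.keys a \<subseteq> S \<Longrightarrow> Poly_Mapping.keys b \<subseteq> S \<Longrightarrow> Poly_Mapping.keys (a + b) \<subseteq> S"
  using keys_add[of a b] by blast

lemma lift0_diff:
  assumes c: "Poly_Mapping.keys c \<subseteq> gens" and d: "Poly_Mapping.keys d \<subseteq> gens"
  shows "lift0 (c - d) = lift0 c \<ominus>\<^bsub>Q\<^esub> lift0 d"
proof -
  have "lift0 c = lift0 (c - d) \<oplus>\<^bsub>Q\<^esub> lift0 d"
    using lift0_add[OF keys_diff_subset[OF c d] d] by simp
  then show ?thesis
    using lift0_closed[OF keys_diff_subset[OF c d]] lift0_closed[OF d]
    by (simp add: Q.M.minus_eq Q.M.a_assoc Q.M.r_neg)
qed

lemma lift0_zero: "lift0 0 = \<zero>\<^bsub>Q\<^esub>"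
  using lift0_diff[of 0 0] lift0_closed[of 0] by (simp add: Q.M.minus_self)

text \<open>The left action on representatives, in the form used by the definition of
  \<open>tensor\<close>.\<close>

abbreviation scale_gens :: "((nat \<Rightarrow> nat) \<Rightarrow>\<^sub>0 int) \<Rightarrow> (((nat \<Rightarrow> nat) \<Rightarrow>\<^sub>0 int) \<times> 'a \<Rightarrow>\<^sub>0 int) \<Rightarrow> ((nat \<Rightarrow> nat) \<Rightarrow>\<^sub>0 int) \<times> 'a \<Rightarrow>\<^sub>0 int" where
  "scale_gens s \<equiv> frag_extend (\<lambda>(p, x). frag_of (s \<odot>\<^bsub>ZM_plus\<^esub> p, x))"

lemma keys_scale_gens:
  assumes "s \<in> carrier ZM" "Poly_Mapping.keys c \<subseteq> gens"
  shows "Poly_Mapping.keys (scale_gens s c) \<subseteq> gens"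
  using assms(2)
proof (induction c rule: frag_induction_on)
  case (one p)
  then have "fst p \<in> carrier ZM" "snd p \<in> carrier N"
    by auto
  then have "s \<otimes>\<^bsub>ZM\<^esub> fst p \<in> carrier ZM" "snd p \<in> carrier N"
    using mult_monoid_ring_closed[OF monoid_inj_monoid assms(1)] by blast+
  then show ?case
    by (simp add: case_prod_unfold)
qed (simp_all only: frag_extend_0 frag_extend_diff keys_diff_subset keys_zero empty_subsetI)

lemma lift0_scale_gens:
  assumes s: "s \<in> carrier ZM" and c: "Poly_Mapping.keys c \<subseteq> gens"
  shows "lift0 (scale_gens s c) = s \<odot>\<^bsub>Q\<^esub> lift0 c"
  using c
proof (induction c rule: frag_induction_on)
  case zero
  then show ?case
    by (simp add: lift0_zero Q.lsmult_r_null[OF s])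
next
  case (one p)
  then show ?case
    using s mult_monoid_ring_closed[OF monoid_inj_monoid s, of "fst p"]
    by (cases p) (simp add: lift0_of Q.lsmult_assoc \<eta>_closed)
next
  case (diff a b)
  then show ?case
    by (simp only: frag_extend_diff lift0_diff keys_scale_gens s Q.lsmult_r_minus lift0_closed)
qed

text \<open>The balancing relations are respected because \<open>\<eta>\<close> carries the action
  of \<open>r\<close> to that of \<open>shift_ring r\<close>; the other two kinds express additivity
  of the action and of \<open>\<eta>\<close>.\<close>

lemma tensor_relations_subset:
  "tensor_relations ZM ZM_plus N \<subseteq> {c. Poly_Mapping.keys c \<subseteq> gens \<and> lift0 c = \<zero>\<^bsub>Q\<^esub>}"
proof
  fix c
  assume "c \<in> tensor_relations ZM ZM_plus N"
  then show "c \<in> {c. Poly_Mapping.keys c \<subseteq> gens \<and> lift0 c = \<zero>\<^bsub>Q\<^esub>}"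
    unfolding tensor_relations_def carrier_ZM_plus add_ZM_plus rsmult_ZM_plus
  proof (elim UnE CollectE exE conjE)
    fix p p' x
    assume 1: "c = frag_of (p + p', x) - frag_of (p, x) - frag_of (p', x)"
      "p \<in> carrier ZM" "p' \<in> carrier ZM" "x \<in> carrier N"
    have k: "Poly_Mapping.keys (frag_of (p + p', x)) \<subseteq> gens" "Poly_Mapping.keys (frag_of (p, x)) \<subseteq> gens"
      "Poly_Mapping.keys (frag_of (p', x)) \<subseteq> gens"
      using 1 carrier_monoid_ring_add by auto
    have "lift0 c = (p \<odot>\<^bsub>Q\<^esub> \<eta> x \<oplus>\<^bsub>Q\<^esub> p' \<odot>\<^bsub>Q\<^esub> \<eta> x) \<ominus>\<^bsub>Q\<^esub> p \<odot>\<^bsub>Q\<^esub> \<eta> x \<ominus>\<^bsub>Q\<^esub> p' \<odot>\<^bsub>Q\<^esub> \<eta> x"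
      using 1 k Q.lsmult_l_distr[OF 1(2,3) \<eta>_closed[OF 1(4)]]
      unfolding 1(1)
      by (simp only: lift0_diff keys_diff_subset lift0_of carrier_monoid_ring_add add_monoid_ring)
    also have "\<dots> = \<zero>\<^bsub>Q\<^esub>"
      using 1 by (intro Q.M.add_minus_minus Q.lsmult_closed \<eta>_closed)
    finally show ?thesis
      using keys_diff_subset[OF keys_diff_subset[OF k(1,2)] k(3)] 1(1) by (simp only: mem_Collect_eq)
  next
    fix p x x'
    assume 2: "c = frag_of (p, x \<oplus>\<^bsub>N\<^esub> x') - frag_of (p, x) - frag_of (p, x')"
      "p \<in> carrier ZM" "x \<in> carrier N" "x' \<in> carrier N"
    have k: "Poly_Mapping.keys (frag_of (p, x \<oplus>\<^bsub>N\<^esub> x')) \<subseteq> gens" "Poly_Mapping.keys (frag_of (p, x)) \<subseteq> gens"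
      "Poly_Mapping.keys (frag_of (p, x')) \<subseteq> gens"
      using 2 by auto
    have "lift0 c = (p \<odot>\<^bsub>Q\<^esub> \<eta> x \<oplus>\<^bsub>Q\<^esub> p \<odot>\<^bsub>Q\<^esub> \<eta> x') \<ominus>\<^bsub>Q\<^esub> p \<odot>\<^bsub>Q\<^esub> \<eta> x \<ominus>\<^bsub>Q\<^esub> p \<odot>\<^bsub>Q\<^esub> \<eta> x'"
      using 2 k by (simp only: lift0_diff keys_diff_subset lift0_of N.M.a_closed \<eta>_add Q.lsmult_r_distr \<eta>_closed)
    also have "\<dots> = \<zero>\<^bsub>Q\<^esub>"
      using 2 by (intro Q.M.add_minus_minus Q.lsmult_closed \<eta>_closed)
    finally show ?thesis
      using keys_diff_subset[OF keys_diff_subset[OF k(1,2)] k(3)] 2(1) by (simp only: mem_Collect_eq)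
  next
    fix p r x
    assume 3: "c = frag_of (p \<otimes>\<^bsub>ZM\<^esub> shift_ring r, x) - frag_of (p, r \<odot>\<^bsub>N\<^esub> x)"
      "p \<in> carrier ZM" "r \<in> carrier ZM" "x \<in> carrier N"
    have cl: "p \<otimes>\<^bsub>ZM\<^esub> shift_ring r \<in> carrier ZM"
      by (rule mult_monoid_ring_closed[OF monoid_inj_monoid 3(2) shift_ring_closed[OF 3(3)]])
    have k: "Poly_Mapping.keys (frag_of (p \<otimes>\<^bsub>ZM\<^esub> shift_ring r, x)) \<subseteq> gens"
      "Poly_Mapping.keys (frag_of (p, r \<odot>\<^bsub>N\<^esub> x)) \<subseteq> gens"
      using 3 cl by (auto simp: N.lsmult_closed)
    have "lift0 c = p \<odot>\<^bsub>Q\<^esub> (shift_ring r \<odot>\<^bsub>Q\<^esub> \<eta> x) \<ominus>\<^bsub>Q\<^esub> p \<odot>\<^bsub>Q\<^esub> (shift_ring r \<odot>\<^bsub>Q\<^esub> \<eta> x)"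
      using 3 k cl by (simp only: lift0_diff lift0_of N.lsmult_closed \<eta>_shift Q.lsmult_assoc shift_ring_closed \<eta>_closed)
    also have "\<dots> = \<zero>\<^bsub>Q\<^esub>"
      using 3 by (simp add: Q.lsmult_closed \<eta>_closed shift_ring_closed Q.M.minus_self)
    finally show ?thesis
      using keys_diff_subset[OF k] 3(1) by (simp only: mem_Collect_eq)
  qed
qed

lemma K_subgroup: "subgroup K (free_Abelian_group gens)"
  using tensor_relations_subset unfolding tensor_subgroup_def carrier_ZM_plus
  by (intro group.generate_is_subgroup) auto

lemma K_zero: "0 \<in> K"
  using subgroup.one_closed[OF K_subgroup] by simp

lemma K_keys: "c \<in> K \<Longrightarrow> Poly_Mapping.keys c \<subseteq> gens"
  using subgroup.mem_carrier[OF K_subgroup] by simp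

lemma K_add: "c \<in> K \<Longrightarrow> d \<in> K \<Longrightarrow> c + d \<in> K"
  using subgroup.m_closed[OF K_subgroup] by simp

lemma K_minus: "c \<in> K \<Longrightarrow> - c \<in> K"
  using subgroup.m_inv_closed[OF K_subgroup] K_keys by simp

lemma K_diff: "c \<in> K \<Longrightarrow> d \<in> K \<Longrightarrow> c - d \<in> K"
  using K_add[OF _ K_minus] by fastforce

lemma K_relation: "c \<in> tensor_relations ZM ZM_plus N \<Longrightarrow> c \<in> K"
  unfolding tensor_subgroup_def by (rule generate.incl)

lemma K_add_left:
  "p \<in> carrier ZM \<Longrightarrow> p' \<in> carrier ZM \<Longrightarrow> x \<in> carrier N \<Longrightarrow>
     frag_of (p + p', x) - frag_of (p, x) - frag_of (p', x) \<in> K"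
  by (rule K_relation) (force simp: tensor_relations_def)

lemma K_add_right:
  "p \<in> carrier ZM \<Longrightarrow> x \<in> carrier N \<Longrightarrow> x' \<in> carrier N \<Longrightarrow>
     frag_of (p, x \<oplus>\<^bsub>N\<^esub> x') - frag_of (p, x) - frag_of (p, x') \<in> K"
  by (rule K_relation) (force simp: tensor_relations_def)

lemma K_balanced:
  "p \<in> carrier ZM \<Longrightarrow> r \<in> carrier ZM \<Longrightarrow> x \<in> carrier N \<Longrightarrow>
     frag_of (p \<otimes>\<^bsub>ZM\<^esub> shift_ring r, x) - frag_of (p, r \<odot>\<^bsub>N\<^esub> x) \<in> K"
  by (rule K_relation) (force simp: tensor_relations_def)

lemma K_zero_right: "p \<in> carrier ZM \<Longrightarrow> frag_of (p, \<zero>\<^bsub>N\<^esub>) \<in> K"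
  using K_minus[OF K_add_right[of p "\<zero>\<^bsub>N\<^esub>" "\<zero>\<^bsub>N\<^esub>"]] by simp

lemma K_zero_left: "x \<in> carrier N \<Longrightarrow> frag_of (0, x) \<in> K"
  using K_minus[OF K_add_left[of 0 0 x]] by (simp add: carrier_monoid_ring_zero)

lemma K_diff_left:
  "p \<in> carrier ZM \<Longrightarrow> p' \<in> carrier ZM \<Longrightarrow> x \<in> carrier N \<Longrightarrow>
     frag_of (p - p', x) - (frag_of (p, x) - frag_of (p', x)) \<in> K"
  using K_minus[OF K_add_left[of "p - p'" p' x]] by (simp add: carrier_monoid_ring_diff algebra_simps)

lemma K_diff_right:
  assumes "p \<in> carrier ZM" "x \<in> carrier N" "x' \<in> carrier N"
  shows "frag_of (p, x \<ominus>\<^bsub>N\<^esub> x') - (frag_of (p, x) - frag_of (p, x')) \<in> K"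
proof -
  have "(x \<ominus>\<^bsub>N\<^esub> x') \<oplus>\<^bsub>N\<^esub> x' = x"
    using assms by (simp add: N.M.minus_eq N.M.a_assoc N.M.l_neg)
  then show ?thesis
    using K_minus[OF K_add_right[of p "x \<ominus>\<^bsub>N\<^esub> x'" x']] assms by (simp add: algebra_simps)
qed

section \<open>Normal forms of tensors with respect to the cycles\<close>

definition normal_form :: "nat \<Rightarrow> (nat \<Rightarrow> 'a) \<Rightarrow> ((nat \<Rightarrow> nat) \<Rightarrow>\<^sub>0 int) \<times> 'a \<Rightarrow>\<^sub>0 int" where
  "normal_form L x = (\<Sum>i<L. frag_of (frag_of (cyc (Suc i)), x i))"

lemma cyc_carrier: "frag_of (cyc (Suc i)) \<in> carrier ZM"
  by (rule carrier_monoid_ring_of[OF cyc_inj_monoid]) simp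

lemma normal_form_Suc: "normal_form (Suc L) x = normal_form L x + frag_of (frag_of (cyc (Suc L)), x L)"
  by (simp add: normal_form_def)

lemma keys_normal_form:
  assumes "\<And>i. x i \<in> carrier N"
  shows "Poly_Mapping.keys (normal_form L x) \<subseteq> gens"
proof (induction L)
  case (Suc L)
  have "Poly_Mapping.keys (frag_of (frag_of (cyc (Suc L)), x L)) \<subseteq> gens"
    using cyc_carrier assms by simp
  with Suc show ?case
    unfolding normal_form_Suc by (rule keys_add_subset)
qed (simp add: normal_form_def)

text \<open>Terms with coefficient zero lie in \<open>K\<close>, so lengths of normal forms can be
  aligned.\<close>

lemma normal_form_pad:
  assumes "L \<le> L'" "\<And>i. L \<le> i \<Longrightarrow> x i = \<zero>\<^bsub>N\<^esub>"
  shows "normal_form L' x - normal_form L x \<in> K"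
  using assms(1)
proof (induction rule: dec_induct)
  case base
  show ?case
    by (simp add: K_zero)
next
  case (step n)
  then show ?case
    using K_add[OF _ K_zero_right[OF cyc_carrier[of n]]] assms(2)[of n] by (fastforce simp: normal_form_Suc algebra_simps)
qed

lemma normal_form_diff:
  assumes "\<And>i. x i \<in> carrier N" "\<And>i. y i \<in> carrier N"
  shows "normal_form L (\<lambda>i. x i \<ominus>\<^bsub>N\<^esub> y i) - (normal_form L x - normal_form L y) \<in> K"
proof (induction L)
  case 0
  show ?case
    by (simp add: normal_form_def K_zero)
next
  case (Suc L)
  show ?case
    using K_add[OF Suc K_diff_right[OF cyc_carrier[of L] assms(1)[of L] assms(2)[of L]]]
    by (simp add: normal_form_Suc algebra_simps)
qed

text \<open>The coefficients form a total sequence that is zero from \<open>L\<close> on, so that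
  two normal forms can be padded to a common length before they are subtracted.\<close>

definition has_normal_form where
  "has_normal_form c \<longleftrightarrow> (\<exists>L x. (\<forall>i. x i \<in> carrier N) \<and> (\<forall>i\<ge>L. x i = \<zero>\<^bsub>N\<^esub>) \<and> c - normal_form L x \<in> K)"

lemma has_normal_formI:
  "(\<And>i. x i \<in> carrier N) \<Longrightarrow> (\<And>i. L \<le> i \<Longrightarrow> x i = \<zero>\<^bsub>N\<^esub>) \<Longrightarrow> c - normal_form L x \<in> K \<Longrightarrow> has_normal_form c"
  unfolding has_normal_form_def by blast

lemma has_normal_form_cong:
  assumes "has_normal_form d" "c - d \<in> K"
  shows "has_normal_form c"
proof -
  obtain L x where x: "\<And>i. x i \<in> carrier N" "\<And>i. L \<le> i \<Longrightarrow> x i = \<zero>\<^bsub>N\<^esub>" "d - normal_form L x \<in> K"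
    using assms(1) unfolding has_normal_form_def by blast
  have "c - normal_form L x \<in> K"
    using K_add[OF assms(2) x(3)] by simp
  then show ?thesis
    by (rule has_normal_formI[rotated 2]) (rule x, erule x)
qed

lemma has_normal_form_zero: "has_normal_form 0"
  by (rule has_normal_formI[of "\<lambda>_. \<zero>\<^bsub>N\<^esub>" 0]) (simp_all add: normal_form_def K_zero)

lemma has_normal_form_diff:
  assumes "has_normal_form c" "has_normal_form d"
  shows "has_normal_form (c - d)"
proof -
  obtain L x where x: "\<And>i. x i \<in> carrier N" "\<And>i. L \<le> i \<Longrightarrow> x i = \<zero>\<^bsub>N\<^esub>" "c - normal_form L x \<in> K"
    using assms(1) unfolding has_normal_form_def by blast
  obtain L' y where y: "\<And>i. y i \<in> carrier N" "\<And>i. L' \<le> i \<Longrightarrow> y i = \<zero>\<^bsub>N\<^esub>" "d - normal_form L' y \<in> K"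
    using assms(2) unfolding has_normal_form_def by blast
  let ?m = "max L L'"
  \<comment> \<open>Both normal forms are padded to length \<open>?m\<close> and subtracted there;
    the error terms telescope to the claim.\<close>
  have "(c - normal_form L x) - (d - normal_form L' y)
      - (normal_form ?m x - normal_form L x) + (normal_form ?m y - normal_form L' y)
      - (normal_form ?m (\<lambda>i. x i \<ominus>\<^bsub>N\<^esub> y i) - (normal_form ?m x - normal_form ?m y)) \<in> K"
    by (intro K_diff K_add x y normal_form_pad normal_form_diff) auto
  then have "(c - d) - normal_form ?m (\<lambda>i. x i \<ominus>\<^bsub>N\<^esub> y i) \<in> K"
    by (simp add: algebra_simps)
  then show ?thesis
    by (rule has_normal_formI[rotated 2]) (simp_all add: x y N.M.minus_self)
qed

lemma has_normal_form_cyc: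
  assumes y: "y \<in> carrier N"
  shows "has_normal_form (frag_of (frag_of (cyc (Suc i)), y))"
proof -
  let ?x = "\<lambda>j. if j = i then y else \<zero>\<^bsub>N\<^esub>"
  have "normal_form i ?x = normal_form i (\<lambda>_. \<zero>\<^bsub>N\<^esub>)"
    by (simp add: normal_form_def)
  then have "normal_form i ?x \<in> K"
    using normal_form_pad[of 0 i "\<lambda>_. \<zero>\<^bsub>N\<^esub>"] by (simp add: normal_form_def)
  then have "frag_of (frag_of (cyc (Suc i)), y) - normal_form (Suc i) ?x \<in> K"
    using K_minus by (simp add: normal_form_Suc)
  then show ?thesis
    by (rule has_normal_formI[rotated 2]) (use y in auto)
qed

text \<open>A monoid element \<open>f\<close> is \<open>cyc (f 1)\<close> times the shift of
  \<open>shift_down f\<close>, and the balancing relation moves the second factor across the tensor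
  sign. A general \<open>p\<close> is reached by differences.\<close>

lemma has_normal_form_of:
  assumes "p \<in> carrier ZM" and x: "x \<in> carrier N"
  shows "has_normal_form (frag_of (p, x))"
  using assms(1)
proof (induction p rule: monoid_ring_induct)
  case zero
  show ?case
    by (rule has_normal_form_cong[OF has_normal_form_zero]) (simp add: K_zero_left x)
next
  case (one f)
  \<comment> \<open>The value at 1 is positive, while normal forms number the cycles from 0.\<close>
  obtain i where i: "f 1 = Suc i"
    using inj_monoid_pos[OF one, of 1] by (cases "f 1") auto
  have g: "frag_of (shift_down f) \<in> carrier ZM"
    by (rule carrier_monoid_ring_of[OF shift_down_inj_monoid[OF one]])
  have "frag_of (cyc (Suc i)) \<otimes>\<^bsub>ZM\<^esub> shift_ring (frag_of (shift_down f)) = frag_of f"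
    using cyc_one_times_shift_down[OF one] i by (simp add: mult_monoid_ring_of)
  then have "frag_of (frag_of f, x) - frag_of (frag_of (cyc (Suc i)), frag_of (shift_down f) \<odot>\<^bsub>N\<^esub> x) \<in> K"
    using K_balanced[OF cyc_carrier[of i] g x] by simp
  then show ?case
    by (rule has_normal_form_cong[OF has_normal_form_cyc[OF N.lsmult_closed[OF g x]]])
next
  case (diff a b)
  show ?case
    by (rule has_normal_form_cong[OF has_normal_form_diff[OF diff(3,4)] K_diff_left[OF diff(1,2) x]])
qed

lemma has_normal_form: "Poly_Mapping.keys c \<subseteq> gens \<Longrightarrow> has_normal_form c"
proof (induction c rule: frag_induction_on)
  case (one p)
  then show ?case
    using has_normal_form_of[of "fst p" "snd p"] by (auto simp: mem_Times_iff)
qed (simp_all add: has_normal_form_zero has_normal_form_diff)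

text \<open>All terms except the one of index \<open>j\<close> are killed by \<open>P\<close>, so
  additivity leaves a single coefficient.\<close>

lemma lift0_normal_form_detect:
  assumes P: "P \<in> hom (add_monoid Q) (add_monoid N)"
    and P0: "\<And>i x. i \<noteq> j \<Longrightarrow> x \<in> carrier N \<Longrightarrow> P (frag_of (cyc (Suc i)) \<odot>\<^bsub>Q\<^esub> \<eta> x) = \<zero>\<^bsub>N\<^esub>"
    and x: "\<And>i. x i \<in> carrier N"
  shows "P (lift0 (normal_form L x)) = (if j < L then P (frag_of (cyc (Suc j)) \<odot>\<^bsub>Q\<^esub> \<eta> (x j)) else \<zero>\<^bsub>N\<^esub>)"
proof (induction L)
  case 0
  show ?case
    by (simp add: normal_form_def lift0_zero hom_zero[OF Q.M.abelian_group_axioms N.M.abelian_group_axioms P])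
next
  case (Suc L)
  have cl: "frag_of (cyc (Suc i)) \<odot>\<^bsub>Q\<^esub> \<eta> (x i) \<in> carrier Q" for i
    by (intro Q.lsmult_closed cyc_carrier \<eta>_closed x)
  have Pcl: "P z \<in> carrier N" if "z \<in> carrier Q" for z
    using hom_in_carrier[OF P] that by simp
  have "lift0 (normal_form (Suc L) x) = lift0 (normal_form L x) \<oplus>\<^bsub>Q\<^esub> frag_of (cyc (Suc L)) \<odot>\<^bsub>Q\<^esub> \<eta> (x L)"
    unfolding normal_form_Suc lift0_of[OF cyc_carrier x, symmetric]
    by (rule lift0_add[OF keys_normal_form[OF x]]) (simp add: cyc_carrier x)
  then have "P (lift0 (normal_form (Suc L) x)) = P (lift0 (normal_form L x)) \<oplus>\<^bsub>N\<^esub> P (frag_of (cyc (Suc L)) \<odot>\<^bsub>Q\<^esub> \<eta> (x L))"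
    using hom_mult[OF P, of "lift0 (normal_form L x)" "frag_of (cyc (Suc L)) \<odot>\<^bsub>Q\<^esub> \<eta> (x L)"]
      lift0_closed[OF keys_normal_form[OF x]] cl by simp
  then show ?case
    using Suc P0[of L "x L"] x Pcl[OF cl] by (cases "L = j") auto
qed

text \<open>This is the injectivity of the induced map. An element of the kernel is congruent to a
  normal form, whose image vanishes as well. The detecting homomorphisms then force every
  coefficient to be zero, and a normal form with zero coefficients lies in \<open>K\<close>.\<close>

lemma K_iff: "c \<in> K \<longleftrightarrow> Poly_Mapping.keys c \<subseteq> gens \<and> lift0 c = \<zero>\<^bsub>Q\<^esub>"
proof
  let ?Z = "{c. Poly_Mapping.keys c \<subseteq> gens \<and> lift0 c = \<zero>\<^bsub>Q\<^esub>}"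
  have "subgroup ?Z (free_Abelian_group gens)"
  proof (rule group.subgroupI[OF group_free_Abelian_group])
    show "?Z \<noteq> {}"
      using lift0_zero by (intro ex_in_conv[THEN iffD1] exI[of _ 0]) simp
    show "inv\<^bsub>free_Abelian_group gens\<^esub> c \<in> ?Z" if "c \<in> ?Z" for c
      using that lift0_diff[of 0 c] lift0_zero by (simp add: Q.M.minus_self)
    show "c \<otimes>\<^bsub>free_Abelian_group gens\<^esub> d \<in> ?Z" if "c \<in> ?Z" "d \<in> ?Z" for c d
      using that lift0_add[of c d] keys_add_subset[of c gens d] by simp
  qed auto
  then have "K \<subseteq> ?Z"
    unfolding tensor_subgroup_def carrier_ZM_plus
    by (intro group.generate_subgroup_incl[OF group_free_Abelian_group tensor_relations_subset])
  then show "Poly_Mapping.keys c \<subseteq> gens \<and> lift0 c = \<zero>\<^bsub>Q\<^esub>" if "c \<in> K"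
    using that by blast
  assume c: "Poly_Mapping.keys c \<subseteq> gens \<and> lift0 c = \<zero>\<^bsub>Q\<^esub>"
  obtain L x where x: "\<And>i. x i \<in> carrier N" "c - normal_form L x \<in> K"
    using has_normal_form c unfolding has_normal_form_def by blast
  have "lift0 (c - normal_form L x) = \<zero>\<^bsub>Q\<^esub>"
    using \<open>K \<subseteq> ?Z\<close> x(2) by blast
  then have "lift0 (normal_form L x) = \<zero>\<^bsub>Q\<^esub>"
    using c lift0_diff[of c "normal_form L x"] keys_normal_form[OF x(1)] lift0_closed[OF keys_normal_form[OF x(1)]]
    by (simp add: Q.M.minus_eq)
  have "x j = \<zero>\<^bsub>N\<^esub>" if "j < L" for j
  proof -
    obtain P where P: "P \<in> hom (add_monoid Q) (add_monoid N)"
      "\<And>i x. i \<noteq> j \<Longrightarrow> x \<in> carrier N \<Longrightarrow> P (frag_of (cyc (Suc i)) \<odot>\<^bsub>Q\<^esub> \<eta> x) = \<zero>\<^bsub>N\<^esub>"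
      "\<And>x. x \<in> carrier N \<Longrightarrow> P (frag_of (cyc (Suc j)) \<odot>\<^bsub>Q\<^esub> \<eta> x) = \<zero>\<^bsub>N\<^esub> \<Longrightarrow> x = \<zero>\<^bsub>N\<^esub>"
      using detected[of j] by blast
    have "P (lift0 (normal_form L x)) = \<zero>\<^bsub>N\<^esub>"
      using \<open>lift0 (normal_form L x) = \<zero>\<^bsub>Q\<^esub>\<close> hom_zero[OF Q.M.abelian_group_axioms N.M.abelian_group_axioms P(1)] by simp
    moreover have "P (lift0 (normal_form L x)) = (if j < L then P (frag_of (cyc (Suc j)) \<odot>\<^bsub>Q\<^esub> \<eta> (x j)) else \<zero>\<^bsub>N\<^esub>)"
      by (rule lift0_normal_form_detect[OF P(1)]) (simp_all add: P(2) x(1))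
    ultimately show ?thesis
      using that P(3)[OF x(1)] by simp
  qed
  then have "normal_form L x = normal_form L (\<lambda>_. \<zero>\<^bsub>N\<^esub>)"
    by (simp add: normal_form_def)
  then have "normal_form L x \<in> K"
    using normal_form_pad[of 0 L "\<lambda>_. \<zero>\<^bsub>N\<^esub>"] by (simp add: normal_form_def)
  then show "c \<in> K"
    using K_add[OF x(2)] by fastforce
qed

text \<open>The image of \<open>lift0\<close> is a subgroup that contains a generating set of
  \<open>Q\<close>.\<close>

lemma lift0_surj:
  assumes "q \<in> carrier Q"
  obtains c where "Poly_Mapping.keys c \<subseteq> gens" "lift0 c = q"
proof -
  interpret h: group_hom "free_Abelian_group gens" "add_monoid Q" lift0
    using lift0 Q.M.a_group by (intro group_hom.intro group_hom_axioms.intro) auto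
  have "{frag_of f \<odot>\<^bsub>Q\<^esub> \<eta> x | f x. f \<in> carrier inj_monoid \<and> x \<in> carrier N}
      \<subseteq> lift0 ` carrier (free_Abelian_group gens)"
  proof clarify
    fix f x
    assume "f \<in> carrier inj_monoid" "x \<in> carrier N"
    then show "frag_of f \<odot>\<^bsub>Q\<^esub> \<eta> x \<in> lift0 ` carrier (free_Abelian_group gens)"
      by (intro image_eqI[of _ _ "frag_of (frag_of f, x)"]) (simp_all add: lift0_of carrier_monoid_ring_of)
  qed
  then have "generate (add_monoid Q) {frag_of f \<odot>\<^bsub>Q\<^esub> \<eta> x | f x. f \<in> carrier inj_monoid \<and> x \<in> carrier N}
      \<subseteq> lift0 ` carrier (free_Abelian_group gens)"
    by (rule group.generate_subgroup_incl[OF Q.M.a_group _ h.img_is_subgroup])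
  then have "q \<in> lift0 ` carrier (free_Abelian_group gens)"
    using generated assms by blast
  then obtain c where "c \<in> carrier (free_Abelian_group gens)" "q = lift0 c"
    by blast
  then show thesis
    using that[of c] by simp
qed

text \<open>By \<open>K_iff\<close> the cosets are the fibres of \<open>lift0\<close>. Equations
  between classes in the tensor product can therefore be checked after applying
  \<open>lift0\<close>, that is, in \<open>Q\<close>.\<close>

lemma mem_tcls:
  assumes c: "Poly_Mapping.keys c \<subseteq> gens"
  shows "d \<in> tcls c \<longleftrightarrow> Poly_Mapping.keys d \<subseteq> gens \<and> lift0 d = lift0 c"
proof
  assume "d \<in> tcls c"
  then obtain k where "k \<in> K" "d = k + c"
    by (auto simp: tensor_class_def r_coset_def)
  then show "Poly_Mapping.keys d \<subseteq> gens \<and> lift0 d = lift0 c"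
    using c keys_add_subset[of k gens c] lift0_add[of k c] lift0_closed[OF c] by (simp add: K_iff)
next
  assume d: "Poly_Mapping.keys d \<subseteq> gens \<and> lift0 d = lift0 c"
  then have "d - c \<in> K"
    using c lift0_diff[of d c] keys_diff_subset[of d gens c] lift0_closed[OF c] by (simp add: K_iff Q.M.minus_self)
  then show "d \<in> tcls c"
    unfolding tensor_class_def r_coset_def by (auto intro!: bexI[of _ "d - c"])
qed

lemma tcls_eq:
  "Poly_Mapping.keys c \<subseteq> gens \<Longrightarrow> Poly_Mapping.keys d \<subseteq> gens \<Longrightarrow> tcls c = tcls d \<longleftrightarrow> lift0 c = lift0 d"
  by (metis (mono_tags) mem_tcls set_eq_iff)

lemma carrier_tensor: "carrier Ten = {tcls c | c. Poly_Mapping.keys c \<subseteq> gens}"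
  by (auto simp: tensor_def Let_def FactGroup_def RCOSETS_def tensor_class_def)

lemma tcls_closed: "Poly_Mapping.keys c \<subseteq> gens \<Longrightarrow> tcls c \<in> carrier Ten"
  by (auto simp: carrier_tensor)

lemma tensorE:
  assumes "C \<in> carrier Ten"
  obtains c where "Poly_Mapping.keys c \<subseteq> gens" "C = tcls c"
  using assms by (auto simp: carrier_tensor)

lemma add_tcls:
  assumes "Poly_Mapping.keys c \<subseteq> gens" "Poly_Mapping.keys d \<subseteq> gens"
  shows "tcls c \<oplus>\<^bsub>Ten\<^esub> tcls d = tcls (c + d)"
proof -
  interpret comm_group "free_Abelian_group gens"
    by (rule abelian_free_Abelian_group)
  show ?thesis
    using normal.rcos_sum[OF subgroup_imp_normal[OF K_subgroup], of c d] assms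
    by (simp add: tensor_def Let_def FactGroup_def tensor_class_def)
qed

lemma zero_tensor: "\<zero>\<^bsub>Ten\<^esub> = tcls 0"
proof -
  interpret group "free_Abelian_group gens"
    by simp
  show ?thesis
    using coset_mult_one[OF subgroup.subset[OF K_subgroup]]
    by (simp add: tensor_def Let_def FactGroup_def tensor_class_def)
qed

text \<open>The action is well defined because \<open>lift0\<close> turns the scaling of
  representatives into the action on \<open>Q\<close>.\<close>

lemma smult_tcls:
  assumes s: "s \<in> carrier ZM" and c: "Poly_Mapping.keys c \<subseteq> gens"
  shows "s \<odot>\<^bsub>Ten\<^esub> tcls c = tcls (scale_gens s c)"
proof -
  have "the_elem ((\<lambda>d. tcls (scale_gens s d)) ` tcls c) = tcls (scale_gens s c)"
  proof (rule the_elem_image_const)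
    show "tcls c \<noteq> {}"
      using c mem_tcls by blast
    fix d
    assume "d \<in> tcls c"
    then have d: "Poly_Mapping.keys d \<subseteq> gens" "lift0 d = lift0 c"
      using mem_tcls[OF c] by auto
    then show "tcls (scale_gens s d) = tcls (scale_gens s c)"
      by (simp only: tcls_eq keys_scale_gens s c lift0_scale_gens)
  qed
  then show ?thesis
    by (simp add: tensor_def Let_def)
qed

definition ext where
  "ext C = the_elem (lift0 ` C)"

lemma ext_tcls:
  assumes "Poly_Mapping.keys c \<subseteq> gens"
  shows "ext (tcls c) = lift0 c"
  unfolding ext_def by (rule the_elem_image_const) (use assms mem_tcls in blast)+

lemma abelian_group_tensor: "abelian_group Ten"
proof (rule abelian_groupI)
  fix C
  assume "C \<in> carrier Ten"
  then obtain c where c: "Poly_Mapping.keys c \<subseteq> gens" "C = tcls c"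
    by (rule tensorE)
  then have "tcls (- c) \<oplus>\<^bsub>Ten\<^esub> C = \<zero>\<^bsub>Ten\<^esub>"
    by (simp add: add_tcls zero_tensor)
  then show "\<exists>D \<in> carrier Ten. D \<oplus>\<^bsub>Ten\<^esub> C = \<zero>\<^bsub>Ten\<^esub>"
    using tcls_closed[of "- c"] c by auto
next
  fix C D E
  assume C: "C \<in> carrier Ten" and D: "D \<in> carrier Ten"
  obtain c where c: "Poly_Mapping.keys c \<subseteq> gens" "C = tcls c"
    using C by (rule tensorE)
  obtain d where d: "Poly_Mapping.keys d \<subseteq> gens" "D = tcls d"
    using D by (rule tensorE)
  show "C \<oplus>\<^bsub>Ten\<^esub> D \<in> carrier Ten"
    using c d by (simp add: add_tcls tcls_closed keys_add_subset)
  show "C \<oplus>\<^bsub>Ten\<^esub> D = D \<oplus>\<^bsub>Ten\<^esub> C"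
    using c d by (simp add: add_tcls add.commute)
  assume "E \<in> carrier Ten"
  then obtain e where e: "Poly_Mapping.keys e \<subseteq> gens" "E = tcls e"
    by (rule tensorE)
  show "C \<oplus>\<^bsub>Ten\<^esub> D \<oplus>\<^bsub>Ten\<^esub> E = C \<oplus>\<^bsub>Ten\<^esub> (D \<oplus>\<^bsub>Ten\<^esub> E)"
    using c d e by (simp add: add_tcls keys_add_subset add.assoc)
qed (auto simp: zero_tensor add_tcls tcls_closed elim: tensorE)

text \<open>Additivity in the scalar, associativity and the unit law hold for the images in
  \<open>Q\<close>, and classes are determined by their images. Additivity in the second argument is
  visible on representatives.\<close>

lemma left_module_tensor: "left_module ZM Ten"
proof (intro left_module.intro left_module_axioms.intro abelian_group_tensor N.R.ring_axioms)
  fix a b C D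
  assume a: "a \<in> carrier ZM" and "C \<in> carrier Ten"
  then obtain c where c: "Poly_Mapping.keys c \<subseteq> gens" "C = tcls c"
    by (auto elim: tensorE)
  note sc = smult_tcls keys_scale_gens lift0_scale_gens
  show "a \<odot>\<^bsub>Ten\<^esub> C \<in> carrier Ten"
    using a c by (simp only: sc tcls_closed)
  {
    assume "D \<in> carrier Ten"
    then obtain d where d: "Poly_Mapping.keys d \<subseteq> gens" "D = tcls d"
      by (rule tensorE)
    show "a \<odot>\<^bsub>Ten\<^esub> (C \<oplus>\<^bsub>Ten\<^esub> D) = a \<odot>\<^bsub>Ten\<^esub> C \<oplus>\<^bsub>Ten\<^esub> a \<odot>\<^bsub>Ten\<^esub> D"
      using a c d by (simp only: sc add_tcls keys_add_subset frag_extend_add)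
  }
  assume b: "b \<in> carrier ZM"
  have ab: "a + b \<in> carrier ZM" "a \<otimes>\<^bsub>ZM\<^esub> b \<in> carrier ZM"
    using a b by (simp_all add: carrier_monoid_ring_add mult_monoid_ring_closed monoid_inj_monoid)
  have l: "lift0 c \<in> carrier Q"
    using c lift0_closed by simp
  show "(a \<oplus>\<^bsub>ZM\<^esub> b) \<odot>\<^bsub>Ten\<^esub> C = a \<odot>\<^bsub>Ten\<^esub> C \<oplus>\<^bsub>Ten\<^esub> b \<odot>\<^bsub>Ten\<^esub> C"
    unfolding c(2) add_monoid_ring
    using a b ab c(1) Q.lsmult_l_distr[OF a b l, unfolded add_monoid_ring]
    by (simp only: sc add_tcls tcls_eq keys_add_subset lift0_add)
  show "(a \<otimes>\<^bsub>ZM\<^esub> b) \<odot>\<^bsub>Ten\<^esub> C = a \<odot>\<^bsub>Ten\<^esub> (b \<odot>\<^bsub>Ten\<^esub> C)"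
    unfolding c(2)
    using a b ab c(1) Q.lsmult_assoc[OF a b l]
    by (simp only: sc tcls_eq)
next
  fix C
  assume "C \<in> carrier Ten"
  then obtain c where c: "Poly_Mapping.keys c \<subseteq> gens" "C = tcls c"
    by (rule tensorE)
  show "\<one>\<^bsub>ZM\<^esub> \<odot>\<^bsub>Ten\<^esub> C = C"
    unfolding c(2) using c(1) N.R.one_closed Q.lsmult_one[OF lift0_closed[OF c(1)]]
    by (simp only: smult_tcls keys_scale_gens lift0_scale_gens tcls_eq)
qed

lemma ext_iso: "ext \<in> iso (add_monoid Ten) (add_monoid Q)"
  unfolding iso_def mem_Collect_eq
proof
  show "ext \<in> hom (add_monoid Ten) (add_monoid Q)"
  proof (rule homI)
    fix C D
    assume C: "C \<in> carrier (add_monoid Ten)" and D: "D \<in> carrier (add_monoid Ten)"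
    obtain c where c: "Poly_Mapping.keys c \<subseteq> gens" "C = tcls c"
      using C by (auto elim: tensorE)
    obtain d where d: "Poly_Mapping.keys d \<subseteq> gens" "D = tcls d"
      using D by (auto elim: tensorE)
    show "ext C \<in> carrier (add_monoid Q)"
      using c by (simp add: ext_tcls lift0_closed)
    show "ext (C \<otimes>\<^bsub>add_monoid Ten\<^esub> D) = ext C \<otimes>\<^bsub>add_monoid Q\<^esub> ext D"
      using c d by (simp add: add_tcls ext_tcls keys_add_subset lift0_add)
  qed
  show "bij_betw ext (carrier (add_monoid Ten)) (carrier (add_monoid Q))"
  proof (rule bij_betw_imageI)
    show "inj_on ext (carrier (add_monoid Ten))"
    proof (rule inj_onI)
      fix C D
      assume C: "C \<in> carrier (add_monoid Ten)" and D: "D \<in> carrier (add_monoid Ten)" and eq: "ext C = ext D"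
      obtain c where c: "Poly_Mapping.keys c \<subseteq> gens" "C = tcls c"
        using C by (auto elim: tensorE)
      obtain d where d: "Poly_Mapping.keys d \<subseteq> gens" "D = tcls d"
        using D by (auto elim: tensorE)
      show "C = D"
        using eq unfolding c(2) d(2) by (simp only: ext_tcls tcls_eq c d)
    qed
    show "ext ` carrier (add_monoid Ten) = carrier (add_monoid Q)"
    proof
      show "ext ` carrier (add_monoid Ten) \<subseteq> carrier (add_monoid Q)"
        by (auto elim!: tensorE simp: ext_tcls lift0_closed)
      show "carrier (add_monoid Q) \<subseteq> ext ` carrier (add_monoid Ten)"
      proof
        fix q
        assume "q \<in> carrier (add_monoid Q)"
        then obtain c where "Poly_Mapping.keys c \<subseteq> gens" "lift0 c = q"
          using lift0_surj by auto
        then show "q \<in> ext ` carrier (add_monoid Ten)"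
          using tcls_closed by (intro image_eqI[of _ _ "tcls c"]) (simp_all add: ext_tcls)
      qed
    qed
  qed
qed

lemma ext_smult:
  assumes "a \<in> carrier ZM" "C \<in> carrier Ten"
  shows "ext (a \<odot>\<^bsub>Ten\<^esub> C) = a \<odot>\<^bsub>Q\<^esub> ext C"
  using assms(2) by (auto elim!: tensorE simp only: smult_tcls assms(1) ext_tcls keys_scale_gens lift0_scale_gens)

text \<open>The isomorphism is wanted from the homotopy group to the tensor product, opposite to the
  direction in which the universal property provides it.\<close>

definition ext_inv where
  "ext_inv = inv_into (carrier Ten) ext"

lemma ext_bij: "bij_betw ext (carrier Ten) (carrier Q)"
  using ext_iso by (simp add: iso_def)

lemma ext_inv_ext: "C \<in> carrier Ten \<Longrightarrow> ext_inv (ext C) = C"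
  unfolding ext_inv_def using ext_bij by (rule bij_betw_inv_into_left)

lemma ext_ext_inv: "q \<in> carrier Q \<Longrightarrow> ext (ext_inv q) = q"
  unfolding ext_inv_def using ext_bij by (rule bij_betw_inv_into_right)

lemma ext_inv_closed: "q \<in> carrier Q \<Longrightarrow> ext_inv q \<in> carrier Ten"
  unfolding ext_inv_def using ext_bij by (metis bij_betw_def inv_into_into)

lemma left_module_iso_ext_inv: "left_module_iso ZM Q Ten ext_inv"
  unfolding left_module_iso_def
proof (intro conjI ballI left_module_tensor Q.left_module_axioms)
  show "ext_inv \<in> iso (add_monoid Q) (add_monoid Ten)"
    using group.iso_set_sym[OF abelian_group.a_group[OF abelian_group_tensor] ext_iso]
    by (simp add: ext_inv_def)
  interpret T: left_module ZM Ten
    by (rule left_module_tensor)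
  fix a q
  assume a: "a \<in> carrier ZM" and q: "q \<in> carrier Q"
  have "ext (a \<odot>\<^bsub>Ten\<^esub> ext_inv q) = a \<odot>\<^bsub>Q\<^esub> q"
    using a q by (simp add: ext_smult ext_inv_closed ext_ext_inv)
  then show "ext_inv (a \<odot>\<^bsub>Q\<^esub> q) = a \<odot>\<^bsub>Ten\<^esub> ext_inv q"
    using ext_inv_ext[OF T.lsmult_closed[OF a ext_inv_closed[OF q]]] by simp
qed

end

text \<open>The inverses are compared through \<open>lift0\<close>: a combination representing the
  image of \<open>q\<close> is mapped by \<open>g\<close> to one whose lift is \<open>h q\<close>.
  Linearity of \<open>h\<close> over the monoid ring follows from its compatibility with monoid
  elements.\<close>

lemma ext_inv_natural:
  assumes 1: "extension_of_scalars N Q \<eta>" and 2: "extension_of_scalars N' Q' \<eta>'"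
    and g: "\<And>x. x \<in> carrier N \<Longrightarrow> g x \<in> carrier N'"
    and h: "h \<in> hom (add_monoid Q) (add_monoid Q')"
    and h_smult: "\<And>f q. f \<in> carrier inj_monoid \<Longrightarrow> q \<in> carrier Q \<Longrightarrow> h (frag_of f \<odot>\<^bsub>Q\<^esub> q) = frag_of f \<odot>\<^bsub>Q'\<^esub> h q"
    and hg: "\<And>x. x \<in> carrier N \<Longrightarrow> h (\<eta> x) = \<eta>' (g x)"
    and q: "q \<in> carrier Q"
  shows "extension_of_scalars.ext_inv N' Q' \<eta>' (h q)
    = tensor_map ZM ZM_plus N' g (extension_of_scalars.ext_inv N Q \<eta> q)"
proof -
  interpret A: extension_of_scalars N Q \<eta> by fact
  interpret B: extension_of_scalars N' Q' \<eta>' by fact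
  let ?g = "frag_extend (\<lambda>(p, x). frag_of (p, g x))"
  have hcl: "h z \<in> carrier Q'" if "z \<in> carrier Q" for z
    using hom_in_carrier[OF h] that by simp
  note hm = hom_minus[OF A.Q.M.abelian_group_axioms B.Q.M.abelian_group_axioms h]
  note hz = hom_zero[OF A.Q.M.abelian_group_axioms B.Q.M.abelian_group_axioms h]
  have keys: "Poly_Mapping.keys (?g c) \<subseteq> B.gens" if "Poly_Mapping.keys c \<subseteq> A.gens" for c
    using that
  proof (induction c rule: frag_induction_on)
    case (one p)
    then show ?case
      using g by (auto simp: case_prod_unfold)
  qed (simp_all only: frag_extend_0 frag_extend_diff A.keys_diff_subset keys_zero empty_subsetI)
  have h_smult': "h (a \<odot>\<^bsub>Q\<^esub> z) = a \<odot>\<^bsub>Q'\<^esub> h z" if "a \<in> carrier ZM" and z: "z \<in> carrier Q" for a z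
    using that(1)
  proof (induction a rule: monoid_ring_induct)
    case zero
    then show ?case
      using A.Q.lsmult_l_null[OF z] B.Q.lsmult_l_null[OF hcl[OF z]] hz by simp
  next
    case (one f)
    then show ?case
      by (simp add: h_smult z)
  next
    case (diff a b)
    then show ?case
      by (simp add: A.Q_diff B.Q_diff z hcl hm A.Q.lsmult_closed)
  qed
  have lift: "B.lift0 (?g c) = h (A.lift0 c)" if "Poly_Mapping.keys c \<subseteq> A.gens" for c
    using that
  proof (induction c rule: frag_induction_on)
    case zero
    then show ?case
      by (simp add: A.lift0_zero B.lift0_zero hz)
  next
    case (one p)
    then show ?case
      by (cases p) (simp add: A.lift0_of B.lift0_of g h_smult' A.\<eta>_closed hg)
  next
    case (diff a b)
    then show ?case
      by (simp only: frag_extend_diff A.lift0_diff B.lift0_diff keys hm A.lift0_closed)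
  qed
  obtain c where c: "Poly_Mapping.keys c \<subseteq> A.gens" "A.ext_inv q = A.tcls c"
    using A.ext_inv_closed[OF q] by (rule A.tensorE)
  have "A.lift0 c = q"
    using A.ext_ext_inv[OF q] c by (simp add: A.ext_tcls)
  have "tensor_map ZM ZM_plus N' g (A.tcls c) = B.tcls (?g c)"
    unfolding tensor_map_def
  proof (rule the_elem_image_const)
    show "A.tcls c \<noteq> {}"
      using c A.mem_tcls by blast
    fix d
    assume "d \<in> A.tcls c"
    then have "Poly_Mapping.keys d \<subseteq> A.gens" "A.lift0 d = A.lift0 c"
      using A.mem_tcls[OF c(1)] by auto
    then show "B.tcls (?g d) = B.tcls (?g c)"
      using c(1) by (simp only: B.tcls_eq keys lift)
  qed
  moreover have "B.ext_inv (h q) = B.tcls (?g c)"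
    using B.ext_inv_ext[OF B.tcls_closed[OF keys[OF c(1)]]] \<open>A.lift0 c = q\<close>
    by (simp only: B.ext_tcls keys c(1) lift)
  ultimately show ?thesis
    by (simp only: c(2))
qed

section \<open>Suspension\<close>

lemma points_S1: "points S1 = {0..<1}"
proof -
  have "frac ` {0..1} = {0..<1 :: real}"
  proof
    show "frac ` {0..1} \<subseteq> {0..<1 :: real}"
      by (auto simp: frac_lt_1)
    show "{0..<1 :: real} \<subseteq> frac ` {0..1}"
    proof
      fix x :: real
      assume x: "x \<in> {0..<1}"
      then have "x = frac x"
        using frac_eq[of x] by simp
      then show "x \<in> frac ` {0..1}"
        using x by (intro image_eqI[of _ _ x]) auto
    qed
  qed
  then show ?thesis
    by (simp add: S1_def)
qed

lemma base_S1 [simp]: "base S1 = 0"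
  by (simp add: S1_def)

lemma frac_points_S1: "frac x \<in> points S1"
  by (simp add: points_S1 frac_lt_1)

lemma continuous_map_frac: "continuous_map (top_of_set {0..1}) (top_of S1) frac"
  using quotient_imp_continuous_map[OF quotient_map_quot_topology] by (simp add: S1_def)

lemma continuous_map_smash_proj:
  "continuous_map (prod_topology (top_of A) (top_of B)) (top_of (smash A B)) (smash_proj A B)"
  using quotient_imp_continuous_map[OF quotient_map_quot_topology] by (simp add: smash_def)

lemma base_smash: "base (smash A B) = (base A, base B)"
  by (simp add: smash_def)

lemma points_smash: "points (smash A B) = smash_proj A B ` (points A \<times> points B)"
  by (simp add: smash_def)

lemma smash_proj_base: "x = base A \<or> y = base B \<Longrightarrow> smash_proj A B (x, y) = base (smash A B)"
  by (auto simp: smash_proj_def base_smash)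

lemma base_in_smash: "base A \<in> points A \<Longrightarrow> base B \<in> points B \<Longrightarrow> base (smash A B) \<in> points (smash A B)"
  by (metis SigmaI image_eqI points_smash smash_proj_base)

lemma base_in_smash_S1: "base A \<in> points A \<Longrightarrow> base (smash A S1) \<in> points (smash A S1)"
  by (rule base_in_smash) (simp_all add: points_S1)

text \<open>As a real function \<open>frac\<close> jumps at 1; it is continuous only as the quotient
  map onto the circle. The parameter \<open>w\<close> is therefore kept in [0,1], and
  \<open>frac\<close> is applied last.\<close>

lemma continuous_map_smash_frac:
  assumes K: "continuous_map T (top_of A) K" and w: "continuous_map T (top_of_set {0..1}) w"
  shows "continuous_map T (top_of (smash A S1)) (\<lambda>p. smash_proj A S1 (K p, frac (w p)))"
proof -
  have "continuous_map T (top_of S1) (frac \<circ> w)"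
    by (rule continuous_map_compose[OF w continuous_map_frac])
  then have "continuous_map T (prod_topology (top_of A) (top_of S1)) (\<lambda>p. (K p, frac (w p)))"
    using K by (simp add: continuous_map_pairedI o_def)
  then show ?thesis
    using continuous_map_compose[OF _ continuous_map_smash_proj] by (fastforce simp: o_def)
qed

lemma restrict_unit_cube: "t \<in> unit_cube (Suc m) \<Longrightarrow> restrict t {1..m} \<in> unit_cube m"
  by (auto simp: unit_cube_def PiE_iff)

lemma cube_boundary_SucE:
  assumes "t \<in> cube_boundary (Suc m)"
  obtains "restrict t {1..m} \<in> cube_boundary m" | "t (Suc m) = 0" | "t (Suc m) = 1"
proof -
  obtain i where i: "i \<in> {1..Suc m}" "t i = 0 \<or> t i = 1"
    using assms by (auto simp: cube_boundary_eq)
  show thesis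
  proof (cases "i = Suc m")
    case True
    then show ?thesis
      using i that by auto
  next
    case False
    then have "i \<in> {1..m}"
      using i by auto
    then have "restrict t {1..m} \<in> cube_boundary m"
      using restrict_unit_cube[OF cube_boundary_subset[OF assms]] i(2)
      unfolding cube_boundary_eq by (auto intro!: bexI[of _ i])
    then show ?thesis
      by (rule that)
  qed
qed

lemma continuous_map_restrict_cube:
  "continuous_map (top_of_set ({0..1 :: real} \<times> unit_cube (Suc m))) (top_of_set ({0..1} \<times> unit_cube m))
     (\<lambda>p. (fst p, restrict (snd p) {1..m}))"
proof -
  have "continuous_on ({0..1 :: real} \<times> unit_cube (Suc m)) (\<lambda>p. restrict (snd p) {1..m})"
  proof (rule continuous_on_coordinatewise_then_product)
    fix j
    show "continuous_on ({0..1 :: real} \<times> unit_cube (Suc m)) (\<lambda>p. restrict (snd p) {1..m} j)"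
    proof (cases "j \<in> {1..m}")
      case False
      then have eq: "(\<lambda>p :: real \<times> (nat \<Rightarrow> real). restrict (snd p) {1..m} j) = (\<lambda>_. undefined)"
        by (auto simp: fun_eq_iff)
      show ?thesis
        unfolding eq by (rule continuous_on_const)
    qed (simp add: continuous_on_coord_snd)
  qed
  then have "continuous_on ({0..1 :: real} \<times> unit_cube (Suc m)) (\<lambda>p. (fst p, restrict (snd p) {1..m}))"
    by (rule continuous_on_Pair[OF continuous_on_fst[OF continuous_on_id]])
  moreover have "(\<lambda>p. (fst p, restrict (snd p) {1..m})) \<in> {0..1 :: real} \<times> unit_cube (Suc m) \<rightarrow> {0..1} \<times> unit_cube m"
  proof
    fix p :: "real \<times> (nat \<Rightarrow> real)"
    assume "p \<in> {0..1} \<times> unit_cube (Suc m)"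
    then show "(fst p, restrict (snd p) {1..m}) \<in> {0..1} \<times> unit_cube m"
      by (intro SigmaI restrict_unit_cube) (simp_all only: mem_Times_iff)
  qed
  ultimately show ?thesis
    by (simp only: continuous_map_subtopology_eu simp_thms)
qed

lemma suspend_map_homotopic:
  assumes "(g, h) \<in> cube_homotopic m A"
  shows "(suspend_map m A g, suspend_map m A h) \<in> cube_homotopic (Suc m) (smash A S1)"
proof -
  obtain K where K: "continuous_map (top_of_set ({0..1::real} \<times> unit_cube m)) (top_of A) K"
    "\<And>t. t \<in> unit_cube m \<Longrightarrow> K (0, t) = g t" "\<And>t. t \<in> unit_cube m \<Longrightarrow> K (1, t) = h t"
    "\<And>r t. r \<in> {0..1} \<Longrightarrow> t \<in> cube_boundary m \<Longrightarrow> K (r, t) = base A"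
    by (rule cube_homotopicE[OF assms], rule that)
  define H where "H = (\<lambda>p. smash_proj A S1 (K (fst p, restrict (snd p) {1..m}), frac (snd p (Suc m))))"
  have "continuous_map (top_of_set ({0..1} \<times> unit_cube (Suc m))) (top_of (smash A S1)) H"
    unfolding H_def
  proof (rule continuous_map_smash_frac)
    show "continuous_map (top_of_set ({0..1} \<times> unit_cube (Suc m))) (top_of A)
        (\<lambda>p. K (fst p, restrict (snd p) {1..m}))"
      using continuous_map_compose[OF continuous_map_restrict_cube K(1)] by (simp add: o_def)
    show "continuous_map (top_of_set ({0..1} \<times> unit_cube (Suc m))) (top_of_set {0..1}) (\<lambda>p. snd p (Suc m))"
      using unit_cube_coord[of _ "Suc m" "Suc m"] by (auto simp: continuous_on_coord_snd)
  qed
  moreover have "H (r, t) = base (smash A S1)" if "r \<in> {0..1}" "t \<in> cube_boundary (Suc m)" for r t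
    using that(2)
  proof (cases rule: cube_boundary_SucE)
    case 1
    then have "K (r, restrict t {1..m}) = base A"
      using K(4) that by blast
    then show ?thesis
      by (simp add: H_def smash_proj_base)
  qed (simp_all add: H_def smash_proj_base)
  moreover have "H (0, t) = suspend_map m A g t" "H (1, t) = suspend_map m A h t"
    if "t \<in> unit_cube (Suc m)" for t
    using K(2,3)[OF restrict_unit_cube[OF that]] by (simp_all add: H_def suspend_map_def)
  ultimately show ?thesis
    unfolding cube_homotopic_iff by (intro exI[of _ H]) simp
qed

lemma suspend_map_maps: "g \<in> cube_maps m A \<Longrightarrow> suspend_map m A g \<in> cube_maps (Suc m) (smash A S1)"
  using suspend_map_homotopic cube_homotopic_maps cube_homotopic_refl by metis

lemma suspension_class:
  assumes "g \<in> cube_maps m A"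
  shows "suspension m A (cube_class m A g) = cube_class (Suc m) (smash A S1) (suspend_map m A g)"
  unfolding suspension_def
proof (rule the_elem_cube_class[OF assms])
  fix h
  assume "(g, h) \<in> cube_homotopic m A"
  then show "cube_class (Suc m) (smash A S1) (suspend_map m A h) = cube_class (Suc m) (smash A S1) (suspend_map m A g)"
    using cube_class_eq[OF suspend_map_homotopic] by metis
qed

text \<open>The new coordinate comes last and does not interfere with concatenation in an old one.
  This is why suspension is a homomorphism.\<close>

lemma suspend_map_concat:
  assumes "i \<in> {1..m}"
  shows "suspend_map m A (concat_at i g h) = concat_at i (suspend_map m A g) (suspend_map m A h)"
proof
  fix t :: "nat \<Rightarrow> real"
  have "(restrict t {1..m})(i := x) = restrict (t(i := x)) {1..m}" for x
    using assms by (auto simp: fun_eq_iff)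
  then show "suspend_map m A (concat_at i g h) t = concat_at i (suspend_map m A g) (suspend_map m A h) t"
    using assms by (auto simp: suspend_map_def concat_at_def)
qed

lemma suspension_hom:
  assumes A: "base A \<in> points A" and m: "2 \<le> m"
  shows "suspension m A \<in> hom (homotopy_group m A) (homotopy_group (Suc m) (smash A S1))"
proof (rule homI)
  fix x y
  assume "x \<in> carrier (homotopy_group m A)" "y \<in> carrier (homotopy_group m A)"
  then obtain g h where g: "g \<in> cube_maps m A" "x = cube_class m A g"
    and h: "h \<in> cube_maps m A" "y = cube_class m A h"
    by (metis homotopy_groupE)
  have 1: "1 \<in> {1..m}" "1 \<in> {1..Suc m}"
    using m by auto
  show "suspension m A x \<in> carrier (homotopy_group (Suc m) (smash A S1))"
    using g by (simp add: suspension_class cube_class_in_carrier suspend_map_maps)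
  have "suspension m A (x \<otimes>\<^bsub>homotopy_group m A\<^esub> y)
      = cube_class (Suc m) (smash A S1) (concat_at 1 (suspend_map m A g) (suspend_map m A h))"
    unfolding g(2) h(2) mult_cube_class[OF g(1) h(1) 1(1) A] suspension_class[OF concat_at_maps[OF g(1) h(1) 1(1)]]
      suspend_map_concat[OF 1(1)] ..
  also have "\<dots> = suspension m A x \<otimes>\<^bsub>homotopy_group (Suc m) (smash A S1)\<^esub> suspension m A y"
    unfolding g(2) h(2) suspension_class[OF g(1)] suspension_class[OF h(1)]
    by (rule mult_cube_class[OF suspend_map_maps[OF g(1)] suspend_map_maps[OF h(1)] 1(2) base_in_smash_S1[OF A], symmetric])
  finally show "suspension m A (x \<otimes>\<^bsub>homotopy_group m A\<^esub> y)
      = suspension m A x \<otimes>\<^bsub>homotopy_group (Suc m) (smash A S1)\<^esub> suspension m A y" .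
qed

lemma continuous_map_closed_cases:
  assumes S: "closedin X S" and T: "closedin X T" and ST: "topspace X \<subseteq> S \<union> T"
    and f: "continuous_map (subtopology X S) Y f" and g: "continuous_map (subtopology X T) Y g"
    and eq: "\<And>x. x \<in> S \<inter> T \<Longrightarrow> f x = g x"
  shows "continuous_map X Y (\<lambda>x. if x \<in> S then f x else g x)"
proof (rule pasting_lemma_closed[where I = UNIV and T = "\<lambda>b. if b then S else T" and f = "\<lambda>b. if b then f else g"])
  show "\<exists>b. b \<in> UNIV \<and> x \<in> (if b then S else T) \<and> (if x \<in> S then f x else g x) = (if b then f else g) x"
    if "x \<in> topspace X" for x
    using that ST by (cases "x \<in> S") (auto intro: exI[of _ True] exI[of _ False])
qed (use assms in \<open>auto split: if_splits\<close>)

text \<open>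
  A suspended map into a wedge \<open>U \<or> V\<close> is the sum of its two components: the self-map of the suspension
  that stretches the suspension coordinate over \<open>[0,1/2]\<close> on \<open>U\<close> and over \<open>[1/2,1]\<close> on \<open>V\<close> is homotopic
  to the identity, and it turns the suspended map into a concatenation in the suspension coordinate.
\<close>

lemma suspend_wedge_split:
  assumes A: "base A \<in> points A" and m: "2 \<le> m" and g: "g \<in> cube_maps m A"
    and U: "closedin (top_of A) U" and V: "closedin (top_of A) V"
    and UV: "U \<union> V = points A" "U \<inter> V \<subseteq> {base A}"
    and u: "pointed_map A A u" "\<And>x. x \<in> U \<Longrightarrow> u x = x" "\<And>x. x \<in> V \<Longrightarrow> u x = base A"
    and v: "pointed_map A A v" "\<And>x. x \<in> V \<Longrightarrow> v x = x" "\<And>x. x \<in> U \<Longrightarrow> v x = base A"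
  shows "cube_class (Suc m) (smash A S1) (suspend_map m A g) =
    cube_class (Suc m) (smash A S1) (suspend_map m A (u \<circ> g)) \<otimes>\<^bsub>homotopy_group (Suc m) (smash A S1)\<^esub>
    cube_class (Suc m) (smash A S1) (suspend_map m A (v \<circ> g))"
proof -
  let ?T = "top_of_set ({0..1 :: real} \<times> unit_cube (Suc m))"
  define G where "G = (\<lambda>p :: real \<times> (nat \<Rightarrow> real). g (restrict (snd p) {1..m}))"
  define s where "s = (\<lambda>p :: real \<times> (nat \<Rightarrow> real). snd p (Suc m))"
  \<comment> \<open>\<open>wu\<close> and \<open>wv\<close> interpolate from the identity at time 0
    to the stretchings min(1, 2s) and max(0, 2s - 1) at time 1. Both keep the ends 0 and 1 fixed
    throughout, so these faces stay at the base point.\<close>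
  define wu where "wu = (\<lambda>p. (1 - fst p) * s p + fst p * min 1 (2 * s p))"
  define wv where "wv = (\<lambda>p. (1 - fst p) * s p + fst p * max 0 (2 * s p - 1))"
  define H where "H = (\<lambda>p. if p \<in> {p \<in> topspace ?T. G p \<in> U}
    then smash_proj A S1 (G p, frac (wu p)) else smash_proj A S1 (G p, frac (wv p)))"
  have s01: "s p \<in> {0..1}" if "p \<in> topspace ?T" for p
    using that unit_cube_coord[of "snd p" "Suc m" "Suc m"] by (auto simp: s_def)
  have conv: "(1 - r) * x + r * y \<in> {0..1}" if "r \<in> {0..1}" "x \<in> {0..1}" "y \<in> {0..1}" for r x y :: real
    using that convexD_alt[of "{0..1::real}" x y r] by simp
  have s: "continuous_on ({0..1} \<times> unit_cube (Suc m)) s"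
    unfolding s_def by (rule continuous_on_coord_snd)
  have wu: "continuous_map ?T (top_of_set {0..1}) wu"
  proof -
    have "continuous_on ({0..1} \<times> unit_cube (Suc m)) wu"
      unfolding wu_def by (intro continuous_intros s)
    moreover have "wu p \<in> {0..1}" if "p \<in> topspace ?T" for p
      unfolding wu_def using that s01[OF that] by (intro conv) auto
    ultimately show ?thesis
      by auto
  qed
  have wv: "continuous_map ?T (top_of_set {0..1}) wv"
  proof -
    have "continuous_on ({0..1} \<times> unit_cube (Suc m)) wv"
      unfolding wv_def by (intro continuous_intros s)
    moreover have "wv p \<in> {0..1}" if "p \<in> topspace ?T" for p
      unfolding wv_def using that s01[OF that] by (intro conv) auto
    ultimately show ?thesis
      by auto
  qed
  have G: "continuous_map ?T (top_of A) G"
  proof -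
    have "continuous_map (top_of_set ({0..1 :: real} \<times> unit_cube m)) (top_of_set (unit_cube m)) snd"
      by (auto intro!: continuous_intros)
    moreover have "continuous_map (top_of_set (unit_cube m)) (top_of A) g"
      using g by (simp add: cube_maps_iff)
    ultimately have "continuous_map (top_of_set ({0..1 :: real} \<times> unit_cube m)) (top_of A) (g \<circ> snd)"
      by (rule continuous_map_compose)
    then show ?thesis
      using continuous_map_compose[OF continuous_map_restrict_cube] unfolding G_def by (fastforce simp: o_def)
  qed
  have cl: "closedin ?T {p \<in> topspace ?T. G p \<in> W}" if "closedin (top_of A) W" for W
    by (rule closedin_continuous_map_preimage[OF G that])
  have "continuous_map ?T (top_of (smash A S1)) H"
    unfolding H_def
  proof (rule continuous_map_closed_cases[OF cl[OF U] cl[OF V]])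
    show "topspace ?T \<subseteq> {p \<in> topspace ?T. G p \<in> U} \<union> {p \<in> topspace ?T. G p \<in> V}"
      using UV(1) continuous_map_image_subset_topspace[OF G] by blast
    show "continuous_map (subtopology ?T {p \<in> topspace ?T. G p \<in> U}) (top_of (smash A S1))
        (\<lambda>p. smash_proj A S1 (G p, frac (wu p)))"
      by (rule continuous_map_from_subtopology[OF continuous_map_smash_frac[OF G wu]])
    show "continuous_map (subtopology ?T {p \<in> topspace ?T. G p \<in> V}) (top_of (smash A S1))
        (\<lambda>p. smash_proj A S1 (G p, frac (wv p)))"
      by (rule continuous_map_from_subtopology[OF continuous_map_smash_frac[OF G wv]])
    show "smash_proj A S1 (G p, frac (wu p)) = smash_proj A S1 (G p, frac (wv p))"
      if "p \<in> {p \<in> topspace ?T. G p \<in> U} \<inter> {p \<in> topspace ?T. G p \<in> V}" for p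
    proof -
      \<comment> \<open>On the overlap the point is the base point, over which the suspension
        coordinate is collapsed.\<close>
      have "G p = base A"
        using that UV(2) by blast
      then show ?thesis
        by (simp add: smash_proj_base)
    qed
  qed
  moreover have "H (r, t) = base (smash A S1)" if r: "r \<in> {0..1}" and t: "t \<in> cube_boundary (Suc m)" for r t
    using t
  proof (cases rule: cube_boundary_SucE)
    case 1
    then have "G (r, t) = base A"
      using cube_maps_boundary[OF g] by (simp add: G_def)
    then show ?thesis
      by (simp add: H_def smash_proj_base)
  next
    case 2
    then have "wu (r, t) = 0" "wv (r, t) = 0"
      by (simp_all add: wu_def wv_def s_def)
    then show ?thesis
      by (simp add: H_def smash_proj_base)
  next
    case 3
    then have "wu (r, t) = 1" "wv (r, t) = 1"
      by (simp_all add: wu_def wv_def s_def)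
    then show ?thesis
      by (simp add: H_def smash_proj_base)
  qed
  moreover have "H (0, t) = suspend_map m A g t" for t
    by (simp add: H_def suspend_map_def G_def wu_def wv_def s_def)
  moreover have "H (1, t) = concat_at (Suc m) (suspend_map m A (u \<circ> g)) (suspend_map m A (v \<circ> g)) t"
    if t: "t \<in> unit_cube (Suc m)" for t
  proof -
    have r: "restrict (t(Suc m := x)) {1..m} = restrict t {1..m}" for x
      by (auto simp: fun_eq_iff)
    have G1: "G (1, t) = g (restrict t {1..m})"
      by (simp add: G_def)
    have top: "(1, t) \<in> topspace ?T"
      using t by simp
    have w: "wu (1, t) = min 1 (2 * t (Suc m))" "wv (1, t) = max 0 (2 * t (Suc m) - 1)"
      by (simp_all add: wu_def wv_def s_def)
    \<comment> \<open>On \<open>U\<close> the map \<open>u\<close> is the identity and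
      \<open>v\<close> collapses, so the concatenation runs through the suspension line in its first
      half and rests in the second; on \<open>V\<close> it is the other way round.\<close>
    have "g (restrict t {1..m}) \<in> U \<union> V"
      using cube_maps_point[OF g restrict_unit_cube[OF t]] UV(1) by simp
    then consider (U) "g (restrict t {1..m}) \<in> U" | (V) "g (restrict t {1..m}) \<notin> U" "g (restrict t {1..m}) \<in> V"
      by blast
    then show ?thesis
    proof cases
      case U
      then have H1: "H (1, t) = smash_proj A S1 (g (restrict t {1..m}), frac (min 1 (2 * t (Suc m))))"
        using top by (simp add: H_def G1 w)
      show ?thesis
      proof (cases "t (Suc m) \<le> 1/2")
        case True
        then have "min 1 (2 * t (Suc m)) = 2 * t (Suc m)"
          by simp
        then show ?thesis
          using True u(2)[OF U] unfolding H1 by (simp add: concat_at_def suspend_map_def r)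
      next
        case False
        then have "min 1 (2 * t (Suc m)) = 1"
          by simp
        then show ?thesis
          using False v(3)[OF U] unfolding H1 by (simp add: concat_at_def suspend_map_def r smash_proj_base)
      qed
    next
      case V
      then have H1: "H (1, t) = smash_proj A S1 (g (restrict t {1..m}), frac (max 0 (2 * t (Suc m) - 1)))"
        using top by (simp add: H_def G1 w)
      show ?thesis
      proof (cases "t (Suc m) \<le> 1/2")
        case True
        then have "max 0 (2 * t (Suc m) - 1) = 0"
          by simp
        then show ?thesis
          using True u(3)[OF V(2)] unfolding H1 by (simp add: concat_at_def suspend_map_def r smash_proj_base)
      next
        case False
        then have "max 0 (2 * t (Suc m) - 1) = 2 * t (Suc m) - 1"
          by simp
        then show ?thesis
          using False v(2)[OF V(2)] unfolding H1 by (simp add: concat_at_def suspend_map_def r)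
      qed
    qed
  qed
  ultimately have "(suspend_map m A g, concat_at (Suc m) (suspend_map m A (u \<circ> g)) (suspend_map m A (v \<circ> g)))
      \<in> cube_homotopic (Suc m) (smash A S1)"
    unfolding cube_homotopic_iff by (intro exI[of _ H]) simp
  then have "cube_class (Suc m) (smash A S1) (suspend_map m A g)
      = cube_class (Suc m) (smash A S1) (concat_at (Suc m) (suspend_map m A (u \<circ> g)) (suspend_map m A (v \<circ> g)))"
    by (rule cube_class_eq)
  \<comment> \<open>The concatenation is in coordinate \<open>Suc m\<close>, which represents the
    product as well as coordinate 1 does.\<close>
  also have "\<dots> = cube_class (Suc m) (smash A S1) (suspend_map m A (u \<circ> g)) \<otimes>\<^bsub>homotopy_group (Suc m) (smash A S1)\<^esub>
      cube_class (Suc m) (smash A S1) (suspend_map m A (v \<circ> g))"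
    by (rule mult_cube_class[symmetric])
      (simp_all add: suspend_map_maps cube_maps_comp[OF g] u(1) v(1) base_in_smash_S1 A)
  finally show ?thesis .
qed

section \<open>The action of the injection monoid\<close>

text \<open>The pointed and equivariant structure from which homotopy groups and the monoid action
  are built. Both \<open>X\<close> and \<open>F1_smash X\<close> are instances, so the construction
  is carried out once.\<close>

locale equivariant_spectrum =
  fixes X :: "'a spectrum_data"
  assumes base_point: "base (level X n) \<in> points (level X n)"
    and act_pointed: "\<gamma> permutes {1..n} \<Longrightarrow> pointed_map (level X n) (level X n) (sym_act X n \<gamma>)"
    and act_id: "x \<in> points (level X n) \<Longrightarrow> sym_act X n id x = x"
    and act_comp: "\<gamma> permutes {1..n} \<Longrightarrow> \<delta> permutes {1..n} \<Longrightarrow> x \<in> points (level X n) \<Longrightarrow>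
      sym_act X n (\<gamma> \<circ> \<delta>) x = sym_act X n \<gamma> (sym_act X n \<delta> x)"
    and struct_pointed: "pointed_map (smash (level X n) S1) (level X (Suc n)) (struct_map X n)"
    and equivariant: "\<gamma> permutes {1..n} \<Longrightarrow> \<delta> permutes {1..m} \<Longrightarrow> x \<in> points (level X n) \<Longrightarrow>
      t \<in> {1..m} \<rightarrow> points S1 \<Longrightarrow>
      iter_struct_map X n m (sym_act X n \<gamma> x) (t \<circ> inv_into UNIV \<delta>) =
      sym_act X (n + m) (block_perm n \<gamma> \<delta>) (iter_struct_map X n m x t)"

lemma equivariant_spectrum: "symmetric_spectrum X \<Longrightarrow> equivariant_spectrum X"
  unfolding symmetric_spectrum_def
  by (rule equivariant_spectrum.intro) (simp_all add: pointed_CGWH_def)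

abbreviation sdim :: "int \<Rightarrow> nat \<Rightarrow> nat" where
  "sdim k n \<equiv> nat (k + int n)"

definition stab :: "'a spectrum_data \<Rightarrow> nat \<Rightarrow> 'a \<Rightarrow> real \<Rightarrow> 'a" where
  "stab X n x s = struct_map X n (smash_proj (level X n) S1 (x, s))"

text \<open>The effect of \<open>iota\<close> on a representative. Likewise \<open>iter_map\<close>
  describes an iterate of \<open>iota\<close>, with the last \<open>d\<close> cube coordinates
  entering the iterated structure map.\<close>

definition stab_map :: "'a spectrum_data \<Rightarrow> nat \<Rightarrow> nat \<Rightarrow> ((nat \<Rightarrow> real) \<Rightarrow> 'a) \<Rightarrow> (nat \<Rightarrow> real) \<Rightarrow> 'a" where
  "stab_map X n p g t = stab X n (g (restrict t {1..p})) (frac (t (Suc p)))"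

definition iter_map :: "'a spectrum_data \<Rightarrow> nat \<Rightarrow> nat \<Rightarrow> nat \<Rightarrow> ((nat \<Rightarrow> real) \<Rightarrow> 'a) \<Rightarrow> (nat \<Rightarrow> real) \<Rightarrow> 'a" where
  "iter_map X n p d g t = iter_struct_map X n d (g (restrict t {1..p})) (\<lambda>j. frac (t (p + j)))"

lemma stab_map_eq: "struct_map X n \<circ> suspend_map p (level X n) g = stab_map X n p g"
  by (simp add: fun_eq_iff stab_map_def stab_def suspend_map_def)

lemma dim_Suc: "n \<in> stable_range k \<Longrightarrow> sdim k (Suc n) = Suc (sdim k n)"
  by (simp add: stable_range_def)

lemma dim_add: "n \<in> stable_range k \<Longrightarrow> sdim k (n + d) = sdim k n + d"
  by (simp add: stable_range_def)

lemma dim_ge_2: "n \<in> stable_range k \<Longrightarrow> 2 \<le> sdim k n"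
  by (simp add: stable_range_def)

lemma stable_range_Suc: "n \<in> stable_range k \<Longrightarrow> Suc n \<in> stable_range k"
  by (simp add: stable_range_def)

lemma stable_range_shift: "Suc n \<in> stable_range k \<longleftrightarrow> n \<in> stable_range (k + 1)"
  by (simp add: stable_range_def)

text \<open>Level \<open>n\<close> of \<open>X\<close> in degree \<open>k + 1\<close> and level
  \<open>1 + n\<close> of the smash product in degree \<open>k\<close> use cubes of the same
  dimension. This is the source of the degree shift in the theorem.\<close>

lemma dim_shift: "sdim k (Suc n) = sdim (k + 1) n"
  by (simp add: add.assoc add.commute)

lemma pointed_map_id: "pointed_map A A id"
  by (simp add: pointed_map_def)

lemma pointed_map_comp: "pointed_map A B f \<Longrightarrow> pointed_map B C g \<Longrightarrow> pointed_map A C (g \<circ> f)"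
  by (auto simp: pointed_map_def intro: continuous_map_compose)

lemma pointed_map_point: "pointed_map A B f \<Longrightarrow> x \<in> points A \<Longrightarrow> f x \<in> points B"
  using continuous_map_image_subset_topspace by (fastforce simp: pointed_map_def)

lemma homotopy_map_closed:
  "pointed_map A B f \<Longrightarrow> c \<in> carrier (homotopy_group m A) \<Longrightarrow> homotopy_map m B f c \<in> carrier (homotopy_group m B)"
  by (auto elim!: homotopy_groupE simp: homotopy_map_class cube_class_in_carrier cube_maps_comp)

lemma homotopy_map_comp:
  assumes "pointed_map A B f" "pointed_map B C g" "c \<in> carrier (homotopy_group m A)"
  shows "homotopy_map m C (g \<circ> f) c = homotopy_map m C g (homotopy_map m B f c)"
  using assms(3)
  by (rule homotopy_groupE)
    (simp add: homotopy_map_class[OF _ assms(1)] homotopy_map_class[OF _ assms(2)] cube_maps_comp[OF _ assms(1)]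
      homotopy_map_class[OF _ pointed_map_comp[OF assms(1,2)]] comp_assoc)

lemma homotopy_map_cong:
  assumes "pointed_map A B f" "pointed_map A B g" "\<And>x. x \<in> points A \<Longrightarrow> f x = g x"
    and c: "c \<in> carrier (homotopy_group m A)"
  shows "homotopy_map m B f c = homotopy_map m B g c"
proof -
  obtain u where u: "u \<in> cube_maps m A" "c = cube_class m A u"
    using c by (rule homotopy_groupE)
  have "(f \<circ> u, g \<circ> u) \<in> cube_homotopic m B"
    by (rule cube_homotopic_eq[OF cube_maps_comp[OF u(1) assms(1)]]) (simp add: assms(3) cube_maps_point[OF u(1)])
  then show ?thesis
    using u assms(1,2) by (simp add: homotopy_map_class cube_class_eq)
qed

lemma homotopy_map_id:
  assumes "c \<in> carrier (homotopy_group m A)"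
  shows "homotopy_map m A id c = c"
  using assms by (rule homotopy_groupE) (simp add: homotopy_map_class[OF _ pointed_map_id])

section \<open>Block permutations and extensions of injections to permutations\<close>

lemma iter_struct_map_cong:
  "(\<And>j. j \<in> {1..m} \<Longrightarrow> t j = t' j) \<Longrightarrow> iter_struct_map X n m x t = iter_struct_map X n m x t'"
  by (induction m) auto

lemma permutes_permutation: "\<gamma> permutes {1..m :: nat} \<Longrightarrow> permutation \<gamma>"
  by (rule permutes_imp_permutation) simp_all

lemma block_perm_id_right:
  assumes "\<gamma> permutes {1..n}"
  shows "block_perm n \<gamma> id = \<gamma>"
  using permutes_not_in[OF assms] by (auto simp: block_perm_def fun_eq_iff)

text \<open>Each transposition in a decomposition of \<open>\<delta>\<close> becomes the
  transposition shifted by \<open>n\<close>.\<close>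

lemma block_perm_id_permutes_sign:
  assumes "\<delta> permutes {1..d}"
  shows "block_perm n id \<delta> permutes {1..n + d} \<and> sign (block_perm n id \<delta>) = sign \<delta>"
  using assms finite_atLeastAtMost
proof (induction rule: permutes_induct)
  case id
  have "block_perm n id id = id"
    by (auto simp: block_perm_def fun_eq_iff)
  then show ?case
    by (simp only: permutes_id)
next
  case (swap a b p)
  have p0: "p 0 = 0"
    using permutes_not_in[OF swap(4), of 0] by simp
  have pos: "p j \<noteq> 0" if "j \<noteq> 0" for j
    using that p0 permutes_inj[OF swap(4)] by (metis injD)
  have eq: "block_perm n id (Transposition.transpose a b \<circ> p)
      = Transposition.transpose (n + a) (n + b) \<circ> block_perm n id p"
  proof
    fix i
    show "block_perm n id (Transposition.transpose a b \<circ> p) i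
        = (Transposition.transpose (n + a) (n + b) \<circ> block_perm n id p) i"
      using swap(1-3) by (auto simp: block_perm_def Transposition.transpose_def)
  qed
  have ab: "n + a \<in> {1..n + d}" "n + b \<in> {1..n + d}" "n + a \<noteq> n + b"
    using swap(1-3) by auto
  have perm: "permutation p" "permutation (block_perm n id p)"
    by (rule permutes_permutation[OF swap(4)], rule permutes_permutation[OF conjunct1[OF swap(5)]])
  have T: "Transposition.transpose (n + a) (n + b) permutes {1..n + d}"
    by (rule permutes_swap_id[OF ab(1,2)])
  have "block_perm n id (Transposition.transpose a b \<circ> p) permutes {1..n + d}"
    unfolding eq using permutes_compose[OF _ T] swap(5) by blast
  moreover have "sign (block_perm n id (Transposition.transpose a b \<circ> p)) = sign (Transposition.transpose a b \<circ> p)"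
    unfolding eq sign_compose[OF permutation_swap_id perm(1)] sign_compose[OF permutation_swap_id perm(2)]
      sign_swap_id using swap(5) ab(3) swap(3) by (simp only: if_False)
  ultimately show ?case ..
qed

lemma permutes_fixing_initial:
  assumes \<beta>: "\<beta> permutes {1..n + d}" and fixed: "\<And>i. i \<in> {1..n} \<Longrightarrow> \<beta> i = i"
  obtains \<delta> where "\<delta> permutes {1..d}" "\<beta> = block_perm n id \<delta>"
proof -
  define \<delta> where "\<delta> = (\<lambda>j. if j = 0 then 0 else \<beta> (n + j) - n)"
  \<comment> \<open>A value at most \<open>n\<close> is itself fixed by \<open>\<beta>\<close>, so
    injectivity would make it equal to its argument \<open>n + j\<close>.\<close>
  have big: "n < \<beta> (n + j)" if "j \<noteq> 0" for j
  proof (rule ccontr)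
    assume "\<not> n < \<beta> (n + j)"
    then have "\<beta> (\<beta> (n + j)) = \<beta> (n + j)"
      using fixed permutes_not_in[OF \<beta>, of 0] by (cases "\<beta> (n + j) = 0") auto
    then have "\<beta> (n + j) = n + j"
      using permutes_inj[OF \<beta>] by (metis injD)
    then show False
      using \<open>\<not> n < \<beta> (n + j)\<close> that by simp
  qed
  have block: "\<beta> = block_perm n id \<delta>"
  proof
    fix i
    show "\<beta> i = block_perm n id \<delta> i"
    proof (cases "i \<le> n")
      case True
      then show ?thesis
        using fixed[of i] permutes_not_in[OF \<beta>, of 0] by (cases "i = 0") (auto simp: block_perm_def)
    next
      case False
      then show ?thesis
        using big[of "i - n"] by (auto simp: block_perm_def \<delta>_def)
    qed
  qed
  have fixd: "\<delta> j = j" if "j \<notin> {1..d}" for j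
    using that permutes_not_in[OF \<beta>, of "n + j"] by (auto simp: \<delta>_def)
  have inj: "inj \<delta>"
  proof (rule injI)
    fix a b
    assume "\<delta> a = \<delta> b"
    then have "n + \<delta> a = n + \<delta> b"
      by simp
    moreover have "n + \<delta> c = \<beta> (n + c)" for c
      using big[of c] fixed[of n] permutes_not_in[OF \<beta>, of 0] by (cases "c = 0"; cases "n = 0") (auto simp: \<delta>_def)
    ultimately show "a = b"
      using permutes_inj[OF \<beta>] by (metis add_left_cancel injD)
  qed
  have "\<delta> ` {1..d} \<subseteq> {1..d}"
    using fixd inj by (metis image_subsetI injD)
  then have "bij_betw \<delta> {1..d} {1..d}"
    using inj by (metis bij_betw_def endo_inj_surj finite_atLeastAtMost inj_on_subset subset_UNIV)
  then show thesis
    using that[OF bij_imp_permutes block] fixd by blast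
qed

text \<open>The complements of {1..n} and of its image in {1..m} have the same size, so a bijection
  between them completes \<open>f\<close>. This provides the permutations on which the action is
  evaluated, for every bound \<open>m\<close> on the values.\<close>

lemma extend_injection:
  assumes f: "f \<in> carrier inj_monoid" and m: "\<And>i. i \<in> {1..n} \<Longrightarrow> f i \<le> m"
  obtains \<gamma> where "\<gamma> permutes {1..m}" "\<And>i. i \<in> {1..n} \<Longrightarrow> \<gamma> i = f i" "n \<le> m"
proof -
  have im: "f ` {1..n} \<subseteq> {1..m}"
    using m inj_monoid_pos[OF f] by auto
  have inj: "inj_on f {1..n}"
    using f by (auto simp: carrier_inj_monoid intro: inj_on_subset)
  have nm: "n \<le> m"
    using card_inj_on_le[OF inj im] by simp
  have "card ({1..m} - {1..n}) = m - n"
    using card_Diff_subset[of "{1..n}" "{1..m}"] nm by simp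
  moreover have "card ({1..m} - f ` {1..n}) = m - n"
    using card_Diff_subset[OF _ im] card_image[OF inj] by simp
  ultimately have "\<exists>h. bij_betw h ({1..m} - {1..n}) ({1..m} - f ` {1..n})"
    by (intro finite_same_card_bij) simp_all
  then obtain h where h: "bij_betw h ({1..m} - {1..n}) ({1..m} - f ` {1..n})" ..
  define \<gamma> where "\<gamma> = (\<lambda>i. if i \<in> {1..n} then f i else if i \<in> {1..m} then h i else i)"
  have "bij_betw f {1..n} (f ` {1..n})"
    using inj by (rule inj_on_imp_bij_betw)
  then have "bij_betw \<gamma> {1..n} (f ` {1..n})"
    by (rule bij_betw_cong[THEN iffD1, rotated]) (simp add: \<gamma>_def)
  moreover have "bij_betw \<gamma> ({1..m} - {1..n}) ({1..m} - f ` {1..n})"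
    using h by (rule bij_betw_cong[THEN iffD1, rotated]) (simp add: \<gamma>_def)
  ultimately have "bij_betw \<gamma> ({1..n} \<union> ({1..m} - {1..n})) (f ` {1..n} \<union> ({1..m} - f ` {1..n}))"
    by (rule bij_betw_combine) auto
  moreover have "{1..n} \<union> ({1..m} - {1..n}) = {1..m}" "f ` {1..n} \<union> ({1..m} - f ` {1..n}) = {1..m}"
    using nm im by auto
  ultimately have "\<gamma> permutes {1..m}"
    using nm by (intro bij_imp_permutes) (auto simp: \<gamma>_def)
  then show thesis
    using that nm by (simp add: \<gamma>_def)
qed

lemma max_value_ge: "i \<in> {1..n} \<Longrightarrow> f i \<le> max_value f n"
  by (auto simp: max_value_def)

lemma extend_injection_max:
  assumes f: "f \<in> carrier inj_monoid"
  obtains \<gamma> where "\<gamma> permutes {1..max_value f n}" "\<And>i. i \<in> {1..n} \<Longrightarrow> \<gamma> i = f i" "n \<le> max_value f n"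
proof (rule extend_injection[of f n "max_value f n"])
  show "f i \<le> max_value f n" if "i \<in> {1..n}" for i
    using that by (rule max_value_ge)
qed (use f that in blast)+

section \<open>Stabilization on representatives\<close>

context equivariant_spectrum
begin

lemma stab_map_maps:
  assumes "g \<in> cube_maps p (level X n)"
  shows "stab_map X n p g \<in> cube_maps (Suc p) (level X (Suc n))"
  using cube_maps_comp[OF suspend_map_maps[OF assms] struct_pointed] by (simp add: stab_map_eq)

lemma comm_group_level_group: "n \<in> stable_range k \<Longrightarrow> comm_group (level_group X k n)"
  unfolding level_group_def by (rule comm_group_homotopy_group[OF base_point dim_ge_2])

lemma iota_class:
  assumes "n \<in> stable_range k" "g \<in> cube_maps (sdim k n) (level X n)"
  shows "iota X k n (cube_class (sdim k n) (level X n) g)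
    = cube_class (Suc (sdim k n)) (level X (Suc n)) (stab_map X n (sdim k n) g)"
  unfolding iota_def suspension_class[OF assms(2)] dim_Suc[OF assms(1)]
    homotopy_map_class[OF suspend_map_maps[OF assms(2)] struct_pointed] stab_map_eq ..

lemma iota_hom:
  assumes n: "n \<in> stable_range k"
  shows "iota X k n \<in> hom (level_group X k n) (level_group X k (Suc n))"
proof -
  have "homotopy_map (Suc (sdim k n)) (level X (Suc n)) (struct_map X n) \<circ> suspension (sdim k n) (level X n)
      \<in> hom (homotopy_group (sdim k n) (level X n)) (homotopy_group (Suc (sdim k n)) (level X (Suc n)))"
    using dim_ge_2[OF n]
    by (intro hom_compose[OF suspension_hom homotopy_map_hom] base_point struct_pointed base_in_smash_S1) auto
  moreover have "iota X k n = homotopy_map (Suc (sdim k n)) (level X (Suc n)) (struct_map X n) \<circ> suspension (sdim k n) (level X n)"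
    by (simp only: fun_eq_iff iota_def dim_Suc[OF n] o_apply) simp
  ultimately show ?thesis
    unfolding level_group_def dim_Suc[OF n] by simp
qed

sublocale sc: seq_colim "stable_range k" "level_group X k" "iota X k" for k
proof (rule seq_colim.intro)
  show "stable_range k \<noteq> {}"
    by (auto simp: stable_range_def intro!: exI[of _ "nat (2 - k)"])
qed (auto intro: stable_range_Suc comm_group_level_group iota_hom)

lemma stable_class_eq: "stable_class X k (n, x) = sc.cls k n x"
  by (simp add: stable_class_def)

lemma carrier_level_group: "c \<in> carrier (level_group X k n) \<longleftrightarrow> c \<in> carrier (homotopy_group (sdim k n) (level X n))"
  by (simp add: level_group_def)

lemma iter_map_class:
  assumes n: "n \<in> stable_range k" and g: "g \<in> cube_maps (sdim k n) (level X n)"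
  shows "iter_map X n (sdim k n) d g \<in> cube_maps (sdim k n + d) (level X (n + d)) \<and>
    seq_iter (iota X k) n d (cube_class (sdim k n) (level X n) g)
      = cube_class (sdim k n + d) (level X (n + d)) (iter_map X n (sdim k n) d g)"
proof (induction d)
  case 0
  have "(g, iter_map X n (sdim k n) 0 g) \<in> cube_homotopic (sdim k n) (level X n)"
    by (rule cube_homotopic_eq[OF g]) (simp add: unit_cube_def iter_map_def)
  then show ?case
    using cube_homotopic_maps cube_class_eq by (simp only: seq_iter.simps add_0_right) blast
next
  case (Suc d)
  let ?p = "sdim k n"
  have nd: "n + d \<in> stable_range k"
    by (rule sc.index_le[OF n]) simp
  \<comment> \<open>Stabilizing an iterate appends one circle coordinate. The inner restriction has
    no effect, because the iterate reads only the coordinates up to \<open>?p + d\<close>.\<close>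
  have eq: "stab_map X (n + d) (?p + d) (iter_map X n ?p d g) = iter_map X n ?p (Suc d) g"
  proof
    fix t :: "nat \<Rightarrow> real"
    have r: "restrict (restrict t {1..?p + d}) {1..?p} = restrict t {1..?p}"
      by (auto simp: fun_eq_iff)
    have "iter_struct_map X n d (g (restrict t {1..?p})) (\<lambda>j. frac (restrict t {1..?p + d} (?p + j)))
        = iter_struct_map X n d (g (restrict t {1..?p})) (\<lambda>j. frac (t (?p + j)))"
      by (rule iter_struct_map_cong) auto
    then show "stab_map X (n + d) (?p + d) (iter_map X n ?p d g) t = iter_map X n ?p (Suc d) g t"
      unfolding stab_map_def stab_def iter_map_def r by simp
  qed
  have G: "iter_map X n ?p d g \<in> cube_maps (sdim k (n + d)) (level X (n + d))"
    unfolding dim_add[OF n] using Suc by blast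
  have "seq_iter (iota X k) n (Suc d) (cube_class ?p (level X n) g)
      = iota X k (n + d) (cube_class (sdim k (n + d)) (level X (n + d)) (iter_map X n ?p d g))"
    unfolding dim_add[OF n] seq_iter.simps using Suc by (simp only:)
  also have "\<dots> = cube_class (Suc (?p + d)) (level X (Suc (n + d))) (iter_map X n ?p (Suc d) g)"
    unfolding iota_class[OF nd G] unfolding dim_add[OF n] eq ..
  finally show ?case
    using stab_map_maps[of "iter_map X n ?p d g" "?p + d" "n + d"] Suc unfolding eq by simp
qed

text \<open>
  Permuting the suspension coordinates of an iterated stabilization permutes coordinates of the cube.
\<close>

lemma block_perm_seq_iter:
  assumes n: "n \<in> stable_range k" and x: "x \<in> carrier (level_group X k n)" and \<delta>: "\<delta> permutes {1..d}"
  shows "homotopy_map (sdim k (n + d)) (level X (n + d)) (sym_act X (n + d) (block_perm n id \<delta>)) (seq_iter (iota X k) n d x)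
    = seq_iter (iota X k) n d x [^]\<^bsub>level_group X k (n + d)\<^esub> sign \<delta>"
proof -
  obtain g where g: "g \<in> cube_maps (sdim k n) (level X n)" "x = cube_class (sdim k n) (level X n) g"
    using x unfolding carrier_level_group by (rule homotopy_groupE)
  define p where "p = sdim k n"
  define G where "G = iter_map X n p d g"
  have G: "G \<in> cube_maps (p + d) (level X (n + d))"
    "seq_iter (iota X k) n d x = cube_class (p + d) (level X (n + d)) G"
    using iter_map_class[OF n g(1), of d] unfolding g(2) G_def p_def by simp_all
  \<comment> \<open>\<open>\<delta>\<close> permutes the circle factors by precomposition with its
    inverse, hence the inverse here; the sign is the same.\<close>
  define \<epsilon> where "\<epsilon> = inv_into UNIV \<delta>"
  have \<epsilon>: "\<epsilon> permutes {1..d}"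
    unfolding \<epsilon>_def by (rule permutes_inv[OF \<delta>])
  have sign: "sign \<epsilon> = sign \<delta>"
    unfolding \<epsilon>_def by (rule sign_inverse[OF permutes_permutation[OF \<delta>]])
  define \<pi> where "\<pi> = block_perm p id \<epsilon>"
  have \<pi>: "\<pi> permutes {1..p + d}" "sign \<pi> = sign \<delta>"
    using block_perm_id_permutes_sign[OF \<epsilon>, of p] sign by (simp_all add: \<pi>_def)
  have bp: "block_perm n id \<delta> permutes {1..n + d}"
    using block_perm_id_permutes_sign[OF \<delta>] by blast
  have "sym_act X (n + d) (block_perm n id \<delta>) (G t) = G (t \<circ> \<pi>)" if t: "t \<in> unit_cube (p + d)" for t
  proof -
    have "restrict t {1..p} \<in> unit_cube p"
      using t by (auto simp: unit_cube_def PiE_iff)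
    then have gt: "g (restrict t {1..p}) \<in> points (level X n)"
      using cube_maps_point[OF g(1)] by (simp add: p_def)
    have r: "restrict (t \<circ> \<pi>) {1..p} = restrict t {1..p}"
      by (auto simp: fun_eq_iff \<pi>_def block_perm_def)
    have "sym_act X (n + d) (block_perm n id \<delta>) (G t)
        = iter_struct_map X n d (sym_act X n id (g (restrict t {1..p}))) ((\<lambda>j. frac (t (p + j))) \<circ> \<epsilon>)"
      unfolding G_def iter_map_def \<epsilon>_def
      by (rule equivariant[OF permutes_id \<delta> gt, symmetric]) (auto simp only: Pi_iff frac_points_S1)
    also have "\<dots> = iter_struct_map X n d (g (restrict t {1..p})) (\<lambda>j. frac ((t \<circ> \<pi>) (p + j)))"
      unfolding act_id[OF gt] by (rule iter_struct_map_cong) (auto simp: \<pi>_def block_perm_def)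
    also have "\<dots> = G (t \<circ> \<pi>)"
      unfolding G_def iter_map_def r ..
    finally show ?thesis .
  qed
  then have "(sym_act X (n + d) (block_perm n id \<delta>) \<circ> G, \<lambda>t. G (t \<circ> \<pi>)) \<in> cube_homotopic (p + d) (level X (n + d))"
    by (intro cube_homotopic_eq cube_maps_comp[OF G(1) act_pointed[OF bp]]) simp
  then have "cube_class (p + d) (level X (n + d)) (sym_act X (n + d) (block_perm n id \<delta>) \<circ> G)
      = cube_class (p + d) (level X (n + d)) G [^]\<^bsub>homotopy_group (p + d) (level X (n + d))\<^esub> sign \<delta>"
    using cube_class_permute[OF \<pi>(1) G(1) base_point] dim_ge_2[OF n] \<pi>(2) by (simp add: cube_class_eq p_def)
  then show ?thesis
    unfolding G(2) level_group_def dim_add[OF n] p_def[symmetric]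
      homotopy_map_class[OF G(1) act_pointed[OF bp]] .
qed

end

text \<open>The levels and degrees on the two sides are tied only by the dimension of the cube.
  Besides morphisms and permutations, this covers the inclusions of a copy into the wedge and the
  projections back, which change level and degree by one.\<close>

lemma iota_natural:
  assumes X: "equivariant_spectrum X" and Y: "equivariant_spectrum Y"
    and n: "n \<in> stable_range k" and n': "n' \<in> stable_range k'" and dims: "sdim k n = sdim k' n'"
    and f: "pointed_map (level X n) (level Y n') f" and f': "pointed_map (level X (Suc n)) (level Y (Suc n')) f'"
    and comm: "\<And>x s. x \<in> points (level X n) \<Longrightarrow> s \<in> points S1 \<Longrightarrow> f' (stab X n x s) = stab Y n' (f x) s"
    and c: "c \<in> carrier (level_group X k n)"
  shows "homotopy_map (sdim k (Suc n)) (level Y (Suc n')) f' (iota X k n c)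
    = iota Y k' n' (homotopy_map (sdim k n) (level Y n') f c)"
proof -
  interpret X: equivariant_spectrum X by fact
  interpret Y: equivariant_spectrum Y by fact
  obtain g where g: "g \<in> cube_maps (sdim k n) (level X n)" "c = cube_class (sdim k n) (level X n) g"
    using c unfolding X.carrier_level_group by (rule homotopy_groupE)
  have fg: "f \<circ> g \<in> cube_maps (sdim k' n') (level Y n')"
    using cube_maps_comp[OF g(1) f] dims by simp
  have "(f' \<circ> stab_map X n (sdim k n) g, stab_map Y n' (sdim k n) (f \<circ> g)) \<in> cube_homotopic (Suc (sdim k n)) (level Y (Suc n'))"
  proof (rule cube_homotopic_eq[OF cube_maps_comp[OF X.stab_map_maps[OF g(1)] f']])
    fix t
    assume "t \<in> unit_cube (Suc (sdim k n))"
    then have "g (restrict t {1..sdim k n}) \<in> points (level X n)"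
      using cube_maps_point[OF g(1) restrict_unit_cube] by blast
    then show "(f' \<circ> stab_map X n (sdim k n) g) t = stab_map Y n' (sdim k n) (f \<circ> g) t"
      unfolding stab_map_def o_apply by (rule comm[OF _ frac_points_S1])
  qed
  from cube_class_eq[OF this] show ?thesis
    unfolding g(2) X.iota_class[OF n g(1)] dim_Suc[OF n] homotopy_map_class[OF X.stab_map_maps[OF g(1)] f']
      homotopy_map_class[OF g(1) f] unfolding dims Y.iota_class[OF n' fg] .
qed

text \<open>The action formula at a freely chosen level \<open>m\<close> and permutation
  \<open>\<gamma>\<close>, whereas \<open>inj_action\<close> insists on the maximal value of the
  injection as level.\<close>

definition act_val ::
  "'a spectrum_data \<Rightarrow> int \<Rightarrow> nat \<Rightarrow> ((nat \<Rightarrow> real) \<Rightarrow> 'a) set \<Rightarrow> nat \<Rightarrow> (nat \<Rightarrow> nat)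
     \<Rightarrow> (nat \<times> ((nat \<Rightarrow> real) \<Rightarrow> 'a) set) set" where
  "act_val X k n x m \<gamma> = stable_class X k
     (m, homotopy_map (sdim k m) (level X m) (sym_act X m \<gamma>) (seq_iter (iota X k) n (m - n) x)
       [^]\<^bsub>level_group X k m\<^esub> sign \<gamma>)"

lemma sign_squared: "sign p * (sign q * sign p) = sign q"
  by (simp add: sign_def)

context equivariant_spectrum
begin

text \<open>The equivariance axiom for one suspension coordinate, with the identity on that
  coordinate.\<close>

lemma act_stab:
  assumes \<gamma>: "\<gamma> permutes {1..n}" and x: "x \<in> points (level X n)" and s: "s \<in> points S1"
  shows "sym_act X (Suc n) \<gamma> (stab X n x s) = stab X n (sym_act X n \<gamma> x) s"
proof -
  have "iter_struct_map X n 1 (sym_act X n \<gamma> x) ((\<lambda>_. s) \<circ> inv_into UNIV id)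
      = sym_act X (n + 1) (block_perm n \<gamma> id) (iter_struct_map X n 1 x (\<lambda>_. s))"
    by (rule equivariant[OF \<gamma> permutes_id x]) (simp add: s)
  then show ?thesis
    by (simp add: block_perm_id_right[OF \<gamma>] stab_def One_nat_def)
qed

lemma group_level_group: "n \<in> stable_range k \<Longrightarrow> group (level_group X k n)"
  by (rule sc.group_level)

lemma act_hom:
  assumes n: "n \<in> stable_range k" and \<gamma>: "\<gamma> permutes {1..n}"
  shows "homotopy_map (sdim k n) (level X n) (sym_act X n \<gamma>) \<in> hom (level_group X k n) (level_group X k n)"
  unfolding level_group_def
  by (rule homotopy_map_hom[OF act_pointed[OF \<gamma>] base_point base_point dim_ge_2[OF n]])

lemma act_iota:
  assumes n: "n \<in> stable_range k" and \<gamma>: "\<gamma> permutes {1..n}" and c: "c \<in> carrier (level_group X k n)"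
  shows "homotopy_map (sdim k (Suc n)) (level X (Suc n)) (sym_act X (Suc n) \<gamma>) (iota X k n c)
    = iota X k n (homotopy_map (sdim k n) (level X n) (sym_act X n \<gamma>) c)"
proof (rule iota_natural[OF equivariant_spectrum_axioms equivariant_spectrum_axioms n n refl])
  show "pointed_map (level X (Suc n)) (level X (Suc n)) (sym_act X (Suc n) \<gamma>)"
    using \<gamma> by (intro act_pointed permutes_subset[OF \<gamma>]) auto
qed (use \<gamma> c in \<open>simp_all add: act_pointed act_stab\<close>)

text \<open>Stabilization commutes with \<open>\<gamma>\<close>, and a permutation keeps its sign
  when regarded on one more letter.\<close>

lemma act_val_Suc:
  assumes n: "n \<in> stable_range k" and x: "x \<in> carrier (level_group X k n)" and m: "n \<le> m"
    and \<gamma>: "\<gamma> permutes {1..m}"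
  shows "act_val X k n x (Suc m) \<gamma> = act_val X k n x m \<gamma>"
proof -
  have mI: "m \<in> stable_range k"
    by (rule sc.index_le[OF n m])
  define y where "y = seq_iter (iota X k) n (m - n) x"
  define z where "z = homotopy_map (sdim k m) (level X m) (sym_act X m \<gamma>) y"
  have y: "y \<in> carrier (level_group X k m)"
    unfolding y_def by (rule sc.seq_iter_closed[OF n m x])
  have z: "z \<in> carrier (level_group X k m)"
    unfolding z_def by (rule hom_in_carrier[OF act_hom[OF mI \<gamma>] y])
  have y': "seq_iter (iota X k) n (Suc m - n) x = iota X k m y"
    using m by (simp add: y_def Suc_diff_le)
  have "iota X k m (z [^]\<^bsub>level_group X k m\<^esub> sign \<gamma>) = iota X k m z [^]\<^bsub>level_group X k (Suc m)\<^esub> sign \<gamma>"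
    by (rule hom_int_pow[OF iota_hom[OF mI] z group_level_group[OF mI] group_level_group[OF stable_range_Suc[OF mI]]])
  then have "act_val X k n x (Suc m) \<gamma> = sc.cls k (Suc m) (iota X k m (z [^]\<^bsub>level_group X k m\<^esub> sign \<gamma>))"
    unfolding act_val_def y' act_iota[OF mI \<gamma> y] z_def stable_class_eq by (simp only:)
  also have "\<dots> = act_val X k n x m \<gamma>"
    unfolding act_val_def stable_class_eq y_def[symmetric] z_def[symmetric]
    by (rule sc.cls_step[OF mI group.int_pow_closed[OF group_level_group[OF mI] z]])
  finally show ?thesis .
qed

lemma act_val_le:
  assumes n: "n \<in> stable_range k" and x: "x \<in> carrier (level_group X k n)" and m: "n \<le> m"
    and \<gamma>: "\<gamma> permutes {1..m}" and "m \<le> m'"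
  shows "act_val X k n x m' \<gamma> = act_val X k n x m \<gamma>"
  using \<open>m \<le> m'\<close>
proof (induction rule: dec_induct)
  case (step l)
  have "\<gamma> permutes {1..l}"
    using step by (intro permutes_subset[OF \<gamma>]) auto
  then show ?case
    using act_val_Suc[OF n x, of l \<gamma>] step m by simp
qed simp

text \<open>Two extensions of one injection differ by a permutation that fixes 1, ..., n and hence
  moves only suspension coordinates. It acts on the stabilized class by its sign, and the factor
  \<open>sign\<close> in the action formula is there to compensate for this.\<close>

lemma act_val_same_level:
  assumes n: "n \<in> stable_range k" and x: "x \<in> carrier (level_group X k n)" and m: "n \<le> m"
    and \<gamma>: "\<gamma> permutes {1..m}" and \<gamma>': "\<gamma>' permutes {1..m}" and agree: "\<And>i. i \<in> {1..n} \<Longrightarrow> \<gamma> i = \<gamma>' i"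
  shows "act_val X k n x m \<gamma> = act_val X k n x m \<gamma>'"
proof -
  have mI: "m \<in> stable_range k"
    by (rule sc.index_le[OF n m])
  interpret L: group "level_group X k m"
    by (rule group_level_group[OF mI])
  obtain d where d: "m = n + d"
    using m le_Suc_ex by blast
  define \<beta> where "\<beta> = inv_into UNIV \<gamma> \<circ> \<gamma>'"
  have \<beta>: "\<beta> permutes {1..n + d}"
    using permutes_compose[OF \<gamma>' permutes_inv[OF \<gamma>]] by (simp add: \<beta>_def d)
  have "\<beta> i = i" if "i \<in> {1..n}" for i
    using agree[OF that] permutes_inverses(2)[OF \<gamma>, of i] by (simp add: \<beta>_def)
  then obtain \<delta> where \<delta>: "\<delta> permutes {1..d}" "\<beta> = block_perm n id \<delta>"
    by (rule permutes_fixing_initial[OF \<beta>])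
  have \<beta>m: "\<beta> permutes {1..m}"
    using \<beta> d by simp
  have sign\<beta>: "sign \<beta> = sign \<delta>"
    using block_perm_id_permutes_sign[OF \<delta>(1), of n] \<delta>(2) by simp
  have \<gamma>'_eq: "\<gamma>' = \<gamma> \<circ> \<beta>"
    using permutes_inverses(1)[OF \<gamma>] by (simp add: \<beta>_def fun_eq_iff)
  define y where "y = seq_iter (iota X k) n (m - n) x"
  have y: "y \<in> carrier (level_group X k m)"
    unfolding y_def by (rule sc.seq_iter_closed[OF n m x])
  let ?h = "\<lambda>\<gamma>. homotopy_map (sdim k m) (level X m) (sym_act X m \<gamma>)"
  have "?h \<beta> y = y [^]\<^bsub>level_group X k m\<^esub> sign \<delta>"
    using block_perm_seq_iter[OF n x \<delta>(1)] by (simp add: y_def d \<delta>(2))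
  moreover have "?h \<gamma>' y = ?h \<gamma> (?h \<beta> y)"
  proof -
    have yc: "y \<in> carrier (homotopy_group (sdim k m) (level X m))"
      using y by (simp add: carrier_level_group)
    have "?h \<gamma>' y = homotopy_map (sdim k m) (level X m) (sym_act X m \<gamma> \<circ> sym_act X m \<beta>) y"
      by (rule homotopy_map_cong[OF act_pointed[OF \<gamma>'] pointed_map_comp[OF act_pointed[OF \<beta>m] act_pointed[OF \<gamma>]] _ yc])
        (simp add: \<gamma>'_eq act_comp[OF \<gamma> \<beta>m])
    then show ?thesis
      using homotopy_map_comp[OF act_pointed[OF \<beta>m] act_pointed[OF \<gamma>] yc] by simp
  qed
  ultimately have "?h \<gamma>' y = ?h \<gamma> y [^]\<^bsub>level_group X k m\<^esub> sign \<delta>"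
    using hom_int_pow[OF act_hom[OF mI \<gamma>] y L.is_group L.is_group] by simp
  moreover have "?h \<gamma> y \<in> carrier (level_group X k m)"
    by (rule hom_in_carrier[OF act_hom[OF mI \<gamma>] y])
  moreover have "sign \<gamma>' = sign \<gamma> * sign \<delta>"
    unfolding \<gamma>'_eq sign_compose[OF permutes_permutation[OF \<gamma>] permutes_permutation[OF \<beta>m]] sign\<beta> ..
  \<comment> \<open>The sign of \<open>\<delta>\<close> appears twice and cancels.\<close>
  ultimately have "?h \<gamma>' y [^]\<^bsub>level_group X k m\<^esub> sign \<gamma>' = ?h \<gamma> y [^]\<^bsub>level_group X k m\<^esub> sign \<gamma>"
    by (simp only: L.int_pow_pow sign_squared)
  then show ?thesis
    unfolding act_val_def y_def by (simp only:)
qed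

lemma act_val_eq:
  assumes n: "n \<in> stable_range k" and x: "x \<in> carrier (level_group X k n)"
    and m: "n \<le> m" "\<gamma> permutes {1..m}" and m': "n \<le> m'" "\<gamma>' permutes {1..m'}"
    and agree: "\<And>i. i \<in> {1..n} \<Longrightarrow> \<gamma> i = \<gamma>' i"
  shows "act_val X k n x m \<gamma> = act_val X k n x m' \<gamma>'"
proof -
  let ?M = "max m m'"
  have p: "\<gamma> permutes {1..?M}" "\<gamma>' permutes {1..?M}"
    by (rule permutes_subset[OF m(2)], simp, rule permutes_subset[OF m'(2)], simp)
  have "act_val X k n x m \<gamma> = act_val X k n x ?M \<gamma>"
    by (rule act_val_le[OF n x m, symmetric]) simp
  also have "\<dots> = act_val X k n x ?M \<gamma>'"
    by (rule act_val_same_level[OF n x _ p agree]) (use m in auto)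
  also have "\<dots> = act_val X k n x m' \<gamma>'"
    by (rule act_val_le[OF n x m']) simp
  finally show ?thesis .
qed

lemma act_val_push:
  assumes n: "n \<in> stable_range k" and x: "x \<in> carrier (level_group X k n)" and "n \<le> p" "p \<le> m"
  shows "act_val X k p (seq_iter (iota X k) n (p - n) x) m \<gamma> = act_val X k n x m \<gamma>"
  unfolding act_val_def using seq_iter_le[OF \<open>n \<le> p\<close> \<open>p \<le> m\<close>, of "iota X k" x] by simp

lemma inj_action_cls:
  assumes f: "f \<in> carrier inj_monoid" and n: "n \<in> stable_range k" and x: "x \<in> carrier (level_group X k n)"
    and m: "n \<le> m" and \<gamma>: "\<gamma> permutes {1..m}" and agree: "\<And>i. i \<in> {1..n} \<Longrightarrow> \<gamma> i = f i"
  shows "inj_action X k f (sc.cls k n x) = act_val X k n x m \<gamma>"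
proof -
  let ?S = "{act_val X k n' x' m' \<gamma>' | n' x' m' \<gamma>'. (n', x') \<in> sc.cls k n x \<and> m' = max_value f n' \<and>
      \<gamma>' permutes {1..m'} \<and> (\<forall>i \<in> {1..n'}. \<gamma>' i = f i)}"
  have "s = act_val X k n x m \<gamma>" if sS: "s \<in> ?S" for s
  proof -
    obtain n' x' m' \<gamma>' where s: "s = act_val X k n' x' m' \<gamma>'" "(n', x') \<in> sc.cls k n x" "m' = max_value f n'"
      "\<gamma>' permutes {1..m'}" "\<forall>i \<in> {1..n'}. \<gamma>' i = f i"
      using sS by blast
    have n': "n' \<in> stable_range k" "x' \<in> carrier (level_group X k n')"
      and "\<exists>p. n \<le> p \<and> n' \<le> p \<and> seq_iter (iota X k) n (p - n) x = seq_iter (iota X k) n' (p - n') x'"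
      using s(2) unfolding sc.mem_cls sc.colim_rel_iff by blast+
    then obtain p where p: "n \<le> p" "n' \<le> p" "seq_iter (iota X k) n (p - n) x = seq_iter (iota X k) n' (p - n') x'"
      by blast
    obtain \<Gamma> where \<Gamma>: "\<Gamma> permutes {1..max_value f p}" "\<And>i. i \<in> {1..p} \<Longrightarrow> \<Gamma> i = f i" "p \<le> max_value f p"
      by (rule extend_injection_max[OF f], rule that)
    have "n' \<le> m'"
      unfolding s(3) by (rule extend_injection_max[OF f])
    then have "s = act_val X k n' x' (max_value f p) \<Gamma>"
      unfolding s(1) by (rule act_val_eq[OF n' _ s(4) _ \<Gamma>(1)]) (use s(5) \<Gamma> p in auto)
    also have "\<dots> = act_val X k n x (max_value f p) \<Gamma>"
      using act_val_push[OF n x p(1) \<Gamma>(3), of \<Gamma>] act_val_push[OF n' p(2) \<Gamma>(3), of \<Gamma>] p(3) by simp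
    also have "\<dots> = act_val X k n x m \<gamma>"
      by (rule act_val_eq[OF n x _ \<Gamma>(1) m \<gamma>]) (use \<Gamma> p agree in auto)
    finally show ?thesis .
  qed
  moreover have "\<exists>s. s \<in> ?S"
  proof -
    obtain \<Gamma> where "\<Gamma> permutes {1..max_value f n}" "\<And>i. i \<in> {1..n} \<Longrightarrow> \<Gamma> i = f i" "n \<le> max_value f n"
      by (rule extend_injection_max[OF f], rule that)
    then show ?thesis
      using sc.cls_self[OF n x] by blast
  qed
  ultimately have "?S = {act_val X k n x m \<gamma>}"
    by blast
  moreover have "inj_action X k f (sc.cls k n x) = the_elem ?S"
    unfolding inj_action_def act_val_def ..
  ultimately show ?thesis
    by simp
qed

lemma act_val_closed:
  assumes n: "n \<in> stable_range k" and x: "x \<in> carrier (level_group X k n)" and m: "n \<le> m" and \<gamma>: "\<gamma> permutes {1..m}"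
  shows "act_val X k n x m \<gamma> \<in> carrier (sc.colim k)"
proof -
  have mI: "m \<in> stable_range k"
    by (rule sc.index_le[OF n m])
  show ?thesis
    unfolding act_val_def stable_class_eq
    by (intro sc.cls_closed mI group.int_pow_closed[OF group_level_group[OF mI]] hom_in_carrier[OF act_hom[OF mI \<gamma>]]
        sc.seq_iter_closed n m x)
qed

lemma act_val_mult:
  assumes n: "n \<in> stable_range k" and x: "x \<in> carrier (level_group X k n)" and y: "y \<in> carrier (level_group X k n)"
    and m: "n \<le> m" and \<gamma>: "\<gamma> permutes {1..m}"
  shows "act_val X k n (x \<otimes>\<^bsub>level_group X k n\<^esub> y) m \<gamma> = act_val X k n x m \<gamma> \<oplus>\<^bsub>sc.colim k\<^esub> act_val X k n y m \<gamma>"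
proof -
  have mI: "m \<in> stable_range k"
    by (rule sc.index_le[OF n m])
  interpret L: comm_group "level_group X k m"
    by (rule comm_group_level_group[OF mI])
  define u where "u = seq_iter (iota X k) n (m - n) x"
  define v where "v = seq_iter (iota X k) n (m - n) y"
  let ?h = "homotopy_map (sdim k m) (level X m) (sym_act X m \<gamma>)"
  have uv: "u \<in> carrier (level_group X k m)" "v \<in> carrier (level_group X k m)"
    unfolding u_def v_def by (rule sc.seq_iter_closed[OF n m x], rule sc.seq_iter_closed[OF n m y])
  have huv: "?h u \<in> carrier (level_group X k m)" "?h v \<in> carrier (level_group X k m)"
    using hom_in_carrier[OF act_hom[OF mI \<gamma>]] uv by blast+
  have "?h (seq_iter (iota X k) n (m - n) (x \<otimes>\<^bsub>level_group X k n\<^esub> y)) [^]\<^bsub>level_group X k m\<^esub> sign \<gamma>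
      = ?h u [^]\<^bsub>level_group X k m\<^esub> sign \<gamma> \<otimes>\<^bsub>level_group X k m\<^esub> ?h v [^]\<^bsub>level_group X k m\<^esub> sign \<gamma>"
    unfolding hom_mult[OF sc.seq_iter_hom_le[OF n m] x y] u_def[symmetric] v_def[symmetric]
      hom_mult[OF act_hom[OF mI \<gamma>] uv] by (rule L.int_pow_distrib[OF huv])
  then show ?thesis
    unfolding act_val_def stable_class_eq u_def[symmetric] v_def[symmetric]
    using sc.add_cls[OF mI L.int_pow_closed[OF huv(1)] L.int_pow_closed[OF huv(2)]] by simp
qed

text \<open>One extension \<open>\<gamma>\<close> serves all classes of a level. For fixed
  \<open>\<gamma>\<close> the formula is additive; the power by a sign is so because the groups are
  abelian.\<close>

lemma inj_action_hom:
  assumes f: "f \<in> carrier inj_monoid"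
  shows "inj_action X k f \<in> hom (add_monoid (sc.colim k)) (add_monoid (sc.colim k))"
proof (rule sc.colim_lift(1)[OF sc.abelian_group_colim, where \<phi> = "\<lambda>n x. inj_action X k f (sc.cls k n x)"])
  fix n
  assume n: "n \<in> stable_range k"
  obtain \<gamma> where \<gamma>: "\<gamma> permutes {1..max_value f n}" "\<And>i. i \<in> {1..n} \<Longrightarrow> \<gamma> i = f i" "n \<le> max_value f n"
    by (rule extend_injection_max[OF f], rule that)
  have val: "inj_action X k f (sc.cls k n x) = act_val X k n x (max_value f n) \<gamma>"
    if "x \<in> carrier (level_group X k n)" for x
    using \<gamma> by (intro inj_action_cls f n that)
  show "(\<lambda>x. inj_action X k f (sc.cls k n x)) \<in> hom (level_group X k n) (add_monoid (sc.colim k))"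
  proof (rule homI)
    fix x y
    assume xy: "x \<in> carrier (level_group X k n)" "y \<in> carrier (level_group X k n)"
    have "x \<otimes>\<^bsub>level_group X k n\<^esub> y \<in> carrier (level_group X k n)"
      by (rule monoid.m_closed[OF sc.monoid_level[OF n] xy])
    then show "inj_action X k f (sc.cls k n (x \<otimes>\<^bsub>level_group X k n\<^esub> y))
        = inj_action X k f (sc.cls k n x) \<otimes>\<^bsub>add_monoid (sc.colim k)\<^esub> inj_action X k f (sc.cls k n y)"
      using act_val_mult[OF n xy \<gamma>(3,1)] by (simp add: val xy)
  qed (use act_val_closed[OF n _ \<gamma>(3,1)] in \<open>simp add: val\<close>)
next
  fix n x
  assume "n \<in> stable_range k" "x \<in> carrier (level_group X k n)"
  then show "inj_action X k f (sc.cls k (Suc n) (iota X k n x)) = inj_action X k f (sc.cls k n x)"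
    by (simp only: sc.cls_step)
qed (rule refl)

lemma inj_action_id:
  assumes "c \<in> carrier (sc.colim k)"
  shows "inj_action X k id c = c"
proof -
  obtain n x where n: "n \<in> stable_range k" "x \<in> carrier (level_group X k n)" "c = sc.cls k n x"
    using assms by (rule sc.colimE)
  have xc: "x \<in> carrier (homotopy_group (sdim k n) (level X n))"
    using n(2) by (simp add: carrier_level_group)
  have "homotopy_map (sdim k n) (level X n) (sym_act X n id) x = homotopy_map (sdim k n) (level X n) id x"
    by (rule homotopy_map_cong[OF act_pointed[OF permutes_id] pointed_map_id _ xc]) (simp add: act_id)
  then have "homotopy_map (sdim k n) (level X n) (sym_act X n id) x = x"
    using homotopy_map_id[OF xc] by simp
  then have "act_val X k n x n id = c"
    unfolding act_val_def stable_class_eq n(3) using group.int_pow_1[OF group_level_group[OF n(1)] n(2)] by simp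
  moreover have "inj_action X k id (sc.cls k n x) = act_val X k n x n id"
    by (rule inj_action_cls[OF _ n(1,2) _ permutes_id]) (simp_all add: carrier_inj_monoid)
  ultimately show ?thesis
    by (simp only: n(3))
qed

text \<open>\<open>\<gamma>\<close> extends \<open>g\<close> on {1..n} and \<open>\<delta>\<close>
  extends \<open>f\<close> on {1..m}. As \<open>\<gamma>\<close> maps {1..n} into {1..m}, the
  composite extends \<open>f \<circ> g\<close>, and signs multiply.\<close>

lemma inj_action_comp:
  assumes f: "f \<in> carrier inj_monoid" and g: "g \<in> carrier inj_monoid" and c: "c \<in> carrier (sc.colim k)"
  shows "inj_action X k (f \<circ> g) c = inj_action X k f (inj_action X k g c)"
proof -
  obtain n x where n: "n \<in> stable_range k" and x: "x \<in> carrier (level_group X k n)" and c_eq: "c = sc.cls k n x"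
    using c by (rule sc.colimE)
  obtain \<gamma> m where \<gamma>: "\<gamma> permutes {1..m}" "\<And>i. i \<in> {1..n} \<Longrightarrow> \<gamma> i = g i" "n \<le> m"
    by (rule extend_injection_max[OF g], rule that)
  obtain \<delta> l where \<delta>: "\<delta> permutes {1..l}" "\<And>i. i \<in> {1..m} \<Longrightarrow> \<delta> i = f i" "m \<le> l"
    by (rule extend_injection_max[OF f], rule that)
  have mI: "m \<in> stable_range k" and lI: "l \<in> stable_range k"
    using sc.index_le[OF n \<gamma>(3)] sc.index_le[OF _ \<delta>(3)] by blast+
  interpret L: group "level_group X k l"
    by (rule group_level_group[OF lI])
  let ?h = "\<lambda>m \<gamma>. homotopy_map (sdim k m) (level X m) (sym_act X m \<gamma>)"
  define y where "y = seq_iter (iota X k) n (m - n) x"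
  define z where "z = ?h m \<gamma> y [^]\<^bsub>level_group X k m\<^esub> sign \<gamma>"
  define w where "w = seq_iter (iota X k) n (l - n) x"
  have y: "y \<in> carrier (level_group X k m)"
    unfolding y_def by (rule sc.seq_iter_closed[OF n \<gamma>(3) x])
  have z: "z \<in> carrier (level_group X k m)"
    unfolding z_def
    by (rule group.int_pow_closed[OF group_level_group[OF mI] hom_in_carrier[OF act_hom[OF mI \<gamma>(1)] y]])
  have w: "w \<in> carrier (level_group X k l)"
    unfolding w_def by (rule sc.seq_iter_closed[OF n _ x]) (use \<gamma> \<delta> in simp)
  have \<gamma>l: "\<gamma> permutes {1..l}"
    by (rule permutes_subset[OF \<gamma>(1)]) (use \<delta> in simp)
  have wc: "w \<in> carrier (homotopy_group (sdim k l) (level X l))"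
    using w by (simp add: carrier_level_group)
  \<comment> \<open>The action of \<open>\<gamma>\<close> passes through iterated stabilization, so
    both permutations can be applied at level \<open>l\<close>.\<close>
  have iter: "seq_iter (iota X k) m d (?h m \<gamma> y) = ?h (m + d) \<gamma> (seq_iter (iota X k) m d y)" for d
  proof (induction d)
    case (Suc d)
    have "\<gamma> permutes {1..m + d}"
      by (rule permutes_subset[OF \<gamma>(1)]) simp
    moreover have "m + d \<in> stable_range k"
      by (rule sc.index_le[OF mI]) simp
    moreover have "seq_iter (iota X k) m d y \<in> carrier (level_group X k (m + d))"
      by (rule hom_in_carrier[OF sc.seq_iter_hom[OF mI] y])
    ultimately show ?case
      using Suc act_iota[of "m + d" k \<gamma> "seq_iter (iota X k) m d y"] by simp
  qed simp
  have "seq_iter (iota X k) m (l - m) z = seq_iter (iota X k) m (l - m) (?h m \<gamma> y) [^]\<^bsub>level_group X k l\<^esub> sign \<gamma>"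
    unfolding z_def
    by (rule hom_int_pow[OF sc.seq_iter_hom_le[OF mI \<delta>(3)] hom_in_carrier[OF act_hom[OF mI \<gamma>(1)] y]
        group_level_group[OF mI] L.is_group])
  also have "seq_iter (iota X k) m (l - m) (?h m \<gamma> y) = ?h l \<gamma> w"
    using iter[of "l - m"] \<delta>(3) seq_iter_le[OF \<gamma>(3) \<delta>(3), of "iota X k" x] by (simp add: y_def w_def)
  finally have zl: "seq_iter (iota X k) m (l - m) z = ?h l \<gamma> w [^]\<^bsub>level_group X k l\<^esub> sign \<gamma>" .
  have h\<gamma>w: "?h l \<gamma> w \<in> carrier (level_group X k l)"
    by (rule hom_in_carrier[OF act_hom[OF lI \<gamma>l] w])
  have comp: "?h l (\<delta> \<circ> \<gamma>) w = ?h l \<delta> (?h l \<gamma> w)"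
  proof -
    have "?h l (\<delta> \<circ> \<gamma>) w = homotopy_map (sdim k l) (level X l) (sym_act X l \<delta> \<circ> sym_act X l \<gamma>) w"
      by (rule homotopy_map_cong[OF act_pointed[OF permutes_compose[OF \<gamma>l \<delta>(1)]]
            pointed_map_comp[OF act_pointed[OF \<gamma>l] act_pointed[OF \<delta>(1)]] _ wc])
        (simp add: act_comp[OF \<delta>(1) \<gamma>l])
    then show ?thesis
      using homotopy_map_comp[OF act_pointed[OF \<gamma>l] act_pointed[OF \<delta>(1)] wc] by simp
  qed
  have "?h l \<delta> (seq_iter (iota X k) m (l - m) z) [^]\<^bsub>level_group X k l\<^esub> sign \<delta>
      = ?h l (\<delta> \<circ> \<gamma>) w [^]\<^bsub>level_group X k l\<^esub> sign (\<delta> \<circ> \<gamma>)"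
    unfolding zl comp hom_int_pow[OF act_hom[OF lI \<delta>(1)] h\<gamma>w L.is_group L.is_group]
      sign_compose[OF permutes_permutation[OF \<delta>(1)] permutes_permutation[OF \<gamma>l]]
    using L.int_pow_pow[OF hom_in_carrier[OF act_hom[OF lI \<delta>(1)] h\<gamma>w]] by (simp only: mult.commute)
  then have "act_val X k m z l \<delta> = act_val X k n x l (\<delta> \<circ> \<gamma>)"
    unfolding act_val_def w_def by (simp only:)
  moreover have "inj_action X k g c = sc.cls k m z"
  proof -
    have "inj_action X k g (sc.cls k n x) = act_val X k n x m \<gamma>"
      by (rule inj_action_cls[OF g n x \<gamma>(3,1,2)])
    then show ?thesis
      unfolding c_eq act_val_def stable_class_eq z_def y_def .
  qed
  moreover have "inj_action X k f (sc.cls k m z) = act_val X k m z l \<delta>"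
    by (rule inj_action_cls[OF f mI z \<delta>(3,1,2)])
  moreover have "inj_action X k (f \<circ> g) c = act_val X k n x l (\<delta> \<circ> \<gamma>)"
    unfolding c_eq
  proof (rule inj_action_cls[OF _ n x])
    show "f \<circ> g \<in> carrier inj_monoid"
      using monoid.m_closed[OF monoid_inj_monoid f g] by simp
    show "\<delta> \<circ> \<gamma> permutes {1..l}"
      by (rule permutes_compose[OF \<gamma>l \<delta>(1)])
    show "(\<delta> \<circ> \<gamma>) i = (f \<circ> g) i" if "i \<in> {1..n}" for i
    proof -
      have "\<gamma> i \<in> {1..m}"
        using permutes_in_image[OF \<gamma>(1), of i] that \<gamma>(3) by simp
      then show ?thesis
        using \<gamma>(2)[OF that] \<delta>(2) by simp
    qed
  qed (use \<gamma> \<delta> in simp)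
  ultimately show ?thesis
    by simp
qed

sublocale ma: monoid_action inj_monoid "sc.colim k" "inj_action X k" for k
proof (intro monoid_action.intro monoid_action_axioms.intro monoid_inj_monoid sc.abelian_group_colim inj_action_hom)
qed (simp_all only: mult_inj_monoid one_inj_monoid inj_action_comp inj_action_id)

lemma stable_homotopy_eq: "stable_homotopy X k = action_module (sc.colim k) (inj_action X k)"
  by (simp add: stable_homotopy_def)

lemma left_module_stable_homotopy: "left_module ZM (stable_homotopy X k)"
  unfolding stable_homotopy_eq by (rule ma.left_module_action_module)

lemma smult_stable_homotopy_of:
  "f \<in> carrier inj_monoid \<Longrightarrow> c \<in> carrier (sc.colim k) \<Longrightarrow>
     frag_of f \<odot>\<^bsub>stable_homotopy X k\<^esub> c = inj_action X k f c"
  unfolding stable_homotopy_eq by (rule ma.smult_action_module_of)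

lemma stable_homotopy_simps [simp]:
  "carrier (stable_homotopy X k) = carrier (sc.colim k)"
  "c \<oplus>\<^bsub>stable_homotopy X k\<^esub> d = c \<oplus>\<^bsub>sc.colim k\<^esub> d"
  "\<zero>\<^bsub>stable_homotopy X k\<^esub> = \<zero>\<^bsub>sc.colim k\<^esub>"
  by (simp_all add: stable_homotopy_eq action_module_def)

end

section \<open>Morphisms\<close>

text \<open>The hypothesis is restricted to the iterates of the given \<open>x\<close>, because
  commutation with stabilization is known only on carriers.\<close>

lemma seq_iter_natural:
  assumes "\<And>d. \<phi> (Suc d) (j (n + d) (seq_iter j n d x)) = j' (n' + d) (\<phi> d (seq_iter j n d x))"
  shows "\<phi> d (seq_iter j n d x) = seq_iter j' n' d (\<phi> 0 x)"
  using assms by (induction d) simp_all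

locale equivariant_morphism = X: equivariant_spectrum X + Y: equivariant_spectrum Y
  for X :: "'a spectrum_data" and Y :: "'b spectrum_data" +
  fixes f :: "nat \<Rightarrow> 'a \<Rightarrow> 'b"
  assumes morphism: "spectrum_morphism X Y f"
begin

lemma map_pointed: "pointed_map (level X n) (level Y n) (f n)"
  using morphism by (simp add: spectrum_morphism_def)

lemma map_act: "\<gamma> permutes {1..n} \<Longrightarrow> x \<in> points (level X n) \<Longrightarrow> f n (sym_act X n \<gamma> x) = sym_act Y n \<gamma> (f n x)"
  using morphism by (simp add: spectrum_morphism_def)

lemma map_stab: "x \<in> points (level X n) \<Longrightarrow> s \<in> points S1 \<Longrightarrow> f (Suc n) (stab X n x s) = stab Y n (f n x) s"
  using morphism by (simp add: spectrum_morphism_def stab_def)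

abbreviation push :: "int \<Rightarrow> nat \<Rightarrow> ((nat \<Rightarrow> real) \<Rightarrow> 'a) set \<Rightarrow> ((nat \<Rightarrow> real) \<Rightarrow> 'b) set" where
  "push k n \<equiv> homotopy_map (sdim k n) (level Y n) (f n)"

lemma push_hom: "n \<in> stable_range k \<Longrightarrow> push k n \<in> hom (level_group X k n) (level_group Y k n)"
  unfolding level_group_def
  by (rule homotopy_map_hom[OF map_pointed X.base_point Y.base_point dim_ge_2])

lemma push_closed: "n \<in> stable_range k \<Longrightarrow> x \<in> carrier (level_group X k n) \<Longrightarrow> push k n x \<in> carrier (level_group Y k n)"
  using hom_in_carrier[OF push_hom] .

lemma push_iota:
  "n \<in> stable_range k \<Longrightarrow> x \<in> carrier (level_group X k n) \<Longrightarrow> push k (Suc n) (iota X k n x) = iota Y k n (push k n x)"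
  by (rule iota_natural[OF X.equivariant_spectrum_axioms Y.equivariant_spectrum_axioms _ _ refl map_pointed map_pointed map_stab])

lemma push_seq_iter:
  assumes n: "n \<in> stable_range k" and x: "x \<in> carrier (level_group X k n)" and "n \<le> m"
  shows "push k m (seq_iter (iota X k) n (m - n) x) = seq_iter (iota Y k) n (m - n) (push k n x)"
proof -
  have "push k (n + d) (seq_iter (iota X k) n d x) = seq_iter (iota Y k) n d (push k (n + 0) x)" for d
  proof (rule seq_iter_natural[where \<phi> = "\<lambda>d. push k (n + d)"])
    fix d
    have "n + d \<in> stable_range k"
      by (rule X.sc.index_le[OF n]) simp
    then show "push k (n + Suc d) (iota X k (n + d) (seq_iter (iota X k) n d x))
        = iota Y k (n + d) (push k (n + d) (seq_iter (iota X k) n d x))"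
      using push_iota[OF _ hom_in_carrier[OF X.sc.seq_iter_hom[OF n] x]] by simp
  qed
  from this[of "m - n"] show ?thesis
    using \<open>n \<le> m\<close> by simp
qed

lemma stable_homotopy_map_hom:
  "stable_homotopy_map Y k f \<in> hom (add_monoid (X.sc.colim k)) (add_monoid (Y.sc.colim k))" (is ?hom)
  and stable_homotopy_map_cls: "\<And>n x. n \<in> stable_range k \<Longrightarrow> x \<in> carrier (level_group X k n) \<Longrightarrow>
    stable_homotopy_map Y k f (X.sc.cls k n x) = Y.sc.cls k n (push k n x)" (is "PROP ?cls")
proof -
  have 1: "(\<lambda>x. Y.sc.cls k n (push k n x)) \<in> hom (level_group X k n) (add_monoid (Y.sc.colim k))"
    if "n \<in> stable_range k" for n
    using hom_compose[OF push_hom[OF that] Y.sc.cls_hom[OF that]] by (simp only: o_def)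
  have 2: "Y.sc.cls k (Suc n) (push k (Suc n) (iota X k n x)) = Y.sc.cls k n (push k n x)"
    if "n \<in> stable_range k" "x \<in> carrier (level_group X k n)" for n x
    using push_iota[OF that] Y.sc.cls_step[OF that(1) push_closed[OF that]] by simp
  have 3: "stable_homotopy_map Y k f c = the_elem ((\<lambda>(n, x). Y.sc.cls k n (push k n x)) ` c)" for c
    unfolding stable_homotopy_map_def Y.stable_class_eq ..
  show ?hom
    by (rule X.sc.colim_lift_the_elem(1)[OF Y.sc.abelian_group_colim 1 2 3])
  show "PROP ?cls"
    by (rule X.sc.colim_lift_the_elem(2)[OF Y.sc.abelian_group_colim 1 2 3])
qed

lemma stable_homotopy_map_closed:
  "c \<in> carrier (X.sc.colim k) \<Longrightarrow> stable_homotopy_map Y k f c \<in> carrier (Y.sc.colim k)"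
  using hom_in_carrier[OF stable_homotopy_map_hom] by simp

text \<open>Every ingredient of the action formula, namely stabilization, permutations and powers,
  commutes with the maps induced by an equivariant morphism.\<close>

lemma stable_homotopy_map_action:
  assumes g: "g \<in> carrier inj_monoid" and c: "c \<in> carrier (X.sc.colim k)"
  shows "stable_homotopy_map Y k f (inj_action X k g c) = inj_action Y k g (stable_homotopy_map Y k f c)"
proof -
  obtain n x where n: "n \<in> stable_range k" and x: "x \<in> carrier (level_group X k n)" and c_eq: "c = X.sc.cls k n x"
    using c by (rule X.sc.colimE)
  obtain \<gamma> m where \<gamma>: "\<gamma> permutes {1..m}" "\<And>i. i \<in> {1..n} \<Longrightarrow> \<gamma> i = g i" "n \<le> m"
    by (rule extend_injection_max[OF g], rule that)
  have mI: "m \<in> stable_range k"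
    by (rule X.sc.index_le[OF n \<gamma>(3)])
  define y where "y = seq_iter (iota X k) n (m - n) x"
  have y: "y \<in> carrier (level_group X k m)"
    unfolding y_def by (rule X.sc.seq_iter_closed[OF n \<gamma>(3) x])
  have yc: "y \<in> carrier (homotopy_group (sdim k m) (level X m))"
    using y by (simp add: X.carrier_level_group)
  define z where "z = homotopy_map (sdim k m) (level X m) (sym_act X m \<gamma>) y"
  have z: "z \<in> carrier (level_group X k m)"
    unfolding z_def by (rule hom_in_carrier[OF X.act_hom[OF mI \<gamma>(1)] y])
  have "push k m z = homotopy_map (sdim k m) (level Y m) (f m \<circ> sym_act X m \<gamma>) y"
    unfolding z_def by (rule homotopy_map_comp[OF X.act_pointed[OF \<gamma>(1)] map_pointed yc, symmetric])
  also have "\<dots> = homotopy_map (sdim k m) (level Y m) (sym_act Y m \<gamma> \<circ> f m) y"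
    by (rule homotopy_map_cong[OF pointed_map_comp[OF X.act_pointed[OF \<gamma>(1)] map_pointed]
          pointed_map_comp[OF map_pointed Y.act_pointed[OF \<gamma>(1)]] _ yc]) (simp add: map_act[OF \<gamma>(1)])
  also have "\<dots> = homotopy_map (sdim k m) (level Y m) (sym_act Y m \<gamma>) (push k m y)"
    by (rule homotopy_map_comp[OF map_pointed Y.act_pointed[OF \<gamma>(1)] yc])
  also have "push k m y = seq_iter (iota Y k) n (m - n) (push k n x)"
    unfolding y_def by (rule push_seq_iter[OF n x \<gamma>(3)])
  finally have pz: "push k m z = homotopy_map (sdim k m) (level Y m) (sym_act Y m \<gamma>) (seq_iter (iota Y k) n (m - n) (push k n x))" .
  have "push k m (z [^]\<^bsub>level_group X k m\<^esub> sign \<gamma>) = push k m z [^]\<^bsub>level_group Y k m\<^esub> sign \<gamma>"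
    by (rule hom_int_pow[OF push_hom[OF mI] z X.group_level_group[OF mI] Y.group_level_group[OF mI]])
  moreover have "inj_action X k g c = X.sc.cls k m (z [^]\<^bsub>level_group X k m\<^esub> sign \<gamma>)"
  proof -
    have "inj_action X k g (X.sc.cls k n x) = act_val X k n x m \<gamma>"
      by (rule X.inj_action_cls[OF g n x \<gamma>(3,1,2)])
    then show ?thesis
      unfolding c_eq act_val_def X.stable_class_eq z_def y_def .
  qed
  ultimately have "stable_homotopy_map Y k f (inj_action X k g c) = act_val Y k n (push k n x) m \<gamma>"
    using stable_homotopy_map_cls[OF mI group.int_pow_closed[OF X.group_level_group[OF mI] z]]
    unfolding act_val_def Y.stable_class_eq pz by simp
  also have "\<dots> = inj_action Y k g (Y.sc.cls k n (push k n x))"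
    by (rule Y.inj_action_cls[OF g n push_closed[OF n x] \<gamma>(3,1,2), symmetric])
  finally show ?thesis
    unfolding c_eq stable_homotopy_map_cls[OF n x] .
qed

end


section \<open>The smash product with the free spectrum in level one\<close>

text \<open>A point is the image of a one-point compact Hausdorff space, so weak Hausdorffness
  applies.\<close>

lemma closedin_base_point:
  assumes "symmetric_spectrum X"
  shows "closedin (top_of (level X n)) {base (level X n)}"
proof -
  have A: "weak_Hausdorff_space (top_of (level X n))" "base (level X n) \<in> points (level X n)"
    using assms by (simp_all add: symmetric_spectrum_def pointed_CGWH_def)
  let ?K = "discrete_topology {{}} :: 'a set set topology"
  have "compact_space ?K" "Hausdorff_space ?K"
    by (simp_all add: compact_space_discrete_topology Hausdorff_space_discrete_topology)
  moreover have "continuous_map ?K (top_of (level X n)) (\<lambda>_. base (level X n))"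
    using A by simp
  ultimately have "closedin (top_of (level X n)) ((\<lambda>_. base (level X n)) ` topspace ?K)"
    using A(1) unfolding weak_Hausdorff_space_def by blast
  then show ?thesis
    by simp
qed

lemma continuous_map_discrete_prod:
  assumes "\<And>d. d \<in> D \<Longrightarrow> continuous_map X Z (\<lambda>x. F (d, x))"
  shows "continuous_map (prod_topology (discrete_topology D) X) Z F"
  unfolding continuous_map_def
proof (intro conjI allI impI)
  show "F \<in> topspace (prod_topology (discrete_topology D) X) \<rightarrow> topspace Z"
  proof
    fix p
    assume "p \<in> topspace (prod_topology (discrete_topology D) X)"
    then have "fst p \<in> D" "snd p \<in> topspace X"
      by (auto simp: mem_Times_iff)
    then show "F p \<in> topspace Z"
      using continuous_map_image_subset_topspace[OF assms, of "fst p"] by (auto simp: image_subset_iff)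
  qed
  fix U
  assume U: "openin Z U"
  have "{p \<in> topspace (prod_topology (discrete_topology D) X). F p \<in> U}
      = (\<Union>d\<in>D. {d} \<times> {x \<in> topspace X. F (d, x) \<in> U})"
    by auto
  moreover have "openin (prod_topology (discrete_topology D) X) ({d} \<times> {x \<in> topspace X. F (d, x) \<in> U})" if "d \<in> D" for d
    using that openin_continuous_map_preimage[OF assms[OF that] U] by (simp add: openin_prod_Times_iff)
  ultimately show "openin (prod_topology (discrete_topology D) X)
      {p \<in> topspace (prod_topology (discrete_topology D) X). F p \<in> U}"
    by (metis (no_types, lifting) openin_Union imageE)
qed

text \<open>In this form the sign of \<open>1 \<times> \<gamma>\<close> is known from the lemma on
  block permutations.\<close>

lemma one_times_eq_block: "one_times f = block_perm 1 id f" if "f 0 = 0"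
  using that by (auto simp: one_times_def block_perm_def fun_eq_iff)

text \<open>This identity turns the equivariance of \<open>X\<close> in its suspension coordinates
  into that of the smash product, whose levels carry one additional letter in front.\<close>

lemma one_times_block: "one_times (block_perm n id \<delta>) = block_perm (Suc n) id \<delta>"
proof
  fix i
  show "one_times (block_perm n id \<delta>) i = block_perm (Suc n) id \<delta> i"
    by (cases i) (auto simp: one_times_def block_perm_def)
qed

lemma block_perm_eq_comp:
  assumes \<gamma>: "\<gamma> permutes {1..n}" and \<delta>: "\<delta> permutes {1..d}"
  shows "block_perm n \<gamma> \<delta> = \<gamma> \<circ> block_perm n id \<delta>"
proof
  fix i
  have "\<gamma> (n + \<delta> (i - n)) = n + \<delta> (i - n)" if "\<not> i \<le> n"
  proof (rule permutes_not_in[OF \<gamma>])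
    have "1 \<le> \<delta> (i - n)"
      by (rule inj_monoid_pos[OF permutes_inj_monoid[OF \<delta>]]) (use that in linarith)
    then show "n + \<delta> (i - n) \<notin> {1..n}"
      by simp
  qed
  then show "block_perm n \<gamma> \<delta> i = (\<gamma> \<circ> block_perm n id \<delta>) i"
    by (simp add: block_perm_def)
qed

lemma block_perm_commute:
  assumes \<alpha>: "\<alpha> permutes {1..n}" and \<delta>: "\<delta> permutes {1..d}"
  shows "block_perm n id \<delta> \<circ> \<alpha> = \<alpha> \<circ> block_perm n id \<delta>"
proof
  fix i
  show "(block_perm n id \<delta> \<circ> \<alpha>) i = (\<alpha> \<circ> block_perm n id \<delta>) i"
  proof (cases "i \<le> n")
    case True
    then have "\<alpha> i \<le> n"
      using permutes_in_image[OF \<alpha>, of i] permutes_not_in[OF \<alpha>, of i] by (cases "i \<in> {1..n}") auto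
    then show ?thesis
      using True by (simp add: block_perm_def)
  next
    case False
    then have "1 \<le> \<delta> (i - n)"
      by (intro inj_monoid_pos[OF permutes_inj_monoid[OF \<delta>]]) linarith
    then have "\<alpha> (n + \<delta> (i - n)) = n + \<delta> (i - n)"
      by (intro permutes_not_in[OF \<alpha>]) simp
    then show ?thesis
      using False permutes_not_in[OF \<alpha>, of i] by (simp add: block_perm_def)
  qed
qed

text \<open>Closedness of the base point makes the copies of \<open>X\<close> closed in the wedge,
  so that maps can be pasted over them.\<close>

locale closed_base_spectrum = equivariant_spectrum X for X :: "'a spectrum_data" +
  assumes base_closed: "closedin (top_of (level X n)) {base (level X n)}"
begin

abbreviation cl :: "nat \<Rightarrow> (nat \<Rightarrow> nat) \<Rightarrow> 'a \<Rightarrow> ((nat \<Rightarrow> nat) \<times> 'a) set" where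
  "cl n \<alpha> x \<equiv> F1_class X n (\<alpha>, x)"

abbreviation Lev :: "nat \<Rightarrow> ((nat \<Rightarrow> nat) \<times> 'a) set pointed_space" where
  "Lev n \<equiv> F1_level X (Suc n)"

lemma act_point: "\<gamma> permutes {1..n} \<Longrightarrow> x \<in> points (level X n) \<Longrightarrow> sym_act X n \<gamma> x \<in> points (level X n)"
  using pointed_map_point[OF act_pointed] .

lemma act_base: "\<gamma> permutes {1..n} \<Longrightarrow> sym_act X n \<gamma> (base (level X n)) = base (level X n)"
  using act_pointed by (simp add: pointed_map_def)

lemma act_continuous: "\<gamma> permutes {1..n} \<Longrightarrow> continuous_map (top_of (level X n)) (top_of (level X n)) (sym_act X n \<gamma>)"
  using act_pointed by (simp add: pointed_map_def)

section \<open>The levels of the smash product as quotients\<close>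

lemma F1_rel_iff:
  "((\<alpha>, x), (\<beta>, y)) \<in> F1_rel X n \<longleftrightarrow>
     \<alpha> permutes {1..Suc n} \<and> \<beta> permutes {1..Suc n} \<and> x \<in> points (level X n) \<and> y \<in> points (level X n) \<and>
     ((\<exists>\<gamma>. \<gamma> permutes {1..n} \<and> \<alpha> = \<beta> \<circ> one_times \<gamma> \<and> y = sym_act X n \<gamma> x) \<or>
      (x = base (level X n) \<and> y = base (level X n)))"
  by (simp add: F1_rel_def plus_1_eq_Suc)

lemma F1_rel_sym:
  assumes "(p, q) \<in> F1_rel X n"
  shows "(q, p) \<in> F1_rel X n"
proof -
  obtain \<alpha> x \<beta> y where pq: "p = (\<alpha>, x)" "q = (\<beta>, y)"
    by (metis surj_pair)
  have r: "\<alpha> permutes {1..Suc n}" "\<beta> permutes {1..Suc n}" "x \<in> points (level X n)" "y \<in> points (level X n)"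
    using assms unfolding pq F1_rel_iff by simp_all
  consider (1) \<gamma> where "\<gamma> permutes {1..n}" "\<alpha> = \<beta> \<circ> one_times \<gamma>" "y = sym_act X n \<gamma> x"
    | (2) "x = base (level X n)" "y = base (level X n)"
    using assms unfolding pq F1_rel_iff by blast
  then show ?thesis
  proof cases
    case 1
    let ?\<delta> = "inv_into UNIV \<gamma>"
    have \<delta>: "?\<delta> permutes {1..n}"
      by (rule permutes_inv[OF 1(1)])
    have "one_times \<gamma> \<circ> one_times ?\<delta> = id"
      using one_times_comp[OF permutes_inj_monoid[OF 1(1)] permutes_inj_monoid[OF \<delta>]]
        permutes_inv_o(1)[OF 1(1)] by simp
    then have "\<beta> = \<alpha> \<circ> one_times ?\<delta>"
      unfolding 1(2) by (simp add: comp_assoc)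
    moreover have "x = sym_act X n ?\<delta> y"
      unfolding 1(3) using act_comp[OF \<delta> 1(1) r(3)] permutes_inv_o(2)[OF 1(1)] act_id[OF r(3)] by simp
    ultimately show ?thesis
      unfolding pq F1_rel_iff using r \<delta> by blast
  next
    case 2
    then show ?thesis
      unfolding pq F1_rel_iff using r by blast
  qed
qed

text \<open>Away from the base point the relation is an orbit relation. The two clauses do not mix
  points with base points, because the symmetric group fixes the base point.\<close>

lemma F1_rel_trans:
  assumes "(p, q) \<in> F1_rel X n" "(q, r) \<in> F1_rel X n"
  shows "(p, r) \<in> F1_rel X n"
proof -
  obtain \<alpha> x \<beta> y \<delta> z where pqr: "p = (\<alpha>, x)" "q = (\<beta>, y)" "r = (\<delta>, z)"
    by (metis surj_pair)
  have s: "\<alpha> permutes {1..Suc n}" "\<delta> permutes {1..Suc n}" "x \<in> points (level X n)" "z \<in> points (level X n)"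
    using assms unfolding pqr F1_rel_iff by simp_all
  show ?thesis
  proof (cases "x = base (level X n) \<or> y = base (level X n) \<or> z = base (level X n)")
    case True
    have xy: "x = base (level X n) \<longleftrightarrow> y = base (level X n)" if "((\<alpha>, x), (\<beta>, y)) \<in> F1_rel X n" for \<alpha> x \<beta> y
    proof
      show "y = base (level X n)" if "x = base (level X n)"
        using that \<open>((\<alpha>, x), (\<beta>, y)) \<in> F1_rel X n\<close> act_base unfolding F1_rel_iff by metis
      show "x = base (level X n)" if "y = base (level X n)"
        using that F1_rel_sym[OF \<open>((\<alpha>, x), (\<beta>, y)) \<in> F1_rel X n\<close>] act_base unfolding F1_rel_iff by metis
    qed
    show ?thesis
      using True xy assms s unfolding pqr F1_rel_iff[of \<alpha> x \<delta> z] by metis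
  next
    case False
    then obtain \<gamma> \<gamma>' where g: "\<gamma> permutes {1..n}" "\<alpha> = \<beta> \<circ> one_times \<gamma>" "y = sym_act X n \<gamma> x"
      "\<gamma>' permutes {1..n}" "\<beta> = \<delta> \<circ> one_times \<gamma>'" "z = sym_act X n \<gamma>' y"
      using assms unfolding pqr F1_rel_iff by blast
    have "\<gamma>' \<circ> \<gamma> permutes {1..n}"
      by (rule permutes_compose[OF g(1,4)])
    moreover have "\<alpha> = \<delta> \<circ> one_times (\<gamma>' \<circ> \<gamma>)"
      unfolding g(2,5) one_times_comp[OF permutes_inj_monoid[OF g(4)] permutes_inj_monoid[OF g(1)]] by (simp only: comp_assoc)
    moreover have "z = sym_act X n (\<gamma>' \<circ> \<gamma>) x"
      unfolding g(6,3) act_comp[OF g(4,1) s(3)] ..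
    ultimately show ?thesis
      unfolding pqr F1_rel_iff using s by blast
  qed
qed

lemma mem_cl: "q \<in> F1_class X n p \<longleftrightarrow> (p, q) \<in> F1_rel X n"
  by (simp add: F1_class_def)

lemma F1_class_eqI:
  assumes "(p, q) \<in> F1_rel X n"
  shows "F1_class X n p = F1_class X n q"
proof
  show "F1_class X n p \<subseteq> F1_class X n q"
    using F1_rel_trans[OF F1_rel_sym[OF assms]] by (auto simp: mem_cl)
  show "F1_class X n q \<subseteq> F1_class X n p"
    using F1_rel_trans[OF assms] by (auto simp: mem_cl)
qed

lemma F1_rel_refl: "\<alpha> permutes {1..Suc n} \<Longrightarrow> x \<in> points (level X n) \<Longrightarrow> ((\<alpha>, x), (\<alpha>, x)) \<in> F1_rel X n"
  unfolding F1_rel_iff using permutes_id[of "{1..n}"] by (auto simp: act_id intro!: exI[of _ id])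

lemma cl_shift:
  assumes "\<beta> permutes {1..Suc n}" "\<gamma> permutes {1..n}" "x \<in> points (level X n)"
  shows "cl n (\<beta> \<circ> one_times \<gamma>) x = cl n \<beta> (sym_act X n \<gamma> x)"
  by (rule F1_class_eqI)
    (use assms permutes_compose[OF one_times_permutes[OF assms(2)] assms(1)] in \<open>auto simp: F1_rel_iff act_point\<close>)

lemma cl_base: "\<alpha> permutes {1..Suc n} \<Longrightarrow> \<beta> permutes {1..Suc n} \<Longrightarrow> cl n \<alpha> (base (level X n)) = cl n \<beta> (base (level X n))"
  by (rule F1_class_eqI) (simp add: F1_rel_iff base_point)

text \<open>The cycles represent the cosets of the image of \<open>1 \<times> -\<close>. So every
  point is the image of a point of \<open>X\<close> under one of the inclusions
  \<open>cl n (cyc i)\<close>.\<close>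

lemma cl_normal:
  assumes "\<alpha> permutes {1..Suc n}" "x \<in> points (level X n)"
  shows "cl n \<alpha> x = cl n (cyc (\<alpha> 1)) (sym_act X n (shift_down \<alpha>) x)"
proof -
  have "\<alpha> 1 \<in> {1..Suc n}"
    using permutes_in_image[OF assms(1), of 1] by simp
  then have "cyc (\<alpha> 1) permutes {1..Suc n}"
    by (intro cyc_permutes) auto
  from cl_shift[OF this shift_down_permutes[OF assms(1)] assms(2)] show ?thesis
    using cyc_one_times_shift_down[OF permutes_inj_monoid[OF assms(1)]] by simp
qed

lemma base_Lev: "base (Lev n) = cl n id (base (level X n))"
  by (simp add: F1_level_def)

lemma cl_base_Lev: "\<alpha> permutes {1..Suc n} \<Longrightarrow> cl n \<alpha> (base (level X n)) = base (Lev n)"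
  unfolding base_Lev by (rule cl_base) (simp_all add: permutes_id)

lemma top_Lev: "top_of (Lev n) = quot_topology
    (prod_topology (discrete_topology {\<alpha>. \<alpha> permutes {1..Suc n}}) (top_of (level X n))) (F1_class X n)"
  by (simp add: F1_level_def plus_1_eq_Suc)

lemma points_Lev: "points (Lev n) = {cl n \<alpha> x | \<alpha> x. \<alpha> permutes {1..Suc n} \<and> x \<in> points (level X n)}"
  by (auto simp: top_Lev)

lemma LevE:
  assumes "C \<in> points (Lev n)"
  obtains \<alpha> x where "\<alpha> permutes {1..Suc n}" "x \<in> points (level X n)" "C = cl n \<alpha> x"
  using assms by (auto simp: points_Lev)

lemma cl_point: "\<alpha> permutes {1..Suc n} \<Longrightarrow> x \<in> points (level X n) \<Longrightarrow> cl n \<alpha> x \<in> points (Lev n)"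
  by (auto simp: points_Lev)

lemma cl_eq_base_iff:
  assumes "\<alpha> permutes {1..Suc n}" "x \<in> points (level X n)"
  shows "cl n \<alpha> x = base (Lev n) \<longleftrightarrow> x = base (level X n)"
proof
  assume "cl n \<alpha> x = base (Lev n)"
  then have "((\<alpha>, x), (id, base (level X n))) \<in> F1_rel X n"
    using F1_rel_refl[OF permutes_id base_point] unfolding base_Lev by (simp flip: mem_cl)
  then have "((id, base (level X n)), (\<alpha>, x)) \<in> F1_rel X n"
    by (rule F1_rel_sym)
  then show "x = base (level X n)"
    unfolding F1_rel_iff using act_base by metis
qed (use cl_base_Lev assms in simp)

text \<open>The two conditions match the two clauses of \<open>F1_rel\<close>: invariance along
  orbits and a common value at the collapsed points.\<close>

lemma F1_descend:
  assumes shift: "\<And>\<beta> \<gamma> x. \<beta> permutes {1..Suc n} \<Longrightarrow> \<gamma> permutes {1..n} \<Longrightarrow> x \<in> points (level X n) \<Longrightarrow>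
      F (\<beta> \<circ> one_times \<gamma>, x) = F (\<beta>, sym_act X n \<gamma> x)"
    and base: "\<And>\<alpha> \<beta>. \<alpha> permutes {1..Suc n} \<Longrightarrow> \<beta> permutes {1..Suc n} \<Longrightarrow>
      F (\<alpha>, base (level X n)) = F (\<beta>, base (level X n))"
    and "\<alpha> permutes {1..Suc n}" "x \<in> points (level X n)"
  shows "the_elem (F ` cl n \<alpha> x) = F (\<alpha>, x)"
proof (rule the_elem_image_const)
  show "cl n \<alpha> x \<noteq> {}"
    using F1_rel_refl[OF assms(3,4)] mem_cl by blast
  fix q
  assume q: "q \<in> cl n \<alpha> x"
  obtain \<beta> y where q_eq: "q = (\<beta>, y)"
    by (metis surj_pair)
  have r: "((\<alpha>, x), (\<beta>, y)) \<in> F1_rel X n"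
    using q by (simp add: mem_cl q_eq)
  then have \<beta>: "\<beta> permutes {1..Suc n}"
    by (simp add: F1_rel_iff)
  from r consider (1) \<gamma> where "\<gamma> permutes {1..n}" "\<alpha> = \<beta> \<circ> one_times \<gamma>" "y = sym_act X n \<gamma> x"
    | (2) "x = base (level X n)" "y = base (level X n)"
    unfolding F1_rel_iff by blast
  then show "F q = F (\<alpha>, x)"
  proof cases
    case 1
    show ?thesis
      unfolding q_eq 1(2,3) by (rule shift[OF \<beta> 1(1) assms(4), symmetric])
  next
    case 2
    show ?thesis
      unfolding q_eq 2 by (rule base[OF \<beta> assms(3)])
  qed
qed

lemma F1_descend_continuous:
  assumes shift: "\<And>\<beta> \<gamma> x. \<beta> permutes {1..Suc n} \<Longrightarrow> \<gamma> permutes {1..n} \<Longrightarrow> x \<in> points (level X n) \<Longrightarrow>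
      F (\<beta> \<circ> one_times \<gamma>, x) = F (\<beta>, sym_act X n \<gamma> x)"
    and base: "\<And>\<alpha> \<beta>. \<alpha> permutes {1..Suc n} \<Longrightarrow> \<beta> permutes {1..Suc n} \<Longrightarrow>
      F (\<alpha>, base (level X n)) = F (\<beta>, base (level X n))"
    and cont: "\<And>\<alpha>. \<alpha> permutes {1..Suc n} \<Longrightarrow> continuous_map (top_of (level X n)) Z (\<lambda>x. F (\<alpha>, x))"
  shows "continuous_map (top_of (Lev n)) Z (\<lambda>C. the_elem (F ` C))"
proof -
  let ?P = "prod_topology (discrete_topology {\<alpha>. \<alpha> permutes {1..Suc n}}) (top_of (level X n))"
  have "continuous_map ?P Z F"
    by (rule continuous_map_discrete_prod) (simp add: cont)
  then have "continuous_map ?P Z ((\<lambda>C. the_elem (F ` C)) \<circ> F1_class X n)"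
  proof (rule continuous_map_eq)
    fix p
    assume "p \<in> topspace ?P"
    then obtain \<alpha> x where p: "p = (\<alpha>, x)" "\<alpha> permutes {1..Suc n}" "x \<in> points (level X n)"
      by auto
    have "the_elem (F ` cl n \<alpha> x) = F (\<alpha>, x)"
    proof (rule F1_descend)
      show "F (\<beta> \<circ> one_times \<gamma>, x) = F (\<beta>, sym_act X n \<gamma> x)"
        if "\<beta> permutes {1..Suc n}" "\<gamma> permutes {1..n}" "x \<in> points (level X n)" for \<beta> \<gamma> x
        using that by (rule shift)
      show "F (\<alpha>, base (level X n)) = F (\<beta>, base (level X n))"
        if "\<alpha> permutes {1..Suc n}" "\<beta> permutes {1..Suc n}" for \<alpha> \<beta>
        using that by (rule base)
    qed (rule p)+
    then show "F p = ((\<lambda>C. the_elem (F ` C)) \<circ> F1_class X n) p"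
      by (simp only: p(1) o_apply)
  qed
  then show ?thesis
    unfolding top_Lev using continuous_compose_quotient_map_eq[OF quotient_map_quot_topology] by blast
qed

lemma cl_continuous:
  assumes "\<alpha> permutes {1..Suc n}"
  shows "continuous_map (top_of (level X n)) (top_of (Lev n)) (cl n \<alpha>)"
proof -
  let ?P = "prod_topology (discrete_topology {\<alpha>. \<alpha> permutes {1..Suc n}}) (top_of (level X n))"
  have "continuous_map (top_of (level X n)) ?P (\<lambda>x. (\<alpha>, x))"
    using assms by (intro continuous_map_pairedI) simp_all
  moreover have "continuous_map ?P (top_of (Lev n)) (F1_class X n)"
    unfolding top_Lev by (rule quotient_imp_continuous_map[OF quotient_map_quot_topology])
  ultimately have "continuous_map (top_of (level X n)) (top_of (Lev n)) (F1_class X n \<circ> (\<lambda>x. (\<alpha>, x)))"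
    by (rule continuous_map_compose)
  then show ?thesis
    by (simp only: o_def)
qed

text \<open>In the quotient topology it suffices that the preimage is closed, and this preimage
  consists of all pairs with second entry the base point of \<open>X\<close>.\<close>

lemma closedin_base_Lev: "closedin (top_of (Lev n)) {base (Lev n)}"
proof -
  let ?P = "prod_topology (discrete_topology {\<alpha>. \<alpha> permutes {1..Suc n}}) (top_of (level X n))"
  have "{p \<in> topspace ?P. F1_class X n p \<in> {base (Lev n)}} = {\<alpha>. \<alpha> permutes {1..Suc n}} \<times> {base (level X n)}"
    using cl_eq_base_iff[of _ n] base_point[of n] by auto
  moreover have "closedin ?P ({\<alpha>. \<alpha> permutes {1..Suc n}} \<times> {base (level X n)})"
    by (simp add: closedin_prod_Times_iff base_closed)
  moreover have "{base (Lev n)} \<subseteq> points (Lev n)"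
    using cl_point[OF permutes_id base_point] by (simp add: base_Lev)
  moreover have "quotient_map ?P (top_of (Lev n)) (F1_class X n)"
    unfolding top_Lev by (rule quotient_map_quot_topology)
  note conjunct2[OF this[unfolded quotient_map_closedin], rule_format, of "{base (Lev n)}"]
  ultimately show ?thesis
    by simp
qed

end

context equivariant_spectrum
begin

lemma stab_point:
  assumes "x \<in> points (level X n)" "s \<in> points S1"
  shows "stab X n x s \<in> points (level X (Suc n))"
  unfolding stab_def
  by (rule pointed_map_point[OF struct_pointed]) (use assms in \<open>simp add: points_smash\<close>)

lemma stab_base:
  assumes "x = base (level X n) \<or> s = 0"
  shows "stab X n x s = base (level X (Suc n))"
proof -
  have "smash_proj (level X n) S1 (x, s) = base (smash (level X n) S1)"
    by (rule smash_proj_base) (use assms in simp)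
  then show ?thesis
    using struct_pointed by (simp add: stab_def pointed_map_def)
qed

lemma stab_continuous:
  "continuous_map (prod_topology (top_of (level X n)) (top_of S1)) (top_of (level X (Suc n)))
     (\<lambda>p. stab X n (fst p) (snd p))"
proof -
  have "continuous_map (top_of (smash (level X n) S1)) (top_of (level X (Suc n))) (struct_map X n)"
    using struct_pointed by (simp add: pointed_map_def)
  then have "continuous_map (prod_topology (top_of (level X n)) (top_of S1)) (top_of (level X (Suc n)))
      (struct_map X n \<circ> smash_proj (level X n) S1)"
    by (rule continuous_map_compose[OF continuous_map_smash_proj])
  then show ?thesis
    by (simp add: stab_def o_def)
qed

lemma iter_struct_map_Suc: "iter_struct_map X n (Suc m) x t = stab X (n + m) (iter_struct_map X n m x t) (t (Suc m))"
  by (simp add: stab_def)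

lemma iter_point:
  "x \<in> points (level X n) \<Longrightarrow> t \<in> {1..m} \<rightarrow> points S1 \<Longrightarrow> iter_struct_map X n m x t \<in> points (level X (n + m))"
proof (induction m)
  case (Suc m)
  then have "iter_struct_map X n m x t \<in> points (level X (n + m))" "t (Suc m) \<in> points S1"
    by (auto simp: Pi_iff)
  then show ?case
    unfolding iter_struct_map_Suc using stab_point[of _ "n + m"] by simp
qed simp

end

lemma continuous_map_from_smash:
  assumes "continuous_map (prod_topology (top_of A) (top_of B)) Z (f \<circ> smash_proj A B)"
  shows "continuous_map (top_of (smash A B)) Z f"
  unfolding smash_def pointed_space.simps
  using assms continuous_compose_quotient_map_eq[OF quotient_map_quot_topology] by blast

context closed_base_spectrum
begin

lemma base_Lev_point: "base (Lev n) \<in> points (Lev n)"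
  unfolding base_Lev by (rule cl_point[OF permutes_id base_point])

lemma one_times_1 [simp]: "one_times f 1 = 1"
  by (simp add: one_times_def)

lemma F1_descend_pointed:
  assumes shift: "\<And>\<beta> \<gamma> x. \<beta> permutes {1..Suc n} \<Longrightarrow> \<gamma> permutes {1..n} \<Longrightarrow> x \<in> points (level X n) \<Longrightarrow>
      F (\<beta> \<circ> one_times \<gamma>, x) = F (\<beta>, sym_act X n \<gamma> x)"
    and base: "\<And>\<alpha>. \<alpha> permutes {1..Suc n} \<Longrightarrow> F (\<alpha>, base (level X n)) = base B"
    and cont: "\<And>\<alpha>. \<alpha> permutes {1..Suc n} \<Longrightarrow> continuous_map (top_of (level X n)) (top_of B) (\<lambda>x. F (\<alpha>, x))"
  shows "pointed_map (Lev n) B (\<lambda>C. the_elem (F ` C))"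
    and "\<And>\<alpha> x. \<alpha> permutes {1..Suc n} \<Longrightarrow> x \<in> points (level X n) \<Longrightarrow> the_elem (F ` cl n \<alpha> x) = F (\<alpha>, x)"
proof -
  have eq: "F (\<alpha>, base (level X n)) = F (\<beta>, base (level X n))"
    if "\<alpha> permutes {1..Suc n}" "\<beta> permutes {1..Suc n}" for \<alpha> \<beta>
    using base that by simp
  show val: "the_elem (F ` cl n \<alpha> x) = F (\<alpha>, x)" if "\<alpha> permutes {1..Suc n}" "x \<in> points (level X n)" for \<alpha> x
    by (rule F1_descend[OF shift eq that])
  have "continuous_map (top_of (Lev n)) (top_of B) (\<lambda>C. the_elem (F ` C))"
    by (rule F1_descend_continuous[OF shift eq cont])
  moreover have "the_elem (F ` base (Lev n)) = base B"
    unfolding base_Lev val[OF permutes_id base_point] by (rule base[OF permutes_id])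
  ultimately show "pointed_map (Lev n) B (\<lambda>C. the_elem (F ` C))"
    by (simp only: pointed_map_def)
qed

lemma
  assumes \<beta>: "\<beta> permutes {1..Suc n}"
  shows F1_act_pointed: "pointed_map (Lev n) (Lev n) (F1_sym_act X (Suc n) \<beta>)"
    and F1_act_cl: "\<And>\<alpha> x. \<alpha> permutes {1..Suc n} \<Longrightarrow> x \<in> points (level X n) \<Longrightarrow>
      F1_sym_act X (Suc n) \<beta> (cl n \<alpha> x) = cl n (\<beta> \<circ> \<alpha>) x"
proof -
  let ?F = "\<lambda>(\<alpha>, x). cl n (\<beta> \<circ> \<alpha>) x"
  have 1: "?F (\<beta>' \<circ> one_times \<gamma>, x) = ?F (\<beta>', sym_act X n \<gamma> x)"
    if "\<beta>' permutes {1..Suc n}" "\<gamma> permutes {1..n}" "x \<in> points (level X n)" for \<beta>' \<gamma> x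
    using cl_shift[OF permutes_compose[OF that(1) \<beta>] that(2,3)] by (simp only: prod.case o_assoc)
  have 2: "?F (\<alpha>, base (level X n)) = base (Lev n)" if "\<alpha> permutes {1..Suc n}" for \<alpha>
    using cl_base_Lev[OF permutes_compose[OF that \<beta>]] by (simp only: prod.case)
  have 3: "continuous_map (top_of (level X n)) (top_of (Lev n)) (\<lambda>x. ?F (\<alpha>, x))" if "\<alpha> permutes {1..Suc n}" for \<alpha>
    using cl_continuous[OF permutes_compose[OF that \<beta>]] by (simp only: prod.case)
  have eq: "F1_sym_act X (Suc n) \<beta> = (\<lambda>C. the_elem (?F ` C))"
    by (simp add: F1_sym_act_def fun_eq_iff)
  note F = F1_descend_pointed[where F = ?F and B = "Lev n", OF 1 2 3]
  show "pointed_map (Lev n) (Lev n) (F1_sym_act X (Suc n) \<beta>)"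
    unfolding eq by (rule F(1))
  show "F1_sym_act X (Suc n) \<beta> (cl n \<alpha> x) = cl n (\<beta> \<circ> \<alpha>) x"
    if "\<alpha> permutes {1..Suc n}" "x \<in> points (level X n)" for \<alpha> x
  proof -
    have "the_elem (?F ` cl n \<alpha> x) = ?F (\<alpha>, x)"
      by (rule F(2)) (assumption | rule that)+
    then show ?thesis
      by (simp only: eq prod.case)
  qed
qed

text \<open>
  \<open>Lev n\<close> is the wedge of \<open>Suc n\<close> copies of \<open>level X n\<close>, where \<open>cl n \<alpha> x\<close> lies in the copy with index
  \<open>\<alpha> 1\<close>: \<open>cl n (cyc i)\<close> is the inclusion of the copy \<open>i\<close>, \<open>pr n i\<close> the projection to it, and
  \<open>ret n S\<close> the retraction to the copies with index in \<open>S\<close>.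
\<close>

definition pr :: "nat \<Rightarrow> nat \<Rightarrow> ((nat \<Rightarrow> nat) \<times> 'a) set \<Rightarrow> 'a" where
  "pr n i C = the_elem ((\<lambda>(\<alpha>, x). if \<alpha> 1 = i then sym_act X n (shift_down \<alpha>) x else base (level X n)) ` C)"

definition ret :: "nat \<Rightarrow> nat set \<Rightarrow> ((nat \<Rightarrow> nat) \<times> 'a) set \<Rightarrow> ((nat \<Rightarrow> nat) \<times> 'a) set" where
  "ret n S C = the_elem ((\<lambda>(\<alpha>, x). if \<alpha> 1 \<in> S then cl n \<alpha> x else base (Lev n)) ` C)"

lemma pr_pointed: "pointed_map (Lev n) (level X n) (pr n i)"
  and pr_cl: "\<And>\<alpha> x. \<alpha> permutes {1..Suc n} \<Longrightarrow> x \<in> points (level X n) \<Longrightarrow>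
    pr n i (cl n \<alpha> x) = (if \<alpha> 1 = i then sym_act X n (shift_down \<alpha>) x else base (level X n))"
proof -
  let ?F = "\<lambda>(\<alpha>, x). if \<alpha> 1 = i then sym_act X n (shift_down \<alpha>) x else base (level X n)"
  \<comment> \<open>Right multiplication by \<open>1 \<times> \<gamma>\<close> keeps the index
    \<open>\<beta> 1\<close> and multiplies \<open>shift_down \<beta>\<close> by
    \<open>\<gamma>\<close> on the right.\<close>
  have 1: "?F (\<beta> \<circ> one_times \<gamma>, x) = ?F (\<beta>, sym_act X n \<gamma> x)"
    if "\<beta> permutes {1..Suc n}" "\<gamma> permutes {1..n}" "x \<in> points (level X n)" for \<beta> \<gamma> x
    using shift_down_comp_one_times[OF permutes_inj_monoid[OF that(1)] permutes_inj_monoid[OF that(2)]]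
      act_comp[OF shift_down_permutes[OF that(1)] that(2,3)] by simp
  have 2: "?F (\<alpha>, base (level X n)) = base (level X n)" if "\<alpha> permutes {1..Suc n}" for \<alpha>
    using that by (simp add: act_base shift_down_permutes)
  have 3: "continuous_map (top_of (level X n)) (top_of (level X n)) (\<lambda>x. ?F (\<alpha>, x))" if "\<alpha> permutes {1..Suc n}" for \<alpha>
    using act_continuous[OF shift_down_permutes[OF that]] base_point by (cases "\<alpha> 1 = i") simp_all
  have eq: "pr n i = (\<lambda>C. the_elem (?F ` C))"
    by (simp add: pr_def fun_eq_iff)
  note F = F1_descend_pointed[where F = ?F and B = "level X n", OF 1 2 3]
  show "pointed_map (Lev n) (level X n) (pr n i)"
    unfolding eq by (rule F(1))
  show "pr n i (cl n \<alpha> x) = (if \<alpha> 1 = i then sym_act X n (shift_down \<alpha>) x else base (level X n))"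
    if "\<alpha> permutes {1..Suc n}" "x \<in> points (level X n)" for \<alpha> x
  proof -
    have "the_elem (?F ` cl n \<alpha> x) = ?F (\<alpha>, x)"
      by (rule F(2)) (assumption | rule that)+
    then show ?thesis
      by (simp only: eq prod.case)
  qed
qed

lemma ret_pointed: "pointed_map (Lev n) (Lev n) (ret n S)"
  and ret_cl: "\<And>\<alpha> x. \<alpha> permutes {1..Suc n} \<Longrightarrow> x \<in> points (level X n) \<Longrightarrow>
    ret n S (cl n \<alpha> x) = (if \<alpha> 1 \<in> S then cl n \<alpha> x else base (Lev n))"
proof -
  let ?F = "\<lambda>(\<alpha>, x). if \<alpha> 1 \<in> S then cl n \<alpha> x else base (Lev n)"
  have 1: "?F (\<beta> \<circ> one_times \<gamma>, x) = ?F (\<beta>, sym_act X n \<gamma> x)"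
    if "\<beta> permutes {1..Suc n}" "\<gamma> permutes {1..n}" "x \<in> points (level X n)" for \<beta> \<gamma> x
    using cl_shift[OF that] by simp
  have 2: "?F (\<alpha>, base (level X n)) = base (Lev n)" if "\<alpha> permutes {1..Suc n}" for \<alpha>
    using that by (simp add: cl_base_Lev)
  have 3: "continuous_map (top_of (level X n)) (top_of (Lev n)) (\<lambda>x. ?F (\<alpha>, x))" if "\<alpha> permutes {1..Suc n}" for \<alpha>
    using cl_continuous[OF that] base_Lev_point by (cases "\<alpha> 1 \<in> S") simp_all
  have eq: "ret n S = (\<lambda>C. the_elem (?F ` C))"
    by (simp add: ret_def fun_eq_iff)
  note F = F1_descend_pointed[where F = ?F and B = "Lev n", OF 1 2 3]
  show "pointed_map (Lev n) (Lev n) (ret n S)"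
    unfolding eq by (rule F(1))
  show "ret n S (cl n \<alpha> x) = (if \<alpha> 1 \<in> S then cl n \<alpha> x else base (Lev n))"
    if "\<alpha> permutes {1..Suc n}" "x \<in> points (level X n)" for \<alpha> x
  proof -
    have "the_elem (?F ` cl n \<alpha> x) = ?F (\<alpha>, x)"
      by (rule F(2)) (assumption | rule that)+
    then show ?thesis
      by (simp only: eq prod.case)
  qed
qed

lemma inc_pointed:
  assumes "\<alpha> permutes {1..Suc n}"
  shows "pointed_map (level X n) (Lev n) (cl n \<alpha>)"
  using cl_continuous[OF assms] cl_base_Lev[OF assms] by (simp add: pointed_map_def)

lemma ret_base: "ret n S (base (Lev n)) = base (Lev n)"
  using ret_pointed by (simp add: pointed_map_def)

lemma ret_ret: "C \<in> points (Lev n) \<Longrightarrow> ret n T (ret n S C) = ret n (T \<inter> S) C"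
  by (erule LevE) (simp add: ret_cl ret_base)

lemma ret_all: "C \<in> points (Lev n) \<Longrightarrow> {1..Suc n} \<subseteq> S \<Longrightarrow> ret n S C = C"
proof (erule LevE)
  fix \<alpha> x
  assume S: "{1..Suc n} \<subseteq> S" and \<alpha>: "\<alpha> permutes {1..Suc n}" "x \<in> points (level X n)" "C = cl n \<alpha> x"
  have "\<alpha> 1 \<in> S"
    using permutes_in_image[OF \<alpha>(1), of 1] S by auto
  then show "ret n S C = C"
    using \<alpha> by (simp add: ret_cl)
qed

lemma ret_empty: "C \<in> points (Lev n) \<Longrightarrow> ret n {} C = base (Lev n)"
  by (erule LevE) (simp add: ret_cl)

lemma ret_singleton:
  assumes i: "i \<in> {1..Suc n}" and C: "C \<in> points (Lev n)"
  shows "ret n {i} C = cl n (cyc i) (pr n i C)"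
proof -
  obtain \<alpha> x where \<alpha>: "\<alpha> permutes {1..Suc n}" "x \<in> points (level X n)" "C = cl n \<alpha> x"
    using C by (rule LevE)
  have cyc: "cyc i permutes {1..Suc n}"
    using i by (intro cyc_permutes) auto
  show ?thesis
  proof (cases "\<alpha> 1 = i")
    case True
    then show ?thesis
      unfolding \<alpha>(3) ret_cl[OF \<alpha>(1,2)] pr_cl[OF \<alpha>(1,2)] using cl_normal[OF \<alpha>(1,2)] by simp
  next
    case False
    then show ?thesis
      unfolding \<alpha>(3) ret_cl[OF \<alpha>(1,2)] pr_cl[OF \<alpha>(1,2)] by (simp add: cl_base_Lev[OF cyc])
  qed
qed

section \<open>The structure maps of the smash product\<close>

lemma F1_struct_cl:
  assumes "\<alpha> permutes {1..Suc n}" "x \<in> points (level X n)" and s: "s \<in> points S1"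
  shows "F1_struct_map X (Suc n) (cl n \<alpha> x, s) = cl (Suc n) \<alpha> (stab X n x s)"
proof -
  let ?F = "\<lambda>(\<alpha>, x). cl (Suc n) \<alpha> (stab X n x s)"
  have up: "\<alpha> permutes {1..Suc (Suc n)}" if "\<alpha> permutes {1..Suc n}" for \<alpha>
    by (rule permutes_subset[OF that]) simp
  have up': "\<gamma> permutes {1..Suc n}" if "\<gamma> permutes {1..n}" for \<gamma>
    by (rule permutes_subset[OF that]) simp
  have "the_elem (?F ` cl n \<alpha> x) = ?F (\<alpha>, x)"
  proof (rule F1_descend)
    show "?F (\<beta> \<circ> one_times \<gamma>, x) = ?F (\<beta>, sym_act X n \<gamma> x)"
      if "\<beta> permutes {1..Suc n}" "\<gamma> permutes {1..n}" "x \<in> points (level X n)" for \<beta> \<gamma> x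
      using cl_shift[OF up[OF that(1)] up'[OF that(2)] stab_point[OF that(3) s]] act_stab[OF that(2,3) s] by simp
    show "?F (\<alpha>, base (level X n)) = ?F (\<beta>, base (level X n))"
      if "\<alpha> permutes {1..Suc n}" "\<beta> permutes {1..Suc n}" for \<alpha> \<beta>
      using cl_base[OF up[OF that(1)] up[OF that(2)]] by (simp add: stab_base)
  qed (rule assms)+
  then show ?thesis
    by (simp add: F1_struct_map_def stab_def)
qed

lemma F1_smash_simps [simp]:
  "level (F1_smash X) = F1_level X" "sym_act (F1_smash X) = F1_sym_act X" "struct_map (F1_smash X) = F1_struct_map X"
  by (simp_all add: F1_smash_def)

lemma F1_stab_cl:
  assumes \<alpha>: "\<alpha> permutes {1..Suc n}" and x: "x \<in> points (level X n)" and s: "s \<in> points S1"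
  shows "stab (F1_smash X) (Suc n) (cl n \<alpha> x) s = cl (Suc n) \<alpha> (stab X n x s)"
\<comment> \<open>A collapsed point enters the structure map as the pair of base points. There the
  value is the base point, and so is the right-hand side.\<close>
proof (cases "cl n \<alpha> x = base (Lev n) \<or> s = 0")
  case True
  have up: "\<alpha> permutes {1..Suc (Suc n)}"
    by (rule permutes_subset[OF \<alpha>]) simp
  have "smash_proj (Lev n) S1 (cl n \<alpha> x, s) = (base (Lev n), 0)"
    using True by (auto simp: smash_proj_def)
  then have "stab (F1_smash X) (Suc n) (cl n \<alpha> x) s = cl (Suc n) id (stab X n (base (level X n)) 0)"
    using F1_struct_cl[OF permutes_id base_point, of 0] by (simp add: stab_def[of "F1_smash X"] base_Lev points_S1)
  also have "\<dots> = base (Lev (Suc n))"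
    by (simp add: stab_base base_Lev)
  also have "\<dots> = cl (Suc n) \<alpha> (stab X n x s)"
    using True cl_eq_base_iff[OF \<alpha> x] by (simp add: stab_base cl_base_Lev[OF up])
  finally show ?thesis .
next
  case False
  then have "smash_proj (Lev n) S1 (cl n \<alpha> x, s) = (cl n \<alpha> x, s)"
    by (simp add: smash_proj_def)
  then show ?thesis
    using F1_struct_cl[OF assms] by (simp add: stab_def[of "F1_smash X"])
qed

lemma F1_stab_0: "stab (F1_smash X) 0 C s = base (Lev 0)"
  by (simp add: stab_def F1_struct_map_def case_prod_unfold One_nat_def)

lemma closedin_ret_base: "closedin (top_of (Lev n)) {C \<in> points (Lev n). ret n S C = base (Lev n)}"
proof -
  have "continuous_map (top_of (Lev n)) (top_of (Lev n)) (ret n S)"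
    using ret_pointed by (simp add: pointed_map_def)
  from closedin_continuous_map_preimage[OF this closedin_base_Lev] show ?thesis
    by simp
qed

text \<open>
  Each of the finitely many closed copies of \<open>X\<close> in a level is a retract, so continuity of the structure
  map can be checked copy by copy.
\<close>

lemma F1_struct_continuous:
  "continuous_map (top_of (smash (Lev n) S1)) (top_of (Lev (Suc n))) (F1_struct_map X (Suc n))"
proof (rule continuous_map_from_smash)
  let ?P = "prod_topology (top_of (Lev n)) (top_of S1)"
  \<comment> \<open>The copy \<open>i\<close> times the circle, the copy being described as the set
    that the retraction to the other copies sends to the base point; this description shows it to be
    closed.\<close>
  let ?T = "\<lambda>i. {C \<in> points (Lev n). ret n (- {i}) C = base (Lev n)} \<times> points S1"
  let ?f = "\<lambda>i p. cl (Suc n) (cyc i) (stab X n (pr n i (fst p)) (snd p))"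
  have eq: "(F1_struct_map X (Suc n) \<circ> smash_proj (Lev n) S1) p = stab (F1_smash X) (Suc n) (fst p) (snd p)" for p
    by (simp add: stab_def)
  have piece: "stab (F1_smash X) (Suc n) (fst p) (snd p) = ?f i p" if i: "i \<in> {1..Suc n}" and p: "p \<in> ?T i" for i p
  proof -
    have C: "fst p \<in> points (Lev n)" "ret n (- {i}) (fst p) = base (Lev n)" and s: "snd p \<in> points S1"
      using p unfolding mem_Times_iff mem_Collect_eq by blast+
    have cyc: "cyc i permutes {1..Suc n}"
      using i by (intro cyc_permutes) auto
    have pr: "pr n i (fst p) \<in> points (level X n)"
      by (rule pointed_map_point[OF pr_pointed C(1)])
    obtain \<alpha> x where \<alpha>: "\<alpha> permutes {1..Suc n}" "x \<in> points (level X n)" "fst p = cl n \<alpha> x"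
      using C(1) by (rule LevE)
    have "ret n (- {i}) (cl n \<alpha> x) = base (Lev n)"
      using C(2) \<alpha>(3) by simp
    then have "fst p = ret n {i} (fst p)"
      unfolding \<alpha>(3) ret_cl[OF \<alpha>(1,2)] by (cases "\<alpha> 1 = i") simp_all
    then have "fst p = cl n (cyc i) (pr n i (fst p))"
      using ret_singleton[OF i C(1)] by simp
    then show ?thesis
      using F1_stab_cl[OF cyc pr s] by simp
  qed
  have cont: "continuous_map ?P (top_of (Lev (Suc n))) (?f i)" if i: "i \<in> {1..Suc n}" for i
  proof -
    have "cyc i permutes {1..Suc (Suc n)}"
      using i by (intro cyc_permutes) auto
    note cyc = cl_continuous[OF this]
    have pr: "continuous_map (top_of (Lev n)) (top_of (level X n)) (pr n i)"
      using pr_pointed by (simp add: pointed_map_def)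
    have "continuous_map ?P (prod_topology (top_of (level X n)) (top_of S1)) (\<lambda>p. (pr n i (fst p), snd p))"
      by (rule continuous_map_pairedI[OF continuous_map_compose[OF continuous_map_fst pr, unfolded o_def] continuous_map_snd])
    from continuous_map_compose[OF continuous_map_compose[OF this stab_continuous] cyc] show ?thesis
      by (simp add: o_def)
  qed
  show "continuous_map ?P (top_of (Lev (Suc n))) (F1_struct_map X (Suc n) \<circ> smash_proj (Lev n) S1)"
  proof (rule pasting_lemma_closed[where I = "{1..Suc n}" and T = ?T and f = ?f])
    show "closedin ?P (?T i)" for i
      using closedin_topspace[of "top_of S1"] by (simp add: closedin_prod_Times_iff closedin_ret_base)
    show "continuous_map (subtopology ?P (?T i)) (top_of (Lev (Suc n))) (?f i)" if "i \<in> {1..Suc n}" for i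
      by (rule continuous_map_from_subtopology[OF cont[OF that]])
    show "?f i p = ?f j p" if "i \<in> {1..Suc n}" "j \<in> {1..Suc n}" "p \<in> topspace ?P \<inter> ?T i \<inter> ?T j" for i j p
    proof -
      have T: "p \<in> ?T i" "p \<in> ?T j"
        using that(3) unfolding Int_iff by blast+
      show ?thesis
        by (rule trans[OF piece[OF that(1) T(1), symmetric] piece[OF that(2) T(2)]])
    qed
    show "\<exists>j. j \<in> {1..Suc n} \<and> p \<in> ?T j \<and> (F1_struct_map X (Suc n) \<circ> smash_proj (Lev n) S1) p = ?f j p"
      if "p \<in> topspace ?P" for p
    proof -
      have C: "fst p \<in> points (Lev n)" "snd p \<in> points S1"
        using that by (simp_all add: mem_Times_iff)
      obtain \<alpha> x where \<alpha>: "\<alpha> permutes {1..Suc n}" "x \<in> points (level X n)" "fst p = cl n \<alpha> x"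
        using C(1) by (rule LevE)
      have i: "\<alpha> 1 \<in> {1..Suc n}"
        using permutes_in_image[OF \<alpha>(1), of 1] by simp
      have "ret n (- {\<alpha> 1}) (fst p) = base (Lev n)"
        unfolding \<alpha>(3) ret_cl[OF \<alpha>(1,2)] by simp
      with C have T: "p \<in> ?T (\<alpha> 1)"
        unfolding mem_Times_iff mem_Collect_eq by (intro conjI)
      show ?thesis
        by (intro exI[of _ "\<alpha> 1"] conjI i T trans[OF eq piece[OF i T]])
    qed
  qed simp
qed

lemma F1_iter_cl:
  assumes \<alpha>: "\<alpha> permutes {1..Suc n}" and x: "x \<in> points (level X n)"
  shows "t \<in> {1..m} \<rightarrow> points S1 \<Longrightarrow>
    iter_struct_map (F1_smash X) (Suc n) m (cl n \<alpha> x) t = cl (n + m) \<alpha> (iter_struct_map X n m x t)"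
proof (induction m)
  case (Suc m)
  then have t: "t \<in> {1..m} \<rightarrow> points S1" "t (Suc m) \<in> points S1"
    by (auto simp: Pi_iff)
  have "\<alpha> permutes {1..Suc (n + m)}"
    by (rule permutes_subset[OF \<alpha>]) simp
  from F1_stab_cl[OF this iter_point[OF x t(1)] t(2)] show ?case
    using Suc.IH[OF t(1)] by (simp add: stab_def)
qed simp

text \<open>Everything that starts in level 0 enters level 1 at the base point and stays at base
  points.\<close>

lemma F1_iter_0: "iter_struct_map (F1_smash X) 0 (Suc m) C t = base (Lev m)"
proof (induction m)
  case 0
  show ?case
    by (simp add: F1_struct_map_def case_prod_unfold One_nat_def)
next
  case (Suc m)
  have "iter_struct_map (F1_smash X) 0 (Suc (Suc m)) C t
      = struct_map (F1_smash X) (Suc m) (smash_proj (Lev m) S1 (base (Lev m), t (Suc (Suc m))))"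
    using Suc by simp
  also have "\<dots> = base (Lev (Suc m))"
    using F1_stab_cl[OF permutes_id base_point, of 0 m] by (simp add: stab_def[of "F1_smash X"] base_Lev points_S1 smash_proj_def stab_base)
  finally show ?case .
qed

lemma F1_level_0: "top_of (F1_level X 0) = discrete_topology {{}}" "base (F1_level X 0) = {}"
  by (simp_all add: F1_level_def)

sublocale F1: equivariant_spectrum "F1_smash X"
proof (rule equivariant_spectrum.intro)
  fix n
  show "base (level (F1_smash X) n) \<in> points (level (F1_smash X) n)"
    by (cases n) (simp_all add: F1_level_0 base_Lev_point)
  show "pointed_map (smash (level (F1_smash X) n) S1) (level (F1_smash X) (Suc n)) (struct_map (F1_smash X) n)"
  proof (cases n)
    case 0
    then have "struct_map (F1_smash X) n = (\<lambda>_. base (Lev 0))"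
      by (simp add: F1_struct_map_def case_prod_unfold fun_eq_iff One_nat_def)
    then show ?thesis
      using base_Lev_point[of 0] 0 by (simp add: pointed_map_def)
  next
    case (Suc l)
    have "stab (F1_smash X) (Suc l) (cl l id (base (level X l))) 0 = cl (Suc l) id (stab X l (base (level X l)) 0)"
      by (rule F1_stab_cl[OF permutes_id base_point]) (simp add: points_S1)
    then have "F1_struct_map X (Suc l) (base (smash (Lev l) S1)) = base (Lev (Suc l))"
      by (simp add: stab_def[of "F1_smash X"] base_smash smash_proj_def stab_base base_Lev)
    then show ?thesis
      using F1_struct_continuous[of l] Suc by (simp add: pointed_map_def)
  qed
  fix \<gamma>
  assume \<gamma>: "\<gamma> permutes {1..n}"
  show "pointed_map (level (F1_smash X) n) (level (F1_smash X) n) (sym_act (F1_smash X) n \<gamma>)"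
  proof (cases n)
    case 0
    then show ?thesis
      by (simp add: pointed_map_def F1_level_0 F1_sym_act_def)
  next
    case (Suc l)
    then show ?thesis
      using F1_act_pointed[of \<gamma> l] \<gamma> by simp
  qed
next
  fix n C
  assume C: "C \<in> points (level (F1_smash X) n)"
  show "sym_act (F1_smash X) n id C = C"
  proof (cases n)
    case 0
    then show ?thesis
      using C by (simp add: F1_sym_act_def F1_level_0)
  next
    case (Suc l)
    then show ?thesis
      using C by (auto elim!: LevE simp: F1_act_cl[OF permutes_id])
  qed
  fix \<gamma> \<delta>
  assume \<gamma>: "\<gamma> permutes {1..n}" and \<delta>: "\<delta> permutes {1..n}"
  show "sym_act (F1_smash X) n (\<gamma> \<circ> \<delta>) C = sym_act (F1_smash X) n \<gamma> (sym_act (F1_smash X) n \<delta> C)"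
  proof (cases n)
    case 0
    then show ?thesis
      by (simp add: F1_sym_act_def)
  next
    case (Suc l)
    obtain \<alpha> x where \<alpha>: "\<alpha> permutes {1..Suc l}" "x \<in> points (level X l)" "C = cl l \<alpha> x"
      using C Suc by (auto elim: LevE)
    have p: "\<gamma> permutes {1..Suc l}" "\<delta> permutes {1..Suc l}"
      using \<gamma> \<delta> Suc by simp_all
    have "F1_sym_act X (Suc l) (\<gamma> \<circ> \<delta>) (cl l \<alpha> x) = cl l (\<gamma> \<circ> \<delta> \<circ> \<alpha>) x"
      by (rule F1_act_cl[OF permutes_compose[OF p(2,1)] \<alpha>(1,2)])
    moreover have "F1_sym_act X (Suc l) \<gamma> (F1_sym_act X (Suc l) \<delta> (cl l \<alpha> x)) = cl l (\<gamma> \<circ> (\<delta> \<circ> \<alpha>)) x"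
      unfolding F1_act_cl[OF p(2) \<alpha>(1,2)] by (rule F1_act_cl[OF p(1) permutes_compose[OF \<alpha>(1) p(2)] \<alpha>(2)])
    ultimately show ?thesis
      unfolding Suc \<alpha>(3) by (simp only: F1_smash_simps comp_assoc)
  qed
next
  fix n m :: nat and \<gamma> \<delta> C t
  assume \<gamma>: "\<gamma> permutes {1..n}" and \<delta>: "\<delta> permutes {1..m}"
    and C: "C \<in> points (level (F1_smash X) n)" and t: "t \<in> {1..m} \<rightarrow> points S1"
  let ?t = "t \<circ> inv_into UNIV \<delta>"
  have t': "?t \<in> {1..m} \<rightarrow> points S1"
    using t permutes_in_image[OF permutes_inv[OF \<delta>]] by (auto simp only: Pi_iff o_apply)
  show "iter_struct_map (F1_smash X) n m (sym_act (F1_smash X) n \<gamma> C) ?t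
      = sym_act (F1_smash X) (n + m) (block_perm n \<gamma> \<delta>) (iter_struct_map (F1_smash X) n m C t)"
  proof (cases n)
    case 0
    show ?thesis
    proof (cases m)
      case 0
      then show ?thesis
        using C \<open>n = 0\<close> by (simp add: F1_sym_act_def)
    next
      case (Suc l)
      have "block_perm 0 \<gamma> \<delta> permutes {1..Suc l}"
        using permutes_compose[OF conjunct1[OF block_perm_id_permutes_sign[OF \<delta>, of 0]], of \<gamma>]
          permutes_subset[OF \<gamma>, of "{1..m}"] block_perm_eq_comp[OF \<gamma> \<delta>] \<open>n = 0\<close> Suc by simp
      then have "pointed_map (Lev l) (Lev l) (F1_sym_act X (Suc l) (block_perm 0 \<gamma> \<delta>))"
        by (rule F1_act_pointed)
      then show ?thesis
        unfolding \<open>n = 0\<close> Suc F1_iter_0 by (simp add: pointed_map_def)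
    qed
  next
    case (Suc l)
    obtain \<alpha> x where \<alpha>: "\<alpha> permutes {1..Suc l}" and x: "x \<in> points (level X l)" and C_eq: "C = cl l \<alpha> x"
      using C Suc by (auto elim: LevE)
    have \<gamma>': "\<gamma> permutes {1..Suc l}"
      using \<gamma> Suc by simp
    define \<beta> where "\<beta> = block_perm l id \<delta>"
    define y where "y = iter_struct_map X l m x t"
    have \<beta>: "\<beta> permutes {1..l + m}"
      unfolding \<beta>_def using block_perm_id_permutes_sign[OF \<delta>] by blast
    have y: "y \<in> points (level X (l + m))"
      unfolding y_def by (rule iter_point[OF x t])
    have up: "\<alpha>' permutes {1..Suc (l + m)}" if "\<alpha>' permutes {1..Suc l}" for \<alpha>'
      by (rule permutes_subset[OF that]) simp
    have "iter_struct_map (F1_smash X) (Suc l) m (F1_sym_act X (Suc l) \<gamma> C) ?t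
        = cl (l + m) (\<gamma> \<circ> \<alpha>) (iter_struct_map X l m x ?t)"
      unfolding C_eq F1_act_cl[OF \<gamma>' \<alpha> x] by (rule F1_iter_cl[OF permutes_compose[OF \<alpha> \<gamma>'] x t'])
    also have "iter_struct_map X l m x ?t = sym_act X (l + m) \<beta> y"
      using equivariant[OF permutes_id \<delta> x t] by (simp only: act_id[OF x] \<beta>_def y_def)
    also have "cl (l + m) (\<gamma> \<circ> \<alpha>) \<dots> = cl (l + m) (\<gamma> \<circ> \<alpha> \<circ> one_times \<beta>) y"
      by (rule cl_shift[OF up[OF permutes_compose[OF \<alpha> \<gamma>']] \<beta> y, symmetric])
    \<comment> \<open>\<open>1 \<times> \<beta>\<close> permutes only the last \<open>m\<close>
      letters, which \<open>\<alpha>\<close> leaves alone, so it can be moved past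
      \<open>\<alpha>\<close> to form a block permutation with \<open>\<gamma>\<close>.\<close>
    also have "\<gamma> \<circ> \<alpha> \<circ> one_times \<beta> = block_perm (Suc l) \<gamma> \<delta> \<circ> \<alpha>"
      unfolding \<beta>_def one_times_block block_perm_eq_comp[OF \<gamma>' \<delta>]
      by (simp only: comp_assoc block_perm_commute[OF \<alpha> \<delta>])
    also have "cl (l + m) (block_perm (Suc l) \<gamma> \<delta> \<circ> \<alpha>) y
        = F1_sym_act X (Suc (l + m)) (block_perm (Suc l) \<gamma> \<delta>) (cl (l + m) \<alpha> y)"
    proof (rule F1_act_cl[OF _ up[OF \<alpha>] y, symmetric])
      show "block_perm (Suc l) \<gamma> \<delta> permutes {1..Suc (l + m)}"
        using permutes_compose[OF _ up[OF \<gamma>']] block_perm_id_permutes_sign[OF \<delta>, of "Suc l"]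
        unfolding block_perm_eq_comp[OF \<gamma>' \<delta>] by simp
    qed
    also have "cl (l + m) \<alpha> y = iter_struct_map (F1_smash X) (Suc l) m C t"
      unfolding C_eq y_def by (rule F1_iter_cl[OF \<alpha> x t, symmetric])
    finally show ?thesis
      unfolding Suc by (simp only: F1_smash_simps add_Suc)
  qed
qed

end

lemma homotopy_map_const:
  assumes "base B \<in> points B" "c \<in> carrier (homotopy_group m A)"
  shows "homotopy_map m B (\<lambda>_. base B) c = \<one>\<^bsub>homotopy_group m B\<^esub>"
proof -
  obtain g where g: "g \<in> cube_maps m A" "c = cube_class m A g"
    using assms(2) by (rule homotopy_groupE)
  have "homotopy_map m B (\<lambda>_. base B) c = cube_class m B ((\<lambda>_. base B) \<circ> g)"
    unfolding g(2) by (rule homotopy_map_class[OF g(1)]) (simp add: pointed_map_def assms(1))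
  then show ?thesis
    by (simp add: one_homotopy_group o_def)
qed

lemma sign_mult_self: "sign p * sign p = (1 :: int)"
  by (simp add: sign_def)

context closed_base_spectrum
begin

section \<open>Inclusions, projections and retractions on homotopy groups\<close>

abbreviation up :: "int \<Rightarrow> nat \<Rightarrow> (nat \<Rightarrow> nat) \<Rightarrow> ((nat \<Rightarrow> real) \<Rightarrow> 'a) set \<Rightarrow> ((nat \<Rightarrow> real) \<Rightarrow> ((nat \<Rightarrow> nat) \<times> 'a) set) set" where
  "up k n \<alpha> \<equiv> homotopy_map (sdim (k + 1) n) (Lev n) (cl n \<alpha>)"

abbreviation down :: "int \<Rightarrow> nat \<Rightarrow> nat \<Rightarrow> ((nat \<Rightarrow> real) \<Rightarrow> ((nat \<Rightarrow> nat) \<times> 'a) set) set \<Rightarrow> ((nat \<Rightarrow> real) \<Rightarrow> 'a) set" where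
  "down k n i \<equiv> homotopy_map (sdim k (Suc n)) (level X n) (pr n i)"

abbreviation retr :: "int \<Rightarrow> nat \<Rightarrow> nat set \<Rightarrow> ((nat \<Rightarrow> real) \<Rightarrow> ((nat \<Rightarrow> nat) \<times> 'a) set) set
    \<Rightarrow> ((nat \<Rightarrow> real) \<Rightarrow> ((nat \<Rightarrow> nat) \<times> 'a) set) set" where
  "retr k n S \<equiv> homotopy_map (sdim k (Suc n)) (Lev n) (ret n S)"

lemma level_group_F1: "level_group (F1_smash X) k (Suc n) = homotopy_group (sdim (k + 1) n) (Lev n)"
  unfolding level_group_def dim_shift by simp

lemma up_hom:
  assumes "n \<in> stable_range (k + 1)" "\<alpha> permutes {1..Suc n}"
  shows "up k n \<alpha> \<in> hom (level_group X (k + 1) n) (level_group (F1_smash X) k (Suc n))"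
  unfolding level_group_F1 level_group_def[of X]
  by (rule homotopy_map_hom[OF inc_pointed[OF assms(2)] base_point base_Lev_point dim_ge_2[OF assms(1)]])

lemma down_hom:
  assumes "n \<in> stable_range (k + 1)"
  shows "down k n i \<in> hom (level_group (F1_smash X) k (Suc n)) (level_group X (k + 1) n)"
  unfolding level_group_F1 level_group_def[of X] dim_shift
  by (rule homotopy_map_hom[OF pr_pointed base_Lev_point base_point dim_ge_2[OF assms]])

lemma up_iota:
  assumes n: "n \<in> stable_range (k + 1)" and \<alpha>: "\<alpha> permutes {1..Suc n}" and c: "c \<in> carrier (level_group X (k + 1) n)"
  shows "up k (Suc n) \<alpha> (iota X (k + 1) n c) = iota (F1_smash X) k (Suc n) (up k n \<alpha> c)"
proof (rule iota_natural[OF equivariant_spectrum_axioms F1.equivariant_spectrum_axioms n _ dim_shift[symmetric] _ _ _ c,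
      unfolded F1_smash_simps])
  show "Suc n \<in> stable_range k"
    using n by (simp only: stable_range_shift)
  have "\<alpha> permutes {1..Suc (Suc n)}"
    by (rule permutes_subset[OF \<alpha>]) simp
  then show "pointed_map (level X (Suc n)) (Lev (Suc n)) (cl (Suc n) \<alpha>)"
    by (rule inc_pointed)
  show "pointed_map (level X n) (Lev n) (cl n \<alpha>)"
    by (rule inc_pointed[OF \<alpha>])
  show "cl (Suc n) \<alpha> (stab X n x s) = stab (F1_smash X) (Suc n) (cl n \<alpha> x) s"
    if "x \<in> points (level X n)" "s \<in> points S1" for x s
    by (rule F1_stab_cl[OF \<alpha> that, symmetric])
qed

text \<open>Stabilization keeps the permutation and hence the index of the copy, so it commutes with
  the projection to a fixed copy.\<close>

lemma pr_stab:
  assumes C: "C \<in> points (Lev n)" and s: "s \<in> points S1"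
  shows "pr (Suc n) i (stab (F1_smash X) (Suc n) C s) = stab X n (pr n i C) s"
proof -
  obtain \<alpha> x where \<alpha>: "\<alpha> permutes {1..Suc n}" and x: "x \<in> points (level X n)" and C_eq: "C = cl n \<alpha> x"
    using C by (rule LevE)
  have "\<alpha> permutes {1..Suc (Suc n)}"
    by (rule permutes_subset[OF \<alpha>]) simp
  note pr' = pr_cl[OF this stab_point[OF x s]]
  show ?thesis
    unfolding C_eq F1_stab_cl[OF \<alpha> x s] pr' pr_cl[OF \<alpha> x]
    using act_stab[OF shift_down_permutes[OF \<alpha>] x s] by (simp add: stab_base)
qed

lemma down_iota:
  assumes n: "n \<in> stable_range (k + 1)" and c: "c \<in> carrier (level_group (F1_smash X) k (Suc n))"
  shows "down k (Suc n) i (iota (F1_smash X) k (Suc n) c) = iota X (k + 1) n (down k n i c)"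
proof (rule iota_natural[OF F1.equivariant_spectrum_axioms equivariant_spectrum_axioms _ n dim_shift _ _ _ c])
  show "Suc n \<in> stable_range k"
    using n by (simp only: stable_range_shift)
qed (simp_all add: pr_pointed pr_stab)

subsection \<open>The unit map\<close>

text \<open>The inclusion of the copy with index 1, from level \<open>n\<close> to level
  \<open>1 + n\<close>. It comes from a morphism from \<open>X\<close> to the shift of the smash
  product, which accounts for the twist by \<open>1 \<times> -\<close> in
  \<open>eta_action\<close>.\<close>

definition eta :: "int \<Rightarrow> (nat \<times> ((nat \<Rightarrow> real) \<Rightarrow> 'a) set) set
    \<Rightarrow> (nat \<times> ((nat \<Rightarrow> real) \<Rightarrow> ((nat \<Rightarrow> nat) \<times> 'a) set) set) set" where
  "eta k c = the_elem ((\<lambda>(n, x). F1.sc.cls k (Suc n) (up k n id x)) ` c)"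

lemma
  shows eta_hom: "eta k \<in> hom (add_monoid (sc.colim (k + 1))) (add_monoid (F1.sc.colim k))"
    and eta_cls: "\<And>n x. n \<in> stable_range (k + 1) \<Longrightarrow> x \<in> carrier (level_group X (k + 1) n) \<Longrightarrow>
      eta k (sc.cls (k + 1) n x) = F1.sc.cls k (Suc n) (up k n id x)"
proof -
  let ?\<phi> = "\<lambda>n x. F1.sc.cls k (Suc n) (up k n id x)"
  have 1: "?\<phi> n \<in> hom (level_group X (k + 1) n) (add_monoid (F1.sc.colim k))"
    if "n \<in> stable_range (k + 1)" for n
    using hom_compose[OF up_hom[OF that permutes_id] F1.sc.cls_hom[OF that[folded stable_range_shift]]] by (simp only: o_def)
  have 2: "?\<phi> (Suc n) (iota X (k + 1) n x) = ?\<phi> n x"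
    if "n \<in> stable_range (k + 1)" "x \<in> carrier (level_group X (k + 1) n)" for n x
    unfolding up_iota[OF that(1) permutes_id that(2)]
    by (rule F1.sc.cls_step[OF that(1)[folded stable_range_shift] hom_in_carrier[OF up_hom[OF that(1) permutes_id] that(2)]])
  show "eta k \<in> hom (add_monoid (sc.colim (k + 1))) (add_monoid (F1.sc.colim k))"
    by (rule sc.colim_lift_the_elem(1)[OF F1.sc.abelian_group_colim 1 2 eta_def])
  show "eta k (sc.cls (k + 1) n x) = F1.sc.cls k (Suc n) (up k n id x)"
    if "n \<in> stable_range (k + 1)" "x \<in> carrier (level_group X (k + 1) n)" for n x
    by (rule sc.colim_lift_the_elem(2)[OF F1.sc.abelian_group_colim 1 2 eta_def that])
qed

lemma act_up:
  assumes n: "n \<in> stable_range (k + 1)" and \<alpha>: "\<alpha> permutes {1..Suc n}" and \<beta>: "\<beta> permutes {1..Suc n}"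
    and x: "x \<in> carrier (level_group X (k + 1) n)"
  shows "homotopy_map (sdim k (Suc n)) (level (F1_smash X) (Suc n)) (sym_act (F1_smash X) (Suc n) \<beta>) (up k n \<alpha> x)
    = up k n (\<beta> \<circ> \<alpha>) x"
proof -
  have xc: "x \<in> carrier (homotopy_group (sdim (k + 1) n) (level X n))"
    using x by (simp only: carrier_level_group)
  have "homotopy_map (sdim (k + 1) n) (Lev n) (F1_sym_act X (Suc n) \<beta>) (up k n \<alpha> x)
      = homotopy_map (sdim (k + 1) n) (Lev n) (F1_sym_act X (Suc n) \<beta> \<circ> cl n \<alpha>) x"
    by (rule homotopy_map_comp[OF inc_pointed[OF \<alpha>] F1_act_pointed[OF \<beta>] xc, symmetric])
  also have "\<dots> = up k n (\<beta> \<circ> \<alpha>) x"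
    by (rule homotopy_map_cong[OF pointed_map_comp[OF inc_pointed[OF \<alpha>] F1_act_pointed[OF \<beta>]]
          inc_pointed[OF permutes_compose[OF \<alpha> \<beta>]] _ xc])
      (simp only: o_apply F1_act_cl[OF \<beta> \<alpha>])
  finally show ?thesis
    unfolding F1_smash_simps dim_shift .
qed

text \<open>On points this is the defining relation [1 \<times> \<gamma>, x] = [id, \<gamma> x] of
  the balanced product.\<close>

lemma up_one_times:
  assumes n: "n \<in> stable_range (k + 1)" and \<gamma>: "\<gamma> permutes {1..n}" and x: "x \<in> carrier (level_group X (k + 1) n)"
  shows "up k n (one_times \<gamma>) x = up k n id (homotopy_map (sdim (k + 1) n) (level X n) (sym_act X n \<gamma>) x)"
proof -
  have xc: "x \<in> carrier (homotopy_group (sdim (k + 1) n) (level X n))"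
    using x by (simp only: carrier_level_group)
  have "up k n (one_times \<gamma>) x = homotopy_map (sdim (k + 1) n) (Lev n) (cl n id \<circ> sym_act X n \<gamma>) x"
    by (rule homotopy_map_cong[OF inc_pointed[OF one_times_permutes[OF \<gamma>]]
          pointed_map_comp[OF act_pointed[OF \<gamma>] inc_pointed[OF permutes_id]] _ xc])
      (simp only: o_apply cl_shift[OF permutes_id \<gamma>, symmetric] id_comp)
  also have "\<dots> = up k n id (homotopy_map (sdim (k + 1) n) (level X n) (sym_act X n \<gamma>) x)"
    by (rule homotopy_map_comp[OF act_pointed[OF \<gamma>] inc_pointed[OF permutes_id] xc])
  finally show ?thesis .
qed

lemma sign_one_times:
  assumes "\<gamma> permutes {1..n}"
  shows "sign (one_times \<gamma>) = sign \<gamma>"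
  using block_perm_id_permutes_sign[OF assms, of 1] one_times_eq_block[of \<gamma>] permutes_not_in[OF assms, of 0] by simp

text \<open>If \<open>\<gamma>\<close> extends \<open>g\<close> on {1..n}, then
  \<open>1 \<times> \<gamma>\<close> extends \<open>1 \<times> g\<close> on {1..1+n} with the same
  sign, and on the copy with index 1 it acts through \<open>\<gamma>\<close>.\<close>

lemma eta_action:
  assumes g: "g \<in> carrier inj_monoid" and c: "c \<in> carrier (sc.colim (k + 1))"
  shows "eta k (inj_action X (k + 1) g c) = inj_action (F1_smash X) k (one_times g) (eta k c)"
proof -
  obtain n x where n: "n \<in> stable_range (k + 1)" and x: "x \<in> carrier (level_group X (k + 1) n)" and c_eq: "c = sc.cls (k + 1) n x"
    using c by (rule sc.colimE)
  obtain \<gamma> m where \<gamma>: "\<gamma> permutes {1..m}" "\<And>i. i \<in> {1..n} \<Longrightarrow> \<gamma> i = g i" "n \<le> m"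
    by (rule extend_injection_max[OF g], rule that)
  have m: "m \<in> stable_range (k + 1)"
    by (rule sc.index_le[OF n \<gamma>(3)])
  have n': "Suc n \<in> stable_range k" and m': "Suc m \<in> stable_range k"
    using n m by (simp_all only: stable_range_shift)
  define y where "y = seq_iter (iota X (k + 1)) n (m - n) x"
  have y: "y \<in> carrier (level_group X (k + 1) m)"
    unfolding y_def by (rule sc.seq_iter_closed[OF n \<gamma>(3) x])
  define z where "z = homotopy_map (sdim (k + 1) m) (level X m) (sym_act X m \<gamma>) y"
  have z: "z \<in> carrier (level_group X (k + 1) m)"
    unfolding z_def by (rule hom_in_carrier[OF act_hom[OF m \<gamma>(1)] y])
  have iter: "seq_iter (iota (F1_smash X) k) (Suc n) (Suc m - Suc n) (up k n id x) = up k m id y"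
  proof -
    have "up k (n + d) id (seq_iter (iota X (k + 1)) n d x) = seq_iter (iota (F1_smash X) k) (Suc n) d (up k (n + 0) id x)" for d
    proof (rule seq_iter_natural[where \<phi> = "\<lambda>d. up k (n + d) id"])
      fix d
      have "n + d \<in> stable_range (k + 1)"
        by (rule sc.index_le[OF n]) simp
      from up_iota[OF this permutes_id hom_in_carrier[OF sc.seq_iter_hom[OF n] x]]
      show "up k (n + Suc d) id (iota X (k + 1) (n + d) (seq_iter (iota X (k + 1)) n d x))
          = iota (F1_smash X) k (Suc n + d) (up k (n + d) id (seq_iter (iota X (k + 1)) n d x))"
        by (simp only: add_Suc_right add_Suc)
    qed
    from this[of "m - n"] show ?thesis
      using \<gamma>(3) by (simp add: y_def)
  qed
  have "inj_action X (k + 1) g c = act_val X (k + 1) n x m \<gamma>"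
    unfolding c_eq by (rule inj_action_cls[OF g n x \<gamma>(3,1,2)])
  then have "inj_action X (k + 1) g c = sc.cls (k + 1) m (z [^]\<^bsub>level_group X (k + 1) m\<^esub> sign \<gamma>)"
    unfolding act_val_def stable_class_eq z_def y_def .
  then have "eta k (inj_action X (k + 1) g c) = F1.sc.cls k (Suc m) (up k m id (z [^]\<^bsub>level_group X (k + 1) m\<^esub> sign \<gamma>))"
    by (simp only: eta_cls[OF m group.int_pow_closed[OF group_level_group[OF m] z]])
  also have "up k m id (z [^]\<^bsub>level_group X (k + 1) m\<^esub> sign \<gamma>)
      = up k m id z [^]\<^bsub>level_group (F1_smash X) k (Suc m)\<^esub> sign \<gamma>"
    by (rule hom_int_pow[OF up_hom[OF m permutes_id] z group_level_group[OF m] F1.group_level_group[OF m']])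
  also have "up k m id z = homotopy_map (sdim k (Suc m)) (level (F1_smash X) (Suc m))
      (sym_act (F1_smash X) (Suc m) (one_times \<gamma>)) (up k m id y)"
    unfolding act_up[OF m permutes_id one_times_permutes[OF \<gamma>(1)] y] comp_id up_one_times[OF m \<gamma>(1) y] z_def ..
  also have "F1.sc.cls k (Suc m) (\<dots> [^]\<^bsub>level_group (F1_smash X) k (Suc m)\<^esub> sign \<gamma>)
      = act_val (F1_smash X) k (Suc n) (up k n id x) (Suc m) (one_times \<gamma>)"
    unfolding act_val_def F1.stable_class_eq iter sign_one_times[OF \<gamma>(1)] ..
  also have "\<dots> = inj_action (F1_smash X) k (one_times g) (F1.sc.cls k (Suc n) (up k n id x))"
  proof (rule F1.inj_action_cls[OF one_times_inj_monoid[OF g] n' hom_in_carrier[OF up_hom[OF n permutes_id] x] _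
        one_times_permutes[OF \<gamma>(1)], symmetric])
    show "one_times \<gamma> i = one_times g i" if "i \<in> {1..Suc n}" for i
    proof (cases "i \<le> 1")
      case False
      then have "i - 1 \<in> {1..n}"
        using that by auto
      then show ?thesis
        using \<gamma>(2) by (simp add: one_times_def)
    qed (simp add: one_times_def)
  qed (use \<gamma>(3) in simp)
  finally show ?thesis
    unfolding c_eq eta_cls[OF n x] .
qed

text \<open>The cycle is itself a permutation of the letters of level \<open>1 + n\<close>, so no
  stabilization occurs. It moves the copy 1 to the copy \<open>i\<close> and contributes its
  sign.\<close>

lemma cyc_eta:
  assumes n: "n \<in> stable_range (k + 1)" and x: "x \<in> carrier (level_group X (k + 1) n)" and i: "i \<in> {1..Suc n}"
  shows "inj_action (F1_smash X) k (cyc i) (eta k (sc.cls (k + 1) n x))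
    = F1.sc.cls k (Suc n) (up k n (cyc i) x [^]\<^bsub>level_group (F1_smash X) k (Suc n)\<^esub> sign (cyc i))"
proof -
  have cyc: "cyc i permutes {1..Suc n}" "cyc i \<in> carrier inj_monoid"
    using i cyc_permutes[of i "Suc n"] cyc_inj_monoid[of i] by simp_all
  have n': "Suc n \<in> stable_range k"
    using n by (simp only: stable_range_shift)
  have "inj_action (F1_smash X) k (cyc i) (F1.sc.cls k (Suc n) (up k n id x))
      = act_val (F1_smash X) k (Suc n) (up k n id x) (Suc n) (cyc i)"
    by (rule F1.inj_action_cls[OF cyc(2) n' hom_in_carrier[OF up_hom[OF n permutes_id] x] order_refl cyc(1) refl])
  also have "\<dots> = F1.sc.cls k (Suc n) (up k n (cyc i) x [^]\<^bsub>level_group (F1_smash X) k (Suc n)\<^esub> sign (cyc i))"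
    unfolding act_val_def F1.stable_class_eq diff_self_eq_0 seq_iter.simps
      act_up[OF n permutes_id cyc(1) x] comp_id ..
  finally show ?thesis
    unfolding eta_cls[OF n x] .
qed

text \<open>As a sign squares to 1, the sign in \<open>cyc_eta\<close> can be moved to the argument.
  Classes coming from a single copy thus belong to the generators.\<close>

lemma cls_up_cyc:
  assumes n: "n \<in> stable_range (k + 1)" and x: "x \<in> carrier (level_group X (k + 1) n)" and i: "i \<in> {1..Suc n}"
  shows "F1.sc.cls k (Suc n) (up k n (cyc i) x)
    = inj_action (F1_smash X) k (cyc i) (eta k (sc.cls (k + 1) n (x [^]\<^bsub>level_group X (k + 1) n\<^esub> sign (cyc i))))"
proof -
  interpret L: group "level_group X (k + 1) n"
    by (rule group_level_group[OF n])
  have n': "Suc n \<in> stable_range k"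
    using n by (simp only: stable_range_shift)
  interpret F: group "level_group (F1_smash X) k (Suc n)"
    by (rule F1.group_level_group[OF n'])
  have cyc: "cyc i permutes {1..Suc n}"
    using i cyc_permutes[of i "Suc n"] by simp
  have u: "up k n (cyc i) x \<in> carrier (level_group (F1_smash X) k (Suc n))"
    by (rule hom_in_carrier[OF up_hom[OF n cyc] x])
  show ?thesis
    unfolding cyc_eta[OF n L.int_pow_closed[OF x] i] hom_int_pow[OF up_hom[OF n cyc] x L.is_group F.is_group]
      F.int_pow_pow[OF u] sign_mult_self F.int_pow_1[OF u] ..
qed

end

context closed_base_spectrum
begin

subsection \<open>The projections onto the summands\<close>

text \<open>Level 0 of the smash product corresponds to no level of \<open>X\<close>; its group is
  trivial, so the value there is zero.\<close>

definition proj :: "int \<Rightarrow> nat \<Rightarrow> (nat \<times> ((nat \<Rightarrow> real) \<Rightarrow> ((nat \<Rightarrow> nat) \<times> 'a) set) set) set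
    \<Rightarrow> (nat \<times> ((nat \<Rightarrow> real) \<Rightarrow> 'a) set) set" where
  "proj k i c = the_elem ((\<lambda>(n, z). case n of
     0 \<Rightarrow> \<zero>\<^bsub>sc.colim (k + 1)\<^esub>
   | Suc l \<Rightarrow> sc.cls (k + 1) l (down k l i z)) ` c)"

lemma level_group_F1_0:
  assumes "z \<in> carrier (level_group (F1_smash X) k 0)"
  shows "z = \<one>\<^bsub>level_group (F1_smash X) k 0\<^esub>"
proof -
  obtain g where g: "g \<in> cube_maps (sdim k 0) (F1_level X 0)" "z = cube_class (sdim k 0) (F1_level X 0) g"
    using assms unfolding level_group_def F1_smash_simps by (rule homotopy_groupE)
  have "(g, \<lambda>_. base (F1_level X 0)) \<in> cube_homotopic (sdim k 0) (F1_level X 0)"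
    by (rule cube_homotopic_eq[OF g(1)]) (use cube_maps_point[OF g(1)] in \<open>simp add: F1_level_0\<close>)
  then show ?thesis
    unfolding g(2) level_group_def F1_smash_simps one_homotopy_group by (rule cube_class_eq)
qed

lemma
  shows proj_hom: "proj k i \<in> hom (add_monoid (F1.sc.colim k)) (add_monoid (sc.colim (k + 1)))"
    and proj_cls: "\<And>n z. n \<in> stable_range (k + 1) \<Longrightarrow> z \<in> carrier (level_group (F1_smash X) k (Suc n)) \<Longrightarrow>
      proj k i (F1.sc.cls k (Suc n) z) = sc.cls (k + 1) n (down k n i z)"
proof -
  let ?\<phi> = "\<lambda>n z. case n of 0 \<Rightarrow> \<zero>\<^bsub>sc.colim (k + 1)\<^esub> | Suc l \<Rightarrow> sc.cls (k + 1) l (down k l i z)"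
  interpret A: abelian_group "sc.colim (k + 1)"
    by (rule sc.abelian_group_colim)
  have lev_hom: "(\<lambda>z. sc.cls (k + 1) l (down k l i z)) \<in> hom (level_group (F1_smash X) k (Suc l)) (add_monoid (sc.colim (k + 1)))"
    if "l \<in> stable_range (k + 1)" for l
    using hom_compose[OF down_hom[OF that] sc.cls_hom[OF that]] by (simp only: o_def)
  have 1: "?\<phi> n \<in> hom (level_group (F1_smash X) k n) (add_monoid (sc.colim (k + 1)))"
    if "n \<in> stable_range k" for n
  proof (cases n)
    case 0
    then show ?thesis
      by (simp add: hom_def)
  next
    case (Suc l)
    then show ?thesis
      using lev_hom[of l] that by (simp add: stable_range_shift)
  qed
  have 2: "?\<phi> (Suc n) (iota (F1_smash X) k n z) = ?\<phi> n z"
    if n: "n \<in> stable_range k" and z: "z \<in> carrier (level_group (F1_smash X) k n)" for n z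
  proof (cases n)
    case 0
    have z1: "z = \<one>\<^bsub>level_group (F1_smash X) k 0\<^esub>"
      using z unfolding 0 by (rule level_group_F1_0)
    have r: "0 \<in> stable_range k" "Suc 0 \<in> stable_range k"
      using n 0 stable_range_Suc by simp_all
    have "iota (F1_smash X) k 0 z = \<one>\<^bsub>level_group (F1_smash X) k (Suc 0)\<^esub>"
      unfolding z1 by (rule hom_one[OF F1.iota_hom[OF r(1)] F1.group_level_group[OF r(1)] F1.group_level_group[OF r(2)]])
    moreover have "sc.cls (k + 1) 0 (down k 0 i \<one>\<^bsub>level_group (F1_smash X) k (Suc 0)\<^esub>) = \<zero>\<^bsub>sc.colim (k + 1)\<^esub>"
      using hom_one[OF lev_hom F1.group_level_group[OF r(2)] abelian_group.a_group[OF sc.abelian_group_colim]] r(2) by (simp add: stable_range_shift)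
    ultimately show ?thesis
      unfolding 0 by simp
  next
    case (Suc l)
    have l: "l \<in> stable_range (k + 1)" and z': "z \<in> carrier (level_group (F1_smash X) k (Suc l))"
      using n z unfolding Suc stable_range_shift .
    show ?thesis
      using sc.cls_step[OF l hom_in_carrier[OF down_hom[OF l] z'], of i] down_iota[OF l z', of i] by (simp add: Suc)
  qed
  show "proj k i \<in> hom (add_monoid (F1.sc.colim k)) (add_monoid (sc.colim (k + 1)))"
    by (rule F1.sc.colim_lift_the_elem(1)[OF sc.abelian_group_colim 1 2 proj_def])
  show "proj k i (F1.sc.cls k (Suc n) z) = sc.cls (k + 1) n (down k n i z)"
    if "n \<in> stable_range (k + 1)" "z \<in> carrier (level_group (F1_smash X) k (Suc n))" for n z
    using F1.sc.colim_lift_the_elem(2)[OF sc.abelian_group_colim 1 2 proj_def that(1)[folded stable_range_shift] that(2)]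
    by (simp only: nat.case)
qed

text \<open>On points, including the copy \<open>i\<close> and projecting to the copy
  \<open>j\<close> is constant or, for i = j, the action of \<open>shift_down (cyc i)\<close>, which
  is the identity.\<close>

lemma down_up:
  assumes n: "n \<in> stable_range (k + 1)" and x: "x \<in> carrier (level_group X (k + 1) n)" and i: "i \<in> {1..Suc n}"
  shows "down k n j (up k n (cyc i) x) = (if i = j then x else \<one>\<^bsub>level_group X (k + 1) n\<^esub>)"
proof -
  have xc: "x \<in> carrier (homotopy_group (sdim (k + 1) n) (level X n))"
    using x by (simp only: carrier_level_group)
  have cyc: "cyc i permutes {1..Suc n}"
    using i cyc_permutes[of i "Suc n"] by simp
  have comp: "pointed_map (level X n) (level X n) (pr n j \<circ> cl n (cyc i))"
    by (rule pointed_map_comp[OF inc_pointed[OF cyc] pr_pointed])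
  have "down k n j (up k n (cyc i) x) = homotopy_map (sdim (k + 1) n) (level X n) (pr n j \<circ> cl n (cyc i)) x"
    unfolding dim_shift by (rule homotopy_map_comp[OF inc_pointed[OF cyc] pr_pointed xc, symmetric])
  also have "\<dots> = (if i = j then x else \<one>\<^bsub>level_group X (k + 1) n\<^esub>)"
  proof (cases "i = j")
    case True
    have "homotopy_map (sdim (k + 1) n) (level X n) (pr n j \<circ> cl n (cyc i)) x = homotopy_map (sdim (k + 1) n) (level X n) id x"
      by (rule homotopy_map_cong[OF comp pointed_map_id _ xc])
        (use i True in \<open>simp add: pr_cl[OF cyc[unfolded True]] shift_down_cyc act_id\<close>)
    then show ?thesis
      using True homotopy_map_id[OF xc] by simp
  next
    case False
    have "homotopy_map (sdim (k + 1) n) (level X n) (pr n j \<circ> cl n (cyc i)) x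
        = homotopy_map (sdim (k + 1) n) (level X n) (\<lambda>_. base (level X n)) x"
      by (rule homotopy_map_cong[OF comp _ _ xc])
        (use False in \<open>simp_all add: pr_cl[OF cyc] pointed_map_def base_point\<close>)
    then show ?thesis
      using False homotopy_map_const[OF base_point xc] by (simp add: level_group_def)
  qed
  finally show ?thesis .
qed

lemma proj_cyc_eta:
  assumes i: "1 \<le> i" and c: "c \<in> carrier (sc.colim (k + 1))"
  shows "proj k j (inj_action (F1_smash X) k (cyc i) (eta k c))
    = (if i = j then [sign (cyc i)] \<cdot>\<^bsub>sc.colim (k + 1)\<^esub> c else \<zero>\<^bsub>sc.colim (k + 1)\<^esub>)"
proof -
  \<comment> \<open>The representative is taken in a level high enough for the copy \<open>i\<close>
    to exist.\<close>
  obtain n x where "i \<le> n" and n: "n \<in> stable_range (k + 1)" and x: "x \<in> carrier (level_group X (k + 1) n)"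
    and c_eq: "c = sc.cls (k + 1) n x"
    using c by (rule sc.colimE)
  have i': "i \<in> {1..Suc n}"
    using i \<open>i \<le> n\<close> by simp
  have cyc: "cyc i permutes {1..Suc n}"
    using i' cyc_permutes[of i "Suc n"] by simp
  have n': "Suc n \<in> stable_range k"
    using n by (simp only: stable_range_shift)
  interpret L: group "level_group X (k + 1) n"
    by (rule group_level_group[OF n])
  interpret F: group "level_group (F1_smash X) k (Suc n)"
    by (rule F1.group_level_group[OF n'])
  have u: "up k n (cyc i) x \<in> carrier (level_group (F1_smash X) k (Suc n))"
    by (rule hom_in_carrier[OF up_hom[OF n cyc] x])
  have "proj k j (inj_action (F1_smash X) k (cyc i) (eta k c))
      = sc.cls (k + 1) n (down k n j (up k n (cyc i) x) [^]\<^bsub>level_group X (k + 1) n\<^esub> sign (cyc i))"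
    unfolding c_eq cyc_eta[OF n x i'] proj_cls[OF n F.int_pow_closed[OF u]]
      hom_int_pow[OF down_hom[OF n] u F.is_group L.is_group] ..
  then show ?thesis
    unfolding down_up[OF n x i'] c_eq using sc.cls_int_pow[OF n x]
    by (simp add: sc.zero_colim[OF n])
qed

subsection \<open>Generators\<close>

lemma suspension_ret_split:
  assumes m: "2 \<le> m" and w: "w \<in> carrier (homotopy_group m (Lev n))"
  shows "suspension m (Lev n) w
    = suspension m (Lev n) (homotopy_map m (Lev n) (ret n (- {i})) w)
      \<otimes>\<^bsub>homotopy_group (Suc m) (smash (Lev n) S1)\<^esub> suspension m (Lev n) (homotopy_map m (Lev n) (ret n {i}) w)"
proof -
  obtain g where g: "g \<in> cube_maps m (Lev n)" "w = cube_class m (Lev n) g"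
    using w by (rule homotopy_groupE)
  \<comment> \<open>\<open>U S\<close> is the wedge of the copies with index outside
    \<open>S\<close>. So \<open>ret n (- {i})\<close> is the identity on \<open>U {i}\<close>, and
    \<open>ret n {i}\<close> is the identity on \<open>U (- {i})\<close>.\<close>
  define U where "U = (\<lambda>S. {C \<in> points (Lev n). ret n S C = base (Lev n)})"
  have split: "ret n (- {i}) C = C \<and> ret n {i} C = base (Lev n) \<or> ret n (- {i}) C = base (Lev n) \<and> ret n {i} C = C"
    if C: "C \<in> points (Lev n)" for C
  proof -
    obtain \<alpha> x where \<alpha>: "\<alpha> permutes {1..Suc n}" "x \<in> points (level X n)" "C = cl n \<alpha> x"
      using C by (rule LevE)
    show ?thesis
      unfolding \<alpha>(3) ret_cl[OF \<alpha>(1,2)] by simp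
  qed
  have "cube_class (Suc m) (smash (Lev n) S1) (suspend_map m (Lev n) g)
      = cube_class (Suc m) (smash (Lev n) S1) (suspend_map m (Lev n) (ret n (- {i}) \<circ> g))
        \<otimes>\<^bsub>homotopy_group (Suc m) (smash (Lev n) S1)\<^esub>
        cube_class (Suc m) (smash (Lev n) S1) (suspend_map m (Lev n) (ret n {i} \<circ> g))"
  proof (rule suspend_wedge_split[OF base_Lev_point m g(1)])
    show "closedin (top_of (Lev n)) (U {i})" "closedin (top_of (Lev n)) (U (- {i}))"
      unfolding U_def by (rule closedin_ret_base)+
    show "U {i} \<union> U (- {i}) = points (Lev n)"
      unfolding U_def using split by blast
    show "U {i} \<inter> U (- {i}) \<subseteq> {base (Lev n)}"
      unfolding U_def using split by fastforce
    show "ret n (- {i}) C = C" if "C \<in> U {i}" for C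
      using that split[of C] unfolding U_def by auto
    show "ret n {i} C = C" if "C \<in> U (- {i})" for C
      using that split[of C] unfolding U_def by auto
  qed (simp_all only: ret_pointed, simp_all add: U_def)
  then show ?thesis
    unfolding g(2) homotopy_map_class[OF g(1) ret_pointed] suspension_class[OF g(1)]
      suspension_class[OF cube_maps_comp[OF g(1) ret_pointed]] .
qed

text \<open>The splitting is available only after one suspension. As a class in the colimit equals
  the class of its stabilization, it holds there for \<open>w\<close> itself.\<close>

lemma cls_ret_split:
  assumes n: "n \<in> stable_range (k + 1)" and w: "w \<in> carrier (level_group (F1_smash X) k (Suc n))"
  shows "F1.sc.cls k (Suc n) w
    = F1.sc.cls k (Suc n) (retr k n (- {i}) w) \<oplus>\<^bsub>F1.sc.colim k\<^esub> F1.sc.cls k (Suc n) (retr k n {i} w)"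
proof -
  let ?m = "sdim (k + 1) n" and ?F = "F1_smash X"
  have n': "Suc n \<in> stable_range k"
    using n by (simp only: stable_range_shift)
  have wc: "w \<in> carrier (homotopy_group ?m (Lev n))"
    using w by (simp only: level_group_F1)
  have r: "retr k n S w \<in> carrier (level_group ?F k (Suc n))" for S
    unfolding level_group_F1 dim_shift by (rule homotopy_map_closed[OF ret_pointed wc])
  have rc: "homotopy_map ?m (Lev n) (ret n S) w \<in> carrier (homotopy_group ?m (Lev n))" for S
    by (rule homotopy_map_closed[OF ret_pointed wc])
  have susp: "suspension ?m (Lev n) v \<in> carrier (homotopy_group (Suc ?m) (smash (Lev n) S1))"
    if "v \<in> carrier (homotopy_group ?m (Lev n))" for v
    by (rule hom_in_carrier[OF suspension_hom[OF base_Lev_point dim_ge_2[OF n]] that])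
  have struct: "homotopy_map (Suc ?m) (Lev (Suc n)) (F1_struct_map X (Suc n))
      \<in> hom (homotopy_group (Suc ?m) (smash (Lev n) S1)) (homotopy_group (Suc ?m) (Lev (Suc n)))"
    by (rule homotopy_map_hom[OF F1.struct_pointed[of "Suc n", unfolded F1_smash_simps]
          base_in_smash_S1[OF base_Lev_point] base_Lev_point]) (use dim_ge_2[OF n] in simp)
  have dims: "sdim k (Suc (Suc n)) = Suc ?m"
    by (rule trans[OF dim_Suc[OF n'] arg_cong[OF dim_shift[of k n], of Suc]])
  have iota: "iota ?F k (Suc n) v = homotopy_map (Suc ?m) (Lev (Suc n)) (F1_struct_map X (Suc n)) (suspension ?m (Lev n) v)" for v
    unfolding iota_def F1_smash_simps dims unfolding dim_shift[of k n] ..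
  have "iota ?F k (Suc n) w = iota ?F k (Suc n) (retr k n (- {i}) w)
      \<otimes>\<^bsub>level_group ?F k (Suc (Suc n))\<^esub> iota ?F k (Suc n) (retr k n {i} w)"
    unfolding iota level_group_F1 dim_Suc[OF n] dim_shift[of k n] suspension_ret_split[OF dim_ge_2[OF n] wc, of i]
    by (rule hom_mult[OF struct susp[OF rc] susp[OF rc]])
  then have "F1.sc.cls k (Suc (Suc n)) (iota ?F k (Suc n) w)
      = F1.sc.cls k (Suc (Suc n)) (iota ?F k (Suc n) (retr k n (- {i}) w))
        \<oplus>\<^bsub>F1.sc.colim k\<^esub> F1.sc.cls k (Suc (Suc n)) (iota ?F k (Suc n) (retr k n {i} w))"
    using F1.sc.add_cls[OF stable_range_Suc[OF n'] hom_in_carrier[OF F1.iota_hom[OF n'] r] hom_in_carrier[OF F1.iota_hom[OF n'] r]]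
    by simp
  then show ?thesis
    unfolding F1.sc.cls_step[OF n' w] F1.sc.cls_step[OF n' r] .
qed

text \<open>Induction on \<open>S\<close>: splitting off the copy \<open>i\<close> leaves the
  retraction to the remaining copies, and the part split off comes from \<open>X\<close>.\<close>

lemma cls_retr_generate:
  assumes n: "n \<in> stable_range (k + 1)" and z: "z \<in> carrier (level_group (F1_smash X) k (Suc n))"
    and S: "S \<subseteq> {1..Suc n}"
  shows "F1.sc.cls k (Suc n) (retr k n S z) \<in> generate (add_monoid (F1.sc.colim k))
    {inj_action (F1_smash X) k f (eta k c) | f c. f \<in> carrier inj_monoid \<and> c \<in> carrier (sc.colim (k + 1))}"
    (is "_ \<in> generate ?Q ?G")
  using finite_subset[OF S finite_atLeastAtMost] S
proof (induction S rule: finite_induct)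
  case empty
  have n': "Suc n \<in> stable_range k"
    using n by (simp only: stable_range_shift)
  have zc: "z \<in> carrier (homotopy_group (sdim k (Suc n)) (Lev n))"
    using z by (simp only: level_group_F1 dim_shift)
  have "retr k n {} z = homotopy_map (sdim k (Suc n)) (Lev n) (\<lambda>_. base (Lev n)) z"
    by (rule homotopy_map_cong[OF ret_pointed _ _ zc])
      (simp_all add: ret_empty pointed_map_def base_Lev_point)
  also have "\<dots> = \<one>\<^bsub>level_group (F1_smash X) k (Suc n)\<^esub>"
    unfolding homotopy_map_const[OF base_Lev_point zc] unfolding level_group_F1 dim_shift[of k n] ..
  finally show ?case
    using generate.one[of ?Q ?G] F1.sc.zero_colim[OF n'] by simp
next
  case (insert i S)
  have i: "i \<in> {1..Suc n}"
    using insert.prems by simp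
  have zc: "z \<in> carrier (homotopy_group (sdim k (Suc n)) (Lev n))"
    using z by (simp only: level_group_F1 dim_shift)
  have w: "retr k n (insert i S) z \<in> carrier (level_group (F1_smash X) k (Suc n))"
    unfolding level_group_F1 dim_shift[of k n, symmetric] by (rule homotopy_map_closed[OF ret_pointed zc])
  have rr: "retr k n T (retr k n (insert i S) z) = retr k n (T \<inter> insert i S) z" for T
  proof -
    have "homotopy_map (sdim k (Suc n)) (Lev n) (ret n T \<circ> ret n (insert i S)) z = retr k n (T \<inter> insert i S) z"
      by (rule homotopy_map_cong[OF pointed_map_comp[OF ret_pointed ret_pointed] ret_pointed _ zc])
        (simp only: o_apply ret_ret)
    then show ?thesis
      unfolding homotopy_map_comp[OF ret_pointed ret_pointed zc] .
  qed
  have T: "- {i} \<inter> insert i S = S" "{i} \<inter> insert i S = {i}"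
    using insert.hyps by auto
  have cyc: "cyc i permutes {1..Suc n}"
    using i cyc_permutes[of i "Suc n"] by simp
  have down: "down k n i z \<in> carrier (level_group X (k + 1) n)"
    by (rule hom_in_carrier[OF down_hom[OF n] z])
  \<comment> \<open>The retraction to a single copy factors through \<open>X\<close>, as projection
    followed by inclusion.\<close>
  have "retr k n {i} z = homotopy_map (sdim k (Suc n)) (Lev n) (cl n (cyc i) \<circ> pr n i) z"
    by (rule homotopy_map_cong[OF ret_pointed pointed_map_comp[OF pr_pointed inc_pointed[OF cyc]] _ zc])
      (simp only: o_apply ret_singleton[OF i])
  also have "\<dots> = up k n (cyc i) (down k n i z)"
    unfolding homotopy_map_comp[OF pr_pointed inc_pointed[OF cyc] zc] unfolding dim_shift[of k n] ..
  finally have ret: "retr k n {i} z = up k n (cyc i) (down k n i z)" .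
  have "F1.sc.cls k (Suc n) (retr k n {i} z) \<in> ?G"
  proof (intro CollectI exI conjI)
    show "F1.sc.cls k (Suc n) (retr k n {i} z) = inj_action (F1_smash X) k (cyc i)
        (eta k (sc.cls (k + 1) n (down k n i z [^]\<^bsub>level_group X (k + 1) n\<^esub> sign (cyc i))))"
      unfolding ret by (rule cls_up_cyc[OF n down i])
    show "cyc i \<in> carrier inj_monoid"
      using i by (intro cyc_inj_monoid) simp
    show "sc.cls (k + 1) n (down k n i z [^]\<^bsub>level_group X (k + 1) n\<^esub> sign (cyc i)) \<in> carrier (sc.colim (k + 1))"
      by (rule sc.cls_closed[OF n group.int_pow_closed[OF group_level_group[OF n] down]])
  qed
  then have "F1.sc.cls k (Suc n) (retr k n {i} z) \<in> generate ?Q ?G"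
    by (rule generate.incl)
  moreover have "F1.sc.cls k (Suc n) (retr k n S z) \<in> generate ?Q ?G"
    using insert by simp
  ultimately show ?case
    using generate.eng[of _ ?Q ?G] unfolding cls_ret_split[OF n w, of i] rr T by simp
qed

lemma colim_generate:
  "carrier (F1.sc.colim k) \<subseteq> generate (add_monoid (F1.sc.colim k))
    {inj_action (F1_smash X) k f (eta k c) | f c. f \<in> carrier inj_monoid \<and> c \<in> carrier (sc.colim (k + 1))}"
proof
  fix q
  assume "q \<in> carrier (F1.sc.colim k)"
  \<comment> \<open>Level 0 is avoided; in a positive level the retraction to all copies is the
    identity.\<close>
  then obtain n z where n: "Suc 0 \<le> n" "n \<in> stable_range k" "z \<in> carrier (level_group (F1_smash X) k n)"
    and q: "q = F1.sc.cls k n z"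
    by (rule F1.sc.colimE)
  obtain l where l: "n = Suc l"
    using n(1) by (cases n) auto
  have l': "l \<in> stable_range (k + 1)" and z: "z \<in> carrier (level_group (F1_smash X) k (Suc l))"
    using n(2,3) unfolding l stable_range_shift .
  have zc: "z \<in> carrier (homotopy_group (sdim k (Suc l)) (Lev l))"
    using z by (simp only: level_group_F1 dim_shift)
  have "retr k l {1..Suc l} z = homotopy_map (sdim k (Suc l)) (Lev l) id z"
    by (rule homotopy_map_cong[OF ret_pointed pointed_map_id _ zc]) (simp add: ret_all)
  then have "retr k l {1..Suc l} z = z"
    using homotopy_map_id[OF zc] by simp
  then show "q \<in> generate (add_monoid (F1.sc.colim k))
    {inj_action (F1_smash X) k f (eta k c) | f c. f \<in> carrier inj_monoid \<and> c \<in> carrier (sc.colim (k + 1))}"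
    using cls_retr_generate[OF l' z order_refl] unfolding q l by simp
qed

end


section \<open>Naturality in the spectrum\<close>

locale closed_base_morphism = X: closed_base_spectrum X + Y: closed_base_spectrum Y + equivariant_morphism X Y f
  for X Y :: "'a spectrum_data" and f
begin

lemma
  shows F1_map_pointed: "pointed_map (X.Lev n) (Y.Lev n) (F1_smash_map Y f (Suc n))"
    and F1_map_cl: "\<And>\<alpha> x. \<alpha> permutes {1..Suc n} \<Longrightarrow> x \<in> points (level X n) \<Longrightarrow>
      F1_smash_map Y f (Suc n) (X.cl n \<alpha> x) = Y.cl n \<alpha> (f n x)"
proof -
  let ?F = "\<lambda>(\<alpha>, x). Y.cl n \<alpha> (f n x)"
  have pt: "f n x \<in> points (level Y n)" if "x \<in> points (level X n)" for x
    by (rule pointed_map_point[OF map_pointed that])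
  have 1: "?F (\<beta> \<circ> one_times \<gamma>, x) = ?F (\<beta>, sym_act X n \<gamma> x)"
    if "\<beta> permutes {1..Suc n}" "\<gamma> permutes {1..n}" "x \<in> points (level X n)" for \<beta> \<gamma> x
    using Y.cl_shift[OF that(1,2) pt[OF that(3)]] map_act[OF that(2,3)] by simp
  have f: "f n (base (level X n)) = base (level Y n)" "continuous_map (top_of (level X n)) (top_of (level Y n)) (f n)"
    using map_pointed by (simp_all add: pointed_map_def)
  have 2: "?F (\<alpha>, base (level X n)) = base (Y.Lev n)" if "\<alpha> permutes {1..Suc n}" for \<alpha>
    using that by (simp add: f(1) Y.cl_base_Lev)
  have 3: "continuous_map (top_of (level X n)) (top_of (Y.Lev n)) (\<lambda>x. ?F (\<alpha>, x))" if "\<alpha> permutes {1..Suc n}" for \<alpha>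
    using continuous_map_compose[OF f(2) Y.cl_continuous[OF that]] by (simp add: o_def)
  have eq: "F1_smash_map Y f (Suc n) = (\<lambda>C. the_elem (?F ` C))"
    by (simp add: F1_smash_map_def fun_eq_iff)
  note F = X.F1_descend_pointed[where F = ?F and B = "Y.Lev n", OF 1 2 3]
  show "pointed_map (X.Lev n) (Y.Lev n) (F1_smash_map Y f (Suc n))"
    unfolding eq by (rule F(1))
  show "F1_smash_map Y f (Suc n) (X.cl n \<alpha> x) = Y.cl n \<alpha> (f n x)"
    if "\<alpha> permutes {1..Suc n}" "x \<in> points (level X n)" for \<alpha> x
  proof -
    have "the_elem (?F ` X.cl n \<alpha> x) = ?F (\<alpha>, x)"
      by (rule F(2)) (assumption | rule that)+
    then show ?thesis
      by (simp only: eq prod.case)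
  qed
qed

lemma F1_morphism: "spectrum_morphism (F1_smash X) (F1_smash Y) (F1_smash_map Y f)"
  unfolding spectrum_morphism_def
proof (intro conjI allI ballI impI)
  fix n
  show "pointed_map (level (F1_smash X) n) (level (F1_smash Y) n) (F1_smash_map Y f n)"
  proof (cases n)
    case 0
    then show ?thesis
      by (simp add: pointed_map_def X.F1_level_0 Y.F1_level_0 F1_smash_map_def)
  qed (simp add: F1_map_pointed)
next
  fix n \<gamma> C
  assume \<gamma>: "\<gamma> permutes {1..n}" and C: "C \<in> points (level (F1_smash X) n)"
  show "F1_smash_map Y f n (sym_act (F1_smash X) n \<gamma> C) = sym_act (F1_smash Y) n \<gamma> (F1_smash_map Y f n C)"
  proof (cases n)
    case 0
    then show ?thesis
      by (simp add: F1_sym_act_def F1_smash_map_def)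
  next
    case (Suc l)
    have \<gamma>': "\<gamma> permutes {1..Suc l}"
      using \<gamma> Suc by simp
    obtain \<alpha> x where \<alpha>: "\<alpha> permutes {1..Suc l}" and x: "x \<in> points (level X l)" and C_eq: "C = X.cl l \<alpha> x"
      using C Suc by (auto elim: X.LevE)
    show ?thesis
      unfolding Suc C_eq X.F1_smash_simps Y.F1_smash_simps X.F1_act_cl[OF \<gamma>' \<alpha> x] F1_map_cl[OF \<alpha> x]
        F1_map_cl[OF permutes_compose[OF \<alpha> \<gamma>'] x] Y.F1_act_cl[OF \<gamma>' \<alpha> pointed_map_point[OF map_pointed x]] ..
  qed
next
  fix n C s
  assume C: "C \<in> points (level (F1_smash X) n)" and s: "s \<in> points S1"
  have "F1_smash_map Y f (Suc n) (stab (F1_smash X) n C s) = stab (F1_smash Y) n (F1_smash_map Y f n C) s"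
  proof (cases n)
    case 0
    then show ?thesis
      using F1_map_pointed[of 0] by (simp add: X.F1_stab_0 Y.F1_stab_0 pointed_map_def)
  next
    case (Suc l)
    obtain \<alpha> x where \<alpha>: "\<alpha> permutes {1..Suc l}" and x: "x \<in> points (level X l)" and C_eq: "C = X.cl l \<alpha> x"
      using C Suc by (auto elim: X.LevE)
    have \<alpha>': "\<alpha> permutes {1..Suc (Suc l)}"
      by (rule permutes_subset[OF \<alpha>]) simp
    show ?thesis
      unfolding Suc C_eq X.F1_stab_cl[OF \<alpha> x s] F1_map_cl[OF \<alpha>' X.stab_point[OF x s]] F1_map_cl[OF \<alpha> x]
        Y.F1_stab_cl[OF \<alpha> pointed_map_point[OF map_pointed x] s] map_stab[OF x s] ..
  qed
  then show "F1_smash_map Y f (Suc n) (struct_map (F1_smash X) n (smash_proj (level (F1_smash X) n) S1 (C, s)))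
      = struct_map (F1_smash Y) n (smash_proj (level (F1_smash Y) n) S1 (F1_smash_map Y f n C, s))"
    by (simp only: stab_def)
qed

sublocale F1: equivariant_morphism "F1_smash X" "F1_smash Y" "F1_smash_map Y f"
  by unfold_locales (rule F1_morphism)

text \<open>Both composites are induced by the map that puts the point \<open>f n x\<close> into the
  copy with index 1.\<close>

lemma eta_natural:
  assumes "c \<in> carrier (X.sc.colim (k + 1))"
  shows "stable_homotopy_map (F1_smash Y) k (F1_smash_map Y f) (X.eta k c)
    = Y.eta k (stable_homotopy_map Y (k + 1) f c)"
proof -
  obtain n x where n: "n \<in> stable_range (k + 1)" and x: "x \<in> carrier (level_group X (k + 1) n)" and c: "c = X.sc.cls (k + 1) n x"
    using assms by (rule X.sc.colimE)
  have n': "Suc n \<in> stable_range k"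
    using n by (simp only: stable_range_shift)
  have xc: "x \<in> carrier (homotopy_group (sdim (k + 1) n) (level X n))"
    using x by (simp only: X.carrier_level_group)
  note inc = X.inc_pointed[OF permutes_id] Y.inc_pointed[OF permutes_id]
  have "homotopy_map (sdim (k + 1) n) (Y.Lev n) (F1_smash_map Y f (Suc n)) (X.up k n id x)
      = homotopy_map (sdim (k + 1) n) (Y.Lev n) (F1_smash_map Y f (Suc n) \<circ> X.cl n id) x"
    by (rule homotopy_map_comp[OF inc(1) F1_map_pointed xc, symmetric])
  also have "\<dots> = homotopy_map (sdim (k + 1) n) (Y.Lev n) (Y.cl n id \<circ> f n) x"
    by (rule homotopy_map_cong[OF pointed_map_comp[OF inc(1) F1_map_pointed] pointed_map_comp[OF map_pointed inc(2)] _ xc])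
      (simp only: o_apply F1_map_cl[OF permutes_id])
  also have "\<dots> = Y.up k n id (push (k + 1) n x)"
    by (rule homotopy_map_comp[OF map_pointed inc(2) xc])
  finally have "F1.push k (Suc n) (X.up k n id x) = Y.up k n id (push (k + 1) n x)"
    unfolding Y.F1_smash_simps dim_shift .
  then show ?thesis
    unfolding c X.eta_cls[OF n x] stable_homotopy_map_cls[OF n x] Y.eta_cls[OF n push_closed[OF n x]]
      F1.stable_homotopy_map_cls[OF n' hom_in_carrier[OF X.up_hom[OF n permutes_id] x]] by simp
qed

end


text \<open>The modules and the colimit groups have the same addition but are different records;
  this transfers generated subgroups from one to the other.\<close>

lemma generate_cong_subset:
  assumes "carrier G = carrier H" "monoid.mult G = monoid.mult H" "\<one>\<^bsub>G\<^esub> = \<one>\<^bsub>H\<^esub>"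
  shows "generate G S \<subseteq> generate H S"
proof
  have inv: "m_inv G x = m_inv H x" for x
    by (simp add: m_inv_def assms)
  fix x
  assume "x \<in> generate G S"
  then show "x \<in> generate H S"
    by (induction rule: generate.induct)
      (simp_all only: assms inv generate.one generate.incl generate.inv generate.eng)
qed

lemma (in closed_base_spectrum) extension_of_scalars_eta:
  "extension_of_scalars (stable_homotopy X (k + 1)) (stable_homotopy (F1_smash X) k) (eta k)"
proof (intro extension_of_scalars.intro extension_of_scalars_axioms.intro
    left_module_stable_homotopy F1.left_module_stable_homotopy)
  let ?N = "stable_homotopy X (k + 1)" and ?Q = "stable_homotopy (F1_smash X) k"
  interpret A: abelian_group "sc.colim (k + 1)"
    by (rule sc.abelian_group_colim)
  have eta_closed: "eta k x \<in> carrier (F1.sc.colim k)" if "x \<in> carrier (sc.colim (k + 1))" for x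
    using hom_in_carrier[OF eta_hom] that by simp
  show "eta k \<in> hom (add_monoid ?N) (add_monoid ?Q)"
    using eta_hom[of k] by (simp add: hom_def)
  show "eta k (frag_of f \<odot>\<^bsub>?N\<^esub> x) = frag_of (one_times f) \<odot>\<^bsub>?Q\<^esub> eta k x"
    if "f \<in> carrier inj_monoid" "x \<in> carrier ?N" for f x
    using that eta_action
    by (simp add: smult_stable_homotopy_of F1.smult_stable_homotopy_of one_times_inj_monoid eta_closed)
  let ?G = "{frag_of f \<odot>\<^bsub>?Q\<^esub> eta k x | f x. f \<in> carrier inj_monoid \<and> x \<in> carrier ?N}"
  have "{inj_action (F1_smash X) k f (eta k c) | f c. f \<in> carrier inj_monoid \<and> c \<in> carrier (sc.colim (k + 1))} \<subseteq> ?G"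
  proof
    fix q
    assume "q \<in> {inj_action (F1_smash X) k f (eta k c) | f c. f \<in> carrier inj_monoid \<and> c \<in> carrier (sc.colim (k + 1))}"
    then obtain f c where f: "f \<in> carrier inj_monoid" and c: "c \<in> carrier (sc.colim (k + 1))"
      and q: "q = inj_action (F1_smash X) k f (eta k c)"
      by blast
    have "q = frag_of f \<odot>\<^bsub>?Q\<^esub> eta k c"
      unfolding q by (rule F1.smult_stable_homotopy_of[OF f eta_closed[OF c], symmetric])
    then show "q \<in> ?G"
      using f c unfolding stable_homotopy_simps(1) by blast
  qed
  from group.mono_generate[OF abelian_group.a_group[OF F1.sc.abelian_group_colim] this]
  have "carrier ?Q \<subseteq> generate (add_monoid (F1.sc.colim k)) ?G"
    using colim_generate[of k] unfolding F1.stable_homotopy_simps(1) by (rule order_trans[rotated])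
  also have "\<dots> \<subseteq> generate (add_monoid ?Q) ?G"
    by (rule generate_cong_subset) (simp_all add: fun_eq_iff)
  finally show "carrier ?Q \<subseteq> generate (add_monoid ?Q) ?G" .
  fix j
  have proj: "proj k (Suc j) (frag_of (cyc (Suc i)) \<odot>\<^bsub>?Q\<^esub> eta k x)
      = (if i = j then [sign (cyc (Suc i))] \<cdot>\<^bsub>sc.colim (k + 1)\<^esub> x else \<zero>\<^bsub>sc.colim (k + 1)\<^esub>)"
    if "x \<in> carrier (sc.colim (k + 1))" for i x
    using proj_cyc_eta[OF _ that, of "Suc i"]
    by (simp add: F1.smult_stable_homotopy_of cyc_inj_monoid eta_closed that)
  \<comment> \<open>Multiplication by a sign is its own inverse, so the projection is injective on
    its own summand despite the sign of the cycle.\<close>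
  have cancel: "x = \<zero>\<^bsub>sc.colim (k + 1)\<^esub>"
    if x: "x \<in> carrier (sc.colim (k + 1))" and 0: "[sign p] \<cdot>\<^bsub>sc.colim (k + 1)\<^esub> x = \<zero>\<^bsub>sc.colim (k + 1)\<^esub>" for p x
  proof -
    note grp = abelian_group.a_group[OF sc.abelian_group_colim[of "k + 1"]]
    have "[sign p] \<cdot>\<^bsub>sc.colim (k + 1)\<^esub> ([sign p] \<cdot>\<^bsub>sc.colim (k + 1)\<^esub> x) = x"
      using group.int_pow_pow[OF grp, of x "sign p" "sign p"] group.int_pow_1[OF grp, of x] x by (simp add: add_pow_def sign_mult_self)
    moreover have "[sign p] \<cdot>\<^bsub>sc.colim (k + 1)\<^esub> \<zero>\<^bsub>sc.colim (k + 1)\<^esub> = \<zero>\<^bsub>sc.colim (k + 1)\<^esub>"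
      using group.int_pow_one[OF grp, of "sign p"] by (simp add: add_pow_def)
    ultimately show ?thesis
      by (simp add: 0)
  qed
  show "\<exists>P \<in> hom (add_monoid ?Q) (add_monoid ?N).
      (\<forall>i x. i \<noteq> j \<longrightarrow> x \<in> carrier ?N \<longrightarrow> P (frag_of (cyc (Suc i)) \<odot>\<^bsub>?Q\<^esub> eta k x) = \<zero>\<^bsub>?N\<^esub>) \<and>
      (\<forall>x. x \<in> carrier ?N \<longrightarrow> P (frag_of (cyc (Suc j)) \<odot>\<^bsub>?Q\<^esub> eta k x) = \<zero>\<^bsub>?N\<^esub> \<longrightarrow> x = \<zero>\<^bsub>?N\<^esub>)"
  proof (intro bexI[of _ "proj k (Suc j)"] conjI allI impI)
    show "proj k (Suc j) \<in> hom (add_monoid ?Q) (add_monoid ?N)"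
      using proj_hom[of k "Suc j"] by (simp add: hom_def)
    show "proj k (Suc j) (frag_of (cyc (Suc i)) \<odot>\<^bsub>?Q\<^esub> eta k x) = \<zero>\<^bsub>?N\<^esub>"
      if "i \<noteq> j" "x \<in> carrier ?N" for i x
      using that by (simp add: proj)
    show "x = \<zero>\<^bsub>?N\<^esub>"
      if "x \<in> carrier ?N" "proj k (Suc j) (frag_of (cyc (Suc j)) \<odot>\<^bsub>?Q\<^esub> eta k x) = \<zero>\<^bsub>?N\<^esub>" for x
      using that cancel[of x] by (simp add: proj)
  qed
qed

lemma closed_base_spectrum: "symmetric_spectrum X \<Longrightarrow> closed_base_spectrum X"
  by (intro closed_base_spectrum.intro closed_base_spectrum_axioms.intro equivariant_spectrum closedin_base_point)

theorem mainTheorem5: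
  fixes k :: int
  shows "\<exists>\<Phi>.
    (\<forall>X :: 'a spectrum_data. symmetric_spectrum X \<longrightarrow>
       left_module_iso ZM
         (stable_homotopy (F1_smash X) k)
         (tensor ZM ZM_plus (stable_homotopy X (k + 1)))
         (\<Phi> X)) \<and>
    (\<forall>(X :: 'a spectrum_data) (Y :: 'a spectrum_data) f.
       symmetric_spectrum X \<and> symmetric_spectrum Y \<and> spectrum_morphism X Y f \<longrightarrow>
       (\<forall>c \<in> carrier (stable_homotopy (F1_smash X) k).
          \<Phi> Y (stable_homotopy_map (F1_smash Y) k (F1_smash_map Y f) c) =
          tensor_map ZM ZM_plus (stable_homotopy Y (k + 1))
            (stable_homotopy_map Y (k + 1) f) (\<Phi> X c)))"
proof (intro exI conjI allI impI ballI)
  \<comment> \<open>One formula for all spectra at once, since naturality compares the values at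
    \<open>X\<close> and at \<open>Y\<close>.\<close>
  define \<Phi> where "\<Phi> = (\<lambda>X :: 'a spectrum_data. extension_of_scalars.ext_inv
    (stable_homotopy X (k + 1)) (stable_homotopy (F1_smash X) k) (closed_base_spectrum.eta X k))"
  show "left_module_iso ZM (stable_homotopy (F1_smash X) k) (tensor ZM ZM_plus (stable_homotopy X (k + 1))) (\<Phi> X)"
    if X: "symmetric_spectrum X" for X
    unfolding \<Phi>_def
    by (rule extension_of_scalars.left_module_iso_ext_inv
        [OF closed_base_spectrum.extension_of_scalars_eta[OF closed_base_spectrum[OF X]]])
  fix X Y :: "'a spectrum_data" and f c
  assume "symmetric_spectrum X \<and> symmetric_spectrum Y \<and> spectrum_morphism X Y f"
    and c: "c \<in> carrier (stable_homotopy (F1_smash X) k)"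
  then have X: "closed_base_spectrum X" and Y: "closed_base_spectrum Y" and f: "spectrum_morphism X Y f"
    by (simp_all add: closed_base_spectrum)
  interpret closed_base_morphism X Y f
    by (intro closed_base_morphism.intro equivariant_morphism.intro equivariant_morphism_axioms.intro
        X Y f closed_base_spectrum.axioms(1))
  show "\<Phi> Y (stable_homotopy_map (F1_smash Y) k (F1_smash_map Y f) c) =
      tensor_map ZM ZM_plus (stable_homotopy Y (k + 1)) (stable_homotopy_map Y (k + 1) f) (\<Phi> X c)"
    unfolding \<Phi>_def
  proof (rule ext_inv_natural[OF X.extension_of_scalars_eta Y.extension_of_scalars_eta])
    show "stable_homotopy_map (F1_smash Y) k (F1_smash_map Y f)
        \<in> hom (add_monoid (stable_homotopy (F1_smash X) k)) (add_monoid (stable_homotopy (F1_smash Y) k))"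
      using F1.stable_homotopy_map_hom[of k] by (simp add: hom_def)
    show "stable_homotopy_map Y (k + 1) f x \<in> carrier (stable_homotopy Y (k + 1))"
      if "x \<in> carrier (stable_homotopy X (k + 1))" for x
      using that by (simp add: stable_homotopy_map_closed)
    show "stable_homotopy_map (F1_smash Y) k (F1_smash_map Y f) (frag_of g \<odot>\<^bsub>stable_homotopy (F1_smash X) k\<^esub> q)
        = frag_of g \<odot>\<^bsub>stable_homotopy (F1_smash Y) k\<^esub> stable_homotopy_map (F1_smash Y) k (F1_smash_map Y f) q"
      if "g \<in> carrier inj_monoid" "q \<in> carrier (stable_homotopy (F1_smash X) k)" for g q
      using that by (simp add: X.F1.smult_stable_homotopy_of Y.F1.smult_stable_homotopy_of
          F1.stable_homotopy_map_action F1.stable_homotopy_map_closed)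
    show "stable_homotopy_map (F1_smash Y) k (F1_smash_map Y f) (X.eta k x) = Y.eta k (stable_homotopy_map Y (k + 1) f x)"
      if "x \<in> carrier (stable_homotopy X (k + 1))" for x
      using that by (simp add: eta_natural)
    show "c \<in> carrier (stable_homotopy (F1_smash X) k)"
      by (rule c)
  qed
qed

end
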